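(* $$\frac{\log^2 t}{v}\,\log \mathbb{P}\{X(t)>v\}\longrightarrow -\frac{\pi^2}{8}$$ as $v,t\to\infty$ jointly in any manner such that $v/\log^2 t\to\infty$ and $\log v/\log t\to 0$. The same convergence holds with $X(t)$ replaced by $\sup_{0\le s\le t}X(s)$.
   Context: Let $W=(W(x),x\in\mathbb{R})$ be a two-sided one-dimensional Brownian motion with $W(0)=0$, with law $P$. Conditionally on a realization $\omega$ of $W$, let $X$ be the real diffusion started at $X(0)=0$ with generator $\frac12 e^{W(x)}\frac{d}{dx}\big(e^{-W(x)}\frac{d}{dx}\big)$. $\mathbf{P}_\omega$ denotes the quenched law of $X$ given $W$, and $\mathbb{P}=P(d\omega)\otimes\mathbf{P}_\omega$ the annealed (total) law. *)

theory Defs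
  imports "HOL-Probability.Probability"
begin

definition brownian_on :: "'a measure \<Rightarrow> real set \<Rightarrow> (real \<Rightarrow> 'a \<Rightarrow> real) \<Rightarrow> bool" where
  "brownian_on M I B \<longleftrightarrow>
     prob_space M \<and> 0 \<in> I \<and>
     (\<forall>t\<in>I. B t \<in> borel_measurable M) \<and>
     (\<forall>\<omega>\<in>space M. B 0 \<omega> = 0 \<and> continuous_on I (\<lambda>t. B t \<omega>)) \<and>
     (\<forall>s\<in>I. \<forall>t\<in>I. s < t \<longrightarrow>
        distributed M lborel (\<lambda>\<omega>. B t \<omega> - B s \<omega>)
          (\<lambda>x. ennreal (normal_density 0 (sqrt (t - s)) x))) \<and>
     (\<forall>ts :: real list. sorted_wrt (<) ts \<and> set ts \<subseteq> I \<longrightarrow>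
        prob_space.indep_vars M (\<lambda>_. borel)
          (\<lambda>i \<omega>. B (ts ! Suc i) \<omega> - B (ts ! i) \<omega>) {..< length ts - 1})"

text \<open>Brox's construction of the diffusion in the environment W driven by the Brownian
motion B: scale function S(x) = int_0^x exp(W y) dy, X(t) = S^{-1}(B(T^{-1}(t))) with
T(u) = int_0^u exp(-2 W(S^{-1}(B r))) dr.  This diffusion has generator
(1/2) e^{W} d/dx (e^{-W} d/dx) and starts at 0.\<close>

definition brox_scale :: "(real \<Rightarrow> 'a \<Rightarrow> real) \<Rightarrow> 'a \<Rightarrow> real \<Rightarrow> real" where
  "brox_scale W \<omega> x = (LBINT y=0..x. exp (W y \<omega>))"

definition brox_scale_inv :: "(real \<Rightarrow> 'a \<Rightarrow> real) \<Rightarrow> 'a \<Rightarrow> real \<Rightarrow> real" where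
  "brox_scale_inv W \<omega> = inv (brox_scale W \<omega>)"

definition brox_clock :: "(real \<Rightarrow> 'a \<Rightarrow> real) \<Rightarrow> (real \<Rightarrow> 'a \<Rightarrow> real) \<Rightarrow> 'a \<Rightarrow> real \<Rightarrow> real" where
  "brox_clock W B \<omega> u = (LBINT r=0..u. exp (- 2 * W (brox_scale_inv W \<omega> (B r \<omega>)) \<omega>))"

definition brox_clock_inv :: "(real \<Rightarrow> 'a \<Rightarrow> real) \<Rightarrow> (real \<Rightarrow> 'a \<Rightarrow> real) \<Rightarrow> 'a \<Rightarrow> real \<Rightarrow> real" where
  "brox_clock_inv W B \<omega> t = (SOME u. 0 \<le> u \<and> brox_clock W B \<omega> u = t)"

definition brox_X :: "(real \<Rightarrow> 'a \<Rightarrow> real) \<Rightarrow> (real \<Rightarrow> 'a \<Rightarrow> real) \<Rightarrow> real \<Rightarrow> 'a \<Rightarrow> real" where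
  "brox_X W B t \<omega> = brox_scale_inv W \<omega> (B (brox_clock_inv W B \<omega> t) \<omega>)"

end

theory Submission
  imports Defs
begin

text \<open>
In natural scale the diffusion is a time-changed Brownian motion, so functions of the position become
supermartingales as soon as they satisfy a differential inequality.

Upper bound: the solution of \<open>(e\<^sup>-\<^sup>w u')' = (2/t) e\<^sup>-\<^sup>w u\<close> with a flat start bounds the quenched probability
of passing \<open>v\<close> before time \<open>t\<close> by \<open>e / u(v)\<close>, and over consecutive blocks \<open>u\<close> grows at least by factors
\<open>1 + (2/t) \<integral>\<integral> e\<^sup>w\<^sup>(\<^sup>y\<^sup>)\<^sup>-\<^sup>w\<^sup>(\<^sup>x\<^sup>)\<close> over \<open>x < y\<close>. Such a factor fails to be large only if the environment never rises
by more than about \<open>ln t\<close> inside the block. A block of length \<open>l\<close> does so with probability about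
\<open>exp (- \<pi>\<^sup>2 l / (8 ln\<^sup>2 t))\<close>, since the rise above the running minimum is a reflected Brownian motion; the
blocks are independent.

Lower bound: the same exponential rate is the cost for the environment to have no rise above
\<open>(1 - d) ln t\<close> on \<open>[0, v + 1]\<close> and to descend steeply on both adjacent intervals of length \<open>ln\<^sup>2 t\<close>.
In such an environment the diffusion does not escape to the left, reaches the valley to the right of
\<open>v + 1\<close> before time \<open>t\<close>, and does not come back to \<open>v\<close> by time \<open>t\<close>; explicit supermartingales built from
Green potentials bound the three error probabilities.
\<close>

section \<open>Gaussian random walks\<close>

text \<open>The number \<open>pi^2 / 8\<close> is an eigenvalue:
  \<open>cos (pi * r / (2 * a))\<close> has zero slope at the reflecting end 0, vanishes at
  \<open>a\<close>, and decays at rate \<open>pi^2 / (8 * a^2)\<close>; the critical height is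
  \<open>a = ln t\<close>. All processes are treated on grids, as chains with independent Gaussian
  steps. A test function then needs only a one-step inequality, with an error of order
  \<open>h^2\<close> or \<open>e * h\<close> whose sum over a fixed horizon vanishes with the mesh.
  Stopping is encoded by freezing the chain. The two conditions on \<open>v\<close> act at different
  places. Since \<open>ln v / ln t\<close> tends to 0, factors polynomial in \<open>v\<close> are
  small powers of \<open>t\<close>, absorbed by the loss of \<open>d\<close> in
  \<open>(1 - d) * ln t\<close>. Since \<open>v / (ln t)^2\<close> tends to infinity, constant
  factors disappear in the limit; by Brownian scaling the two descents cost only such a factor.
  Environment and Brownian path live on one probability space, so fixing the environment is itself a
  Fubini argument for independent variables. Scale and clock are invertible only for recurrent
  paths; the exceptional null set is the reason for the completion, and paths in it are replaced by
  the zero path.\<close>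

definition gauss :: "real \<Rightarrow> real measure" where
  "gauss h = density lborel (\<lambda>x. ennreal (normal_density 0 (sqrt h) x))"

lemma sets_gauss [simp, measurable_cong]: "sets (gauss h) = sets borel"
  by (simp add: gauss_def)

lemma space_gauss [simp]: "space (gauss h) = UNIV"
  by (simp add: gauss_def)

lemma prob_space_gauss: "0 < h \<Longrightarrow> prob_space (gauss h)"
  unfolding gauss_def by (intro prob_space_normal_density) simp

lemma gauss_even_moment:
  assumes "0 < h"
  shows "has_bochner_integral (gauss h) (\<lambda>x. x ^ (2 * k)) (fact (2 * k) / ((2 / h) ^ k * fact k))"
proof -
  have "has_bochner_integral lborel (\<lambda>x. normal_density 0 (sqrt h) x * (x - 0) ^ (2 * k))
     (fact (2 * k) / ((2 / (sqrt h)\<^sup>2) ^ k * fact k))"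
    using assms by (intro normal_moment_even) simp
  then show ?thesis
    using assms unfolding gauss_def by (intro has_bochner_integral_density) (auto simp: mult.commute)
qed

lemma integrable_gauss_power [simp]: "0 < h \<Longrightarrow> integrable (gauss h) (\<lambda>x. x ^ k)"
  unfolding gauss_def
  using integrable_normal_moment[of "sqrt h" 0 k]
  by (subst integrable_density) auto

lemma integrable_gauss_bounded:
  fixes f :: "real \<Rightarrow> real"
  assumes "0 < h" "f \<in> borel_measurable borel" "\<And>x. \<bar>f x\<bar> \<le> C"
  shows "integrable (gauss h) f"
proof -
  interpret prob_space "gauss h" using assms(1) by (rule prob_space_gauss)
  show ?thesis using assms by (intro integrable_const_bound[where B=C]) auto
qed

lemma gauss_mean [simp]: "0 < h \<Longrightarrow> (\<integral>x. x \<partial>gauss h) = 0"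
  unfolding gauss_def
  using integral_normal_moment_odd[of "sqrt h" 0 0]
  by (subst integral_density) auto

lemma gauss_second_moment [simp]: "0 < h \<Longrightarrow> (\<integral>x. x\<^sup>2 \<partial>gauss h) = h"
  using has_bochner_integral_integral_eq[OF gauss_even_moment[of h 1]] by simp

lemma gauss_fourth_moment [simp]: "0 < h \<Longrightarrow> (\<integral>x. x ^ 4 \<partial>gauss h) = 3 * h\<^sup>2"
  using has_bochner_integral_integral_eq[OF gauss_even_moment[of h 2]]
  by (simp add: fact_numeral power_divide field_simps)

lemma gauss_eq_distr:
  assumes "0 < h"
  shows "gauss h = distr std_normal_distribution borel (\<lambda>x. sqrt h * x)"
proof -
  interpret N: prob_space std_normal_distribution
    by (intro prob_space_normal_density) simp
  have "distributed std_normal_distribution lborel (\<lambda>x. x) (normal_density 0 1)"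
    by (auto simp: distributed_def distr_id2)
  from N.normal_density_affine[OF this, of "sqrt h" 0]
  have "distributed std_normal_distribution lborel (\<lambda>x. sqrt h * x) (normal_density 0 (sqrt h))"
    using assms by simp
  from distributed_distr_eq_density[OF this] show ?thesis
    by (simp add: gauss_def cong: distr_cong)
qed

text \<open>Cosines are eigenfunctions of one Gaussian step. In the addition formula the real part
  of the characteristic function supplies the factor, and its vanishing imaginary part removes the
  sine term.\<close>

lemma gauss_cos:
  assumes "0 < h"
  shows "(\<integral>x. cos (\<theta> * (r + x)) \<partial>gauss h) = exp (- \<theta>\<^sup>2 * h / 2) * cos (\<theta> * r)"
proof -
  interpret N: real_distribution std_normal_distribution
    by (rule real_dist_normal_dist)
  interpret G: prob_space "gauss h" using assms by (rule prob_space_gauss)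
  have *: "char std_normal_distribution (\<theta> * sqrt h) = complex_of_real (exp (- (\<theta> * sqrt h)\<^sup>2 / 2))"
    by (simp add: char_std_normal_distribution)
  have int: "integrable std_normal_distribution (\<lambda>x. iexp (\<theta> * sqrt h * x))"
    by (rule N.integrable_iexp) auto
  have c: "(\<integral>x. cos (\<theta> * sqrt h * x) \<partial>std_normal_distribution) = exp (- (\<theta> * sqrt h)\<^sup>2 / 2)"
    using arg_cong[OF *, of Re] int by (simp add: char_def Re_exp flip: integral_Re)
  have s: "(\<integral>x. sin (\<theta> * sqrt h * x) \<partial>std_normal_distribution) = 0"
    using arg_cong[OF *, of Im] int by (simp add: char_def Im_exp flip: integral_Im)
  have c': "(\<integral>x. cos (\<theta> * x) \<partial>gauss h) = exp (- \<theta>\<^sup>2 * h / 2)"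
    using c assms by (simp add: gauss_eq_distr integral_distr power_mult_distrib mult.assoc)
  have s': "(\<integral>x. sin (\<theta> * x) \<partial>gauss h) = 0"
    using s assms by (simp add: gauss_eq_distr integral_distr mult.assoc)
  have i: "integrable (gauss h) (\<lambda>x. cos (\<theta> * x))" "integrable (gauss h) (\<lambda>x. sin (\<theta> * x))"
    using assms by (auto intro!: integrable_gauss_bounded[where C=1])
  have "(\<integral>x. cos (\<theta> * (r + x)) \<partial>gauss h)
      = (\<integral>x. cos (\<theta> * r) * cos (\<theta> * x) - sin (\<theta> * r) * sin (\<theta> * x) \<partial>gauss h)"
    by (simp add: distrib_left cos_add)
  also have "\<dots> = exp (- \<theta>\<^sup>2 * h / 2) * cos (\<theta> * r)"
    using i by (simp add: c' s')
  finally show ?thesis .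
qed

text \<open>Cameron-Martin formula for a single step: recentring the density by
  \<open>\<mu> * h\<close> changes it by an explicit exponential, which trades a drift for a
  tilt.\<close>

lemma gauss_shift:
  assumes h: "0 < h" and [measurable]: "f \<in> borel_measurable borel"
  shows "(\<integral>\<^sup>+z. f (z - \<mu> * h) \<partial>gauss h) = (\<integral>\<^sup>+z. f z * ennreal (exp (- \<mu> * z - \<mu>\<^sup>2 * h / 2)) \<partial>gauss h)"
proof -
  have d: "normal_density 0 (sqrt h) (\<mu> * h + z)
      = normal_density 0 (sqrt h) z * exp (- \<mu> * z - \<mu>\<^sup>2 * h / 2)" for z
  proof -
    have "- (\<mu> * h + z)\<^sup>2 / (2 * h) = - z\<^sup>2 / (2 * h) + (- \<mu> * z - \<mu>\<^sup>2 * h / 2)"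
      using h by (simp add: field_simps power2_eq_square)
    then show ?thesis using h by (simp add: normal_density_def flip: exp_add)
  qed
  have "(\<integral>\<^sup>+z. f (z - \<mu> * h) \<partial>gauss h)
      = (\<integral>\<^sup>+z. ennreal (normal_density 0 (sqrt h) z) * f (z - \<mu> * h) \<partial>lborel)"
    unfolding gauss_def by (subst nn_integral_density) auto
  also have "\<dots> = (\<integral>\<^sup>+z. ennreal (normal_density 0 (sqrt h) (\<mu> * h + z)) * f z \<partial>lborel)"
    by (subst nn_integral_real_affine[where c=1 and t="\<mu> * h"]) auto
  also have "\<dots> = (\<integral>\<^sup>+z. ennreal (normal_density 0 (sqrt h) z) * (f z * ennreal (exp (- \<mu> * z - \<mu>\<^sup>2 * h / 2))) \<partial>lborel)"
    by (simp add: d ennreal_mult' mult.assoc mult.commute[of "f _"] del: mult_minus_left)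
  also have "\<dots> = (\<integral>\<^sup>+z. f z * ennreal (exp (- \<mu> * z - \<mu>\<^sup>2 * h / 2)) \<partial>gauss h)"
    unfolding gauss_def by (subst nn_integral_density) auto
  finally show ?thesis .
qed

section \<open>Chains driven by independent Gaussian steps\<close>

text \<open>The state type is arbitrary: it will be a reflected walk, a walk in a tube, or a pair of
  position and clock. Stopping is part of \<open>\<Phi>\<close>, which leaves a stopped state
  unchanged, so that no stopping times occur. State \<open>k\<close> uses only the steps with index
  below \<open>k\<close>.\<close>

primrec chain :: "('s \<Rightarrow> real \<Rightarrow> 's) \<Rightarrow> 's \<Rightarrow> (nat \<Rightarrow> real) \<Rightarrow> nat \<Rightarrow> 's" where
  "chain \<Phi> y \<xi> 0 = y"
| "chain \<Phi> y \<xi> (Suc k) = \<Phi> (chain \<Phi> y \<xi> k) (\<xi> k)"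

lemma chain_cong: "(\<And>i. i < k \<Longrightarrow> \<xi> i = \<xi>' i) \<Longrightarrow> chain \<Phi> y \<xi> k = chain \<Phi> y \<xi>' k"
  by (induction k) auto

lemma chain_invariant: "P y \<Longrightarrow> (\<And>s z. P s \<Longrightarrow> P (\<Phi> s z)) \<Longrightarrow> P (chain \<Phi> y \<xi> k)"
  by (induction k) auto

lemma measurable_chain:
  assumes [measurable]: "(\<lambda>(s, z). \<Phi> s z) \<in> measurable (N \<Otimes>\<^sub>M borel) N" and "y \<in> space N"
    and \<xi>: "\<And>i. i < k \<Longrightarrow> (\<lambda>\<omega>. \<xi> \<omega> i) \<in> borel_measurable M"
  shows "(\<lambda>\<omega>. chain \<Phi> y (\<xi> \<omega>) k) \<in> measurable M N"
  using \<xi>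
proof (induction k)
  case 0
  then show ?case using assms by simp
next
  case (Suc k)
  then have [measurable]: "(\<lambda>\<omega>. chain \<Phi> y (\<xi> \<omega>) k) \<in> measurable M N"
      "(\<lambda>\<omega>. \<xi> \<omega> k) \<in> borel_measurable M" by auto
  have "(\<lambda>\<omega>. (\<lambda>(s, z). \<Phi> s z) (chain \<Phi> y (\<xi> \<omega>) k, \<xi> \<omega> k)) \<in> measurable M N"
    by measurable
  then show ?case by simp
qed

definition gauss_steps :: "'a measure \<Rightarrow> real \<Rightarrow> nat \<Rightarrow> ('a \<Rightarrow> nat \<Rightarrow> real) \<Rightarrow> bool" where
  "gauss_steps M h n \<xi> \<longleftrightarrow> 0 < h \<and> prob_space M \<and>
     prob_space.indep_vars M (\<lambda>_. borel) (\<lambda>i \<omega>. \<xi> \<omega> i) {..<n} \<and>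
     (\<forall>i<n. distr M borel (\<lambda>\<omega>. \<xi> \<omega> i) = gauss h)"

lemma gauss_stepsD:
  assumes "gauss_steps M h n \<xi>"
  shows "0 < h" "prob_space M" "prob_space.indep_vars M (\<lambda>_. borel) (\<lambda>i \<omega>. \<xi> \<omega> i) {..<n}"
    "\<And>i. i < n \<Longrightarrow> distr M borel (\<lambda>\<omega>. \<xi> \<omega> i) = gauss h"
    "\<And>i. i < n \<Longrightarrow> (\<lambda>\<omega>. \<xi> \<omega> i) \<in> borel_measurable M"
proof -
  show *: "0 < h" "prob_space M" "prob_space.indep_vars M (\<lambda>_. borel) (\<lambda>i \<omega>. \<xi> \<omega> i) {..<n}"
    "\<And>i. i < n \<Longrightarrow> distr M borel (\<lambda>\<omega>. \<xi> \<omega> i) = gauss h"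
    using assms by (auto simp: gauss_steps_def)
  interpret prob_space M by fact
  show "\<And>i. i < n \<Longrightarrow> (\<lambda>\<omega>. \<xi> \<omega> i) \<in> borel_measurable M"
    using *(3) by (auto simp: indep_vars_def)
qed

text \<open>The Markov property in integrated form. The restrictions of \<open>\<xi>\<close> to
  \<open>{..<k}\<close> and to \<open>{k}\<close> are independent, the state after \<open>k\<close>
  steps factors through the first, and Fubini integrates out the second.\<close>

lemma chain_step:
  assumes G: "gauss_steps M h n \<xi>" and k: "k < n"
    and \<Phi>[measurable]: "(\<lambda>(s, z). \<Phi> s z) \<in> measurable (N \<Otimes>\<^sub>M borel) N" and y: "y \<in> space N"
    and F[measurable]: "F \<in> borel_measurable N"
  shows "(\<integral>\<^sup>+\<omega>. F (chain \<Phi> y (\<xi> \<omega>) (Suc k)) \<partial>M)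
       = (\<integral>\<^sup>+\<omega>. (\<integral>\<^sup>+z. F (\<Phi> (chain \<Phi> y (\<xi> \<omega>) k) z) \<partial>gauss h) \<partial>M)"
proof -
  note GD = gauss_stepsD[OF G]
  interpret prob_space M by (rule GD)
  interpret G: prob_space "gauss h" using GD(1) by (rule prob_space_gauss)
  have Y[measurable]: "(\<lambda>\<omega>. chain \<Phi> y (\<xi> \<omega>) k) \<in> measurable M N"
    using k y GD(5) by (intro measurable_chain) auto
  have [measurable]: "(\<lambda>\<omega>. \<xi> \<omega> k) \<in> borel_measurable M" using GD(5) k by auto
  have iv: "indep_var (PiM {..<k} (\<lambda>_. borel)) (\<lambda>\<omega>. restrict (\<lambda>i. \<xi> \<omega> i) {..<k})
      (PiM {k} (\<lambda>_. borel)) (\<lambda>\<omega>. restrict (\<lambda>i. \<xi> \<omega> i) {k})"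
    using k by (intro indep_var_restrict[OF GD(3)]) auto
  let ?A = "PiM {..<k} (\<lambda>_. borel :: real measure)" and ?B = "PiM {k} (\<lambda>_. borel :: real measure)"
  let ?X = "\<lambda>\<omega>. restrict (\<lambda>i. \<xi> \<omega> i) {..<k}" and ?Y = "\<lambda>\<omega>. restrict (\<lambda>i. \<xi> \<omega> i) {k}"
  from iv have [measurable]: "?X \<in> measurable M ?A" "?Y \<in> measurable M ?B"
    and D: "distr M (?A \<Otimes>\<^sub>M ?B) (\<lambda>\<omega>. (?X \<omega>, ?Y \<omega>)) = distr M ?A ?X \<Otimes>\<^sub>M distr M ?B ?Y"
    by (auto simp: indep_var_distribution_eq)
  interpret Y: prob_space "distr M ?B ?Y" by (rule prob_space_distr) simp
  have [measurable]: "(\<lambda>f. chain \<Phi> y f k) \<in> measurable ?A N"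
    using y by (intro measurable_chain) auto
  have [measurable]: "(\<lambda>g. g k) \<in> measurable ?B borel"
    by (rule measurable_component_singleton) simp
  have [measurable]: "(\<lambda>(s, z). F (\<Phi> s z)) \<in> borel_measurable (N \<Otimes>\<^sub>M borel)"
    using measurable_compose[OF \<Phi> F] by (simp add: split_beta')
  have [measurable]: "(\<lambda>p. F (\<Phi> (chain \<Phi> y (fst p) k) (snd p k))) \<in> borel_measurable (?A \<Otimes>\<^sub>M ?B)"
  proof -
    have "(\<lambda>p. (\<lambda>(s, z). F (\<Phi> s z)) (chain \<Phi> y (fst p) k, snd p k)) \<in> borel_measurable (?A \<Otimes>\<^sub>M ?B)"
      by measurable
    then show ?thesis by simp
  qed
  have [measurable]: "F \<circ> \<Phi> s \<in> borel_measurable borel" if "s \<in> space N" for s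
  proof -
    have "(\<lambda>z. (\<lambda>(s, z). F (\<Phi> s z)) (s, z)) \<in> borel_measurable borel"
      using that by measurable
    then show ?thesis by (simp add: comp_def)
  qed
  have c: "chain \<Phi> y (?X \<omega>) k = chain \<Phi> y (\<xi> \<omega>) k" for \<omega>
    by (rule chain_cong) simp
  have "(\<integral>\<^sup>+\<omega>. F (chain \<Phi> y (\<xi> \<omega>) (Suc k)) \<partial>M)
      = (\<integral>\<^sup>+p. F (\<Phi> (chain \<Phi> y (fst p) k) (snd p k)) \<partial>distr M (?A \<Otimes>\<^sub>M ?B) (\<lambda>\<omega>. (?X \<omega>, ?Y \<omega>)))"
    by (subst nn_integral_distr) (auto simp: c)
  also have "\<dots> = (\<integral>\<^sup>+f. (\<integral>\<^sup>+g. F (\<Phi> (chain \<Phi> y f k) (g k)) \<partial>distr M ?B ?Y) \<partial>distr M ?A ?X)"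
    unfolding D by (subst Y.nn_integral_fst[symmetric]) (auto simp: measurable_cong_sets[OF sets_pair_measure_cong[OF sets_distr sets_distr] refl])
  also have "\<dots> = (\<integral>\<^sup>+f. (\<integral>\<^sup>+z. F (\<Phi> (chain \<Phi> y f k) z) \<partial>gauss h) \<partial>distr M ?A ?X)"
  proof (intro nn_integral_cong)
    fix f assume "f \<in> space (distr M ?A ?X)"
    then have "chain \<Phi> y f k \<in> space N"
      using measurable_space[of "\<lambda>f. chain \<Phi> y f k" ?A N f] by simp
    then have [measurable]: "(\<lambda>z. F (\<Phi> (chain \<Phi> y f k) z)) \<in> borel_measurable borel"
      using \<open>\<And>s. s \<in> space N \<Longrightarrow> F \<circ> \<Phi> s \<in> borel_measurable borel\<close> by (simp add: comp_def)
    show "(\<integral>\<^sup>+g. F (\<Phi> (chain \<Phi> y f k) (g k)) \<partial>distr M ?B ?Y) = (\<integral>\<^sup>+z. F (\<Phi> (chain \<Phi> y f k) z) \<partial>gauss h)"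
      unfolding GD(4)[OF k, symmetric] by (subst (1 2) nn_integral_distr) (auto simp: GD(5) k)
  qed
  also have "\<dots> = (\<integral>\<^sup>+\<omega>. (\<integral>\<^sup>+z. F (\<Phi> (chain \<Phi> y (\<xi> \<omega>) k) z) \<partial>gauss h) \<partial>M)"
  proof -
    have "(\<lambda>(s, z). F (\<Phi> s z)) \<in> borel_measurable (N \<Otimes>\<^sub>M gauss h)"
      by (simp add: measurable_cong_sets[OF sets_pair_measure_cong[OF refl sets_gauss] refl])
    from G.borel_measurable_nn_integral_fst[OF this]
    have "(\<lambda>s. \<integral>\<^sup>+z. F (\<Phi> s z) \<partial>gauss h) \<in> borel_measurable N" by simp
    then have "(\<lambda>f. \<integral>\<^sup>+z. F (\<Phi> (chain \<Phi> y f k) z) \<partial>gauss h) \<in> borel_measurable ?A"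
      by (rule measurable_compose[OF \<open>(\<lambda>f. chain \<Phi> y f k) \<in> measurable ?A N\<close>])
    then show ?thesis
      by (subst nn_integral_distr) (simp_all add: c)
  qed
  finally show ?thesis .
qed

text \<open>Since \<open>\<kappa> \<le> 1\<close>, earlier errors are not amplified and add up to at
  most \<open>k * e\<close>. The invariant \<open>P\<close> confines the one-step inequality to
  states that the chain can reach.\<close>

lemma chain_supermartingale:
  assumes G: "gauss_steps M h n \<xi>" and k: "k \<le> n"
    and \<Phi>: "(\<lambda>(s, z). \<Phi> s z) \<in> measurable (N \<Otimes>\<^sub>M borel) N" and y: "y \<in> space N"
    and F: "F \<in> borel_measurable N"
    and P: "P y" "\<And>s z. P s \<Longrightarrow> P (\<Phi> s z)"
    and step: "\<And>s. P s \<Longrightarrow> (\<integral>\<^sup>+z. F (\<Phi> s z) \<partial>gauss h) \<le> \<kappa> * F s + e" and \<kappa>: "\<kappa> \<le> 1"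
  shows "(\<integral>\<^sup>+\<omega>. F (chain \<Phi> y (\<xi> \<omega>) k) \<partial>M) \<le> \<kappa> ^ k * F y + of_nat k * e"
  using k
proof (induction k)
  case 0
  interpret prob_space M using gauss_stepsD[OF G] by simp
  show ?case by (simp add: emeasure_space_1)
next
  case (Suc k)
  interpret prob_space M using gauss_stepsD[OF G] by simp
  have [measurable]: "(\<lambda>\<omega>. F (chain \<Phi> y (\<xi> \<omega>) k)) \<in> borel_measurable M"
    using Suc.prems y gauss_stepsD(5)[OF G] \<Phi> F by (intro measurable_compose[OF measurable_chain F]) auto
  have "(\<integral>\<^sup>+\<omega>. F (chain \<Phi> y (\<xi> \<omega>) (Suc k)) \<partial>M)
      = (\<integral>\<^sup>+\<omega>. (\<integral>\<^sup>+z. F (\<Phi> (chain \<Phi> y (\<xi> \<omega>) k) z) \<partial>gauss h) \<partial>M)"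
    using Suc.prems by (intro chain_step[OF G _ \<Phi> y F]) auto
  also have "\<dots> \<le> (\<integral>\<^sup>+\<omega>. \<kappa> * F (chain \<Phi> y (\<xi> \<omega>) k) + e \<partial>M)"
    by (intro nn_integral_mono step chain_invariant[where P=P] P)
  also have "\<dots> = \<kappa> * (\<integral>\<^sup>+\<omega>. F (chain \<Phi> y (\<xi> \<omega>) k) \<partial>M) + e"
    by (simp add: nn_integral_add nn_integral_cmult emeasure_space_1)
  also have "\<dots> \<le> \<kappa> * (\<kappa> ^ k * F y + of_nat k * e) + e"
    using Suc by (intro add_right_mono mult_left_mono) auto
  also have "\<dots> \<le> \<kappa> ^ Suc k * F y + 1 * (of_nat k * e) + e"
    unfolding distrib_left power_Suc mult.assoc using \<kappa> by (intro add_mono mult_right_mono) auto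
  also have "\<dots> = \<kappa> ^ Suc k * F y + of_nat (Suc k) * e"
    by (simp add: distrib_right add.assoc add.commute[of e])
  finally show ?case .
qed

text \<open>The error is added on the right-hand side instead of being subtracted on the left,
  because differences in \<open>ennreal\<close> are truncated at zero.\<close>

lemma chain_submartingale:
  assumes G: "gauss_steps M h n \<xi>" and k: "k \<le> n"
    and \<Phi>: "(\<lambda>(s, z). \<Phi> s z) \<in> measurable (N \<Otimes>\<^sub>M borel) N" and y: "y \<in> space N"
    and F: "F \<in> borel_measurable N"
    and P: "P y" "\<And>s z. P s \<Longrightarrow> P (\<Phi> s z)"
    and step: "\<And>s. P s \<Longrightarrow> \<kappa> * F s \<le> (\<integral>\<^sup>+z. F (\<Phi> s z) \<partial>gauss h) + e" and \<kappa>: "\<kappa> \<le> 1"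
  shows "\<kappa> ^ k * F y \<le> (\<integral>\<^sup>+\<omega>. F (chain \<Phi> y (\<xi> \<omega>) k) \<partial>M) + of_nat k * e"
  using k
proof (induction k)
  case 0
  interpret prob_space M using gauss_stepsD[OF G] by simp
  show ?case by (simp add: emeasure_space_1)
next
  case (Suc k)
  interpret prob_space M using gauss_stepsD[OF G] by simp
  have [measurable]: "(\<lambda>\<omega>. F (chain \<Phi> y (\<xi> \<omega>) k)) \<in> borel_measurable M"
    using Suc.prems y gauss_stepsD(5)[OF G] \<Phi> F by (intro measurable_compose[OF measurable_chain F]) auto
  have [measurable]: "(\<lambda>\<omega>. \<integral>\<^sup>+z. F (\<Phi> (chain \<Phi> y (\<xi> \<omega>) k) z) \<partial>gauss h) \<in> borel_measurable M"
  proof -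
    interpret G: prob_space "gauss h" using gauss_stepsD(1)[OF G] by (rule prob_space_gauss)
    have "(\<lambda>(s, z). F (\<Phi> s z)) \<in> borel_measurable (N \<Otimes>\<^sub>M gauss h)"
      using measurable_compose[OF \<Phi> F]
      by (simp add: split_beta' measurable_cong_sets[OF sets_pair_measure_cong[OF refl sets_gauss] refl])
    from G.borel_measurable_nn_integral_fst[OF this]
    have "(\<lambda>s. \<integral>\<^sup>+z. F (\<Phi> s z) \<partial>gauss h) \<in> borel_measurable N" by simp
    then show ?thesis
      using Suc.prems y gauss_stepsD(5)[OF G] \<Phi>
      by (intro measurable_compose[OF measurable_chain]) auto
  qed
  have "\<kappa> ^ Suc k * F y = \<kappa> * (\<kappa> ^ k * F y)"
    by (simp add: ac_simps)
  also have "\<dots> \<le> \<kappa> * ((\<integral>\<^sup>+\<omega>. F (chain \<Phi> y (\<xi> \<omega>) k) \<partial>M) + of_nat k * e)"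
    using Suc by (intro mult_left_mono) auto
  also have "\<dots> \<le> (\<integral>\<^sup>+\<omega>. \<kappa> * F (chain \<Phi> y (\<xi> \<omega>) k) \<partial>M) + 1 * (of_nat k * e)"
    unfolding distrib_left using \<kappa> by (intro add_mono mult_right_mono) (simp_all add: nn_integral_cmult)
  also have "\<dots> \<le> (\<integral>\<^sup>+\<omega>. (\<integral>\<^sup>+z. F (\<Phi> (chain \<Phi> y (\<xi> \<omega>) k) z) \<partial>gauss h) + e \<partial>M) + of_nat k * e"
    unfolding mult_1_left
    by (intro add_right_mono nn_integral_mono step chain_invariant[where P=P] P)
  also have "\<dots> = (\<integral>\<^sup>+\<omega>. F (chain \<Phi> y (\<xi> \<omega>) (Suc k)) \<partial>M) + of_nat (Suc k) * e"
    using Suc.prems chain_step[OF G _ \<Phi> y F, of k]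
    by (simp add: nn_integral_add emeasure_space_1 distrib_right add.assoc add.commute[of e])
  finally show ?case .
qed

section \<open>Brownian motion: small rises and tubes\<close>

lemma brownian_onD:
  assumes "brownian_on M I B"
  shows "prob_space M" "0 \<in> I" "\<And>t. t \<in> I \<Longrightarrow> B t \<in> borel_measurable M"
    "\<And>\<omega>. \<omega> \<in> space M \<Longrightarrow> B 0 \<omega> = 0" "\<And>\<omega>. \<omega> \<in> space M \<Longrightarrow> continuous_on I (\<lambda>t. B t \<omega>)"
    "\<And>s t. s \<in> I \<Longrightarrow> t \<in> I \<Longrightarrow> s < t \<Longrightarrow> distr M borel (\<lambda>\<omega>. B t \<omega> - B s \<omega>) = gauss (t - s)"
    "\<And>ts. sorted_wrt (<) ts \<Longrightarrow> set ts \<subseteq> I \<Longrightarrow> prob_space.indep_vars M (\<lambda>_. borel)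
          (\<lambda>i \<omega>. B (ts ! Suc i) \<omega> - B (ts ! i) \<omega>) {..< length ts - 1}"
proof -
  show "distr M borel (\<lambda>\<omega>. B t \<omega> - B s \<omega>) = gauss (t - s)" if "s \<in> I" "t \<in> I" "s < t" for s t
  proof -
    have "distributed M lborel (\<lambda>\<omega>. B t \<omega> - B s \<omega>) (\<lambda>x. ennreal (normal_density 0 (sqrt (t - s)) x))"
      using assms that by (auto simp: brownian_on_def)
    from distributed_distr_eq_density[OF this] show ?thesis
      by (simp add: gauss_def cong: distr_cong)
  qed
qed (use assms in \<open>auto simp: brownian_on_def\<close>)

lemma brownian_indep_increments:
  assumes B: "brownian_on M I B" and p: "\<And>j. j < n \<Longrightarrow> p j < p (Suc j)" "\<And>j. j \<le> n \<Longrightarrow> p j \<in> I"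
  shows "prob_space.indep_vars M (\<lambda>_. borel) (\<lambda>i \<omega>. B (p (Suc i)) \<omega> - B (p i) \<omega>) {..<n}"
proof -
  interpret prob_space M using B by (rule brownian_onD)
  let ?ts = "map p [0..<Suc n]"
  have lt: "p i < p j" if "i < j" "j \<le> n" for i j
    using that(1,2)
  proof (induction j rule: less_Suc_induct)
    case (1 i)
    then show ?case using p by simp
  next
    case (2 i j k)
    then show ?case by fastforce
  qed
  have "sorted_wrt (<) ?ts"
    by (auto simp: sorted_wrt_iff_nth_less less_Suc_eq_le simp del: upt_Suc intro!: lt)
  moreover have "set ?ts \<subseteq> I"
    using p by (auto simp: less_Suc_eq_le simp del: upt_Suc)
  ultimately have "indep_vars (\<lambda>_. borel) (\<lambda>i \<omega>. B (?ts ! Suc i) \<omega> - B (?ts ! i) \<omega>) {..<length ?ts - 1}"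
    by (rule brownian_onD(7)[OF B])
  also have "?this \<longleftrightarrow> indep_vars (\<lambda>_. borel) (\<lambda>i \<omega>. B (p (Suc i)) \<omega> - B (p i) \<omega>) {..<n}"
    by (rule indep_vars_cong) (auto simp del: upt_Suc)
  finally show ?thesis .
qed

lemma brownian_gauss_steps:
  assumes B: "brownian_on M I B" and h: "0 < h" and I: "\<And>j. j \<le> n \<Longrightarrow> s + real j * h \<in> I"
  shows "gauss_steps M h n (\<lambda>\<omega> i. B (s + real (Suc i) * h) \<omega> - B (s + real i * h) \<omega>)"
proof -
  interpret prob_space M using B by (rule brownian_onD)
  have "indep_vars (\<lambda>_. borel) (\<lambda>i \<omega>. B (s + real (Suc i) * h) \<omega> - B (s + real i * h) \<omega>) {..<n}"
    using h I by (intro brownian_indep_increments[OF B, of n "\<lambda>j. s + real j * h"]) auto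
  moreover have "distr M borel (\<lambda>\<omega>. B (s + real (Suc i) * h) \<omega> - B (s + real i * h) \<omega>) = gauss h" if "i < n" for i
    using brownian_onD(6)[OF B, of "s + real i * h" "s + real (Suc i) * h"] h I[of i] I[of "Suc i"] that
    by (simp add: distrib_right)
  ultimately show ?thesis
    using h prob_space_axioms by (simp add: gauss_steps_def)
qed

lemma ennreal_integral_le_nn_integral:
  fixes f :: "'a \<Rightarrow> real"
  assumes "integrable M f"
  shows "ennreal (integral\<^sup>L M f) \<le> (\<integral>\<^sup>+x. ennreal (f x) \<partial>M)"
proof -
  have "ennreal (integral\<^sup>L M f) \<le> ennreal (\<integral>x. max 0 (f x) \<partial>M)"
    using assms by (intro ennreal_leI integral_mono) auto
  also have "\<dots> = (\<integral>\<^sup>+x. ennreal (max 0 (f x)) \<partial>M)"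
    using assms by (intro nn_integral_eq_integral[symmetric]) auto
  also have "(\<lambda>x. ennreal (max 0 (f x))) = (\<lambda>x. ennreal (f x))"
    by (auto simp: max_def ennreal_neg)
  finally show ?thesis .
qed

lemma ennreal_add_le: "0 \<le> e \<Longrightarrow> ennreal (x + e) \<le> ennreal x + ennreal e"
  by (cases "0 \<le> x") (auto simp: ennreal_neg ennreal_leI)

lemma ennreal_power_le_real:
  assumes "ennreal \<kappa> ^ n * ennreal f \<le> ennreal p + of_nat n * ennreal e" "0 \<le> \<kappa>" "0 \<le> f" "0 \<le> p" "0 \<le> e"
  shows "\<kappa> ^ n * f \<le> p + n * e"
proof -
  have "ennreal (\<kappa> ^ n * f) \<le> ennreal (p + n * e)"
    using assms by (simp add: ennreal_power ennreal_mult' ennreal_of_nat_eq_real_of_nat)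
  then show ?thesis using assms by (subst (asm) ennreal_le_iff) auto
qed

lemma real_le_ennreal_power:
  assumes "ennreal c * ennreal p \<le> ennreal \<kappa> ^ n * ennreal f + of_nat n * ennreal e" "0 \<le> \<kappa>" "0 \<le> f" "0 \<le> c" "0 \<le> e"
  shows "c * p \<le> \<kappa> ^ n * f + n * e"
proof -
  have "ennreal (c * p) \<le> ennreal (\<kappa> ^ n * f + n * e)"
    using assms by (simp add: ennreal_power ennreal_mult' ennreal_of_nat_eq_real_of_nat)
  then show ?thesis using assms by (subst (asm) ennreal_le_iff) auto
qed

lemma nn_integral_le_ennreal_integral:
  fixes g :: "'a \<Rightarrow> real"
  assumes "integrable M g" "\<And>x. x \<in> space M \<Longrightarrow> f x \<le> ennreal (g x)" "\<And>x. x \<in> space M \<Longrightarrow> 0 \<le> g x"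
  shows "(\<integral>\<^sup>+x. f x \<partial>M) \<le> ennreal (integral\<^sup>L M g)"
proof -
  have "(\<integral>\<^sup>+x. f x \<partial>M) \<le> (\<integral>\<^sup>+x. ennreal (g x) \<partial>M)"
    using assms by (intro nn_integral_mono) auto
  also have "\<dots> = ennreal (integral\<^sup>L M g)"
    using assms by (intro nn_integral_eq_integral) auto
  finally show ?thesis .
qed

section \<open>Height above the running minimum\<close>

definition rise_step :: "real \<Rightarrow> real \<Rightarrow> real \<Rightarrow> real" where
  "rise_step a r z = (if r > a then r else max (r + z) 0)"

text \<open>\<open>rise_step\<close> is the Lindley recursion for the height above the running
  minimum, frozen above \<open>a\<close> so that an exceedance is remembered. The induction carries
  more than the equivalence: as long as the chain is unfrozen, its value bounds all
  \<open>x n - x i\<close> and is attained by one of them.\<close>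

lemma chain_rise_step:
  assumes "0 \<le> a"
  shows "chain (rise_step a) 0 (\<lambda>i. x (Suc i) - x i) n \<le> a \<longleftrightarrow> (\<forall>j\<le>n. \<forall>i\<le>j. x j - x i \<le> a)"
proof -
  let ?R = "chain (rise_step a) 0 (\<lambda>i. x (Suc i) - x i)"
  have "(?R n \<le> a \<longleftrightarrow> (\<forall>j\<le>n. \<forall>i\<le>j. x j - x i \<le> a)) \<and>
    (?R n \<le> a \<longrightarrow> (\<forall>i\<le>n. x n - x i \<le> ?R n) \<and> (\<exists>i\<le>n. ?R n = x n - x i))"
  proof (induction n)
    case 0
    then show ?case using assms by simp
  next
    case (Suc n)
    show ?case
    proof (cases "?R n \<le> a")
      case False
      then have "?R (Suc n) = ?R n" by (simp add: rise_step_def)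
      moreover have "\<not> (\<forall>j\<le>n. \<forall>i\<le>j. x j - x i \<le> a)" using Suc False by blast
      ultimately show ?thesis using False le_SucI by metis
    next
      case True
      then have eq: "?R (Suc n) = max (?R n + (x (Suc n) - x n)) 0" by (simp add: rise_step_def)
      have all: "\<forall>j\<le>n. \<forall>i\<le>j. x j - x i \<le> a" and ub: "\<forall>i\<le>n. x n - x i \<le> ?R n"
        using Suc True by blast+
      obtain i0 where i0: "i0 \<le> n" "?R n = x n - x i0" using Suc True by blast
      have ub': "\<forall>i\<le>Suc n. x (Suc n) - x i \<le> ?R (Suc n)"
        using ub unfolding eq by (auto simp: le_Suc_eq)
      \<comment> \<open>The maximum is attained at the old minimiser, or at the new point itself
        when the walk is reflected to 0.\<close>
      have ex: "\<exists>i\<le>Suc n. ?R (Suc n) = x (Suc n) - x i"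
      proof (cases "?R n + (x (Suc n) - x n) \<ge> 0")
        case True
        then show ?thesis using i0 unfolding eq by (intro exI[of _ i0]) auto
      next
        case False
        then show ?thesis unfolding eq by (intro exI[of _ "Suc n"]) auto
      qed
      have "?R (Suc n) \<le> a \<longleftrightarrow> (\<forall>i\<le>Suc n. x (Suc n) - x i \<le> a)"
        using ub' ex by force
      then have "?R (Suc n) \<le> a \<longleftrightarrow> (\<forall>j\<le>Suc n. \<forall>i\<le>j. x j - x i \<le> a)"
        using all by (auto simp: le_Suc_eq)
      with ub' ex show ?thesis by blast
    qed
  qed
  then show ?thesis by blast
qed

lemma chain_rise_step_nonneg: "0 \<le> chain (rise_step a) 0 \<xi> n"
  by (rule chain_invariant[where P="\<lambda>s. 0 \<le> s"]) (auto simp: rise_step_def)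

lemma measurable_rise_step [measurable]: "(\<lambda>(s, z). rise_step a s z) \<in> measurable (borel \<Otimes>\<^sub>M borel) borel"
  unfolding rise_step_def by measurable

text \<open>A pointwise Markov inequality. Fourth powers are used because the fourth moment of a
  step is \<open>3 * h\<^sup>2\<close>, so that over a fixed length the errors of all steps together
  are of order \<open>h\<close>.\<close>

lemma power4_ge:
  fixes z c :: real
  assumes "c \<le> \<bar>z\<bar>" "0 < c"
  shows "1 \<le> z ^ 4 / c ^ 4"
proof -
  have "c ^ 4 \<le> \<bar>z\<bar> ^ 4" using assms by (intro power_mono) auto
  then show ?thesis using assms by (simp add: power_even_abs)
qed

lemma integrable_gauss_cos [simp]: "0 < h \<Longrightarrow> integrable (gauss h) (\<lambda>z. cos (\<theta> * (r + z)))"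
  by (rule integrable_gauss_bounded[where C=1]) auto

text \<open>The ground state of the walk reflected at 0 and killed above \<open>a\<close> is a
  cosine with frequency \<open>pi / (2 * a)\<close>. Cut off outside \<open>[0, a]\<close> it loses
  in one step at most its eigenvalue factor and a quartic error, and it never exceeds the indicator
  of survival.\<close>

lemma prob_small_rise_lower:
  assumes G: "gauss_steps M h n (\<lambda>\<omega> i. x \<omega> (Suc i) - x \<omega> i)" and a: "0 < a"
  shows "exp (- pi\<^sup>2 * (n * h) / (8 * a\<^sup>2)) - n * (3 * h\<^sup>2 / (16 * a ^ 4))
    \<le> measure M {\<omega> \<in> space M. \<forall>j\<le>n. \<forall>i\<le>j. x \<omega> j - x \<omega> i \<le> a}"
proof -
  note GD = gauss_stepsD[OF G]
  interpret prob_space M by (rule GD)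
  define \<theta> where "\<theta> = pi / (2 * a)"
  define f where "f r = (if 0 \<le> r \<and> r \<le> a then cos (\<theta> * r) else 0)" for r
  have \<theta>: "0 < \<theta>" "\<theta> * a = pi / 2" using a by (auto simp: \<theta>_def)
  have f0: "0 \<le> f r" for r
  proof -
    have "0 \<le> cos (\<theta> * r)" if "0 \<le> r" "r \<le> a"
      proof (rule cos_ge_zero)
      have "0 \<le> \<theta> * r" "\<theta> * r \<le> \<theta> * a" using that \<theta> by (auto intro: mult_left_mono)
      then show "- (pi / 2) \<le> \<theta> * r" "\<theta> * r \<le> pi / 2" using \<theta>(2) by linarith+
    qed
    then show ?thesis by (simp add: f_def)
  qed
  have f_lower: "cos (\<theta> * y) - z ^ 4 / (16 * a ^ 4) \<le> f (max y 0)" if "y = r + z" "0 \<le> r" "r \<le> a" for y r z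
  proof -
    have z4: "0 \<le> z ^ 4 / (16 * a ^ 4)" by simp
    \<comment> \<open>Below 0 reflection lifts the function to its maximum 1. Between
      \<open>a\<close> and \<open>3 * a\<close> the cosine is nonpositive. Beyond
      \<open>3 * a\<close> the step exceeds \<open>2 * a\<close>, and
      \<open>16 * a ^ 4 = (2 * a) ^ 4\<close> makes the quartic term at least 1.\<close>
    consider "y < 0" | "0 \<le> y" "y \<le> a" | "a < y" "y < 3 * a" | "3 * a \<le> y" by linarith
    then show ?thesis
    proof cases
      case 1
      then have "f (max y 0) = 1" using a by (simp add: f_def max_def)
      then show ?thesis using z4 cos_le_one[of "\<theta> * y"] by linarith
    next
      case 2
      then show ?thesis using z4 by (simp add: f_def)
    next
      case 3
      have "cos (\<theta> * y - pi) \<ge> 0"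
      proof (rule cos_ge_zero)
        have "\<theta> * a \<le> \<theta> * y" "\<theta> * y \<le> \<theta> * (3 * a)" using 3 \<theta>(1) by (auto intro: mult_left_mono)
        then show "- (pi / 2) \<le> \<theta> * y - pi" "\<theta> * y - pi \<le> pi / 2" using \<theta>(2) by linarith+
      qed
      then have "cos (\<theta> * y) \<le> 0" by (simp add: cos_diff)
      then show ?thesis using z4 f0[of "max y 0"] by linarith
    next
      case 4
      then have "2 * a \<le> \<bar>z\<bar>" using that a by auto
      from power4_ge[OF this] a have "1 \<le> z ^ 4 / (16 * a ^ 4)" by (simp add: power_mult_distrib)
      then show ?thesis using cos_le_one[of "\<theta> * y"] f0[of "max y 0"] by linarith
    qed
  qed
  have [measurable]: "f \<in> borel_measurable borel" unfolding f_def by measurable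
  let ?R = "\<lambda>\<omega>. chain (rise_step a) 0 (\<lambda>i. x \<omega> (Suc i) - x \<omega> i) n"
  define \<kappa> where "\<kappa> = exp (- \<theta>\<^sup>2 * h / 2)"
  define e where "e = 3 * h\<^sup>2 / (16 * a ^ 4)"
  have [measurable]: "?R \<in> borel_measurable M"
    using GD(5) by (intro measurable_chain) auto
  have step: "ennreal \<kappa> * ennreal (f s) \<le> (\<integral>\<^sup>+z. ennreal (f (rise_step a s z)) \<partial>gauss h) + ennreal e"
    if s: "0 \<le> s" for s
  proof (cases "s \<le> a")
    case False
    then show ?thesis by (simp add: f_def)
  next
    case True
    have int: "integrable (gauss h) (\<lambda>z. cos (\<theta> * (s + z)) - z ^ 4 / (16 * a ^ 4))"
      using GD(1) by (intro Bochner_Integration.integrable_diff integrable_divide) auto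
    have "\<kappa> * f s = (\<integral>z. cos (\<theta> * (s + z)) - z ^ 4 / (16 * a ^ 4) \<partial>gauss h) + e"
      using GD(1) gauss_cos[OF GD(1), of \<theta> s] True s by (simp add: f_def \<kappa>_def e_def)
    then have "ennreal \<kappa> * ennreal (f s) = ennreal ((\<integral>z. cos (\<theta> * (s + z)) - z ^ 4 / (16 * a ^ 4) \<partial>gauss h) + e)"
      using f0 by (simp add: \<kappa>_def flip: ennreal_mult')
    also have "\<dots> \<le> ennreal (\<integral>z. cos (\<theta> * (s + z)) - z ^ 4 / (16 * a ^ 4) \<partial>gauss h) + ennreal e"
      by (rule ennreal_add_le) (simp add: e_def)
    also have "ennreal (\<integral>z. cos (\<theta> * (s + z)) - z ^ 4 / (16 * a ^ 4) \<partial>gauss h)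
        \<le> (\<integral>\<^sup>+z. ennreal (cos (\<theta> * (s + z)) - z ^ 4 / (16 * a ^ 4)) \<partial>gauss h)"
      by (rule ennreal_integral_le_nn_integral[OF int])
    also have "\<dots> \<le> (\<integral>\<^sup>+z. ennreal (f (rise_step a s z)) \<partial>gauss h)"
      using True s f_lower by (intro nn_integral_mono ennreal_leI) (simp add: rise_step_def)
    finally show ?thesis by (simp add: add_right_mono)
  qed
  have nn: "0 \<le> \<kappa>" "0 \<le> e" by (auto simp: \<kappa>_def e_def)
  have "ennreal \<kappa> \<le> 1" using GD(1) by (auto simp: \<kappa>_def ennreal_le_1)
  with step have "ennreal \<kappa> ^ n * ennreal (f 0) \<le> (\<integral>\<^sup>+\<omega>. ennreal (f (?R \<omega>)) \<partial>M) + of_nat n * ennreal e"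
    by (intro chain_submartingale[OF G order_refl, where N=borel and P="\<lambda>s. 0 \<le> s"])
      (auto simp: rise_step_def)
  also have "(\<integral>\<^sup>+\<omega>. ennreal (f (?R \<omega>)) \<partial>M) \<le> (\<integral>\<^sup>+\<omega>. indicator {\<omega> \<in> space M. ?R \<omega> \<le> a} \<omega> \<partial>M)"
    by (intro nn_integral_mono) (auto simp: f_def indicator_def)
  also have "\<dots> = ennreal (measure M {\<omega> \<in> space M. ?R \<omega> \<le> a})"
    by (simp add: emeasure_eq_measure)
  also have "{\<omega> \<in> space M. ?R \<omega> \<le> a} = {\<omega> \<in> space M. \<forall>j\<le>n. \<forall>i\<le>j. x \<omega> j - x \<omega> i \<le> a}"
    using a by (auto simp: chain_rise_step[of a])
  finally have "\<kappa> ^ n * f 0 \<le> measure M {\<omega> \<in> space M. \<forall>j\<le>n. \<forall>i\<le>j. x \<omega> j - x \<omega> i \<le> a} + n * e"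
    using nn f0 by (intro ennreal_power_le_real) (auto simp: add_right_mono)
  moreover have "\<kappa> ^ n = exp (- pi\<^sup>2 * (n * h) / (8 * a\<^sup>2))"
    by (simp add: \<kappa>_def \<theta>_def power_divide power_mult_distrib mult_ac flip: exp_of_nat_mult)
  ultimately show ?thesis using a by (simp add: e_def f_def)
qed

text \<open>For an upper bound the cosine must dominate the stopped function after each step,
  although the discrete walk overshoots both ends. Shifting it by \<open>\<eta>\<close> leaves room:
  on \<open>[- 2 * \<eta>, 0]\<close> it is at least its value at 0, and just above \<open>a\<close>
  it is still nonnegative. On \<open>[0, a]\<close> it is at least
  \<open>cos (\<theta> * (a + \<eta>)) > 0\<close>, which turns the expectation into a
  probability.\<close>

lemma prob_small_rise_upper:
  assumes G: "gauss_steps M h n (\<lambda>\<omega> i. x \<omega> (Suc i) - x \<omega> i)" and a: "0 < a"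
    and \<eta>: "0 < \<eta>" and \<theta>: "0 < \<theta>" "\<theta> * (a + \<eta>) < pi / 2"
  shows "cos (\<theta> * (a + \<eta>)) * measure M {\<omega> \<in> space M. \<forall>j\<le>n. \<forall>i\<le>j. x \<omega> j - x \<omega> i \<le> a}
    \<le> exp (- \<theta>\<^sup>2 * (n * h) / 2) + n * (3 * h\<^sup>2 * (1 / (8 * \<eta> ^ 4) + 1 / (pi / (2 * \<theta>) - \<eta> - a) ^ 4))"
proof -
  note GD = gauss_stepsD[OF G]
  interpret prob_space M by (rule GD)
  \<comment> \<open>The distance from \<open>a\<close> to the zero of the shifted cosine.\<close>
  define \<delta> where "\<delta> = pi / (2 * \<theta>) - \<eta> - a"
  define C where "C = 1 / (8 * \<eta> ^ 4) + 1 / \<delta> ^ 4"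
  define f where "f r = (if 0 \<le> r \<and> r \<le> a then cos (\<theta> * (r + \<eta>)) else 0)" for r
  have \<delta>: "0 < \<delta>" using \<theta> by (simp add: \<delta>_def field_simps)
  have C: "0 \<le> C" "1 / (8 * \<eta> ^ 4) \<le> C" "1 / \<delta> ^ 4 \<le> C" by (auto simp: C_def)
  have cos_mono: "cos (\<theta> * (a + \<eta>)) \<le> cos (\<theta> * (r + \<eta>))" if "0 \<le> r" "r \<le> a" for r
  proof (rule cos_monotone_0_pi_le)
    show "0 \<le> \<theta> * (r + \<eta>)" "\<theta> * (r + \<eta>) \<le> \<theta> * (a + \<eta>)" using that \<theta> \<eta> by auto
    show "\<theta> * (a + \<eta>) \<le> pi" using \<theta> pi_gt_zero by linarith
  qed
  have c0: "0 < cos (\<theta> * (a + \<eta>))"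
    using \<theta> a \<eta> by (intro cos_gt_zero) auto
  have f0: "0 \<le> f r" for r using cos_mono[of r] c0 by (auto simp: f_def)
  have f_upper: "f (max y 0) \<le> cos (\<theta> * (y + \<eta>)) + C * z ^ 4" if "y = r + z" "0 \<le> r" "r \<le> a" for y r z
  proof -
    have z4: "0 \<le> z ^ 4" "0 \<le> C * z ^ 4" using C by simp_all
    have cp: "0 \<le> cos (\<theta> * (y + \<eta>))" if "a < y" "y + \<eta> \<le> pi / (2 * \<theta>)"
    proof (rule cos_ge_zero)
      have "0 \<le> \<theta> * (y + \<eta>)" using that \<theta> \<eta> a by simp
      then show "- (pi / 2) \<le> \<theta> * (y + \<eta>)" using pi_gt_zero by linarith
      show "\<theta> * (y + \<eta>) \<le> pi / 2" using that \<theta> by (simp add: field_simps)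
    qed
    consider "y < - 2 * \<eta>" | "- 2 * \<eta> \<le> y" "y < 0" | "0 \<le> y" "y \<le> a"
      | "a < y" "y + \<eta> \<le> pi / (2 * \<theta>)" | "a < y" "pi / (2 * \<theta>) < y + \<eta>" by linarith
    then show ?thesis
    proof cases
      \<comment> \<open>The two sides can differ by 2, hence the constant
        \<open>2 / (2 * \<eta>) ^ 4 = 1 / (8 * \<eta> ^ 4)\<close>.\<close>
      case 1
      then have "2 * \<eta> \<le> \<bar>z\<bar>" using that by auto
      from power4_ge[OF this] \<eta> have "2 \<le> 1 / (8 * \<eta> ^ 4) * z ^ 4" by (simp add: power_mult_distrib field_simps)
      also have "\<dots> \<le> C * z ^ 4" using C z4 by (intro mult_right_mono)
      finally have "2 \<le> C * z ^ 4" .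
      moreover have "f (max y 0) \<le> 1" by (simp add: f_def)
      ultimately show ?thesis using cos_ge_minus_one[of "\<theta> * (y + \<eta>)"] by linarith
    next
      case 2
      have "cos (\<theta> * \<eta>) \<le> cos \<bar>\<theta> * (y + \<eta>)\<bar>"
      proof (rule cos_monotone_0_pi_le)
        have "\<theta> * \<bar>y + \<eta>\<bar> \<le> \<theta> * \<eta>" using 2 \<theta> by (intro mult_left_mono) auto
        then show "\<bar>\<theta> * (y + \<eta>)\<bar> \<le> \<theta> * \<eta>" using \<theta> by (simp add: abs_mult)
        have "\<theta> * \<eta> \<le> \<theta> * (a + \<eta>)" using a \<theta> by simp
        then show "\<theta> * \<eta> \<le> pi" using \<theta> pi_gt_zero by linarith
      qed simp
      then have "f (max y 0) \<le> cos (\<theta> * (y + \<eta>))" using 2 a by (simp add: f_def max_def)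
      then show ?thesis using z4 by linarith
    next
      case 3
      then show ?thesis using z4 by (simp add: f_def)
    next
      case 4
      then have "f (max y 0) = 0" using a by (simp add: f_def max_def)
      then show ?thesis using cp[OF 4] z4 by linarith
    next
      case 5
      then have f: "f (max y 0) = 0" using a by (simp add: f_def max_def)
      have "\<delta> \<le> \<bar>z\<bar>" using 5 that by (auto simp: \<delta>_def)
      from power4_ge[OF this \<delta>] have "1 \<le> 1 / \<delta> ^ 4 * z ^ 4" by simp
      also have "\<dots> \<le> C * z ^ 4" using C z4 by (intro mult_right_mono)
      finally show ?thesis using f cos_ge_minus_one[of "\<theta> * (y + \<eta>)"] by linarith
    qed
  qed
  have [measurable]: "f \<in> borel_measurable borel" unfolding f_def by measurable
  let ?R = "\<lambda>\<omega>. chain (rise_step a) 0 (\<lambda>i. x \<omega> (Suc i) - x \<omega> i) n"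
  define \<kappa> where "\<kappa> = exp (- \<theta>\<^sup>2 * h / 2)"
  define e where "e = C * (3 * h\<^sup>2)"
  have nn: "0 \<le> \<kappa>" "0 \<le> e" using C by (auto simp: \<kappa>_def e_def)
  have [measurable]: "?R \<in> borel_measurable M"
    using GD(5) by (intro measurable_chain) auto
  have step: "(\<integral>\<^sup>+z. ennreal (f (rise_step a s z)) \<partial>gauss h) \<le> ennreal \<kappa> * ennreal (f s) + ennreal e"
    if s: "0 \<le> s" for s
  proof (cases "s \<le> a")
    case False
    then show ?thesis by (simp add: f_def rise_step_def)
  next
    case True
    have int: "integrable (gauss h) (\<lambda>z. cos (\<theta> * ((s + \<eta>) + z)) + C * z ^ 4)"
      using GD(1) by (intro Bochner_Integration.integrable_add integrable_mult_right integrable_gauss_cos) auto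
    have up: "f (rise_step a s z) \<le> cos (\<theta> * ((s + \<eta>) + z)) + C * z ^ 4" for z
      using f_upper[OF refl s True, of z] True by (simp add: rise_step_def ac_simps)
    then have "(\<integral>\<^sup>+z. ennreal (f (rise_step a s z)) \<partial>gauss h)
        \<le> ennreal (\<integral>z. cos (\<theta> * ((s + \<eta>) + z)) + C * z ^ 4 \<partial>gauss h)"
      using f0 by (intro nn_integral_le_ennreal_integral[OF int] ennreal_leI) (auto intro: order_trans)
    also have "(\<integral>z. cos (\<theta> * ((s + \<eta>) + z)) + C * z ^ 4 \<partial>gauss h) = \<kappa> * f s + e"
      using GD(1) gauss_cos[OF GD(1), of \<theta> "s + \<eta>"] True s by (simp add: f_def \<kappa>_def e_def)
    finally show ?thesis using nn f0 by (simp add: ennreal_mult')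
  qed
  have "ennreal \<kappa> \<le> 1" using GD(1) by (auto simp: \<kappa>_def ennreal_le_1)
  have "ennreal (cos (\<theta> * (a + \<eta>))) * ennreal (measure M {\<omega> \<in> space M. ?R \<omega> \<le> a})
      = (\<integral>\<^sup>+\<omega>. ennreal (cos (\<theta> * (a + \<eta>))) * indicator {\<omega> \<in> space M. ?R \<omega> \<le> a} \<omega> \<partial>M)"
    by (simp add: emeasure_eq_measure nn_integral_cmult)
  also have "\<dots> \<le> (\<integral>\<^sup>+\<omega>. ennreal (f (?R \<omega>)) \<partial>M)"
    using cos_mono chain_rise_step_nonneg[of a]
    by (intro nn_integral_mono) (auto simp: f_def indicator_def intro!: ennreal_leI)
  also have "\<dots> \<le> ennreal \<kappa> ^ n * ennreal (f 0) + of_nat n * ennreal e"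
    using step \<open>ennreal \<kappa> \<le> 1\<close>
    by (intro chain_supermartingale[OF G order_refl, where N=borel and P="\<lambda>s. 0 \<le> s"])
      (auto simp: rise_step_def)
  finally have "cos (\<theta> * (a + \<eta>)) * measure M {\<omega> \<in> space M. ?R \<omega> \<le> a} \<le> \<kappa> ^ n * f 0 + n * e"
    using c0 f0 nn by (intro real_le_ennreal_power) auto
  also have "{\<omega> \<in> space M. ?R \<omega> \<le> a} = {\<omega> \<in> space M. \<forall>j\<le>n. \<forall>i\<le>j. x \<omega> j - x \<omega> i \<le> a}"
    using a by (auto simp: chain_rise_step[of a])
  also have "\<kappa> ^ n * f 0 \<le> \<kappa> ^ n" using nn by (simp add: f_def mult_left_le)
  also have "\<kappa> ^ n = exp (- \<theta>\<^sup>2 * (n * h) / 2)"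
    by (simp add: \<kappa>_def mult_ac flip: exp_of_nat_mult)
  finally show ?thesis by (simp add: e_def C_def \<delta>_def mult_ac)
qed

section \<open>Staying in a tube around a sloped line\<close>

definition tube_step :: "real \<Rightarrow> real \<Rightarrow> real \<Rightarrow> real \<Rightarrow> real" where
  "tube_step a d y z = (if \<bar>y\<bar> > a then y else y + (z - d))"

lemma chain_tube_step:
  assumes "0 \<le> a"
  shows "\<bar>chain (tube_step a d) 0 (\<lambda>i. x (Suc i) - x i) n\<bar> \<le> a
    \<longleftrightarrow> (\<forall>j\<le>n. \<bar>x j - x 0 - d * real j\<bar> \<le> a)"
proof -
  let ?Y = "chain (tube_step a d) 0 (\<lambda>i. x (Suc i) - x i)"
  have "(\<bar>?Y n\<bar> \<le> a \<longleftrightarrow> (\<forall>j\<le>n. \<bar>x j - x 0 - d * real j\<bar> \<le> a)) \<and>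
    (\<bar>?Y n\<bar> \<le> a \<longrightarrow> ?Y n = x n - x 0 - d * real n)"
  proof (induction n)
    case 0
    then show ?case using assms by simp
  next
    case (Suc n)
    show ?case
    proof (cases "\<bar>?Y n\<bar> \<le> a")
      case False
      then have "?Y (Suc n) = ?Y n" by (simp add: tube_step_def)
      then show ?thesis using False Suc by (auto simp: le_Suc_eq)
    next
      case True
      have "?Y n = x n - x 0 - d * real n" using Suc True by blast
      then have "?Y (Suc n) = x (Suc n) - x 0 - d * real (Suc n)"
        using True by (simp add: tube_step_def distrib_left)
      then show ?thesis using True Suc by (auto simp: le_Suc_eq)
    qed
  qed
  then show ?thesis by blast
qed

lemma measurable_tube_step [measurable]: "(\<lambda>(s, z). tube_step a d s z) \<in> measurable (borel \<Otimes>\<^sub>M borel) borel"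
  unfolding tube_step_def by measurable

text \<open>The factor \<open>exp (\<mu> * y)\<close> in the test function undoes the drift: after
  the change of measure only the driftless cosine estimate on \<open>[- a, a]\<close> remains. Each
  step pays \<open>exp (- \<mu>\<^sup>2 * h / 2)\<close>, and inside the tube the tilt is never more
  than \<open>exp (\<bar>\<mu>\<bar> * a)\<close>.\<close>

lemma prob_tube_lower:
  assumes G: "gauss_steps M h n (\<lambda>\<omega> i. x \<omega> (Suc i) - x \<omega> i)" and a: "0 < a"
  shows "exp (- (\<mu>\<^sup>2 + (pi / (2 * a))\<^sup>2) * (n * h) / 2) - n * (exp (\<bar>\<mu>\<bar> * a) * (3 * h\<^sup>2 / (16 * a ^ 4)))
    \<le> exp (\<bar>\<mu>\<bar> * a) * measure M {\<omega> \<in> space M. \<forall>j\<le>n. \<bar>x \<omega> j - x \<omega> 0 - \<mu> * h * real j\<bar> \<le> a}"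
proof -
  note GD = gauss_stepsD[OF G]
  interpret prob_space M by (rule GD)
  define \<theta> where "\<theta> = pi / (2 * a)"
  define f where "f r = (if \<bar>r\<bar> \<le> a then cos (\<theta> * r) else 0)" for r
  have \<theta>: "0 < \<theta>" "\<theta> * a = pi / 2" using a by (auto simp: \<theta>_def)
  have f0: "0 \<le> f r" for r
  proof -
    have "0 \<le> cos \<bar>\<theta> * r\<bar>" if "\<bar>r\<bar> \<le> a"
    proof (rule cos_ge_zero)
      have "\<theta> * \<bar>r\<bar> \<le> \<theta> * a" using that \<theta> by (auto intro: mult_left_mono)
      then show "\<bar>\<theta> * r\<bar> \<le> pi / 2" using \<theta> by (simp add: abs_mult)
      show "- (pi / 2) \<le> \<bar>\<theta> * r\<bar>" using pi_gt_zero abs_ge_zero[of "\<theta> * r"] by linarith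
    qed
    then show ?thesis by (simp add: f_def)
  qed
  have f1: "f r \<le> 1" for r by (simp add: f_def)
  have f_lower: "cos (\<theta> * (r + z)) - z ^ 4 / (16 * a ^ 4) \<le> f (r + z)" if "\<bar>r\<bar> \<le> a" for r z
  proof -
    have z4: "0 \<le> z ^ 4 / (16 * a ^ 4)" by simp
    consider "\<bar>r + z\<bar> \<le> a" | "a < \<bar>r + z\<bar>" "\<bar>r + z\<bar> < 3 * a" | "3 * a \<le> \<bar>r + z\<bar>" by linarith
    then show ?thesis
    proof cases
      case 1
      then show ?thesis using z4 by (simp add: f_def)
    next
      case 2
      have "cos (\<theta> * \<bar>r + z\<bar> - pi) \<ge> 0"
      proof (rule cos_ge_zero)
        have "\<theta> * a \<le> \<theta> * \<bar>r + z\<bar>" "\<theta> * \<bar>r + z\<bar> \<le> \<theta> * (3 * a)" using 2 \<theta>(1) by (auto intro: mult_left_mono)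
        then show "- (pi / 2) \<le> \<theta> * \<bar>r + z\<bar> - pi" "\<theta> * \<bar>r + z\<bar> - pi \<le> pi / 2" using \<theta>(2) by linarith+
      qed
      then have "cos \<bar>\<theta> * (r + z)\<bar> \<le> 0" using \<theta> by (simp add: cos_diff abs_mult)
      then have "cos (\<theta> * (r + z)) \<le> 0" by simp
      then show ?thesis using z4 f0[of "r + z"] by linarith
    next
      case 3
      then have "2 * a \<le> \<bar>z\<bar>" using that a by auto
      from power4_ge[OF this] a have "1 \<le> z ^ 4 / (16 * a ^ 4)" by (simp add: power_mult_distrib)
      then show ?thesis using cos_le_one[of "\<theta> * (r + z)"] f0[of "r + z"] by linarith
    qed
  qed
  have [measurable]: "f \<in> borel_measurable borel" unfolding f_def by measurable
  define g where "g y = exp (\<mu> * y) * f y" for y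
  have [measurable]: "g \<in> borel_measurable borel" unfolding g_def by measurable
  have g0: "0 \<le> g y" for y using f0 by (simp add: g_def)
  have exp_le: "exp (\<mu> * y) \<le> exp (\<bar>\<mu>\<bar> * a)" if "\<bar>y\<bar> \<le> a" for y
  proof -
    have "\<mu> * y \<le> \<bar>\<mu>\<bar> * \<bar>y\<bar>" by (metis abs_ge_self abs_mult)
    also have "\<dots> \<le> \<bar>\<mu>\<bar> * a" using that by (intro mult_left_mono) auto
    finally show ?thesis by simp
  qed
  let ?Y = "\<lambda>\<omega>. chain (tube_step a (\<mu> * h)) 0 (\<lambda>i. x \<omega> (Suc i) - x \<omega> i) n"
  define \<kappa>' where "\<kappa>' = exp (- \<theta>\<^sup>2 * h / 2)"
  define \<kappa> where "\<kappa> = exp (- \<mu>\<^sup>2 * h / 2) * \<kappa>'"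
  define e' where "e' = 3 * h\<^sup>2 / (16 * a ^ 4)"
  define e where "e = exp (\<bar>\<mu>\<bar> * a) * e'"
  have nn: "0 \<le> \<kappa>" "0 \<le> e" "0 \<le> e'" by (auto simp: \<kappa>_def \<kappa>'_def e_def e'_def)
  have [measurable]: "?Y \<in> borel_measurable M"
    using GD(5) by (intro measurable_chain) auto
  have step: "ennreal \<kappa> * ennreal (g s) \<le> (\<integral>\<^sup>+z. ennreal (g (tube_step a (\<mu> * h) s z)) \<partial>gauss h) + ennreal e" for s
  proof (cases "\<bar>s\<bar> \<le> a")
    case False
    then show ?thesis by (simp add: g_def f_def)
  next
    case True
    have int: "integrable (gauss h) (\<lambda>z. cos (\<theta> * (s + z)) - z ^ 4 / (16 * a ^ 4))"
      using GD(1) by (intro Bochner_Integration.integrable_diff integrable_divide) auto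
    define c where "c = exp (\<mu> * s - \<mu>\<^sup>2 * h / 2)"
    have c: "0 \<le> c" "c \<le> exp (\<bar>\<mu>\<bar> * a)"
    proof -
      have "c \<le> exp (\<mu> * s)" using GD(1) by (simp add: c_def)
      with exp_le[OF True] show "c \<le> exp (\<bar>\<mu>\<bar> * a)" by linarith
    qed (simp add: c_def)
    have "(\<integral>\<^sup>+z. ennreal (g (tube_step a (\<mu> * h) s z)) \<partial>gauss h) = (\<integral>\<^sup>+z. (\<lambda>z. ennreal (g (s + z))) (z - \<mu> * h) \<partial>gauss h)"
      using True by (simp add: tube_step_def)
    also have "\<dots> = (\<integral>\<^sup>+z. ennreal (g (s + z)) * ennreal (exp (- \<mu> * z - \<mu>\<^sup>2 * h / 2)) \<partial>gauss h)"
      using GD(1) by (intro gauss_shift) auto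
    also have "\<dots> = (\<integral>\<^sup>+z. ennreal c * ennreal (f (s + z)) \<partial>gauss h)"
    proof (intro nn_integral_cong)
      fix z
      \<comment> \<open>The tilt at the new position cancels the density of the shift up to a factor
        that does not depend on \<open>z\<close>.\<close>
      have "exp (\<mu> * (s + z)) * exp (- \<mu> * z - \<mu>\<^sup>2 * h / 2) = c"
        by (simp add: c_def algebra_simps flip: exp_add)
      then show "ennreal (g (s + z)) * ennreal (exp (- \<mu> * z - \<mu>\<^sup>2 * h / 2)) = ennreal c * ennreal (f (s + z))"
        using c by (simp add: g_def ac_simps f0 flip: ennreal_mult')
    qed
    also have "\<dots> = ennreal c * (\<integral>\<^sup>+z. ennreal (f (s + z)) \<partial>gauss h)"
      by (intro nn_integral_cmult) auto
    finally have eq: "(\<integral>\<^sup>+z. ennreal (g (tube_step a (\<mu> * h) s z)) \<partial>gauss h) = ennreal c * (\<integral>\<^sup>+z. ennreal (f (s + z)) \<partial>gauss h)" .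
    have "\<kappa>' * f s = (\<integral>z. cos (\<theta> * (s + z)) - z ^ 4 / (16 * a ^ 4) \<partial>gauss h) + e'"
      using GD(1) gauss_cos[OF GD(1), of \<theta> s] True by (simp add: f_def \<kappa>'_def e'_def)
    then have "ennreal (\<kappa>' * f s) = ennreal ((\<integral>z. cos (\<theta> * (s + z)) - z ^ 4 / (16 * a ^ 4) \<partial>gauss h) + e')"
      by simp
    also have "\<dots> \<le> ennreal (\<integral>z. cos (\<theta> * (s + z)) - z ^ 4 / (16 * a ^ 4) \<partial>gauss h) + ennreal e'"
      by (rule ennreal_add_le) (simp add: e'_def)
    also have "ennreal (\<integral>z. cos (\<theta> * (s + z)) - z ^ 4 / (16 * a ^ 4) \<partial>gauss h)
        \<le> (\<integral>\<^sup>+z. ennreal (cos (\<theta> * (s + z)) - z ^ 4 / (16 * a ^ 4)) \<partial>gauss h)"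
      by (rule ennreal_integral_le_nn_integral[OF int])
    also have "\<dots> \<le> (\<integral>\<^sup>+z. ennreal (f (s + z)) \<partial>gauss h)"
      using True f_lower by (intro nn_integral_mono ennreal_leI) simp
    finally have "ennreal c * ennreal (\<kappa>' * f s) \<le> ennreal c * ((\<integral>\<^sup>+z. ennreal (f (s + z)) \<partial>gauss h) + ennreal e')"
      by (simp add: add_right_mono mult_left_mono)
    also have "\<dots> \<le> (\<integral>\<^sup>+z. ennreal (g (tube_step a (\<mu> * h) s z)) \<partial>gauss h) + ennreal e"
      unfolding eq distrib_left using c nn
      by (auto simp: e_def intro!: add_left_mono ennreal_leI mult_right_mono simp flip: ennreal_mult')
    also have "ennreal c * ennreal (\<kappa>' * f s) = ennreal \<kappa> * ennreal (g s)"
    proof -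
      have "c = exp (- \<mu>\<^sup>2 * h / 2) * exp (\<mu> * s)" by (simp add: c_def flip: exp_add)
      then show ?thesis
        using f0 nn c by (simp add: \<kappa>_def g_def mult_ac \<kappa>'_def flip: ennreal_mult')
    qed
    finally show ?thesis .
  qed
  have "ennreal \<kappa> \<le> 1"
  proof -
    have "exp (- \<mu>\<^sup>2 * h / 2) * \<kappa>' \<le> 1 * 1"
      using GD(1) by (intro mult_mono) (auto simp: \<kappa>'_def)
    then show ?thesis by (simp add: \<kappa>_def ennreal_le_1)
  qed
  with step have "ennreal \<kappa> ^ n * ennreal (g 0) \<le> (\<integral>\<^sup>+\<omega>. ennreal (g (?Y \<omega>)) \<partial>M) + of_nat n * ennreal e"
    by (intro chain_submartingale[OF G order_refl, where N=borel and P="\<lambda>_. True"]) auto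
  also have "(\<integral>\<^sup>+\<omega>. ennreal (g (?Y \<omega>)) \<partial>M)
      \<le> (\<integral>\<^sup>+\<omega>. ennreal (exp (\<bar>\<mu>\<bar> * a)) * indicator {\<omega> \<in> space M. \<bar>?Y \<omega>\<bar> \<le> a} \<omega> \<partial>M)"
  proof (intro nn_integral_mono)
    fix \<omega> assume "\<omega> \<in> space M"
    moreover have "g y \<le> exp (\<bar>\<mu>\<bar> * a)" if "\<bar>y\<bar> \<le> a" for y
      using mult_mono[OF exp_le[OF that] f1[of y]] f0[of y] by (simp add: g_def)
    moreover have "g y = 0" if "\<not> \<bar>y\<bar> \<le> a" for y
      using that by (simp add: g_def f_def)
    ultimately show "ennreal (g (?Y \<omega>)) \<le> ennreal (exp (\<bar>\<mu>\<bar> * a)) * indicator {\<omega> \<in> space M. \<bar>?Y \<omega>\<bar> \<le> a} \<omega>"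
      by (cases "\<bar>?Y \<omega>\<bar> \<le> a") (simp_all add: indicator_def ennreal_leI)
  qed
  also have "\<dots> = ennreal (exp (\<bar>\<mu>\<bar> * a) * measure M {\<omega> \<in> space M. \<bar>?Y \<omega>\<bar> \<le> a})"
    by (simp add: emeasure_eq_measure nn_integral_cmult ennreal_mult')
  also have "{\<omega> \<in> space M. \<bar>?Y \<omega>\<bar> \<le> a} = {\<omega> \<in> space M. \<forall>j\<le>n. \<bar>x \<omega> j - x \<omega> 0 - \<mu> * h * real j\<bar> \<le> a}"
    using a by (auto simp: chain_tube_step[of a])
  finally have "\<kappa> ^ n * g 0 \<le> exp (\<bar>\<mu>\<bar> * a) * measure M {\<omega> \<in> space M. \<forall>j\<le>n. \<bar>x \<omega> j - x \<omega> 0 - \<mu> * h * real j\<bar> \<le> a} + n * e"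
    using nn g0 by (intro ennreal_power_le_real) (auto simp: add_right_mono)
  moreover have "\<kappa> ^ n = exp (- (\<mu>\<^sup>2 + (pi / (2 * a))\<^sup>2) * (n * h) / 2)"
    by (simp add: \<kappa>_def \<kappa>'_def \<theta>_def algebra_simps add_divide_distrib flip: exp_of_nat_mult exp_add)
  ultimately show ?thesis using a by (simp add: e_def e'_def g_def f_def)
qed

section \<open>Independence of blocks\<close>

text \<open>All blocks are cut into the same number \<open>N\<close> of cells, so
  \<open>i = k * N + j\<close> enumerates the grid points increasingly even if the blocks differ in
  length. Block \<open>k\<close> sees exactly the increments with index in
  \<open>{k * N..<Suc k * N}\<close>, and these index sets are disjoint.\<close>

lemma brownian_blocks_indep:
  fixes W :: "real \<Rightarrow> 'a \<Rightarrow> real" and d :: "nat \<Rightarrow> (nat \<Rightarrow> real) \<Rightarrow> real"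
  assumes W: "brownian_on M UNIV W" and x: "\<And>k. k < m \<Longrightarrow> x k < x (Suc k)" and N: "0 < N"
    and d: "\<And>k. k < m \<Longrightarrow> d k \<in> borel_measurable (PiM {..<N} (\<lambda>_. borel))"
  defines "q \<equiv> \<lambda>k j. x k + real j * ((x (Suc k) - x k) / real N)"
  shows "prob_space.indep_vars M (\<lambda>_. borel)
    (\<lambda>k \<omega>. d k (restrict (\<lambda>j. W (q k (Suc j)) \<omega> - W (q k j) \<omega>) {..<N})) {..<m}"
proof -
  interpret prob_space M using W by (rule brownian_onD)
  define p where "p i = q (i div N) (i mod N)" for i
  have q_Suc: "p (Suc (k * N + j)) = q k (Suc j)" if "j < N" for k j
  proof (cases "Suc j < N")
    case True
    then have "Suc (k * N + j) div N = k" "Suc (k * N + j) mod N = Suc j"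
      by (simp_all flip: add_Suc_right)
    then show ?thesis by (simp add: p_def)
  next
    \<comment> \<open>At the last cell the index rolls over to the first point of block
      \<open>k + 1\<close>, which is the end point of block \<open>k\<close>.\<close>
    case False
    with that have "Suc j = N" by simp
    then have "Suc (k * N + j) = Suc k * N" by simp
    moreover have "Suc k * N div N = Suc k" "Suc k * N mod N = 0" using N by (auto simp del: mult_Suc)
    ultimately have "Suc (k * N + j) div N = Suc k" "Suc (k * N + j) mod N = 0" by metis+
    then show ?thesis using N \<open>Suc j = N\<close> by (simp add: p_def q_def del: of_nat_Suc)
  qed
  have q_eq: "p (k * N + j) = q k j" if "j < N" for k j
    using that by (simp add: p_def)
  have ind: "indep_vars (\<lambda>_. borel) (\<lambda>i \<omega>. W (p (Suc i)) \<omega> - W (p i) \<omega>) {..<m * N}"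
  proof (rule brownian_indep_increments[OF W])
    fix i assume i: "i < m * N"
    define k j where "k = i div N" and "j = i mod N"
    have kj: "i = k * N + j" "j < N" using N by (auto simp: k_def j_def)
    have "k < m" using i N by (simp add: k_def less_mult_imp_div_less)
    then have "0 < (x (Suc k) - x k) / real N" using x N by simp
    moreover have "q k (Suc j) = q k j + (x (Suc k) - x k) / real N"
      by (simp add: q_def distrib_right add_divide_distrib)
    ultimately show "p i < p (Suc i)" unfolding kj(1) using kj(2) by (simp only: q_Suc q_eq less_add_same_cancel1)
  qed simp
  define K where "K k = {k * N ..< Suc k * N}" for k
  have KI: "K k \<subseteq> {..<m * N}" if "k \<in> {..<m}" for k
  proof -
    have "Suc k * N \<le> m * N" using that by (intro mult_le_mono1) auto
    then show ?thesis by (auto simp: K_def)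
  qed
  have disj: "disjoint_family_on K {..<m}"
  proof (unfold disjoint_family_on_def, intro ballI impI)
    fix k l :: nat assume "k \<noteq> l"
    have *: "K k \<inter> K l = {}" if "k < l" for k l
    proof -
      have "Suc k * N \<le> l * N" using that by (intro mult_le_mono1) auto
      then show ?thesis by (auto simp: K_def)
    qed
    show "K k \<inter> K l = {}" using *[of k l] *[of l k] \<open>k \<noteq> l\<close> by (cases "k < l") auto
  qed
  have "indep_vars (\<lambda>_. borel) (\<lambda>k \<omega>. (\<lambda>f. d k (restrict (\<lambda>j. f (k * N + j)) {..<N}))
      (restrict (\<lambda>i. W (p (Suc i)) \<omega> - W (p i) \<omega>) (K k))) {..<m}"
  proof (rule indep_vars_compose2[OF indep_vars_restrict[OF ind KI disj]])
    fix k assume k: "k \<in> {..<m}"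
    have "(\<lambda>f. restrict (\<lambda>j. f (k * N + j)) {..<N}) \<in> measurable (PiM (K k) (\<lambda>_. borel)) (PiM {..<N} (\<lambda>_. borel :: real measure))"
      by (intro measurable_restrict measurable_component_singleton) (auto simp: K_def)
    from measurable_compose[OF this d] k
    show "(\<lambda>f. d k (restrict (\<lambda>j. f (k * N + j)) {..<N})) \<in> borel_measurable (PiM (K k) (\<lambda>_. borel))"
      by simp
  qed
  also have "?this \<longleftrightarrow> ?thesis"
  proof (intro indep_vars_cong refl ext)
    fix k \<omega> assume "k \<in> {..<m}"
    have "restrict (\<lambda>j. (restrict (\<lambda>i. W (p (Suc i)) \<omega> - W (p i) \<omega>) (K k)) (k * N + j)) {..<N}
      = restrict (\<lambda>j. W (q k (Suc j)) \<omega> - W (q k j) \<omega>) {..<N}"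
      by (intro restrict_ext) (auto simp: K_def q_Suc q_eq)
    then show "d k (restrict (\<lambda>j. (restrict (\<lambda>i. W (p (Suc i)) \<omega> - W (p i) \<omega>) (K k)) (k * N + j)) {..<N})
      = d k (restrict (\<lambda>j. W (q k (Suc j)) \<omega> - W (q k j) \<omega>) {..<N})" by simp
  qed
  finally show ?thesis .
qed

section \<open>Primitives and Riemann sums\<close>

definition antideriv :: "(real \<Rightarrow> real) \<Rightarrow> real \<Rightarrow> real" where
  "antideriv f x = (LBINT y=0..x. f y)"

lemma antideriv_0 [simp]: "antideriv f 0 = 0"
  by (simp add: antideriv_def zero_ereal_def)

lemma antideriv_has_derivative:
  assumes "continuous_on UNIV f"
  shows "(antideriv f has_real_derivative f x) (at x)"
proof -
  define A where "A = min 0 x - 1"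
  define C where "C = max 0 x + 1"
  have "((\<lambda>u. LBINT y=0..u. f y) has_vector_derivative f x) (at x within {A..C})"
    using interval_integral_FTC2[of A 0 C f x] assms
    by (auto simp: A_def C_def zero_ereal_def continuous_on_subset)
  then have "(antideriv f has_vector_derivative f x) (at x within {A..C})"
    by (simp add: antideriv_def[abs_def])
  moreover have "at x within {A..C} = at x"
    by (rule at_within_interior) (auto simp: A_def C_def interior_atLeastAtMost_real)
  ultimately show ?thesis by (simp add: has_real_derivative_iff_has_vector_derivative)
qed

lemma antideriv_measurable [measurable]:
  assumes "continuous_on UNIV f"
  shows "antideriv f \<in> borel_measurable borel"
proof -
  have "continuous_on UNIV (antideriv f)"
    using antideriv_has_derivative[OF assms] by (intro DERIV_continuous_on) (auto intro: has_field_derivative_at_within)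
  then show ?thesis by (rule borel_measurable_continuous_onI)
qed

text \<open>The bound is uniform in the number \<open>k\<close> of summands, because the sums will
  be read at a freezing index that depends on the path. On each cell the mean value theorem compares
  the left end point with an intermediate point.\<close>

lemma riemann_sum_uniform:
  fixes F f :: "real \<Rightarrow> real"
  assumes F: "\<And>x. (F has_real_derivative f x) (at x)"
    and f: "continuous_on {a..b} f" and e: "0 < e"
  shows "\<exists>\<delta>>0. \<forall>h k. 0 < h \<longrightarrow> h < \<delta> \<longrightarrow> a + real k * h \<le> b \<longrightarrow>
    \<bar>h * (\<Sum>i<k. f (a + real i * h)) - (F (a + real k * h) - F a)\<bar> \<le> e"
proof -
  define e' where "e' = e / (\<bar>b - a\<bar> + 1)"
  have e': "0 < e'" using e by (auto simp: e'_def intro!: divide_pos_pos)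
  have "uniformly_continuous_on {a..b} f"
    by (rule compact_uniformly_continuous[OF f]) simp
  then obtain \<delta> where \<delta>: "0 < \<delta>" "\<And>x y. x \<in> {a..b} \<Longrightarrow> y \<in> {a..b} \<Longrightarrow> \<bar>y - x\<bar> < \<delta> \<Longrightarrow> \<bar>f y - f x\<bar> < e'"
    unfolding uniformly_continuous_on_def dist_real_def using e' by blast
  have "\<bar>h * (\<Sum>i<k. f (a + real i * h)) - (F (a + real k * h) - F a)\<bar> \<le> real k * h * e'"
    if h: "0 < h" "h < \<delta>" and k: "a + real k * h \<le> b" for h k
    using k
  proof (induction k)
    case 0
    then show ?case by simp
  next
    case (Suc k)
    have k: "a + real k * h \<le> b" using Suc.prems h by (simp add: distrib_right)
    let ?u = "a + real k * h" and ?v = "a + real (Suc k) * h"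
    have uv: "?u < ?v" "?v - ?u = h" "a \<le> ?u" "?v \<le> b" using Suc.prems h by (auto simp: distrib_right)
    obtain z where z: "?u < z" "z < ?v" "F ?v - F ?u = (?v - ?u) * f z"
      using MVT2[OF uv(1), of F f] F by auto
    have "\<bar>f ?u - f z\<bar> < e'"
    proof (rule \<delta>(2))
      have "?v = ?u + h" using uv(2) by linarith
      then show "z \<in> {a..b}" "?u \<in> {a..b}" "\<bar>?u - z\<bar> < \<delta>"
        using z(1,2) uv(3,4) h unfolding atLeastAtMost_iff by linarith+
    qed
    then have 1: "\<bar>h * f ?u - (F ?v - F ?u)\<bar> \<le> h * e'"
      using h(1) unfolding z(3) uv(2) by (simp add: abs_mult flip: right_diff_distrib)
    have "\<bar>h * (\<Sum>i<Suc k. f (a + real i * h)) - (F ?v - F a)\<bar>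
        \<le> \<bar>h * (\<Sum>i<k. f (a + real i * h)) - (F ?u - F a)\<bar> + \<bar>h * f ?u - (F ?v - F ?u)\<bar>"
      by (simp add: distrib_left)
    also have "\<dots> \<le> real k * h * e' + h * e'" using Suc.IH[OF k] 1 by linarith
    also have "\<dots> = real (Suc k) * h * e'" by (simp add: distrib_right)
    finally show ?case .
  qed
  moreover have "real k * h * e' \<le> e" if "a + real k * h \<le> b" for h k
  proof -
    have "real k * h * e' \<le> (\<bar>b - a\<bar> + 1) * e'" using that e' by (intro mult_right_mono) auto
    also have "\<dots> = e" by (simp add: e'_def)
    finally show ?thesis .
  qed
  ultimately show ?thesis using \<delta>(1) by (meson order_trans)
qed

section \<open>Dyadic description of path events\<close>

definition dyadic_index :: "nat \<Rightarrow> real \<Rightarrow> nat" where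
  "dyadic_index n u = nat \<lfloor>u * 2 ^ n\<rfloor>"

lemma dyadic_index_le: "u \<le> 1 \<Longrightarrow> dyadic_index n u \<le> 2 ^ n"
  unfolding dyadic_index_def
  by (simp add: nat_le_iff floor_le_iff mult_le_cancel_right1 less_le_trans[of _ "2 ^ n + 1" "2 ^ n + 1"] le_less_trans[of "u * 2 ^ n" "2 ^ n"])

lemma dyadic_index_mono: "u \<le> u' \<Longrightarrow> dyadic_index n u \<le> dyadic_index n u'"
  unfolding dyadic_index_def by (intro nat_mono floor_mono mult_right_mono) auto

lemma dyadic_index_tendsto:
  assumes "0 \<le> u"
  shows "(\<lambda>n. real (dyadic_index n u) / 2 ^ n) \<longlonglongrightarrow> u"
proof (rule tendsto_sandwich[where f="\<lambda>n. u - (1/2) ^ n" and h="\<lambda>_. u"])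
  have eq: "real (dyadic_index n u) = of_int \<lfloor>u * 2 ^ n\<rfloor>" for n
    using assms by (simp add: dyadic_index_def)
  have "(u * 2 ^ n - 1) / 2 ^ n \<le> real (dyadic_index n u) / 2 ^ n" for n
    unfolding eq by (intro divide_right_mono) (auto simp: of_int_floor_le intro: less_imp_le)
  then show "\<forall>\<^sub>F n in sequentially. u - (1/2) ^ n \<le> real (dyadic_index n u) / 2 ^ n"
    by (simp add: diff_divide_distrib power_divide)
  have "real (dyadic_index n u) / 2 ^ n \<le> (u * 2 ^ n) / 2 ^ n" for n
    unfolding eq by (intro divide_right_mono) (auto simp: of_int_floor_le)
  then show "\<forall>\<^sub>F n in sequentially. real (dyadic_index n u) / 2 ^ n \<le> u" by simp
  have "(\<lambda>n. u - (1/2) ^ n) \<longlonglongrightarrow> u - 0" by (intro tendsto_intros) auto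
  then show "(\<lambda>n. u - (1/2) ^ n) \<longlonglongrightarrow> u" by simp
qed simp

definition dyadic_point :: "real \<Rightarrow> real \<Rightarrow> nat \<Rightarrow> nat \<Rightarrow> real" where
  "dyadic_point s l n j = s + real j * (l / 2 ^ n)"

lemma dyadic_point_Suc: "dyadic_point s l (Suc n) (2 * j) = dyadic_point s l n j"
  by (simp add: dyadic_point_def)

lemma dyadic_point_0 [simp]: "dyadic_point s l n 0 = s"
  by (simp add: dyadic_point_def)

lemma dyadic_point_mono: "0 \<le> l \<Longrightarrow> i \<le> j \<Longrightarrow> dyadic_point s l n i \<le> dyadic_point s l n j"
  by (auto simp: dyadic_point_def intro!: divide_right_mono mult_right_mono)

lemma dyadic_point_le: "0 \<le> l \<Longrightarrow> j \<le> 2 ^ n \<Longrightarrow> dyadic_point s l n j \<le> s + l"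
  using dyadic_point_mono[of l j "2 ^ n" s n] by (simp add: dyadic_point_def)

lemma dyadic_point_ge: "0 \<le> l \<Longrightarrow> s \<le> dyadic_point s l n j"
  by (simp add: dyadic_point_def)

lemma dyadic_path_tendsto:
  assumes w: "continuous_on UNIV w" and x: "s \<le> x" and l: "0 < l"
  shows "(\<lambda>n. w (dyadic_point s l n (dyadic_index n ((x - s) / l)))) \<longlonglongrightarrow> (w x :: real)"
proof -
  have "(\<lambda>n. s + real (dyadic_index n ((x - s) / l)) / 2 ^ n * l) \<longlonglongrightarrow> s + (x - s) / l * l"
    using x l by (intro tendsto_intros dyadic_index_tendsto) auto
  then have "(\<lambda>n. dyadic_point s l n (dyadic_index n ((x - s) / l))) \<longlonglongrightarrow> x"
    using l by (simp add: dyadic_point_def)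
  then show ?thesis
    using w by (intro isCont_tendsto_compose[where g=w]) (auto simp: continuous_on_eq_continuous_at)
qed

text \<open>Continuity replaces uncountably many constraints by those at dyadic points. This makes
  the event measurable and presents it as a limit of events about finitely many increments.\<close>

lemma small_rise_iff_dyadic:
  assumes w: "continuous_on UNIV w" and l: "0 < l"
  shows "(\<forall>x y. s \<le> x \<and> x \<le> y \<and> y \<le> s + l \<longrightarrow> w y - w x \<le> a)
    \<longleftrightarrow> (\<forall>n. \<forall>j\<le>2 ^ n. \<forall>i\<le>j. w (dyadic_point s l n j) - w (dyadic_point s l n i) \<le> (a :: real))"
    (is "?L \<longleftrightarrow> ?R")
proof
  assume ?L
  show ?R
  proof (intro allI impI)
    fix n i j :: nat assume "j \<le> 2 ^ n" "i \<le> j"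
    then have "s \<le> dyadic_point s l n i" "dyadic_point s l n i \<le> dyadic_point s l n j" "dyadic_point s l n j \<le> s + l"
      using l by (auto intro!: dyadic_point_ge dyadic_point_le dyadic_point_mono)
    with \<open>?L\<close> show "w (dyadic_point s l n j) - w (dyadic_point s l n i) \<le> a" by blast
  qed
next
  assume R: ?R
  show ?L
  proof (intro allI impI)
    fix x y assume xy: "s \<le> x \<and> x \<le> y \<and> y \<le> s + l"
    have "(\<lambda>n. w (dyadic_point s l n (dyadic_index n ((y - s) / l))) - w (dyadic_point s l n (dyadic_index n ((x - s) / l))))
      \<longlonglongrightarrow> w y - w x"
      using xy l by (intro tendsto_diff dyadic_path_tendsto[OF w]) auto
    moreover have "w (dyadic_point s l n (dyadic_index n ((y - s) / l))) - w (dyadic_point s l n (dyadic_index n ((x - s) / l))) \<le> a" for n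
    proof -
      have "dyadic_index n ((y - s) / l) \<le> 2 ^ n" "dyadic_index n ((x - s) / l) \<le> dyadic_index n ((y - s) / l)"
        using xy l by (auto intro!: dyadic_index_le dyadic_index_mono divide_right_mono)
      then show ?thesis using R by blast
    qed
    ultimately show "w y - w x \<le> a" by (intro LIMSEQ_le_const2) auto
  qed
qed

lemma tube_iff_dyadic:
  assumes w: "continuous_on UNIV w" and l: "0 < l"
  shows "(\<forall>x. s \<le> x \<and> x \<le> s + l \<longrightarrow> \<bar>w x - w s - \<mu> * (x - s)\<bar> \<le> e)
    \<longleftrightarrow> (\<forall>n. \<forall>j\<le>2 ^ n. \<bar>w (dyadic_point s l n j) - w s - \<mu> * (l / 2 ^ n) * real j\<bar> \<le> (e :: real))"
    (is "?L \<longleftrightarrow> ?R")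
proof
  have eq: "\<mu> * (l / 2 ^ n) * real j = \<mu> * (dyadic_point s l n j - s)" for n j
    by (simp add: dyadic_point_def)
  {
    assume L: ?L
    show ?R
    proof (intro allI impI)
      fix n j :: nat assume "j \<le> 2 ^ n"
      then have "s \<le> dyadic_point s l n j" "dyadic_point s l n j \<le> s + l"
        using l by (auto intro!: dyadic_point_ge dyadic_point_le)
      with L show "\<bar>w (dyadic_point s l n j) - w s - \<mu> * (l / 2 ^ n) * real j\<bar> \<le> e"
        unfolding eq by blast
    qed
  next
    assume R: ?R
    show ?L
    proof (intro allI impI)
      fix x assume x: "s \<le> x \<and> x \<le> s + l"
      define w' where "w' x = \<bar>w x - w s - \<mu> * (x - s)\<bar>" for x
      have "continuous_on UNIV w'" unfolding w'_def using w by (intro continuous_intros) auto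
      then have "(\<lambda>n. w' (dyadic_point s l n (dyadic_index n ((x - s) / l)))) \<longlonglongrightarrow> w' x"
        using x l by (intro dyadic_path_tendsto) auto
      moreover have "w' (dyadic_point s l n (dyadic_index n ((x - s) / l))) \<le> e" for n
      proof -
        have "dyadic_index n ((x - s) / l) \<le> 2 ^ n" using x l by (intro dyadic_index_le) auto
        then show ?thesis using R unfolding eq w'_def by blast
      qed
      ultimately have "w' x \<le> e" by (intro LIMSEQ_le_const2) auto
      then show "\<bar>w x - w s - \<mu> * (x - s)\<bar> \<le> e" by (simp add: w'_def)
    qed
  }
qed

lemma brownian_blocks_expectation:
  fixes W :: "real \<Rightarrow> 'a \<Rightarrow> real" and d :: "nat \<Rightarrow> (nat \<Rightarrow> real) \<Rightarrow> real"
  assumes W: "brownian_on M UNIV W" and x: "\<And>k. k < m \<Longrightarrow> x k < x (Suc k)" and N: "0 < N"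
    and d: "\<And>k. k < m \<Longrightarrow> d k \<in> borel_measurable (PiM {..<N} (\<lambda>_. borel))"
    and bd: "\<And>k f. 0 \<le> d k f" "\<And>k f. d k f \<le> 1"
  defines "q \<equiv> \<lambda>k j. x k + real j * ((x (Suc k) - x k) / real N)"
  defines "D \<equiv> \<lambda>k \<omega>. d k (restrict (\<lambda>j. W (q k (Suc j)) \<omega> - W (q k j) \<omega>) {..<N})"
  shows "(\<integral>\<omega>. (\<Prod>k<m. D k \<omega>) \<partial>M) = (\<Prod>k<m. \<integral>\<omega>. D k \<omega> \<partial>M)" "\<And>k. k < m \<Longrightarrow> D k \<in> borel_measurable M"
proof -
  interpret prob_space M using W by (rule brownian_onD)
  have ind: "indep_vars (\<lambda>_. borel) D {..<m}"
    unfolding D_def q_def by (rule brownian_blocks_indep[where W=W and x=x and N=N and d=d]) (use W x N d in auto)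
  then show D: "D k \<in> borel_measurable M" if "k < m" for k
    using that by (auto simp: indep_vars_def)
  show "(\<integral>\<omega>. (\<Prod>k<m. D k \<omega>) \<partial>M) = (\<Prod>k<m. \<integral>\<omega>. D k \<omega> \<partial>M)"
  proof (rule indep_vars_lebesgue_integral[OF _ ind])
    show "integrable M (D k)" if "k \<in> {..<m}" for k
      using D that bd by (intro integrable_const_bound[where B=1]) (auto simp: D_def)
  qed simp
qed

text \<open>Block functionals have to be functions of increments alone; partial sums recover the
  path relative to its value at the start of the block.\<close>

lemma sum_restrict_increments:
  fixes w :: "nat \<Rightarrow> real"
  assumes "j \<le> N"
  shows "(\<Sum>i<j. restrict (\<lambda>i. w (Suc i) - w i) {..<N} i) = w j - w 0"
proof -
  have "(\<Sum>i<j. restrict (\<lambda>i. w (Suc i) - w i) {..<N} i) = (\<Sum>i<j. w (Suc i) - w i)"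
    using assms by (intro sum.cong) auto
  then show ?thesis by (simp add: sum_lessThan_telescope)
qed

lemma prod_3: "(\<Prod>k<3::nat. f k) = f 0 * f 1 * (f 2 :: real)"
  by (simp add: eval_nat_numeral)

text \<open>At dyadic level \<open>n\<close> the three conditions concern independent families of
  increments, so the discrete bounds multiply. Their errors are of order
  \<open>2 ^ n * (l / 2 ^ n)\<^sup>2\<close> and vanish as the dyadic events decrease to
  \<open>E\<close>.\<close>

theorem brownian_tube_rise_tube:
  fixes W :: "real \<Rightarrow> 'a \<Rightarrow> real" and \<mu> :: real
  assumes W: "brownian_on M UNIV W" and x: "x0 < x1" "x1 < x2" "x2 < x3" and a: "0 < a" and e: "0 < e"
  defines "E \<equiv> {\<omega> \<in> space M.
      (\<forall>x. x0 \<le> x \<and> x \<le> x1 \<longrightarrow> \<bar>W x \<omega> - W x0 \<omega> - \<mu> * (x - x0)\<bar> \<le> e) \<and>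
      (\<forall>x y. x1 \<le> x \<and> x \<le> y \<and> y \<le> x2 \<longrightarrow> W y \<omega> - W x \<omega> \<le> a) \<and>
      (\<forall>x. x2 \<le> x \<and> x \<le> x3 \<longrightarrow> \<bar>W x \<omega> - W x2 \<omega> - \<mu> * (x - x2)\<bar> \<le> e)}"
  defines "c \<equiv> \<lambda>l. exp (- (\<mu>\<^sup>2 + (pi / (2 * e))\<^sup>2) * l / 2) / exp (\<bar>\<mu>\<bar> * e)"
  shows "E \<in> sets M" "c (x1 - x0) * exp (- pi\<^sup>2 * (x2 - x1) / (8 * a\<^sup>2)) * c (x3 - x2) \<le> measure M E"
proof -
  interpret prob_space M using W by (rule brownian_onD)
  have [measurable]: "\<And>t. W t \<in> borel_measurable M" using brownian_onD(3)[OF W] by simp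
  have cont: "continuous_on UNIV (\<lambda>t. W t \<omega>)" if "\<omega> \<in> space M" for \<omega>
    using brownian_onD(5)[OF W that] .
  define T where "T s l n f \<longleftrightarrow> (\<forall>j\<le>2 ^ n. \<bar>f j - f 0 - \<mu> * (l / 2 ^ n) * real j\<bar> \<le> e)" for s l :: real and n and f :: "nat \<Rightarrow> real"
  define R where "R n f \<longleftrightarrow> (\<forall>j\<le>2 ^ n. \<forall>i\<le>j. f j - f i \<le> a)" for n and f :: "nat \<Rightarrow> real"
  define p where "p s l n \<omega> j = W (dyadic_point s l n j) \<omega>" for s l n \<omega> j
  define A where "A n = {\<omega> \<in> space M. T x0 (x1 - x0) n (p x0 (x1 - x0) n \<omega>) \<and> R n (p x1 (x2 - x1) n \<omega>)
      \<and> T x2 (x3 - x2) n (p x2 (x3 - x2) n \<omega>)}" for n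
  have [measurable]: "A n \<in> sets M" for n
    unfolding A_def T_def R_def p_def by measurable
  have E: "E = (\<Inter>n. A n)"
  proof -
    have "\<omega> \<in> E \<longleftrightarrow> (\<forall>n. \<omega> \<in> A n)" if "\<omega> \<in> space M" for \<omega>
      unfolding E_def A_def T_def R_def p_def
      using tube_iff_dyadic[OF cont[OF that], of "x1 - x0" x0 \<mu> e] tube_iff_dyadic[OF cont[OF that], of "x3 - x2" x2 \<mu> e]
        small_rise_iff_dyadic[OF cont[OF that], of "x2 - x1" x1 a] x that by auto
    moreover have "E \<subseteq> space M" "A 0 \<subseteq> space M" by (auto simp: E_def A_def)
    ultimately show ?thesis by blast
  qed
  then show "E \<in> sets M" by simp
  have T_Suc: "T s l n (p s l n \<omega>)" if "T s l (Suc n) (p s l (Suc n) \<omega>)" for s l n \<omega>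
    unfolding T_def
  proof (intro allI impI)
    fix j :: nat assume "j \<le> 2 ^ n"
    then have "2 * j \<le> 2 ^ Suc n" by simp
    with that have "\<bar>p s l (Suc n) \<omega> (2 * j) - p s l (Suc n) \<omega> 0 - \<mu> * (l / 2 ^ Suc n) * real (2 * j)\<bar> \<le> e"
      unfolding T_def by blast
    then show "\<bar>p s l n \<omega> j - p s l n \<omega> 0 - \<mu> * (l / 2 ^ n) * real j\<bar> \<le> e"
      by (simp add: p_def dyadic_point_Suc)
  qed
  have R_Suc: "R n (p s l n \<omega>)" if "R (Suc n) (p s l (Suc n) \<omega>)" for s l n \<omega>
    unfolding R_def
  proof (intro allI impI)
    fix i j :: nat assume "j \<le> 2 ^ n" "i \<le> j"
    then have "2 * j \<le> 2 ^ Suc n" "2 * i \<le> 2 * j" by simp_all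
    with that have "p s l (Suc n) \<omega> (2 * j) - p s l (Suc n) \<omega> (2 * i) \<le> a"
      unfolding R_def by blast
    then show "p s l n \<omega> j - p s l n \<omega> i \<le> a"
      by (simp add: p_def dyadic_point_Suc)
  qed
  \<comment> \<open>The points of level \<open>n\<close> are the even points of level
    \<open>n + 1\<close>, so finer conditions imply coarser ones.\<close>
  have dec: "decseq A"
    by (intro decseq_SucI) (auto simp: A_def intro: T_Suc R_Suc)
  have lim: "(\<lambda>n. measure M (A n)) \<longlonglongrightarrow> measure M E"
    unfolding E using dec by (intro finite_Lim_measure_decseq) auto

  define cT where "cT l n = (exp (- (\<mu>\<^sup>2 + (pi / (2 * e))\<^sup>2) * l / 2) - exp (\<bar>\<mu>\<bar> * e) * (3 * l\<^sup>2 / (16 * e ^ 4)) * (1/2) ^ n) / exp (\<bar>\<mu>\<bar> * e)" for l and n :: nat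
  define cR where "cR l n = exp (- pi\<^sup>2 * l / (8 * a\<^sup>2)) - 3 * l\<^sup>2 / (16 * a ^ 4) * (1/2) ^ n" for l and n :: nat
  have steps: "gauss_steps M (l / 2 ^ n) (2 ^ n) (\<lambda>\<omega> i. p s l n \<omega> (Suc i) - p s l n \<omega> i)" if "0 < l" for s l n
    using brownian_gauss_steps[OF W, of "l / 2 ^ n" "2 ^ n" s] that by (simp add: p_def dyadic_point_def)
  have T_prob: "cT l n \<le> measure M {\<omega> \<in> space M. T s l n (p s l n \<omega>)}" if "0 < l" for s l n
  proof -
    have 1: "real (2 ^ n) * (exp (\<bar>\<mu>\<bar> * e) * (3 * (l / 2 ^ n)\<^sup>2 / (16 * e ^ 4))) = exp (\<bar>\<mu>\<bar> * e) * (3 * l\<^sup>2 / (16 * e ^ 4)) * (1/2) ^ n"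
      by (simp add: power_divide power2_eq_square)
    have 2: "real (2 ^ n) * (l / 2 ^ n) = l" by simp
    show ?thesis
      using prob_tube_lower[OF steps[of l n s, OF that] e, of \<mu>, unfolded 1 2]
      unfolding cT_def T_def by (simp add: pos_divide_le_eq mult.commute[of "exp (\<bar>\<mu>\<bar> * e)"])
  qed
  have R_prob: "cR l n \<le> measure M {\<omega> \<in> space M. R n (p s l n \<omega>)}" if "0 < l" for s l n
  proof -
    have 1: "real (2 ^ n) * (3 * (l / 2 ^ n)\<^sup>2 / (16 * a ^ 4)) = 3 * l\<^sup>2 / (16 * a ^ 4) * (1/2) ^ n"
      by (simp add: power_divide power2_eq_square)
    have 2: "real (2 ^ n) * (l / 2 ^ n) = l" by simp
    show ?thesis
      using prob_small_rise_lower[OF steps[of l n s, OF that] a, unfolded 1 2]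
      unfolding cR_def R_def by simp
  qed

  define x where "x = (\<lambda>k. [x0, x1, x2, x3] ! k)"
  define d where "d n k f = (if k = 1 then (if R n (\<lambda>j. \<Sum>i<j. f i) then 1 else 0)
     else (if T (x k) (x (Suc k) - x k) n (\<lambda>j. \<Sum>i<j. f i) then 1 else 0 :: real))" for n and k :: nat and f :: "nat \<Rightarrow> real"
  define q where "q n k j = x k + real j * ((x (Suc k) - x k) / real (2 ^ n))" for n k j
  define D where "D n k \<omega> = d n k (restrict (\<lambda>j. W (q n k (Suc j)) \<omega> - W (q n k j) \<omega>) {..<2 ^ n})" for n k \<omega>
  have q: "W (q n k j) \<omega> = p (x k) (x (Suc k) - x k) n \<omega> j" for n k j \<omega>
    by (simp add: q_def p_def dyadic_point_def)
  have x_less: "x k < x (Suc k)" if "k < 3" for k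
    using that assms(2-4) by (auto simp: x_def less_Suc_eq eval_nat_numeral)
  \<comment> \<open>Both conditions depend on differences only, so it is harmless that sums of
    increments give the path minus its starting value.\<close>
  have R_cong: "R n f \<longleftrightarrow> R n g" if "\<And>i j. j \<le> 2 ^ n \<Longrightarrow> i \<le> j \<Longrightarrow> f j - f i = g j - g i" for n f g
    unfolding R_def by (intro all_cong1 imp_cong refl) (simp add: that)
  have T_cong: "T s l n f \<longleftrightarrow> T s l n g" if "\<And>j. j \<le> 2 ^ n \<Longrightarrow> f j - f 0 = g j - g 0" for s l n f g
    unfolding T_def by (intro all_cong1 imp_cong refl) (simp add: that)
  have D_eq: "D n k \<omega> = (if k = 1 then indicator {\<omega> \<in> space M. R n (p (x k) (x (Suc k) - x k) n \<omega>)} \<omega>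
     else indicator {\<omega> \<in> space M. T (x k) (x (Suc k) - x k) n (p (x k) (x (Suc k) - x k) n \<omega>)} \<omega>)"
    if "\<omega> \<in> space M" for n k \<omega>
  proof -
    have "(\<Sum>i<j. restrict (\<lambda>j. W (q n k (Suc j)) \<omega> - W (q n k j) \<omega>) {..<2 ^ n} i)
        = p (x k) (x (Suc k) - x k) n \<omega> j - p (x k) (x (Suc k) - x k) n \<omega> 0" if "j \<le> 2 ^ n" for j
      using sum_restrict_increments[OF that, of "\<lambda>j. W (q n k j) \<omega>"] by (simp add: q)
    note g = this
    let ?g = "\<lambda>j. \<Sum>i<j. restrict (\<lambda>j. W (q n k (Suc j)) \<omega> - W (q n k j) \<omega>) {..<2 ^ n} i"
      and ?p = "p (x k) (x (Suc k) - x k) n \<omega>"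
    have "?g j - ?g i = ?p j - ?p i" if "j \<le> 2 ^ n" "i \<le> j" for i j
      using g[of i] g[of j] that by simp
    then have "R n ?g \<longleftrightarrow> R n ?p" by (rule R_cong)
    moreover have "?g j - ?g 0 = ?p j - ?p 0" if "j \<le> 2 ^ n" for j
      using g[of j] that by simp
    then have "T (x k) (x (Suc k) - x k) n ?g \<longleftrightarrow> T (x k) (x (Suc k) - x k) n ?p"
      by (rule T_cong)
    ultimately show ?thesis using that unfolding D_def d_def
      by (cases "k = 1") (simp_all only: if_True if_False indicator_def mem_Collect_eq simp_thms of_bool_def)
  qed
  have meas_sum: "(\<lambda>f. \<Sum>i<j. f i) \<in> borel_measurable (PiM {..<2 ^ n} (\<lambda>_. borel :: real measure))" if "j \<le> 2 ^ n" for j n :: nat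
    using that by (intro borel_measurable_sum measurable_component_singleton) auto
  have "d n k \<in> borel_measurable (PiM {..<2 ^ n} (\<lambda>_. borel))" for n k
  proof -
    have eq1: "R n (\<lambda>j. \<Sum>i<j. f i) \<longleftrightarrow> (\<forall>j\<in>{..2 ^ n}. \<forall>i\<in>{..j}. (\<Sum>i<j. f i) - (\<Sum>i<i. f i) \<le> a)" for f
      by (auto simp: R_def)
    have eq2: "T s l n (\<lambda>j. \<Sum>i<j. f i) \<longleftrightarrow> (\<forall>j\<in>{..2 ^ n}. \<bar>(\<Sum>i<j. f i) - 0 - \<mu> * (l / 2 ^ n) * real j\<bar> \<le> e)" for s l f
      by (auto simp: T_def)
    have [measurable]: "Measurable.pred (PiM {..<2 ^ n} (\<lambda>_. borel)) (\<lambda>f. R n (\<lambda>j. \<Sum>i<j. f i))"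
      unfolding eq1 using meas_sum by (intro pred_intros_finite borel_measurable_le borel_measurable_diff) auto
    have [measurable]: "Measurable.pred (PiM {..<2 ^ n} (\<lambda>_. borel)) (\<lambda>f. T s l n (\<lambda>j. \<Sum>i<j. f i))" for s l
      unfolding eq2 using meas_sum by (intro pred_intros_finite borel_measurable_le borel_measurable_diff borel_measurable_abs) auto
    show ?thesis unfolding d_def by measurable
  qed
  note d_meas = this
  have exp: "(\<integral>\<omega>. (\<Prod>k<3. D n k \<omega>) \<partial>M) = (\<Prod>k<3. \<integral>\<omega>. D n k \<omega> \<partial>M)" for n
    unfolding D_def q_def
    by (rule brownian_blocks_expectation(1)[where W=W and x=x and m=3 and N="2 ^ n" and d="d n"])
      (use W x_less d_meas in \<open>auto simp: d_def\<close>)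
  have meas: "measure M (A n) = measure M {\<omega> \<in> space M. T x0 (x1 - x0) n (p x0 (x1 - x0) n \<omega>)}
      * measure M {\<omega> \<in> space M. R n (p x1 (x2 - x1) n \<omega>)}
      * measure M {\<omega> \<in> space M. T x2 (x3 - x2) n (p x2 (x3 - x2) n \<omega>)}" for n
  proof -
    have T_sets: "{\<omega> \<in> space M. T s l n (p s l n \<omega>)} \<in> sets M" for s l
      unfolding T_def p_def by measurable
    have R_sets: "{\<omega> \<in> space M. R n (p s l n \<omega>)} \<in> sets M" for s l
      unfolding R_def p_def by measurable
    have "measure M (A n) = (\<integral>\<omega>. indicator (A n) \<omega> \<partial>M)" by simp
    also have "\<dots> = (\<integral>\<omega>. (\<Prod>k<3. D n k \<omega>) \<partial>M)"
      by (intro Bochner_Integration.integral_cong refl)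
        (auto simp: D_eq prod_3 x_def A_def indicator_def eval_nat_numeral)
    also have "\<dots> = (\<Prod>k<3. \<integral>\<omega>. D n k \<omega> \<partial>M)"
      by (rule exp)
    also have "\<dots> = (\<integral>\<omega>. D n 0 \<omega> \<partial>M) * (\<integral>\<omega>. D n 1 \<omega> \<partial>M) * (\<integral>\<omega>. D n 2 \<omega> \<partial>M)"
      by (rule prod_3)
    also have "(\<integral>\<omega>. D n 0 \<omega> \<partial>M) = measure M {\<omega> \<in> space M. T x0 (x1 - x0) n (p x0 (x1 - x0) n \<omega>)}"
      using T_sets by (simp add: D_eq x_def cong: Bochner_Integration.integral_cong)
    also have "(\<integral>\<omega>. D n 1 \<omega> \<partial>M) = measure M {\<omega> \<in> space M. R n (p x1 (x2 - x1) n \<omega>)}"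
      using R_sets by (simp add: D_eq x_def eval_nat_numeral cong: Bochner_Integration.integral_cong)
    also have "(\<integral>\<omega>. D n 2 \<omega> \<partial>M) = measure M {\<omega> \<in> space M. T x2 (x3 - x2) n (p x2 (x3 - x2) n \<omega>)}"
      using T_sets by (simp add: D_eq x_def eval_nat_numeral cong: Bochner_Integration.integral_cong)
    finally show ?thesis .
  qed
  \<comment> \<open>At coarse levels the discrete lower bounds can be negative; their positive parts
    are taken so that the inequalities may be multiplied.\<close>
  have low: "max 0 (cT (x1 - x0) n) * max 0 (cR (x2 - x1) n) * max 0 (cT (x3 - x2) n) \<le> measure M (A n)" for n
    unfolding meas using T_prob[of "x1 - x0" n x0] R_prob[of "x2 - x1" n x1] T_prob[of "x3 - x2" n x2] assms(2-4)
    by (intro mult_mono) auto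
  have pow: "(\<lambda>n. (1/2::real) ^ n) \<longlonglongrightarrow> 0" by (rule LIMSEQ_realpow_zero) auto
  have limT: "(\<lambda>n. max 0 (cT l n)) \<longlonglongrightarrow> c l" for l
  proof -
    have "(\<lambda>n. max 0 (cT l n)) \<longlonglongrightarrow> max 0 ((exp (- (\<mu>\<^sup>2 + (pi / (2 * e))\<^sup>2) * l / 2) - exp (\<bar>\<mu>\<bar> * e) * (3 * l\<^sup>2 / (16 * e ^ 4)) * 0) / exp (\<bar>\<mu>\<bar> * e))"
      unfolding cT_def by (intro tendsto_intros pow) auto
    then show ?thesis by (simp add: c_def max_def)
  qed
  have limR: "(\<lambda>n. max 0 (cR l n)) \<longlonglongrightarrow> exp (- pi\<^sup>2 * l / (8 * a\<^sup>2))" for l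
  proof -
    have "(\<lambda>n. max 0 (cR l n)) \<longlonglongrightarrow> max 0 (exp (- pi\<^sup>2 * l / (8 * a\<^sup>2)) - 3 * l\<^sup>2 / (16 * a ^ 4) * 0)"
      unfolding cR_def by (intro tendsto_intros pow)
    then show ?thesis by (simp add: max_def)
  qed
  show "c (x1 - x0) * exp (- pi\<^sup>2 * (x2 - x1) / (8 * a\<^sup>2)) * c (x3 - x2) \<le> measure M E"
    using low by (intro LIMSEQ_le[OF tendsto_mult[OF tendsto_mult[OF limT limR] limT] lim]) auto
qed

section \<open>Exponential functionals of blocks\<close>

text \<open>Averages serve instead of point values because, by convexity, the integral of an
  exponential over a cell is bounded below by the exponential of the average, without any modulus of
  continuity of the environment.\<close>

definition cell_avg :: "(real \<Rightarrow> real) \<Rightarrow> real \<Rightarrow> real \<Rightarrow> real" where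
  "cell_avg w s l = (antideriv w (s + l) - antideriv w s) / l"

lemma cell_avg_tendsto:
  assumes w: "continuous_on UNIV w" and l: "0 < l"
  shows "(\<lambda>n. (\<Sum>i<2 ^ n. w (s + real i * (l / 2 ^ n))) / 2 ^ n) \<longlonglongrightarrow> cell_avg w s l"
proof (rule LIMSEQ_I)
  fix e :: real assume e: "0 < e"
  obtain \<delta> where \<delta>: "\<delta> > 0" "\<And>h k. 0 < h \<Longrightarrow> h < \<delta> \<Longrightarrow> s + real k * h \<le> s + l \<Longrightarrow>
      \<bar>h * (\<Sum>i<k. w (s + real i * h)) - (antideriv w (s + real k * h) - antideriv w s)\<bar> \<le> e * l / 2"
    using riemann_sum_uniform[OF antideriv_has_derivative[OF w] continuous_on_subset[OF w subset_UNIV]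
        half_gt_zero[OF mult_pos_pos[OF e l]], of s "s + l"] by blast
  have "(\<lambda>n. l * (1/2) ^ n) \<longlonglongrightarrow> l * 0" by (intro tendsto_intros LIMSEQ_realpow_zero) auto
  then have "\<forall>\<^sub>F n in sequentially. l * (1/2) ^ n < \<delta>"
    using \<delta>(1) by (intro order_tendstoD) auto
  then obtain n0 where n0: "\<And>n. n \<ge> n0 \<Longrightarrow> l * (1/2) ^ n < \<delta>"
    by (auto simp: eventually_sequentially)
  show "\<exists>no. \<forall>n\<ge>no. norm ((\<Sum>i<2 ^ n. w (s + real i * (l / 2 ^ n))) / 2 ^ n - cell_avg w s l) < e"
  proof (intro exI allI impI)
    fix n assume n: "n \<ge> n0"
    let ?S = "\<Sum>i<2 ^ n. w (s + real i * (l / 2 ^ n))"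
    have "l / 2 ^ n < \<delta>" using n0[OF n] by (simp add: power_divide)
    then have "\<bar>l / 2 ^ n * ?S - (antideriv w (s + l) - antideriv w s)\<bar> \<le> e * l / 2"
      using \<delta>(2)[of "l / 2 ^ n" "2 ^ n"] l by simp
    moreover have "?S / 2 ^ n - cell_avg w s l = (l / 2 ^ n * ?S - (antideriv w (s + l) - antideriv w s)) / l"
      using l by (simp add: cell_avg_def diff_divide_distrib)
    ultimately have "\<bar>?S / 2 ^ n - cell_avg w s l\<bar> \<le> (e * l / 2) / l"
      using l by (simp add: abs_divide divide_right_mono del: divide_divide_eq_left times_divide_eq_left)
    also have "\<dots> < e" using l e by simp
    finally show "norm (?S / 2 ^ n - cell_avg w s l) < e" by simp
  qed
qed

lemma measurable_cell_avg:
  assumes W: "\<And>t. W t \<in> borel_measurable M" and c: "\<And>\<omega>. \<omega> \<in> space M \<Longrightarrow> continuous_on UNIV (\<lambda>t. W t \<omega>)" and l: "0 < l"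
  shows "(\<lambda>\<omega>. cell_avg (\<lambda>t. W t \<omega>) s l) \<in> borel_measurable M"
proof (rule borel_measurable_LIMSEQ_real)
  show "(\<lambda>n. (\<Sum>i<2 ^ n. W (s + real i * (l / 2 ^ n)) \<omega>) / 2 ^ n) \<longlonglongrightarrow> cell_avg (\<lambda>t. W t \<omega>) s l" if "\<omega> \<in> space M" for \<omega>
    by (rule cell_avg_tendsto[OF c[OF that] l])
  show "(\<lambda>\<omega>. (\<Sum>i<2 ^ n. W (s + real i * (l / 2 ^ n)) \<omega>) / 2 ^ n) \<in> borel_measurable M" for n :: nat
    using W by measurable
qed

lemma brownian_increment_second_moment:
  assumes B: "brownian_on M I B" and st: "s \<in> I" "t \<in> I" "s \<le> t"
  shows "(\<integral>\<^sup>+\<omega>. ennreal ((B t \<omega> - B s \<omega>)\<^sup>2) \<partial>M) = ennreal (t - s)"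
proof (cases "s = t")
  case False
  then have st': "s < t" using st by simp
  have [measurable]: "B t \<in> borel_measurable M" "B s \<in> borel_measurable M" using brownian_onD(3)[OF B] st by auto
  have "(\<integral>\<^sup>+\<omega>. ennreal ((B t \<omega> - B s \<omega>)\<^sup>2) \<partial>M) = (\<integral>\<^sup>+x. ennreal (x\<^sup>2) \<partial>gauss (t - s))"
    unfolding brownian_onD(6)[OF B st(1,2) st', symmetric] by (subst nn_integral_distr) auto
  also have "\<dots> = ennreal (\<integral>x. x\<^sup>2 \<partial>gauss (t - s))"
    using st' by (intro nn_integral_eq_integral) auto
  finally show ?thesis using st' by simp
qed simp

lemma mean_square_le:
  fixes f :: "nat \<Rightarrow> real"
  shows "((\<Sum>i<n. f i) / real n)\<^sup>2 \<le> (\<Sum>i<n. (f i)\<^sup>2) / real n"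
proof (cases "n = 0")
  case False
  have "(\<Sum>i<n. f i * 1)\<^sup>2 \<le> (\<Sum>i<n. (f i)\<^sup>2) * (\<Sum>i<n. 1\<^sup>2)"
    by (rule Cauchy_Schwarz_ineq_sum)
  then show ?thesis using False by (simp add: power_divide power2_eq_square[of "real n"] divide_simps mult_ac)
qed simp

text \<open>For a Riemann sum, the square of a mean is at most the mean of the squares, and each
  increment within the cell has variance at most \<open>l\<close>. Fatou's lemma passes this to the
  average.\<close>

lemma cell_avg_second_moment:
  assumes W: "brownian_on M UNIV W" and l: "0 < l"
  shows "(\<integral>\<^sup>+\<omega>. ennreal ((cell_avg (\<lambda>t. W t \<omega>) s l - W s \<omega>)\<^sup>2) \<partial>M) \<le> ennreal l"
proof -
  interpret prob_space M using W by (rule brownian_onD)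
  have [measurable]: "\<And>t. W t \<in> borel_measurable M" using brownian_onD(3)[OF W] by simp
  have c: "continuous_on UNIV (\<lambda>t. W t \<omega>)" if "\<omega> \<in> space M" for \<omega>
    using brownian_onD(5)[OF W that] .
  define Z where "Z n \<omega> = (\<Sum>i<2 ^ n. W (s + real i * (l / 2 ^ n)) \<omega> - W s \<omega>) / real (2 ^ n)" for n \<omega>
  have Z: "(\<lambda>n. Z n \<omega>) \<longlonglongrightarrow> cell_avg (\<lambda>t. W t \<omega>) s l - W s \<omega>" if "\<omega> \<in> space M" for \<omega>
  proof -
    have "(\<lambda>n. (\<Sum>i<2 ^ n. W (s + real i * (l / 2 ^ n)) \<omega>) / 2 ^ n - W s \<omega>) \<longlonglongrightarrow> cell_avg (\<lambda>t. W t \<omega>) s l - W s \<omega>"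
      by (intro tendsto_intros cell_avg_tendsto[OF c[OF that] l])
    then show ?thesis by (simp add: Z_def sum_subtractf diff_divide_distrib)
  qed
  have bound: "(\<integral>\<^sup>+\<omega>. ennreal ((Z n \<omega>)\<^sup>2) \<partial>M) \<le> ennreal l" for n
  proof -
    have "(\<integral>\<^sup>+\<omega>. ennreal ((Z n \<omega>)\<^sup>2) \<partial>M)
        \<le> (\<integral>\<^sup>+\<omega>. ennreal ((\<Sum>i<2 ^ n. (W (s + real i * (l / 2 ^ n)) \<omega> - W s \<omega>)\<^sup>2) / real (2 ^ n)) \<partial>M)"
      unfolding Z_def by (intro nn_integral_mono ennreal_leI mean_square_le)
    also have "\<dots> = (\<integral>\<^sup>+\<omega>. ennreal (1 / real (2 ^ n)) * (\<Sum>i<2 ^ n. ennreal ((W (s + real i * (l / 2 ^ n)) \<omega> - W s \<omega>)\<^sup>2)) \<partial>M)"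
      by (intro nn_integral_cong) (simp add: sum_ennreal flip: ennreal_mult')
    also have "\<dots> = ennreal (1 / real (2 ^ n)) * (\<Sum>i<2 ^ n. ennreal (real i * (l / 2 ^ n)))"
      using l by (simp add: nn_integral_cmult nn_integral_sum brownian_increment_second_moment[OF W] del: sum_ennreal)
    also have "\<dots> \<le> ennreal (1 / real (2 ^ n)) * (\<Sum>i<(2::nat) ^ n. ennreal l)"
    proof (intro mult_left_mono sum_mono ennreal_leI)
      fix i assume "i \<in> {..<(2::nat) ^ n}"
      then have "real i * (l / 2 ^ n) \<le> 2 ^ n * (l / 2 ^ n)"
        using l by (intro mult_right_mono) (auto simp: less_imp_le)
      then show "real i * (l / 2 ^ n) \<le> l" by simp
    qed simp
    also have "\<dots> = ennreal l"
      using l by (simp add: ennreal_of_nat_eq_real_of_nat flip: ennreal_mult')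
    finally show ?thesis .
  qed
  have "(\<integral>\<^sup>+\<omega>. ennreal ((cell_avg (\<lambda>t. W t \<omega>) s l - W s \<omega>)\<^sup>2) \<partial>M) = (\<integral>\<^sup>+\<omega>. liminf (\<lambda>n. ennreal ((Z n \<omega>)\<^sup>2)) \<partial>M)"
  proof (intro nn_integral_cong)
    fix \<omega> assume "\<omega> \<in> space M"
    then have "(\<lambda>n. ennreal ((Z n \<omega>)\<^sup>2)) \<longlonglongrightarrow> ennreal ((cell_avg (\<lambda>t. W t \<omega>) s l - W s \<omega>)\<^sup>2)"
      by (intro tendsto_intros Z)
    then show "ennreal ((cell_avg (\<lambda>t. W t \<omega>) s l - W s \<omega>)\<^sup>2) = liminf (\<lambda>n. ennreal ((Z n \<omega>)\<^sup>2))"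
      by (intro lim_imp_Liminf[symmetric]) auto
  qed
  also have "\<dots> \<le> liminf (\<lambda>n. \<integral>\<^sup>+\<omega>. ennreal ((Z n \<omega>)\<^sup>2) \<partial>M)"
    by (intro nn_integral_liminf) (auto simp: Z_def)
  also have "\<dots> \<le> liminf (\<lambda>n. ennreal l)"
    using bound by (intro Liminf_mono) auto
  also have "\<dots> = ennreal l" by (simp add: Liminf_const)
  finally show ?thesis .
qed

lemma prob_cell_avg_deviation:
  assumes W: "brownian_on M UNIV W" and l: "0 < l" and z: "0 < z"
  shows "measure M {\<omega> \<in> space M. z < \<bar>cell_avg (\<lambda>t. W t \<omega>) s l - W s \<omega>\<bar>} \<le> l / z\<^sup>2"
    and "{\<omega> \<in> space M. z < \<bar>cell_avg (\<lambda>t. W t \<omega>) s l - W s \<omega>\<bar>} \<in> sets M"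
proof -
  interpret prob_space M using W by (rule brownian_onD)
  have [measurable]: "\<And>t. W t \<in> borel_measurable M" using brownian_onD(3)[OF W] by simp
  have [measurable]: "(\<lambda>\<omega>. cell_avg (\<lambda>t. W t \<omega>) s l) \<in> borel_measurable M"
    using brownian_onD(5)[OF W] l by (intro measurable_cell_avg) auto
  let ?A = "{\<omega> \<in> space M. z < \<bar>cell_avg (\<lambda>t. W t \<omega>) s l - W s \<omega>\<bar>}"
  show A[measurable]: "?A \<in> sets M" by measurable
  have "ennreal (z\<^sup>2 * measure M ?A) = (\<integral>\<^sup>+\<omega>. ennreal (z\<^sup>2) * indicator ?A \<omega> \<partial>M)"
    by (simp add: nn_integral_cmult emeasure_eq_measure ennreal_mult')
  also have "\<dots> \<le> (\<integral>\<^sup>+\<omega>. ennreal ((cell_avg (\<lambda>t. W t \<omega>) s l - W s \<omega>)\<^sup>2) \<partial>M)"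
    using z by (intro nn_integral_mono) (auto simp: indicator_def simp flip: abs_le_square_iff intro!: ennreal_leI)
  also have "\<dots> \<le> ennreal l" by (rule cell_avg_second_moment[OF W l])
  finally have "z\<^sup>2 * measure M ?A \<le> l" using l by (simp add: ennreal_le_iff)
  then show "measure M ?A \<le> l / z\<^sup>2" using z by (simp add: field_simps)
qed

section \<open>The rise functional of a block\<close>

text \<open>A discrete version of the double integral of \<open>exp (w y - w x)\<close> over
  \<open>x < y\<close>, in a block with \<open>J\<close> grid points at distance \<open>c\<close>.
  The averaging length \<open>l\<close> is separate from \<open>c\<close>: if it is much smaller,
  the averages are close to the values at the grid points.\<close>

definition block_rise :: "(real \<Rightarrow> real) \<Rightarrow> real \<Rightarrow> real \<Rightarrow> real \<Rightarrow> nat \<Rightarrow> real" where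
  "block_rise w s c l J = (\<Sum>j<J. \<Sum>i<j. exp (cell_avg w (s + real j * c) l - cell_avg w (s + real i * c) l))"

lemma block_rise_nonneg: "0 \<le> block_rise w s c l J"
  by (simp add: block_rise_def sum_nonneg)

lemma measurable_block_rise:
  assumes W: "brownian_on M UNIV W" and l: "0 < l"
  shows "(\<lambda>\<omega>. block_rise (\<lambda>t. W t \<omega>) s c l J) \<in> borel_measurable M"
proof -
  have [measurable]: "(\<lambda>\<omega>. cell_avg (\<lambda>t. W t \<omega>) s l) \<in> borel_measurable M" for s
    using brownian_onD(3,5)[OF W] l by (intro measurable_cell_avg) auto
  show ?thesis unfolding block_rise_def by measurable
qed

text \<open>Pointwise, either the grid walk has no rise above \<open>a\<close>, or some average is
  off by more than \<open>z\<close>, or a pair of averages rises by at least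
  \<open>a - 2 * z\<close> and this single summand already makes the fraction at most
  \<open>exp (2 * z - a) / \<rho>\<close>.\<close>

lemma block_rise_expectation:
  assumes W: "brownian_on M UNIV W" and l: "0 < l" and z: "0 < z" and a: "0 < a" and \<rho>: "0 < \<rho>"
  shows "(\<integral>\<omega>. 1 / (1 + \<rho> * block_rise (\<lambda>t. W t \<omega>) s c l (Suc n)) \<partial>M)
    \<le> measure M {\<omega> \<in> space M. \<forall>j\<le>n. \<forall>i\<le>j. W (s + real j * c) \<omega> - W (s + real i * c) \<omega> \<le> a}
      + (real (Suc n) * (l / z\<^sup>2) + exp (2 * z - a) / \<rho>)"
proof -
  interpret prob_space M using W by (rule brownian_onD)
  have [measurable]: "\<And>t. W t \<in> borel_measurable M" using brownian_onD(3)[OF W] by simp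
  have [measurable]: "(\<lambda>\<omega>. block_rise (\<lambda>t. W t \<omega>) s c l (Suc n)) \<in> borel_measurable M"
    by (rule measurable_block_rise[OF W l])
  let ?V = "\<lambda>\<omega> j. cell_avg (\<lambda>t. W t \<omega>) (s + real j * c) l"
  let ?A = "{\<omega> \<in> space M. \<forall>j\<le>n. \<forall>i\<le>j. W (s + real j * c) \<omega> - W (s + real i * c) \<omega> \<le> a}"
  let ?B = "\<lambda>j. {\<omega> \<in> space M. z < \<bar>?V \<omega> j - W (s + real j * c) \<omega>\<bar>}"
  have [measurable]: "?B j \<in> sets M" for j by (rule prob_cell_avg_deviation[OF W l z])
  have [measurable]: "?A \<in> sets M" by measurable
  have pw: "1 / (1 + \<rho> * block_rise (\<lambda>t. W t \<omega>) s c l (Suc n))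
      \<le> indicator ?A \<omega> + (\<Sum>j<Suc n. indicator (?B j) \<omega>) + exp (2 * z - a) / \<rho>" if \<omega>: "\<omega> \<in> space M" for \<omega>
  proof -
    let ?R = "block_rise (\<lambda>t. W t \<omega>) s c l (Suc n)"
    have R0: "0 \<le> \<rho> * ?R" using \<rho> block_rise_nonneg by simp
    then have le1: "1 / (1 + \<rho> * ?R) \<le> 1" by simp
    have nn: "0 \<le> (\<Sum>j<Suc n. indicator (?B j) \<omega> :: real)" by (intro sum_nonneg) simp
    consider "\<omega> \<in> ?A" | j where "j < Suc n" "\<omega> \<in> ?B j" | "\<omega> \<notin> ?A" "\<forall>j<Suc n. \<omega> \<notin> ?B j" by blast
    then show ?thesis
    proof cases
      case 1
      then show ?thesis using le1 nn \<rho> by (simp add: add_nonneg_nonneg add_increasing2 del: sum.lessThan_Suc)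
    next
      case 2
      have "indicator (?B j) \<omega> \<le> (\<Sum>j<Suc n. indicator (?B j) \<omega> :: real)"
        using 2 by (intro member_le_sum) auto
      then have "1 \<le> (\<Sum>j<Suc n. indicator (?B j) \<omega> :: real)" using 2 by simp
      moreover have "0 \<le> (indicator ?A \<omega> :: real)" "0 \<le> exp (2 * z - a) / \<rho>" using \<rho> by auto
      ultimately show ?thesis using le1 by linarith
    next
      case 3
      then obtain i j where ij: "j \<le> n" "i \<le> j" "a < W (s + real j * c) \<omega> - W (s + real i * c) \<omega>"
        using \<omega> by (auto simp: not_le)
      then have "i < j" using a by (cases "i = j") auto
      have "\<bar>?V \<omega> j - W (s + real j * c) \<omega>\<bar> \<le> z" "\<bar>?V \<omega> i - W (s + real i * c) \<omega>\<bar> \<le> z"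
        using 3 ij \<omega> by (auto simp: not_less)
      then have "a - 2 * z \<le> ?V \<omega> j - ?V \<omega> i" using ij by linarith
      then have "exp (a - 2 * z) \<le> exp (?V \<omega> j - ?V \<omega> i)" by simp
      also have "\<dots> \<le> (\<Sum>i<j. exp (?V \<omega> j - ?V \<omega> i))"
        using \<open>i < j\<close> by (intro member_le_sum) auto
      also have "\<dots> \<le> ?R"
        unfolding block_rise_def using ij
        by (intro member_le_sum[of j "{..<Suc n}" "\<lambda>j. \<Sum>i<j. exp (?V \<omega> j - ?V \<omega> i)"]) (auto intro: sum_nonneg)
      finally have "\<rho> * exp (a - 2 * z) \<le> 1 + \<rho> * ?R" using \<rho> by (simp add: add_increasing)
      then have "1 / (1 + \<rho> * ?R) \<le> 1 / (\<rho> * exp (a - 2 * z))"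
        using \<rho> R0 by (intro divide_left_mono mult_pos_pos add_pos_nonneg) auto
      also have "\<dots> = exp (2 * z - a) / \<rho>" by (simp add: exp_diff)
      finally show ?thesis using nn by (simp add: add_increasing indicator_def del: sum.lessThan_Suc)
    qed
  qed
  have int2: "integrable M (\<lambda>\<omega>. indicator ?A \<omega> + (\<Sum>j<Suc n. indicator (?B j) \<omega>) + exp (2 * z - a) / \<rho>)"
    by (intro Bochner_Integration.integrable_add Bochner_Integration.integrable_sum integrable_real_indicator integrable_const)
      (auto simp: less_top[symmetric])
  have "(\<integral>\<omega>. 1 / (1 + \<rho> * block_rise (\<lambda>t. W t \<omega>) s c l (Suc n)) \<partial>M)
      \<le> (\<integral>\<omega>. indicator ?A \<omega> + (\<Sum>j<Suc n. indicator (?B j) \<omega>) + exp (2 * z - a) / \<rho> \<partial>M)"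
  proof (rule integral_mono[OF _ int2 pw])
    show "integrable M (\<lambda>\<omega>. 1 / (1 + \<rho> * block_rise (\<lambda>t. W t \<omega>) s c l (Suc n)))"
    proof (intro integrable_const_bound[where B=1] AE_I2)
      fix \<omega>
      have "0 \<le> \<rho> * block_rise (\<lambda>t. W t \<omega>) s c l (Suc n)" using \<rho> block_rise_nonneg by simp
      then show "norm (1 / (1 + \<rho> * block_rise (\<lambda>t. W t \<omega>) s c l (Suc n))) \<le> 1" by simp
    qed measurable
  qed
  also have "\<dots> = measure M ?A + (\<Sum>j<Suc n. measure M (?B j)) + exp (2 * z - a) / \<rho>"
  proof (rule has_bochner_integral_integral_eq, intro has_bochner_integral_add has_bochner_integral_sum)
    show "has_bochner_integral M (\<lambda>_. exp (2 * z - a) / \<rho>) (exp (2 * z - a) / \<rho>)"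
      by (simp add: has_bochner_integral_iff prob_space)
  qed (auto simp: less_top[symmetric] intro!: has_bochner_integral_real_indicator)
  also have "(\<Sum>j<Suc n. measure M (?B j)) \<le> (\<Sum>j<Suc n. l / z\<^sup>2)"
    by (intro sum_mono prob_cell_avg_deviation[OF W l z])
  finally show ?thesis by simp
qed

text \<open>Averages are not functions of finitely many increments. They are approximated by dyadic
  sums, for which the blocks factorise; since the fractions lie between 0 and 1, dominated
  convergence transfers the product formula. The length \<open>c / 2 ^ p\<close> puts the sample
  points of all averages on one uniform grid.\<close>

lemma block_rise_product:
  fixes W :: "real \<Rightarrow> 'a \<Rightarrow> real"
  assumes W: "brownian_on M UNIV W" and c: "0 < c" and \<rho>: "0 < \<rho>" and J: "0 < J"
  shows "(\<integral>\<omega>. (\<Prod>k<m. 1 / (1 + \<rho> * block_rise (\<lambda>t. W t \<omega>) (s + real k * (real J * c)) c (c / 2 ^ p) J)) \<partial>M)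
    = (\<Prod>k<m. \<integral>\<omega>. 1 / (1 + \<rho> * block_rise (\<lambda>t. W t \<omega>) (s + real k * (real J * c)) c (c / 2 ^ p) J) \<partial>M)"
proof -
  interpret prob_space M using W by (rule brownian_onD)
  define l where "l = c / 2 ^ p"
  have l: "0 < l" using c by (simp add: l_def)
  have [measurable]: "\<And>t. W t \<in> borel_measurable M" using brownian_onD(3)[OF W] by simp
  have cont: "continuous_on UNIV (\<lambda>t. W t \<omega>)" if "\<omega> \<in> space M" for \<omega>
    using brownian_onD(5)[OF W that] .
  define x where "x k = s + real k * (real J * c)" for k
  define D where "D k \<omega> = 1 / (1 + \<rho> * block_rise (\<lambda>t. W t \<omega>) (x k) c l J)" for k \<omega>
  \<comment> \<open>Sample \<open>r\<close> of cell \<open>j\<close> has index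
    \<open>j * 2 ^ (p + n) + r\<close> in the grid with mesh \<open>c / 2 ^ (p + n)\<close>, which
    equals \<open>l / 2 ^ n\<close>. Only the first \<open>2 ^ n\<close> grid points of each cell
    are sampled.\<close>
  define A where "A n j f = (\<Sum>r<2 ^ n. \<Sum>i<j * 2 ^ (p + n) + r. f i) / 2 ^ n" for n j :: nat and f :: "nat \<Rightarrow> real"
  define d where "d n f = 1 / (1 + \<rho> * (\<Sum>j<J. \<Sum>i<j. exp (A n j f - A n i f)))" for n f
  define N where "N n = J * 2 ^ (p + n)" for n
  define q where "q n k j = x k + real j * ((x (Suc k) - x k) / real (N n))" for n k j
  define D' where "D' n k \<omega> = d n (restrict (\<lambda>j. W (q n k (Suc j)) \<omega> - W (q n k j) \<omega>) {..<N n})" for n k \<omega>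
  have idx: "j * 2 ^ (p + n) + r \<le> N n" if "j < J" "r < 2 ^ n" for j r n :: nat
  proof -
    have "(2::nat) ^ n \<le> 2 ^ (p + n)" by (intro power_increasing) auto
    then have "r \<le> 2 ^ (p + n)" using that(2) by (meson less_imp_le order_trans)
    then have "j * 2 ^ (p + n) + r \<le> Suc j * 2 ^ (p + n)" by simp
    also have "\<dots> \<le> J * 2 ^ (p + n)" using that by (intro mult_le_mono1) auto
    finally show ?thesis by (simp add: N_def)
  qed
  have q_eq: "q n k (j * 2 ^ (p + n) + r) = x k + real j * c + real r * (l / 2 ^ n)" for n k j r
  proof -
    have "(x (Suc k) - x k) / real (N n) = c / 2 ^ (p + n)"
      using J by (simp add: x_def N_def distrib_right)
    then show ?thesis by (simp add: q_def l_def distrib_right power_add add_divide_distrib)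
  qed
  have d01: "0 \<le> d n f" "d n f \<le> 1" for n f
  proof -
    have "0 \<le> \<rho> * (\<Sum>j<J. \<Sum>i<j. exp (A n j f - A n i f))" using \<rho> by (intro mult_nonneg_nonneg sum_nonneg) auto
    then show "0 \<le> d n f" "d n f \<le> 1" by (auto simp: d_def)
  qed
  have d_meas: "d n \<in> borel_measurable (PiM {..<N n} (\<lambda>_. borel))" for n
  proof -
    have [measurable]: "A n j \<in> borel_measurable (PiM {..<N n} (\<lambda>_. borel))" if "j < J" for j
      unfolding A_def using idx[OF that]
      by (intro borel_measurable_divide borel_measurable_sum measurable_component_singleton)
        (auto intro: less_le_trans)
    show ?thesis unfolding d_def
      by (intro borel_measurable_divide borel_measurable_add borel_measurable_times borel_measurable_sum
          borel_measurable_exp borel_measurable_diff measurable_const) auto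
  qed
  have x_less: "x k < x (Suc k)" for k using J c by (simp add: x_def distrib_right)
  have N0: "0 < N n" for n using J by (simp add: N_def)
  have exp: "(\<integral>\<omega>. (\<Prod>k<m. D' n k \<omega>) \<partial>M) = (\<Prod>k<m. \<integral>\<omega>. D' n k \<omega> \<partial>M)" for n
    unfolding D'_def q_def
    by (rule brownian_blocks_expectation(1)[where W=W and x=x and N="N n" and d="\<lambda>_. d n"])
      (use W x_less d_meas d01 N0 in auto)
  have [measurable]: "D' n k \<in> borel_measurable M" if "k < m" for n k
    unfolding D'_def q_def
    by (rule brownian_blocks_expectation(2)[where W=W and x=x and N="N n" and d="\<lambda>_. d n" and m=m])
      (use W x_less d_meas d01 N0 that in auto)
  have [measurable]: "D k \<in> borel_measurable M" for k
    unfolding D_def using measurable_block_rise[OF W l, of "x k" c J] by measurable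
  have D01: "0 \<le> D k \<omega>" "D k \<omega> \<le> 1" for k \<omega>
  proof -
    have "0 \<le> \<rho> * block_rise (\<lambda>t. W t \<omega>) (x k) c l J" using \<rho> block_rise_nonneg by simp
    then show "0 \<le> D k \<omega>" "D k \<omega> \<le> 1" by (simp_all add: D_def)
  qed
  have lim: "(\<lambda>n. D' n k \<omega>) \<longlonglongrightarrow> D k \<omega>" if \<omega>: "\<omega> \<in> space M" for k \<omega>
  proof -
    define V where "V n j = (\<Sum>r<2 ^ n. W (x k + real j * c + real r * (l / 2 ^ n)) \<omega>) / 2 ^ n" for n j
    have A_eq: "A n j (restrict (\<lambda>j. W (q n k (Suc j)) \<omega> - W (q n k j) \<omega>) {..<N n}) = V n j - W (x k) \<omega>"
      if "j < J" for n j
    proof -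
      have "(\<Sum>i<j * 2 ^ (p + n) + r. restrict (\<lambda>j. W (q n k (Suc j)) \<omega> - W (q n k j) \<omega>) {..<N n} i)
          = W (x k + real j * c + real r * (l / 2 ^ n)) \<omega> - W (x k) \<omega>" if "r < 2 ^ n" for r
        using sum_restrict_increments[OF idx[OF \<open>j < J\<close> that], of "\<lambda>j. W (q n k j) \<omega>"]
        by (simp add: q_eq) (simp add: q_def)
      then have "A n j (restrict (\<lambda>j. W (q n k (Suc j)) \<omega> - W (q n k j) \<omega>) {..<N n})
          = (\<Sum>r<2 ^ n. W (x k + real j * c + real r * (l / 2 ^ n)) \<omega> - W (x k) \<omega>) / 2 ^ n"
        unfolding A_def by (intro arg_cong2[where f="(/)"] sum.cong refl) auto
      then show ?thesis by (simp add: V_def sum_subtractf diff_divide_distrib)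
    qed
    have "D' n k \<omega> = 1 / (1 + \<rho> * (\<Sum>j<J. \<Sum>i<j. exp (V n j - V n i)))" for n
      unfolding D'_def d_def by (intro arg_cong2[where f="(/)"] arg_cong2[where f="(+)"] arg_cong2[where f=times] sum.cong refl)
        (simp add: A_eq)
    moreover have "(\<lambda>n. 1 / (1 + \<rho> * (\<Sum>j<J. \<Sum>i<j. exp (V n j - V n i)))) \<longlonglongrightarrow> D k \<omega>"
      unfolding D_def block_rise_def V_def
    proof (intro tendsto_intros cell_avg_tendsto[OF cont[OF \<omega>] l])
      have "0 \<le> \<rho> * block_rise (\<lambda>t. W t \<omega>) (x k) c l J" using \<rho> block_rise_nonneg by simp
      then show "1 + \<rho> * (\<Sum>j<J. \<Sum>i<j. exp (cell_avg (\<lambda>t. W t \<omega>) (x k + real j * c) l - cell_avg (\<lambda>t. W t \<omega>) (x k + real i * c) l)) \<noteq> 0"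
        unfolding block_rise_def by linarith
    qed
    ultimately show ?thesis by simp
  qed
  have D'01: "0 \<le> D' n k \<omega>" "D' n k \<omega> \<le> 1" for n k \<omega> using d01 by (auto simp: D'_def)
  have 1: "(\<lambda>n. \<integral>\<omega>. (\<Prod>k<m. D' n k \<omega>) \<partial>M) \<longlonglongrightarrow> (\<integral>\<omega>. (\<Prod>k<m. D k \<omega>) \<partial>M)"
    using D'01 D01 lim
    by (intro integral_dominated_convergence[where w="\<lambda>_. 1"] AE_I2 tendsto_prod)
      (auto intro!: borel_measurable_prod simp: abs_prod prod_le_1)
  have 2: "(\<lambda>n. \<Prod>k<m. \<integral>\<omega>. D' n k \<omega> \<partial>M) \<longlonglongrightarrow> (\<Prod>k<m. \<integral>\<omega>. D k \<omega> \<partial>M)"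
    using D'01 D01 lim
    by (intro tendsto_prod integral_dominated_convergence[where w="\<lambda>_. 1"] AE_I2) auto
  have "(\<integral>\<omega>. (\<Prod>k<m. D k \<omega>) \<partial>M) = (\<Prod>k<m. \<integral>\<omega>. D k \<omega> \<partial>M)"
    using LIMSEQ_unique[OF 1[unfolded exp] 2] .
  then show ?thesis by (simp add: D_def x_def l_def)
qed

text \<open>The three parts of \<open>\<kappa>\<close> come from a grid walk without large rise,
  from averages off by more than \<open>z\<close>, and from the size of the fraction after a rise
  above \<open>a\<close>.\<close>

theorem block_rise_product_bound:
  fixes W :: "real \<Rightarrow> 'a \<Rightarrow> real" and n p :: nat and c \<theta> :: real
  assumes W: "brownian_on M UNIV W" and c: "0 < c" and \<rho>: "0 < \<rho>" and z: "0 < z" and a: "0 < a"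
    and \<eta>: "0 < \<eta>" and \<theta>: "0 < \<theta>" "\<theta> * (a + \<eta>) < pi / 2"
  defines "\<kappa> \<equiv> (exp (- \<theta>\<^sup>2 * (n * c) / 2) + n * (3 * c\<^sup>2 * (1 / (8 * \<eta> ^ 4) + 1 / (pi / (2 * \<theta>) - \<eta> - a) ^ 4)))
        / cos (\<theta> * (a + \<eta>)) + (real (Suc n) * (c / 2 ^ p / z\<^sup>2) + exp (2 * z - a) / \<rho>)"
  shows "(\<integral>\<omega>. (\<Prod>k<m. 1 / (1 + \<rho> * block_rise (\<lambda>t. W t \<omega>) (s + real k * (real (Suc n) * c)) c (c / 2 ^ p) (Suc n))) \<partial>M)
    \<le> \<kappa> ^ m"
proof -
  have "(\<integral>\<omega>. 1 / (1 + \<rho> * block_rise (\<lambda>t. W t \<omega>) x c (c / 2 ^ p) (Suc n)) \<partial>M) \<le> \<kappa>" for x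
  proof -
    have G: "gauss_steps M c n (\<lambda>\<omega> i. W (x + real (Suc i) * c) \<omega> - W (x + real i * c) \<omega>)"
      by (rule brownian_gauss_steps[OF W c]) simp
    have c0: "0 < cos (\<theta> * (a + \<eta>))"
      using \<theta> a \<eta> by (intro cos_gt_zero) auto
    note prob_small_rise_upper[OF G a \<eta> \<theta>]
    then have "measure M {\<omega> \<in> space M. \<forall>j\<le>n. \<forall>i\<le>j. W (x + real j * c) \<omega> - W (x + real i * c) \<omega> \<le> a}
      \<le> (exp (- \<theta>\<^sup>2 * (n * c) / 2) + n * (3 * c\<^sup>2 * (1 / (8 * \<eta> ^ 4) + 1 / (pi / (2 * \<theta>) - \<eta> - a) ^ 4)))
        / cos (\<theta> * (a + \<eta>))"
      using c0 by (simp add: pos_le_divide_eq mult.commute)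
    with block_rise_expectation[OF W _ z a \<rho>, of "c / 2 ^ p" x c n] c show ?thesis
      unfolding \<kappa>_def by simp
  qed
  moreover have "0 \<le> (\<integral>\<omega>. 1 / (1 + \<rho> * block_rise (\<lambda>t. W t \<omega>) x c (c / 2 ^ p) (Suc n)) \<partial>M)" for x
    using \<rho> block_rise_nonneg by (intro Bochner_Integration.integral_nonneg) (auto simp: add_nonneg_nonneg)
  ultimately have "(\<Prod>k<m. \<integral>\<omega>. 1 / (1 + \<rho> * block_rise (\<lambda>t. W t \<omega>) (s + real k * (real (Suc n) * c)) c (c / 2 ^ p) (Suc n)) \<partial>M)
      \<le> (\<Prod>k<m. \<kappa>)"
    by (intro prod_mono) auto
  then show ?thesis
    unfolding block_rise_product[OF W c \<rho> zero_less_Suc] by simp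
qed

section \<open>Clocks and frozen supermartingales\<close>

text \<open>A discrete Ito formula in the form of an inequality: the linear term has mean zero, and
  the second derivative changes by at most \<open>e\<close> for small steps and by at most
  \<open>C * z\<^sup>2\<close> for large ones. The bounded support of \<open>n\<close> makes this
  uniform in \<open>b\<close>, although \<open>G\<close> itself may grow.\<close>

lemma gauss_taylor_step:
  fixes G G' n :: "real \<Rightarrow> real"
  assumes G: "\<And>b. (G has_real_derivative G' b) (at b)" and G': "\<And>b. (G' has_real_derivative n b) (at b)"
    and n: "continuous_on UNIV n" and supp: "\<And>b. R < \<bar>b\<bar> \<Longrightarrow> n b = 0" and G0: "\<And>b. 0 \<le> G b" and e: "0 < e"
  shows "\<exists>h0>0. \<forall>h b. 0 < h \<longrightarrow> h < h0 \<longrightarrow>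
    (\<integral>\<^sup>+z. ennreal (G (b + z)) \<partial>gauss h) \<le> ennreal (G b + h * n b / 2 + e * h)"
proof -
  let ?I = "{- \<bar>R\<bar> - 1..\<bar>R\<bar> + 1}"
  have "uniformly_continuous_on ?I n"
    by (rule compact_uniformly_continuous[OF continuous_on_subset[OF n]]) auto
  then obtain \<delta>' where \<delta>': "0 < \<delta>'" "\<And>x y. x \<in> ?I \<Longrightarrow> y \<in> ?I \<Longrightarrow> \<bar>y - x\<bar> < \<delta>' \<Longrightarrow> \<bar>n y - n x\<bar> < e"
    by (metis uniformly_continuous_onE dist_real_def e)
  define \<delta> where "\<delta> = min \<delta>' 1"
  have \<delta>: "0 < \<delta>" "\<bar>n y - n x\<bar> < e" if "\<bar>y - x\<bar> < \<delta>" for x y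
  proof -
    show "0 < \<delta>" using \<delta>'(1) by (simp add: \<delta>_def)
    show "\<bar>n y - n x\<bar> < e"
    proof (cases "x \<in> ?I \<and> y \<in> ?I")
      case True
      then show ?thesis using \<delta>'(2)[of x y] that by (auto simp: \<delta>_def)
    next
      case False
      then have "R < \<bar>x\<bar> \<and> R < \<bar>y\<bar>" using that by (auto simp: \<delta>_def)
      then show ?thesis using supp[of x] supp[of y] e by simp
    qed
  qed
  have \<delta>0: "0 < \<delta>" using \<delta>'(1) by (simp add: \<delta>_def)
  have "bounded (n ` ?I)" by (intro compact_imp_bounded compact_continuous_image continuous_on_subset[OF n]) auto
  then obtain C0 where "\<forall>x\<in>?I. \<bar>n x\<bar> \<le> C0" by (auto simp: bounded_iff)
  then have C0: "\<bar>n x\<bar> \<le> C0" if "x \<in> ?I" for x using that by blast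
  have "\<bar>n 0\<bar> \<le> C0" by (rule C0) auto
  then have C0_pos: "0 \<le> C0" by linarith
  have nC: "\<bar>n x\<bar> \<le> C0" for x
  proof (cases "x \<in> ?I")
    case False
    then have "R < \<bar>x\<bar>" by auto
    then show ?thesis using supp[of x] C0_pos by simp
  qed (rule C0)
  \<comment> \<open>A change of \<open>n\<close> is never more than \<open>2 * C0\<close>; for
    \<open>\<delta> \<le> \<bar>z\<bar>\<close> this is at most
    \<open>2 * C0 / \<delta>\<^sup>2 * z\<^sup>2\<close>. The added 1 keeps \<open>C\<close>
    positive.\<close>
  define C where "C = 2 * C0 / \<delta>\<^sup>2 + 1"
  have C: "0 < C" "2 * C0 / \<delta>\<^sup>2 \<le> C" using C0_pos by (auto simp: C_def add_nonneg_pos)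
  have n_diff: "n c \<le> n b + e + C * z\<^sup>2" if "\<bar>c - b\<bar> \<le> \<bar>z\<bar>" for b c z
  proof (cases "\<bar>c - b\<bar> < \<delta>")
    case True
    have "0 \<le> C * z\<^sup>2" using C by simp
    then show ?thesis using \<delta>(2)[OF True] by linarith
  next
    case False
    then have "\<delta> \<le> \<bar>z\<bar>" using that by simp
    then have "\<delta>\<^sup>2 \<le> z\<^sup>2" using \<delta>0 power_mono[of \<delta> "\<bar>z\<bar>" 2] by simp
    then have "2 * C0 \<le> 2 * C0 / \<delta>\<^sup>2 * z\<^sup>2"
      using \<delta>0 C0_pos by (simp add: field_simps mult_left_mono)
    also have "\<dots> \<le> C * z\<^sup>2" using C by (intro mult_right_mono) auto
    finally show ?thesis using nC[of c] nC[of b] e by linarith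
  qed
  have taylor: "G (b + z) \<le> G b + G' b * z + z\<^sup>2 / 2 * (n b + e) + C / 2 * z ^ 4" for b z
  proof (cases "z = 0")
    case False
    define diff where "diff m = (if m = 0 then G else if m = 1 then G' else n)" for m :: nat
    obtain t where t: "if b + z < b then b + z < t \<and> t < b else b < t \<and> t < b + z"
      and eq: "G (b + z) = (\<Sum>m<2. diff m b / fact m * (b + z - b) ^ m) + diff 2 t / fact 2 * (b + z - b)\<^sup>2"
    proof -
      have "\<exists>t. (if b + z < b then b + z < t \<and> t < b else b < t \<and> t < b + z) \<and>
        G (b + z) = (\<Sum>m<2. diff m b / fact m * (b + z - b) ^ m) + diff 2 t / fact 2 * (b + z - b)\<^sup>2"
        by (rule Taylor[where a="b - \<bar>z\<bar>" and b="b + \<bar>z\<bar>"])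
          (use False G G' in \<open>auto simp: diff_def less_Suc_eq numeral_2_eq_2\<close>)
      then show ?thesis using that by blast
    qed
    have 1: "G (b + z) = G b + G' b * z + z\<^sup>2 / 2 * n t"
      unfolding eq by (simp add: diff_def eval_nat_numeral)
    have "\<bar>t - b\<bar> \<le> \<bar>z\<bar>" using t by (auto split: if_splits)
    from n_diff[OF this] have "z\<^sup>2 / 2 * n t \<le> z\<^sup>2 / 2 * (n b + e + C * z\<^sup>2)"
      by (intro mult_left_mono) auto
    also have "\<dots> = z\<^sup>2 / 2 * (n b + e) + C / 2 * z ^ 4"
      by (simp add: field_simps eval_nat_numeral)
    finally show ?thesis using 1 by linarith
  qed simp
  show ?thesis
  \<comment> \<open>The uniform error contributes \<open>e * h / 2\<close>; below this threshold the
    quartic term \<open>C / 2 * (3 * h\<^sup>2)\<close> contributes at most as much.\<close>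
  proof (intro exI[of _ "e / (3 * C)"] conjI allI impI)
    show "0 < e / (3 * C)" using e C by simp
    fix h b :: real assume h: "0 < h" "h < e / (3 * C)"
    have int: "has_bochner_integral (gauss h) (\<lambda>z. G b + G' b * z + z\<^sup>2 / 2 * (n b + e) + C / 2 * z ^ 4)
      (G b + G' b * 0 + h / 2 * (n b + e) + C / 2 * (3 * h\<^sup>2))"
    proof -
      interpret prob_space "gauss h" using h(1) by (rule prob_space_gauss)
      have 0: "has_bochner_integral (gauss h) (\<lambda>_. G b) (G b)"
        using prob_space by (simp add: has_bochner_integral_iff)
      have 1: "has_bochner_integral (gauss h) (\<lambda>z. G' b * z) (G' b * 0)"
        using h(1) integrable_gauss_power[OF h(1), of 1] by (simp add: has_bochner_integral_iff)
      have 2: "has_bochner_integral (gauss h) (\<lambda>z. z\<^sup>2 / 2 * (n b + e)) (h / 2 * (n b + e))"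
        using h(1) by (simp add: has_bochner_integral_iff)
      have 4: "has_bochner_integral (gauss h) (\<lambda>z. C / 2 * z ^ 4) (C / 2 * (3 * h\<^sup>2))"
        using h(1) by (simp add: has_bochner_integral_iff)
      show ?thesis by (intro has_bochner_integral_add 0 1 2 4)
    qed
    have "(\<integral>\<^sup>+z. ennreal (G (b + z)) \<partial>gauss h)
        \<le> ennreal (\<integral>z. G b + G' b * z + z\<^sup>2 / 2 * (n b + e) + C / 2 * z ^ 4 \<partial>gauss h)"
      using taylor G0 int by (intro nn_integral_le_ennreal_integral ennreal_leI) (auto intro: order_trans has_bochner_integral_iff[THEN iffD1, THEN conjunct1])
    also have "\<dots> = ennreal (G b + h / 2 * (n b + e) + C / 2 * (3 * h\<^sup>2))"
      using has_bochner_integral_integral_eq[OF int] by simp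
    also have "\<dots> \<le> ennreal (G b + h * n b / 2 + e * h)"
    proof (rule ennreal_leI)
      have "h * (3 * C) \<le> e" using h C by (simp add: field_simps less_imp_le)
      then have "h * (h * (3 * C)) \<le> h * e" using h by (intro mult_left_mono) auto
      moreover have "G b + h / 2 * (n b + e) + C / 2 * (3 * h\<^sup>2) = G b + h * n b / 2 + h * e / 2 + h * (h * (3 * C)) / 2"
        by (simp add: power2_eq_square field_simps)
      ultimately show "G b + h / 2 * (n b + e) + C / 2 * (3 * h\<^sup>2) \<le> G b + h * n b / 2 + e * h"
        using mult.commute[of e h] by linarith
    qed
    finally show "(\<integral>\<^sup>+z. ennreal (G (b + z)) \<partial>gauss h) \<le> ennreal (G b + h * n b / 2 + e * h)" .
  qed
qed

text \<open>The pair consists of the Brownian position and the elapsed clock. The clock advances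
  with the rate at the left end of the step, so its increment is known beforehand and only the
  position is integrated.\<close>

definition freeze_step :: "(real \<Rightarrow> real \<Rightarrow> bool) \<Rightarrow> (real \<Rightarrow> real) \<Rightarrow> real \<Rightarrow> real \<times> real \<Rightarrow> real \<Rightarrow> real \<times> real" where
  "freeze_step Q c h p z = (if Q (fst p) (snd p) then p else (fst p + z, snd p + h * c (fst p)))"

lemma chain_freeze_step:
  fixes x :: "nat \<Rightarrow> real" and c :: "real \<Rightarrow> real" and h :: real
  assumes "x 0 = 0"
  defines "\<tau> \<equiv> \<lambda>k. h * (\<Sum>i<k. c (x i))"
  shows "\<exists>k\<le>n. chain (freeze_step Q c h) (0, 0) (\<lambda>i. x (Suc i) - x i) n = (x k, \<tau> k)
    \<and> (\<forall>i<k. \<not> Q (x i) (\<tau> i)) \<and> (k = n \<or> Q (x k) (\<tau> k))"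
proof (induction n)
  case 0
  then show ?case using assms by simp
next
  case (Suc n)
  let ?Y = "chain (freeze_step Q c h) (0, 0) (\<lambda>i. x (Suc i) - x i)"
  from Suc obtain k where k: "k \<le> n" "?Y n = (x k, \<tau> k)" "\<forall>i<k. \<not> Q (x i) (\<tau> i)" "k = n \<or> Q (x k) (\<tau> k)"
    by blast
  show ?case
  proof (cases "Q (x k) (\<tau> k)")
    case True
    then have "?Y (Suc n) = (x k, \<tau> k)" using k by (simp add: freeze_step_def)
    with k True show ?thesis by (intro exI[of _ k]) auto
  next
    case False
    then have "k = n" using k by blast
    then have "?Y (Suc n) = (x (Suc n), \<tau> (Suc n))" using k False by (simp add: freeze_step_def \<tau>_def distrib_left)
    with k False \<open>k = n\<close> show ?thesis by (intro exI[of _ "Suc n"]) (auto simp: less_Suc_eq)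
  qed
qed

definition frozen :: "(real \<Rightarrow> real \<Rightarrow> bool) \<Rightarrow> (real \<Rightarrow> real) \<Rightarrow> (real \<Rightarrow> real) \<Rightarrow> real \<Rightarrow> nat \<Rightarrow> real \<times> real" where
  "frozen Q c b N j = chain (freeze_step Q c (N / 2 ^ j)) (0, 0)
     (\<lambda>i. b (real (Suc i) * (N / 2 ^ j)) - b (real i * (N / 2 ^ j))) (2 ^ j)"

lemma frozen_supermartingale_bound:
  fixes B :: "real \<Rightarrow> 'a \<Rightarrow> real" and F :: "real \<Rightarrow> real \<Rightarrow> real"
  assumes B: "brownian_on M {0..} B" and N: "0 < N" and c: "c \<in> borel_measurable borel" "\<And>b. 0 \<le> c b"
    and Q: "Measurable.pred (borel \<Otimes>\<^sub>M borel) (\<lambda>(b, T). Q b T)"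
    and F: "(\<lambda>(b, T). F b T) \<in> borel_measurable (borel \<Otimes>\<^sub>M borel)" "\<And>b T. 0 \<le> F b T"
    and step: "\<And>e. 0 < e \<Longrightarrow> \<exists>h0>0. \<forall>h b T. 0 < h \<longrightarrow> h < h0 \<longrightarrow> 0 \<le> T \<longrightarrow> \<not> Q b T \<longrightarrow>
      (\<integral>\<^sup>+z. ennreal (F (b + z) (T + h * c b)) \<partial>gauss h) \<le> ennreal (F b T + e * h)"
    and A: "A \<in> sets M" and g: "0 \<le> g"
    and ev: "\<And>\<omega>. \<omega> \<in> A \<Longrightarrow> \<forall>\<^sub>F j in sequentially. g \<le> (\<lambda>(b, T). F b T) (frozen Q c (\<lambda>r. B r \<omega>) N j)"
  shows "g * measure M A \<le> F 0 0"
proof -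
  interpret prob_space M using B by (rule brownian_onD)
  let ?F = "\<lambda>(b, T). F b T"
  have [measurable]: "c \<in> borel_measurable borel" "Measurable.pred (borel \<Otimes>\<^sub>M borel) (\<lambda>p. Q (fst p) (snd p))"
    using c Q by (auto simp: split_beta')
  have [measurable]: "(\<lambda>(s, z). freeze_step Q c h s z) \<in> measurable ((borel \<Otimes>\<^sub>M borel) \<Otimes>\<^sub>M borel) (borel \<Otimes>\<^sub>M borel)" for h
    unfolding freeze_step_def by measurable
  define Y where "Y j \<omega> = frozen Q c (\<lambda>r. B r \<omega>) N j" for j \<omega>
  have G: "gauss_steps M (N / 2 ^ j) (2 ^ j) (\<lambda>\<omega> i. B (real (Suc i) * (N / 2 ^ j)) \<omega> - B (real i * (N / 2 ^ j)) \<omega>)" for j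
    using brownian_gauss_steps[OF B, of "N / 2 ^ j" "2 ^ j" 0] N by simp
  have Y_meas[measurable]: "Y j \<in> measurable M (borel \<Otimes>\<^sub>M borel)" for j
    unfolding Y_def frozen_def using gauss_stepsD(5)[OF G[of j]]
    by (intro measurable_chain) (auto simp: space_pair_measure)
  have F_meas[measurable]: "?F \<in> borel_measurable (borel \<Otimes>\<^sub>M borel)" by (rule F)
  have bound: "g * measure M A \<le> F 0 0 + N * e" if e: "0 < e" for e
  proof -
    obtain h0 where h0: "0 < h0" "\<And>h b T. 0 < h \<Longrightarrow> h < h0 \<Longrightarrow> 0 \<le> T \<Longrightarrow> \<not> Q b T \<Longrightarrow>
      (\<integral>\<^sup>+z. ennreal (F (b + z) (T + h * c b)) \<partial>gauss h) \<le> ennreal (F b T + e * h)"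
      using step[OF e] by blast
    have "(\<lambda>j. N * (1/2) ^ j) \<longlonglongrightarrow> N * 0" by (intro tendsto_intros LIMSEQ_realpow_zero) auto
    then have "\<forall>\<^sub>F j in sequentially. N * (1/2) ^ j < h0"
      using h0(1) by (intro order_tendstoD) auto
    then obtain j1 where j1: "\<And>j. j \<ge> j1 \<Longrightarrow> N * (1/2) ^ j < h0"
      by (auto simp: eventually_sequentially)
    have E: "(\<integral>\<^sup>+\<omega>. ennreal (?F (Y j \<omega>)) \<partial>M) \<le> ennreal (F 0 0 + N * e)" if j: "j \<ge> j1" for j
    proof -
      define h where "h = N / 2 ^ j"
      have h: "0 < h" "h < h0" using N j1[OF j] by (auto simp: h_def power_divide)
      have st: "(\<integral>\<^sup>+z. ennreal (?F (freeze_step Q c h s z)) \<partial>gauss h) \<le> 1 * ennreal (?F s) + ennreal (e * h)"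
        if "0 \<le> snd s" for s
      proof (cases "Q (fst s) (snd s)")
        case True
        interpret gp: prob_space "gauss h" using h(1) by (rule prob_space_gauss)
        show ?thesis using True gp.emeasure_space_1 by (simp add: freeze_step_def)
      next
        case False
        then have "(\<integral>\<^sup>+z. ennreal (?F (freeze_step Q c h s z)) \<partial>gauss h) \<le> ennreal (F (fst s) (snd s) + e * h)"
          using h0(2)[OF h that False] by (simp add: freeze_step_def)
        also have "\<dots> = ennreal (F (fst s) (snd s)) + ennreal (e * h)"
          using F e h by (intro ennreal_plus) auto
        finally show ?thesis by (simp add: split_beta')
      qed
      have "(\<integral>\<^sup>+\<omega>. ennreal (?F (Y j \<omega>)) \<partial>M) \<le> 1 ^ (2 ^ j) * ennreal (?F (0, 0)) + of_nat (2 ^ j) * ennreal (e * h)"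
        unfolding Y_def frozen_def h_def[symmetric]
      proof (rule chain_supermartingale[OF G[of j, folded h_def] order_refl, where N="borel \<Otimes>\<^sub>M borel" and P="\<lambda>s. 0 \<le> snd s"])
        show "0 \<le> snd (freeze_step Q c h s z)" if "0 \<le> snd s" for s z
          using that c h by (auto simp: freeze_step_def)
      qed (use st in \<open>auto simp: space_pair_measure\<close>)
      also have "\<dots> = ennreal (F 0 0) + ennreal (N * e)"
        using e N by (simp add: h_def ennreal_of_nat_eq_real_of_nat flip: ennreal_mult')
      finally show ?thesis using F e N by simp
    qed
    \<comment> \<open>The level from which the bound holds depends on the path; the sets
      \<open>D J\<close> fix it, and they increase to \<open>A\<close>.\<close>
    define D where "D J = {\<omega> \<in> A. \<forall>j\<ge>J. g \<le> ?F (Y j \<omega>)}" for J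
    have D_sets[measurable]: "D J \<in> sets M" for J
    proof -
      have "{\<omega> \<in> space M. \<forall>j\<ge>J. g \<le> ?F (Y j \<omega>)} \<in> sets M" by measurable
      moreover have "D J = A \<inter> {\<omega> \<in> space M. \<forall>j\<ge>J. g \<le> ?F (Y j \<omega>)}"
        using sets.sets_into_space[OF A] by (auto simp: D_def)
      ultimately show ?thesis using A by auto
    qed
    have D_bound: "g * measure M (D J) \<le> F 0 0 + N * e" for J
    proof -
      define j where "j = max J j1"
      have "ennreal (g * measure M (D J)) = (\<integral>\<^sup>+\<omega>. ennreal g * indicator (D J) \<omega> \<partial>M)"
        using g by (simp add: nn_integral_cmult emeasure_eq_measure ennreal_mult')
      also have "\<dots> \<le> (\<integral>\<^sup>+\<omega>. ennreal (?F (Y j \<omega>)) \<partial>M)"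
        by (intro nn_integral_mono) (auto simp: indicator_def D_def j_def intro!: ennreal_leI)
      also have "\<dots> \<le> ennreal (F 0 0 + N * e)" by (rule E) (simp add: j_def)
      finally show ?thesis using F e N by (subst (asm) ennreal_le_iff) auto
    qed
    have "incseq D" by (auto simp: incseq_def D_def)
    then have "(\<lambda>J. measure M (D J)) \<longlonglongrightarrow> measure M (\<Union>J. D J)"
      by (intro finite_Lim_measure_incseq) auto
    moreover have "(\<Union>J. D J) = A"
      using ev by (auto simp: D_def eventually_sequentially Y_def)
    ultimately have "(\<lambda>J. g * measure M (D J)) \<longlonglongrightarrow> g * measure M A" by (intro tendsto_intros) simp
    then show ?thesis using D_bound by (intro LIMSEQ_le_const2) auto
  qed
  show ?thesis
  proof (rule field_le_epsilon)
    fix e :: real assume "0 < e"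
    then show "g * measure M A \<le> F 0 0 + e" using bound[of "e / N"] N by simp
  qed
qed

section \<open>The additive clock of a path\<close>

text \<open>The path is continued to negative times by its value at 0, which makes the rate
  continuous on the whole line and the clock differentiable at 0 from both sides.\<close>

definition clock :: "(real \<Rightarrow> real) \<Rightarrow> (real \<Rightarrow> real) \<Rightarrow> real \<Rightarrow> real" where
  "clock c b = antideriv (\<lambda>r. c (b (max 0 r)))"

lemma continuous_clock_rate:
  fixes b c :: "real \<Rightarrow> real"
  assumes "continuous_on UNIV c" "continuous_on {0..} b"
  shows "continuous_on UNIV (\<lambda>r. c (b (max 0 r)) :: real)"
proof -
  have "continuous_on UNIV (\<lambda>r::real. max 0 r)"
    by (rule continuous_on_max[OF continuous_on_const continuous_on_id])
  then have "continuous_on UNIV (\<lambda>r. b (max 0 r))"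
    by (rule continuous_on_compose2[OF assms(2)]) auto
  then show ?thesis by (rule continuous_on_compose2[OF assms(1)]) auto
qed

lemma clock_has_derivative:
  assumes "continuous_on UNIV c" "continuous_on {0..} b"
  shows "(clock c b has_real_derivative c (b (max 0 r))) (at r)"
  unfolding clock_def by (rule antideriv_has_derivative[OF continuous_clock_rate[OF assms]])

lemma clock_0 [simp]: "clock c b 0 = 0"
  by (simp add: clock_def)

lemma continuous_clock:
  assumes "continuous_on UNIV c" "continuous_on {0..} b"
  shows "continuous_on UNIV (clock c b)"
  using clock_has_derivative[OF assms] by (intro DERIV_continuous_on) (auto intro: has_field_derivative_at_within)

lemma clock_mono:
  assumes "continuous_on UNIV c" "continuous_on {0..} b" "\<And>x. 0 \<le> c x" "r \<le> s"
  shows "clock c b r \<le> clock c b s"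
  using clock_has_derivative[OF assms(1,2)] assms by (intro DERIV_nonneg_imp_nondecreasing[OF assms(4)]) blast

lemma clock_strict_mono:
  assumes "continuous_on UNIV c" "continuous_on {0..} b" "\<And>x. 0 < c x" "r < s"
  shows "clock c b r < clock c b s"
  using clock_has_derivative[OF assms(1,2)] assms by (intro DERIV_pos_imp_increasing[OF assms(4)]) blast

lemma clock_riemann:
  assumes "continuous_on UNIV c" "continuous_on {0..} b" "0 < e" and N: "0 < N"
  shows "\<forall>\<^sub>F j in sequentially. \<forall>k\<le>2 ^ j. \<bar>N / 2 ^ j * (\<Sum>i<k. c (b (real i * (N / 2 ^ j)))) - clock c b (real k * (N / 2 ^ j))\<bar> \<le> e"
proof -
  obtain \<delta> where \<delta>: "\<delta> > 0" "\<And>h k. 0 < h \<Longrightarrow> h < \<delta> \<Longrightarrow> 0 + real k * h \<le> N \<Longrightarrow>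
      \<bar>h * (\<Sum>i<k. c (b (max 0 (0 + real i * h)))) - (clock c b (0 + real k * h) - clock c b 0)\<bar> \<le> e"
    using riemann_sum_uniform[OF clock_has_derivative[OF assms(1,2)] continuous_on_subset[OF continuous_clock_rate[OF assms(1,2)] subset_UNIV] assms(3), of 0 N]
    by blast
  have "(\<lambda>j. N * (1/2) ^ j) \<longlonglongrightarrow> N * 0" by (intro tendsto_intros LIMSEQ_realpow_zero) auto
  then have "\<forall>\<^sub>F j in sequentially. N * (1/2) ^ j < \<delta>"
    using \<delta>(1) by (intro order_tendstoD) auto
  then show ?thesis
  proof eventually_elim
    case (elim j)
    show ?case
    proof (intro allI impI)
      fix k :: nat assume "k \<le> 2 ^ j"
      then have "real k \<le> 2 ^ j" by (metis of_nat_le_iff of_nat_numeral of_nat_power)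
      then have "real k * (N / 2 ^ j) \<le> N" using N by (simp add: field_simps)
      moreover have "max 0 (real i * (N / 2 ^ j)) = real i * (N / 2 ^ j)" for i using N by simp
      ultimately show "\<bar>N / 2 ^ j * (\<Sum>i<k. c (b (real i * (N / 2 ^ j)))) - clock c b (real k * (N / 2 ^ j))\<bar> \<le> e"
        using \<delta>(2)[of "N / 2 ^ j" k] elim N by (simp add: power_divide)
    qed
  qed
qed

section \<open>Recurrence\<close>

lemma measurable_clock:
  assumes c: "\<And>\<omega>. \<omega> \<in> space M \<Longrightarrow> continuous_on UNIV (c \<omega>)"
    and b: "\<And>\<omega>. \<omega> \<in> space M \<Longrightarrow> continuous_on {0..} (b \<omega>)"
    and m: "\<And>r. 0 \<le> r \<Longrightarrow> (\<lambda>\<omega>. c \<omega> (b \<omega> r)) \<in> borel_measurable M" and u: "0 \<le> u"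
  shows "(\<lambda>\<omega>. clock (c \<omega>) (b \<omega>) u) \<in> borel_measurable M"
proof (cases "u = 0")
  case False
  then have u: "0 < u" using u by simp
  show ?thesis
  proof (rule borel_measurable_LIMSEQ_real)
    show "(\<lambda>\<omega>. u / 2 ^ j * (\<Sum>i<2 ^ j. c \<omega> (b \<omega> (real i * (u / 2 ^ j))))) \<in> borel_measurable M" for j :: nat
      by (intro borel_measurable_times borel_measurable_const borel_measurable_sum m) (use u in auto)
    fix \<omega> assume \<omega>: "\<omega> \<in> space M"
    show "(\<lambda>j. u / 2 ^ j * (\<Sum>i<2 ^ j. c \<omega> (b \<omega> (real i * (u / 2 ^ j))))) \<longlonglongrightarrow> clock (c \<omega>) (b \<omega>) u"
    proof (rule tendstoI)
      fix e :: real assume e: "0 < e"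
      show "\<forall>\<^sub>F j in sequentially. dist (u / 2 ^ j * (\<Sum>i<2 ^ j. c \<omega> (b \<omega> (real i * (u / 2 ^ j))))) (clock (c \<omega>) (b \<omega>) u) < e"
        using clock_riemann[OF c[OF \<omega>] b[OF \<omega>] half_gt_zero[OF e] u]
      proof eventually_elim
        case (elim j)
        from elim[rule_format, of "2 ^ j"] e show ?case by (simp add: dist_real_def)
      qed
    qed
  qed
qed simp

section \<open>Occupation time near the origin\<close>

definition tent :: "real \<Rightarrow> real" where
  "tent b = max 0 (1 - \<bar>b\<bar>)"

lemma tent_nonneg [simp]: "0 \<le> tent b" by (simp add: tent_def)
lemma tent_le_1 [simp]: "tent b \<le> 1" by (simp add: tent_def)
lemma tent_outside [simp]: "1 \<le> \<bar>b\<bar> \<Longrightarrow> tent b = 0" by (simp add: tent_def)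

lemma continuous_tent [continuous_intros]: "continuous_on A f \<Longrightarrow> continuous_on A (\<lambda>x. tent (f x))"
  unfolding tent_def by (intro continuous_on_max continuous_intros) 

lemma measurable_tent [measurable]: "tent \<in> borel_measurable borel"
  by (intro borel_measurable_continuous_onI continuous_tent continuous_on_id)

text \<open>A convex function with second derivative \<open>tent\<close> that is at least 1 and
  grows linearly: it is large where the path has wandered off, and its second derivative is
  dominated by \<open>tent\<close> times the function.\<close>

definition tent_test :: "real \<Rightarrow> real" where
  "tent_test b = 1 + antideriv (antideriv tent) b"

lemma tent_antideriv: "(antideriv tent has_real_derivative tent b) (at b)"
  by (intro antideriv_has_derivative continuous_tent continuous_on_id)

lemma tent_test_derivative: "(tent_test has_real_derivative antideriv tent b) (at b)"
proof -
  have "continuous_on UNIV (antideriv tent)"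
    using tent_antideriv by (intro DERIV_continuous_on) (auto intro: has_field_derivative_at_within)
  then show ?thesis unfolding tent_test_def[abs_def]
    by (auto intro!: derivative_eq_intros antideriv_has_derivative)
qed

lemma antideriv_tent_mono: "b \<le> b' \<Longrightarrow> antideriv tent b \<le> antideriv tent b'"
  by (rule DERIV_nonneg_imp_nondecreasing) (use tent_antideriv tent_nonneg in blast)+

lemma antideriv_tent_half: "1 / 4 \<le> antideriv tent (1/2)" "antideriv tent (-1/2) \<le> - 1 / 4"
proof -
  obtain z where z: "0 < z" "z < 1/2" "antideriv tent (1/2) - antideriv tent 0 = (1/2 - 0) * tent z"
    using MVT2[of 0 "1/2" "antideriv tent" tent] tent_antideriv by auto
  then show "1 / 4 \<le> antideriv tent (1/2)" by (simp add: tent_def)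
  obtain z where z: "-1/2 < z" "z < 0" "antideriv tent 0 - antideriv tent (-1/2) = (0 - (-1/2)) * tent z"
    using MVT2[of "-1/2" 0 "antideriv tent" tent] tent_antideriv by auto
  then show "antideriv tent (-1/2) \<le> - 1 / 4" by (simp add: tent_def)
qed

lemma tent_test_ge_1: "1 \<le> tent_test b"
proof (cases "0 \<le> b")
  case True
  have "tent_test 0 \<le> tent_test b"
  proof (rule DERIV_nonneg_imp_nondecreasing[OF True])
    fix x :: real assume "0 \<le> x"
    then have "0 \<le> antideriv tent x" using antideriv_tent_mono[of 0 x] by simp
    then show "\<exists>y. (tent_test has_real_derivative y) (at x) \<and> 0 \<le> y" using tent_test_derivative by blast
  qed
  then show ?thesis by (simp add: tent_test_def)
next
  case False
  have "tent_test 0 \<le> tent_test b"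
  proof (rule DERIV_nonpos_imp_nonincreasing[of b 0])
    fix x :: real assume "x \<le> 0"
    then have "antideriv tent x \<le> 0" using antideriv_tent_mono[of x 0] by simp
    then show "\<exists>y. (tent_test has_real_derivative y) (at x) \<and> y \<le> 0" using tent_test_derivative by blast
  qed (use False in simp)
  then show ?thesis by (simp add: tent_test_def)
qed

lemma tent_test_ge_abs: "\<bar>b\<bar> / 4 \<le> tent_test b"
proof -
  consider "\<bar>b\<bar> \<le> 1/2" | "1/2 < b" | "b < -1/2" by linarith
  then show ?thesis
  proof cases
    case 1
    then show ?thesis using tent_test_ge_1[of b] by linarith
  next
    case 2
    have "(\<lambda>b. tent_test b - b / 4) (1/2) \<le> (\<lambda>b. tent_test b - b / 4) b"
    proof (rule DERIV_nonneg_imp_nondecreasing[of "1/2" b])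
      fix x :: real assume "1/2 \<le> x" "x \<le> b"
      then have "0 \<le> antideriv tent x - 1/4" using antideriv_tent_half(1) antideriv_tent_mono[of "1/2" x] by linarith
      moreover have "((\<lambda>b. tent_test b - b / 4) has_real_derivative antideriv tent x - 1/4) (at x)"
        by (auto intro!: derivative_eq_intros tent_test_derivative)
      ultimately show "\<exists>y. ((\<lambda>b. tent_test b - b / 4) has_real_derivative y) (at x) \<and> 0 \<le> y" by blast
    qed (use 2 in simp)
    then show ?thesis using tent_test_ge_1[of "1/2"] 2 by simp
  next
    case 3
    have "(\<lambda>b. tent_test b + b / 4) (-1/2) \<le> (\<lambda>b. tent_test b + b / 4) b"
    proof (rule DERIV_nonpos_imp_nonincreasing[of b "-1/2"])
      fix x :: real assume "b \<le> x" "x \<le> -1/2"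
      then have "antideriv tent x + 1/4 \<le> 0" using antideriv_tent_half(2) antideriv_tent_mono[of x "-1/2"] by linarith
      moreover have "((\<lambda>b. tent_test b + b / 4) has_real_derivative antideriv tent x + 1/4) (at x)"
        by (auto intro!: derivative_eq_intros tent_test_derivative)
      ultimately show "\<exists>y. ((\<lambda>b. tent_test b + b / 4) has_real_derivative y) (at x) \<and> y \<le> 0" by blast
    qed (use 3 in simp)
    then show ?thesis using tent_test_ge_1[of "-1/2"] 3 by simp
  qed
qed

lemma brownian_prob_small:
  assumes B: "brownian_on M {0..} B" and N: "0 < N" and K: "0 \<le> K"
  shows "measure M {\<omega> \<in> space M. \<bar>B N \<omega>\<bar> \<le> K} \<le> 2 * K / sqrt N"
proof -
  interpret prob_space M using B by (rule brownian_onD)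
  have [measurable]: "B N \<in> borel_measurable M" "B 0 \<in> borel_measurable M" using brownian_onD(3)[OF B] N by auto
  have D: "distr M borel (\<lambda>\<omega>. B N \<omega> - B 0 \<omega>) = gauss N"
    using brownian_onD(6)[OF B, of 0 N] N by simp
  have "ennreal (measure M {\<omega> \<in> space M. \<bar>B N \<omega>\<bar> \<le> K}) = emeasure M ((\<lambda>\<omega>. B N \<omega> - B 0 \<omega>) -` {-K..K} \<inter> space M)"
    unfolding emeasure_eq_measure using brownian_onD(4)[OF B]
    by (intro arg_cong[where f="\<lambda>A. ennreal (measure M A)"]) (auto simp: abs_le_iff)
  also have "\<dots> = emeasure (gauss N) {-K..K}"
    unfolding D[symmetric] by (subst emeasure_distr) auto
  also have "\<dots> = (\<integral>\<^sup>+x. ennreal (normal_density 0 (sqrt N) x) * indicator {-K..K} x \<partial>lborel)"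
    unfolding gauss_def by (subst emeasure_density) auto
  also have "\<dots> \<le> (\<integral>\<^sup>+x. ennreal (1 / sqrt N) * indicator {-K..K} x \<partial>lborel)"
  proof (intro nn_integral_mono mult_right_mono ennreal_leI)
    fix x :: real
    have "normal_density 0 (sqrt N) x \<le> 1 / sqrt (2 * pi * N) * 1"
      unfolding normal_density_def using N by (intro mult_mono) auto
    also have "\<dots> \<le> 1 / sqrt N"
    proof -
      have "1 * N \<le> 2 * pi * N" using N pi_gt3 by (intro mult_right_mono) auto
      then show ?thesis using N by (simp add: divide_left_mono real_sqrt_le_mono mult_pos_pos)
    qed
    finally show "normal_density 0 (sqrt N) x \<le> 1 / sqrt N" .
  qed simp
  also have "\<dots> = ennreal (1 / sqrt N * (2 * K))"
    using K N by (simp add: nn_integral_cmult flip: ennreal_mult')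
  finally show ?thesis using K N by (subst (asm) ennreal_le_iff) auto
qed

lemma frozen_never:
  assumes "b 0 = 0"
  shows "frozen (\<lambda>_ _. False) c b N j = (b N, N / 2 ^ j * (\<Sum>i<2 ^ j. c (b (real i * (N / 2 ^ j)))))"
  using chain_freeze_step[of "\<lambda>i. b (real i * (N / 2 ^ j))" "2 ^ j" "\<lambda>_ _. False" c "N / 2 ^ j"] assms
  unfolding frozen_def by auto

text \<open>\<open>tent_test\<close> of the position times \<open>exp\<close> of minus the clock is
  a supermartingale, since half of \<open>tent\<close> is at most \<open>tent * tent_test\<close>.
  At time \<open>N\<close> the path is typically beyond \<open>K\<close>, where
  \<open>tent_test\<close> exceeds \<open>K / 4\<close>; the bounded expectation then leaves little
  probability for a small clock.\<close>

lemma prob_tent_clock_le: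
  assumes B: "brownian_on M {0..} B" and N: "0 < N" and K: "0 < K"
  shows "measure M {\<omega> \<in> space M. clock tent (\<lambda>r. B r \<omega>) N \<le> m} \<le> 2 * K / sqrt N + 4 * exp (m + 1) / K"
proof -
  interpret prob_space M using B by (rule brownian_onD)
  have [measurable]: "\<And>r. 0 \<le> r \<Longrightarrow> B r \<in> borel_measurable M" using brownian_onD(3)[OF B] by auto
  have cont: "continuous_on UNIV tent" by (intro continuous_tent continuous_on_id)
  have [measurable]: "B N \<in> borel_measurable M" using N by simp
  have [measurable]: "(\<lambda>\<omega>. clock tent (\<lambda>r. B r \<omega>) N) \<in> borel_measurable M"
    using cont brownian_onD(5)[OF B] N by (intro measurable_clock) auto
  let ?A = "{\<omega> \<in> space M. K < \<bar>B N \<omega>\<bar> \<and> clock tent (\<lambda>r. B r \<omega>) N \<le> m}"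
  have [measurable]: "tent_test \<in> borel_measurable borel"
    using tent_test_derivative by (intro borel_measurable_continuous_onI DERIV_continuous_on) (auto intro: has_field_derivative_at_within)
  \<comment> \<open>The 1 in \<open>m + 1\<close> absorbs the error of the Riemann sums for the
    clock.\<close>
  have "K / 4 * exp (- (m + 1)) * measure M ?A \<le> tent_test 0 * exp (- 0)"
  proof (rule frozen_supermartingale_bound[where F="\<lambda>b T. tent_test b * exp (- T)" and Q="\<lambda>_ _. False" and c=tent
        and A="?A" and g="K / 4 * exp (- (m + 1))", OF B N])
    show "0 \<le> tent_test b * exp (- T)" for b T using tent_test_ge_1[of b] by simp
    show "0 \<le> K / 4 * exp (- (m + 1))" using K by simp
    show "(\<lambda>(b, T). tent_test b * exp (- T)) \<in> borel_measurable (borel \<Otimes>\<^sub>M borel)" by measurable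
    show "?A \<in> sets M" by measurable
    show "Measurable.pred (borel \<Otimes>\<^sub>M borel) (\<lambda>(b, T). False)" by simp
    show "tent \<in> borel_measurable borel" by measurable
  next
    fix e :: real assume e: "0 < e"
    have nn: "0 \<le> tent_test b" for b using tent_test_ge_1[of b] by linarith
    have "\<exists>h0>0. \<forall>h b. 0 < h \<longrightarrow> h < h0 \<longrightarrow>
        (\<integral>\<^sup>+z. ennreal (tent_test (b + z)) \<partial>gauss h) \<le> ennreal (tent_test b + h * tent b / 2 + e * h)"
      by (rule gauss_taylor_step[OF tent_test_derivative tent_antideriv cont _ nn e, of 1]) simp
    then obtain h0 where h0: "h0 > 0" "\<And>h b. 0 < h \<Longrightarrow> h < h0 \<Longrightarrow>
        (\<integral>\<^sup>+z. ennreal (tent_test (b + z)) \<partial>gauss h) \<le> ennreal (tent_test b + h * tent b / 2 + e * h)"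
      by blast
    show "\<exists>h0>0. \<forall>h b T. 0 < h \<longrightarrow> h < h0 \<longrightarrow> 0 \<le> T \<longrightarrow> \<not> False \<longrightarrow>
      (\<integral>\<^sup>+z. ennreal (tent_test (b + z) * exp (- (T + h * tent b))) \<partial>gauss h) \<le> ennreal (tent_test b * exp (- T) + e * h)"
    proof (intro exI[of _ h0] conjI h0(1) allI impI)
      fix h b T :: real assume h: "0 < h" "h < h0" and T: "0 \<le> T"
      define x where "x = h * tent b"
      have x: "0 \<le> x" using h by (simp add: x_def)
      have "(\<integral>\<^sup>+z. ennreal (tent_test (b + z) * exp (- (T + h * tent b))) \<partial>gauss h)
          = ennreal (exp (- (T + x))) * (\<integral>\<^sup>+z. ennreal (tent_test (b + z)) \<partial>gauss h)"
        by (subst nn_integral_cmult[symmetric]) (auto simp: x_def mult.commute simp flip: ennreal_mult'')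
      also have "\<dots> \<le> ennreal (exp (- (T + x))) * ennreal (tent_test b + x / 2 + e * h)"
        using h0(2)[OF h] by (intro mult_left_mono) (auto simp: x_def)
      also have "\<dots> = ennreal (exp (- (T + x)) * (tent_test b + x / 2 + e * h))"
        by (simp add: ennreal_mult')
      also have "\<dots> \<le> ennreal (tent_test b * exp (- T) + e * h)"
      proof (rule ennreal_leI)
        have "tent_test b + x / 2 \<le> tent_test b * (1 + x)"
          using tent_test_ge_1[of b] x mult_right_mono[of 1 "tent_test b" x] by (simp add: distrib_left)
        also have "\<dots> \<le> tent_test b * exp x"
          using tent_test_ge_1[of b] exp_ge_add_one_self[of x] by (intro mult_left_mono) auto
        finally have "exp (- (T + x)) * (tent_test b + x / 2) \<le> exp (- (T + x)) * (tent_test b * exp x)"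
          by (intro mult_left_mono) auto
        also have "\<dots> = tent_test b * exp (- T)"
        proof -
          have "exp (- (T + x)) * exp x = exp (- T)" by (simp flip: exp_add)
          then show ?thesis by (simp add: mult.left_commute)
        qed
        finally have 1: "exp (- (T + x)) * (tent_test b + x / 2) \<le> tent_test b * exp (- T)" .
        have "exp (- (T + x)) * (e * h) \<le> 1 * (e * h)"
          using T x e h by (intro mult_right_mono) auto
        with 1 show "exp (- (T + x)) * (tent_test b + x / 2 + e * h) \<le> tent_test b * exp (- T) + e * h"
          by (simp add: distrib_left)
      qed
      finally show "(\<integral>\<^sup>+z. ennreal (tent_test (b + z) * exp (- (T + h * tent b))) \<partial>gauss h) \<le> ennreal (tent_test b * exp (- T) + e * h)" .
    qed
  next
    fix \<omega> assume "\<omega> \<in> ?A"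
    then have \<omega>: "\<omega> \<in> space M" "K < \<bar>B N \<omega>\<bar>" "clock tent (\<lambda>r. B r \<omega>) N \<le> m" by auto
    show "\<forall>\<^sub>F j in sequentially. K / 4 * exp (- (m + 1)) \<le> (\<lambda>(b, T). tent_test b * exp (- T)) (frozen (\<lambda>_ _. False) tent (\<lambda>r. B r \<omega>) N j)"
      using clock_riemann[OF cont brownian_onD(5)[OF B \<omega>(1)] zero_less_one N]
    proof eventually_elim
      case (elim j)
      let ?T = "N / 2 ^ j * (\<Sum>i<2 ^ j. tent (B (real i * (N / 2 ^ j)) \<omega>))"
      have "?T \<le> m + 1" using elim[rule_format, of "2 ^ j"] \<omega>(3) by auto
      then have "K / 4 * exp (- (m + 1)) \<le> tent_test (B N \<omega>) * exp (- ?T)"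
        using tent_test_ge_abs[of "B N \<omega>"] \<omega>(2) tent_test_ge_1[of "B N \<omega>"] K by (intro mult_mono) auto
      then show ?case using frozen_never[of "\<lambda>r. B r \<omega>"] brownian_onD(4)[OF B \<omega>(1)] by simp
    qed
  qed simp
  then have "K / 4 * exp (- (m + 1)) * measure M ?A \<le> 1" by (simp add: tent_test_def)
  then have "exp (m + 1) * (K / 4 * exp (- (m + 1)) * measure M ?A) \<le> exp (m + 1) * 1"
    by (intro mult_left_mono) auto
  moreover have "exp (m + 1) * (K / 4 * exp (- (m + 1)) * measure M ?A) = K / 4 * measure M ?A * (exp (m + 1) * exp (- (m + 1)))"
    by (simp only: mult_ac)
  moreover have "exp (m + 1) * exp (- (m + 1)) = 1" by (simp flip: exp_add)
  ultimately have "K / 4 * measure M ?A \<le> exp (m + 1)" by (simp only: mult_1_right)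
  then have "measure M ?A \<le> 4 * exp (m + 1) / K" using K by (simp add: field_simps)
  moreover have "measure M {\<omega> \<in> space M. clock tent (\<lambda>r. B r \<omega>) N \<le> m}
      \<le> measure M ({\<omega> \<in> space M. \<bar>B N \<omega>\<bar> \<le> K} \<union> ?A)"
    by (intro finite_measure_mono) auto
  moreover have "\<dots> \<le> measure M {\<omega> \<in> space M. \<bar>B N \<omega>\<bar> \<le> K} + measure M ?A"
    by (intro measure_Un_le) auto
  moreover have "measure M {\<omega> \<in> space M. \<bar>B N \<omega>\<bar> \<le> K} \<le> 2 * K / sqrt N"
    using brownian_prob_small[OF B N, of K] K by simp
  ultimately show ?thesis by linarith
qed

text \<open>Unbounded occupation time near 0 is the form of recurrence that makes every clock with a
  positive continuous rate diverge; both the time change and the scale function rely on it.\<close>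

definition recurrent_path :: "(real \<Rightarrow> real) \<Rightarrow> bool" where
  "recurrent_path b \<longleftrightarrow> (\<forall>m::nat. \<exists>N::nat. real m < clock tent b (real N))"

lemma measurable_recurrent_path:
  assumes b: "\<And>\<omega>. \<omega> \<in> space M \<Longrightarrow> continuous_on {0..} (\<lambda>r. B r \<omega>)"
    and m: "\<And>r. 0 \<le> r \<Longrightarrow> B r \<in> borel_measurable M"
  shows "{\<omega> \<in> space M. recurrent_path (\<lambda>r. B r \<omega>)} \<in> sets M"
proof -
  have [measurable]: "(\<lambda>\<omega>. clock tent (\<lambda>r. B r \<omega>) (real N)) \<in> borel_measurable M" for N
    using b m by (intro measurable_clock measurable_compose[OF m measurable_tent]) (auto intro: continuous_tent continuous_on_id)
  show ?thesis unfolding recurrent_path_def by measurable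
qed

lemma brownian_recurrent:
  assumes B: "brownian_on M {0..} B"
  shows "AE \<omega> in M. recurrent_path (\<lambda>r. B r \<omega>)"
proof -
  interpret prob_space M using B by (rule brownian_onD)
  have cont: "continuous_on UNIV tent" by (intro continuous_tent continuous_on_id)
  have [measurable]: "(\<lambda>\<omega>. clock tent (\<lambda>r. B r \<omega>) (real N)) \<in> borel_measurable M" for N
    using cont brownian_onD(3,5)[OF B] by (intro measurable_clock measurable_compose[OF _ measurable_tent]) auto
  have "AE \<omega> in M. \<exists>N::nat. real m < clock tent (\<lambda>r. B r \<omega>) (real N)" for m :: nat
  proof -
    let ?Z = "{\<omega> \<in> space M. \<forall>N::nat. clock tent (\<lambda>r. B r \<omega>) (real N) \<le> real m}"
    have [measurable]: "?Z \<in> sets M" by measurable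
    have le: "measure M ?Z \<le> 2 / real n + 4 * exp (real m + 1) / real n" if n: "0 < n" for n :: nat
    proof -
      \<comment> \<open>Distance \<open>K = n\<close> and horizon \<open>n ^ 4\<close> make both
        error terms of order \<open>1 / n\<close>.\<close>
      have "measure M ?Z \<le> measure M {\<omega> \<in> space M. clock tent (\<lambda>r. B r \<omega>) (real (n ^ 4)) \<le> real m}"
        by (intro finite_measure_mono) (auto simp del: of_nat_power)
      also have "\<dots> \<le> 2 * real n / sqrt (real (n ^ 4)) + 4 * exp (real m + 1) / real n"
        using n by (intro prob_tent_clock_le[OF B]) auto
      also have "sqrt (real (n ^ 4)) = real n * real n"
        by (rule real_sqrt_unique) (auto simp: eval_nat_numeral)
      finally show ?thesis using n by simp
    qed
    have "measure M ?Z \<le> 0"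
    proof (rule LIMSEQ_le_const)
      show "(\<lambda>n. 2 / real n + 4 * exp (real m + 1) / real n) \<longlonglongrightarrow> 0"
        by (auto intro!: tendsto_eq_intros lim_const_over_n)
      show "\<exists>N. \<forall>n\<ge>N. measure M ?Z \<le> 2 / real n + 4 * exp (real m + 1) / real n"
        using le by (intro exI[of _ 1]) auto
    qed
    then have "emeasure M ?Z = 0" using measure_nonneg[of M ?Z] by (simp add: emeasure_eq_measure)
    then show ?thesis
      by (intro AE_I[of _ _ ?Z]) (auto simp: not_less)
  qed
  then show ?thesis unfolding recurrent_path_def by (simp add: AE_all_countable)
qed

lemma clock_compare:
  assumes c: "continuous_on UNIV c" "\<And>x. 0 < c x" and b: "continuous_on {0..} b"
  obtains \<kappa> where "0 < \<kappa>" "\<And>x. \<kappa> * tent x \<le> c x"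
proof -
  have "\<exists>x\<in>{-1..1}. \<forall>y\<in>{-1..1}. c x \<le> c y"
    by (rule continuous_attains_inf) (auto intro: continuous_on_subset[OF c(1)])
  then obtain x0 where x0: "x0 \<in> {-1..1::real}" "\<And>y. y \<in> {-1..1} \<Longrightarrow> c x0 \<le> c y" by blast
  show ?thesis
  proof (rule that[of "c x0"])
    show "c x0 * tent x \<le> c x" for x
    proof (cases "x \<in> {-1..1}")
      case True
      then show ?thesis using x0(2)[OF True] c(2)[of x0] tent_le_1[of x] mult_left_le[of "tent x" "c x0"] by linarith
    next
      case False
      then have "tent x = 0" by (intro tent_outside) auto
      then show ?thesis using c(2)[of x] by (simp add: less_imp_le)
    qed
  qed (rule c)
qed

text \<open>On \<open>[-1, 1]\<close> the rate is bounded below by a positive constant, so the clock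
  grows at least like a multiple of the occupation time near 0.\<close>

lemma clock_unbounded:
  assumes c: "continuous_on UNIV c" "\<And>x. 0 < c x" and b: "continuous_on {0..} b" and r: "recurrent_path b"
  shows "\<exists>N\<ge>0. m < clock c b N"
proof -
  obtain \<kappa> where \<kappa>: "0 < \<kappa>" "\<And>x. \<kappa> * tent x \<le> c x" using clock_compare[OF c b] by blast
  obtain k :: nat where k: "m / \<kappa> < real k" using reals_Archimedean2 by blast
  obtain N :: nat where N: "real k < clock tent b (real N)" using r by (auto simp: recurrent_path_def)
  have cont: "continuous_on UNIV tent" by (intro continuous_tent continuous_on_id)
  have "(\<lambda>u. clock c b u - \<kappa> * clock tent b u) 0 \<le> (\<lambda>u. clock c b u - \<kappa> * clock tent b u) (real N)"
  proof (rule DERIV_nonneg_imp_nondecreasing[where f="\<lambda>u. clock c b u - \<kappa> * clock tent b u" and a=0 and b="real N"])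
    fix x :: real
    have "((\<lambda>u. clock c b u - \<kappa> * clock tent b u) has_real_derivative (c (b (max 0 x)) - \<kappa> * tent (b (max 0 x)))) (at x)"
      using DERIV_diff[OF clock_has_derivative[OF c(1) b, of x] DERIV_cmult[OF clock_has_derivative[OF cont b, of x], of \<kappa>]] .
    moreover have "0 \<le> c (b (max 0 x)) - \<kappa> * tent (b (max 0 x))" using \<kappa>(2) by simp
    ultimately show "\<exists>y. ((\<lambda>u. clock c b u - \<kappa> * clock tent b u) has_real_derivative y) (at x) \<and> 0 \<le> y" by blast
  qed simp
  then have "\<kappa> * clock tent b (real N) \<le> clock c b (real N)" by simp
  moreover have "m < \<kappa> * clock tent b (real N)"
  proof -
    have "m < \<kappa> * real k" using k \<kappa> by (simp add: field_simps)
    also have "\<dots> < \<kappa> * clock tent b (real N)" using N \<kappa> by simp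
    finally show ?thesis .
  qed
  ultimately show ?thesis by (intro exI[of _ "real N"]) auto
qed

section \<open>Surjectivity of the scale function\<close>

text \<open>Recurrence is needed on both half-lines of the environment. Reversal turns increment
  \<open>i\<close> along a sorted list into minus increment \<open>n - 2 - i\<close> along the
  negated list in reverse order.\<close>

lemma brownian_reverse:
  assumes W: "brownian_on M UNIV W"
  shows "brownian_on M {0..} (\<lambda>r. W (- r))"
proof -
  interpret prob_space M using W by (rule brownian_onD)
  have dist: "distributed M lborel (\<lambda>\<omega>. W (- t) \<omega> - W (- s) \<omega>) (\<lambda>x. ennreal (normal_density 0 (sqrt (t - s)) x))"
    if "s < t" for s t
  proof -
    have "\<forall>s\<in>UNIV. \<forall>t\<in>UNIV. s < t \<longrightarrow> distributed M lborel (\<lambda>\<omega>. W t \<omega> - W s \<omega>) (\<lambda>x. ennreal (normal_density 0 (sqrt (t - s)) x))"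
      using W unfolding brownian_on_def by blast
    from this[rule_format, of "- t" "- s"] that
    have "distributed M lborel (\<lambda>\<omega>. W (- s) \<omega> - W (- t) \<omega>) (\<lambda>x. ennreal (normal_density 0 (sqrt (- s - - t)) x))"
      by simp
    from normal_density_affine[OF this, of "-1" 0] that show ?thesis by simp
  qed
  have indep: "indep_vars (\<lambda>_. borel) (\<lambda>i \<omega>. W (- (ts ! Suc i)) \<omega> - W (- (ts ! i)) \<omega>) {..<length ts - 1}"
    if ts: "sorted_wrt (<) ts" for ts :: "real list"
  proof -
    define n where "n = length ts"
    define rs where "rs = rev (map uminus ts)"
    have rs: "sorted_wrt (<) rs"
      using ts by (simp add: rs_def sorted_wrt_rev sorted_wrt_map)
    have len: "length rs = n" by (simp add: rs_def n_def)
    have "indep_vars (\<lambda>_. borel) (\<lambda>i \<omega>. W (rs ! Suc i) \<omega> - W (rs ! i) \<omega>) {..<n - 1}"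
      using brownian_onD(7)[OF W rs] len by simp
    note I = this
    let ?K = "\<lambda>i. {n - 2 - i}"
    have "indep_vars (\<lambda>_. borel) (\<lambda>i \<omega>. (\<lambda>f. - f (n - 2 - i)) (restrict (\<lambda>i. W (rs ! Suc i) \<omega> - W (rs ! i) \<omega>) (?K i))) {..<n - 1}"
    proof (rule indep_vars_compose2[OF indep_vars_restrict[OF I]])
      show "disjoint_family_on ?K {..<n - 1}"
        by (auto simp: disjoint_family_on_def)
      show "(\<lambda>f :: nat \<Rightarrow> real. - f (n - 2 - i)) \<in> borel_measurable (PiM (?K i) (\<lambda>_. borel))" for i
        by (intro borel_measurable_uminus measurable_component_singleton) auto
    qed auto
    also have "?this \<longleftrightarrow> ?thesis"
    proof (rule indep_vars_cong)
      fix i assume "i \<in> {..<n - 1}"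
      then have i: "Suc i < n" by auto
      have "rs ! Suc (n - 2 - i) = - (ts ! i)" "rs ! (n - 2 - i) = - (ts ! Suc i)"
        using i by (simp_all add: rs_def rev_nth n_def Suc_diff_Suc flip: n_def)
      then show "(\<lambda>\<omega>. (\<lambda>f. - f (n - 2 - i)) (restrict (\<lambda>i. W (rs ! Suc i) \<omega> - W (rs ! i) \<omega>) (?K i)))
        = (\<lambda>\<omega>. W (- (ts ! Suc i)) \<omega> - W (- (ts ! i)) \<omega>)"
        by (simp add: fun_eq_iff)
    qed (auto simp: n_def)
    finally show ?thesis .
  qed
  have "continuous_on {0..} (\<lambda>r. W (- r) \<omega>)" if "\<omega> \<in> space M" for \<omega>
    by (rule continuous_on_compose2[OF brownian_onD(5)[OF W that]]) (auto intro!: continuous_intros)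
  with dist indep show ?thesis
    using brownian_onD(3,4)[OF W] prob_space_axioms by (auto simp: brownian_on_def)
qed

lemma brownian_restrict_nonneg: "brownian_on M UNIV W \<Longrightarrow> brownian_on M {0..} W"
  by (auto simp: brownian_on_def intro: continuous_on_subset)

definition scale_fun :: "(real \<Rightarrow> real) \<Rightarrow> real \<Rightarrow> real" where
  "scale_fun w = antideriv (\<lambda>x. exp (w x))"

lemma scale_fun_has_derivative: "continuous_on UNIV w \<Longrightarrow> (scale_fun w has_real_derivative exp (w x)) (at x)"
  unfolding scale_fun_def by (intro antideriv_has_derivative continuous_intros)

text \<open>On the right half-line the scale function is itself a clock, with the environment as
  path and \<open>exp\<close> as rate, so the divergence of clocks along recurrent paths also shows
  that it is unbounded.\<close>

lemma scale_fun_eq_clock: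
  assumes w: "continuous_on UNIV w" and u: "0 \<le> u"
  shows "scale_fun w u = clock exp w u"
proof -
  have ex: "continuous_on UNIV (exp :: real \<Rightarrow> real)" by (intro continuous_intros)
  have w1: "continuous_on {0..} w" using w by (rule continuous_on_subset) simp
  have "(\<lambda>u. scale_fun w u - clock exp w u) u = (\<lambda>u. scale_fun w u - clock exp w u) 0"
  proof (cases "u = 0")
    case False
    then show ?thesis
    proof (intro DERIV_isconst2[of 0 u])
      show "continuous_on {0..u} (\<lambda>u. scale_fun w u - clock exp w u)"
        using scale_fun_has_derivative[OF w] clock_has_derivative[OF ex w1]
        by (intro continuous_intros DERIV_continuous_on) (auto intro: has_field_derivative_at_within)
      fix x :: real assume x: "0 < x" "x < u"
      have "((\<lambda>u. scale_fun w u - clock exp w u) has_real_derivative exp (w x) - exp (w (max 0 x))) (at x)"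
        by (intro DERIV_diff scale_fun_has_derivative[OF w] clock_has_derivative[OF ex w1])
      then show "((\<lambda>u. scale_fun w u - clock exp w u) has_real_derivative 0) (at x)" using x by simp
    qed (use u False in auto)
  qed simp
  then show ?thesis by (simp add: scale_fun_def)
qed

lemma scale_fun_minus_eq_clock:
  assumes w: "continuous_on UNIV w" and u: "0 \<le> u"
  shows "- scale_fun w (- u) = clock exp (\<lambda>r. w (- r)) u"
proof -
  have ex: "continuous_on UNIV (exp :: real \<Rightarrow> real)" by (intro continuous_intros)
  have w2: "continuous_on {0..} (\<lambda>r. w (- r))"
    by (rule continuous_on_compose2[OF w]) (auto intro!: continuous_intros)
  have d: "((\<lambda>u. - scale_fun w (- u)) has_real_derivative exp (w (- x))) (at x)" for x
  proof -
    have "((\<lambda>u. scale_fun w (- u)) has_real_derivative exp (w (- x)) * (- 1)) (at x)"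
      by (rule DERIV_chain2[where f="scale_fun w" and g=uminus, OF scale_fun_has_derivative[OF w]])
        (auto intro!: derivative_eq_intros)
    from DERIV_minus[OF this] show ?thesis by simp
  qed
  have "(\<lambda>u. - scale_fun w (- u) - clock exp (\<lambda>r. w (- r)) u) u = (\<lambda>u. - scale_fun w (- u) - clock exp (\<lambda>r. w (- r)) u) 0"
  proof (cases "u = 0")
    case False
    then show ?thesis
    proof (intro DERIV_isconst2[of 0 u])
      show "continuous_on {0..u} (\<lambda>u. - scale_fun w (- u) - clock exp (\<lambda>r. w (- r)) u)"
        using d clock_has_derivative[OF ex w2]
        by (intro continuous_on_diff DERIV_continuous_on) (auto intro: has_field_derivative_at_within)
      fix x :: real assume x: "0 < x" "x < u"
      have "((\<lambda>u. - scale_fun w (- u) - clock exp (\<lambda>r. w (- r)) u) has_real_derivative exp (w (- x)) - exp (w (- (max 0 x)))) (at x)"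
        by (intro DERIV_diff d clock_has_derivative[OF ex w2])
      then show "((\<lambda>u. - scale_fun w (- u) - clock exp (\<lambda>r. w (- r)) u) has_real_derivative 0) (at x)" using x by simp
    qed (use u False in auto)
  qed simp
  then show ?thesis by (simp add: scale_fun_def)
qed

lemma surj_scale_fun:
  assumes w: "continuous_on UNIV w" and r: "recurrent_path w" "recurrent_path (\<lambda>r. w (- r))"
  shows "surj (scale_fun w)"
proof -
  have ex: "continuous_on UNIV (exp :: real \<Rightarrow> real)" by (intro continuous_intros)
  have w1: "continuous_on {0..} w" using w by (rule continuous_on_subset) simp
  have w2: "continuous_on {0..} (\<lambda>r. w (- r))"
    by (rule continuous_on_compose2[OF w]) (auto intro!: continuous_intros)
  have cont: "continuous_on A (scale_fun w)" for A
    using scale_fun_has_derivative[OF w] by (intro DERIV_continuous_on) (auto intro: has_field_derivative_at_within)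
  show ?thesis
  proof (unfold surj_def, intro allI)
    fix y :: real
    obtain u where u: "0 \<le> u" "y < clock exp w u" using clock_unbounded[OF ex _ w1 r(1), of y] by auto
    obtain u' where u': "0 \<le> u'" "- y < clock exp (\<lambda>r. w (- r)) u'" using clock_unbounded[OF ex _ w2 r(2), of "- y"] by auto
    have "\<exists>x. - u' \<le> x \<and> x \<le> u \<and> scale_fun w x = y"
      using scale_fun_eq_clock[OF w u(1)] scale_fun_minus_eq_clock[OF w u'(1)] u u' by (intro IVT' cont) auto
    then show "\<exists>x. y = scale_fun w x" by blast
  qed
qed

section \<open>Quenched hitting estimates\<close>

definition scale_inv :: "(real \<Rightarrow> real) \<Rightarrow> real \<Rightarrow> real" where
  "scale_inv w = inv (scale_fun w)"

definition speed_rate :: "(real \<Rightarrow> real) \<Rightarrow> real \<Rightarrow> real" where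
  "speed_rate w b = exp (- 2 * w (scale_inv w b))"

lemma scale_fun_less:
  assumes w: "continuous_on UNIV w" and "x < y"
  shows "scale_fun w x < scale_fun w y"
  by (rule DERIV_pos_imp_increasing[OF assms(2)]) (use scale_fun_has_derivative[OF w] exp_gt_zero in blast)

lemma scale_fun_less_iff: "continuous_on UNIV w \<Longrightarrow> scale_fun w x < scale_fun w y \<longleftrightarrow> x < y"
  using scale_fun_less[of w x y] scale_fun_less[of w y x] by (cases x y rule: linorder_cases) auto

lemma scale_fun_le_iff: "continuous_on UNIV w \<Longrightarrow> scale_fun w x \<le> scale_fun w y \<longleftrightarrow> x \<le> y"
  using scale_fun_less_iff[of w y x] by (simp flip: not_less)

lemma inj_scale_fun: "continuous_on UNIV w \<Longrightarrow> inj (scale_fun w)"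
  using scale_fun_less[of w] by (intro linorder_injI) (auto simp: less_imp_neq)

lemma scale_fun_0 [simp]: "scale_fun w 0 = 0"
  by (simp add: scale_fun_def)

lemma scale_inv_scale_fun: "continuous_on UNIV w \<Longrightarrow> scale_inv w (scale_fun w x) = x"
  unfolding scale_inv_def by (rule inv_f_f[OF inj_scale_fun])

lemma scale_inv_0: "continuous_on UNIV w \<Longrightarrow> scale_inv w 0 = 0"
  using scale_inv_scale_fun[of w 0] by simp

context
  fixes w :: "real \<Rightarrow> real"
  assumes w: "continuous_on UNIV w" and surj: "surj (scale_fun w)"
begin

lemma scale_fun_scale_inv: "scale_fun w (scale_inv w b) = b"
  unfolding scale_inv_def by (rule surj_f_inv_f[OF surj])

lemma scale_inv_less_iff: "scale_inv w b < x \<longleftrightarrow> b < scale_fun w x"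
  using scale_fun_less_iff[OF w, of "scale_inv w b" x] by (simp add: scale_fun_scale_inv)

lemma less_scale_inv_iff: "x < scale_inv w b \<longleftrightarrow> scale_fun w x < b"
  using scale_fun_less_iff[OF w, of x "scale_inv w b"] by (simp add: scale_fun_scale_inv)

lemma isCont_scale_inv: "isCont (scale_inv w) b"
proof -
  have "isCont (scale_fun w) z" for z
    by (rule DERIV_isCont[OF scale_fun_has_derivative[OF w]])
  then have "isCont (scale_inv w) (scale_fun w (scale_inv w b))"
    by (intro isCont_inverse_function[where d=1 and f="scale_fun w"]) (auto simp: scale_inv_scale_fun[OF w])
  then show ?thesis by (simp add: scale_fun_scale_inv)
qed

lemma scale_inv_has_derivative: "(scale_inv w has_real_derivative exp (- w (scale_inv w b))) (at b)"
  unfolding exp_minus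
  by (rule DERIV_inverse_function[where f="scale_fun w" and a="b - 1" and b="b + 1"])
    (use scale_fun_has_derivative[OF w] isCont_scale_inv scale_fun_scale_inv in auto)

lemma continuous_scale_inv: "continuous_on A (scale_inv w)"
  using isCont_scale_inv by (simp add: continuous_at_imp_continuous_on)

lemma continuous_speed_rate: "continuous_on UNIV (speed_rate w)"
  unfolding speed_rate_def[abs_def]
  by (intro continuous_intros continuous_on_compose2[OF w] continuous_scale_inv) auto

lemma speed_rate_pos: "0 < speed_rate w b"
  by (simp add: speed_rate_def)

lemma measurable_speed_rate: "speed_rate w \<in> borel_measurable borel"
  by (rule borel_measurable_continuous_onI[OF continuous_speed_rate])

text \<open>In natural scale \<open>k\<close> has second derivative \<open>speed_rate * r\<close>,
  and the factor \<open>speed_rate * h\<close> is the clock time of the step; hence the generator of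
  the diffusion maps \<open>k\<close> to \<open>r / 2\<close>. Writing the operator through the flux
  \<open>\<kappa>\<close> avoids differentiating the environment.\<close>

lemma generator_step:
  fixes k \<kappa> r :: "real \<Rightarrow> real"
  assumes k: "\<And>x. (k has_real_derivative exp (w x) * \<kappa> x) (at x)"
    and \<kappa>: "\<And>x. (\<kappa> has_real_derivative exp (- w x) * r x) (at x)"
    and r: "continuous_on UNIV r" "\<And>x. R < \<bar>x\<bar> \<Longrightarrow> r x = 0" and k0: "\<And>x. 0 \<le> k x" and e: "0 < e"
  shows "\<exists>h0>0. \<forall>h b. 0 < h \<longrightarrow> h < h0 \<longrightarrow>
    (\<integral>\<^sup>+z. ennreal (k (scale_inv w (b + z))) \<partial>gauss h)
      \<le> ennreal (k (scale_inv w b) + h * (speed_rate w b * r (scale_inv w b)) / 2 + e * h)"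
proof (rule gauss_taylor_step[OF _ _ _ _ _ e])
  show "((\<lambda>b. k (scale_inv w b)) has_real_derivative \<kappa> (scale_inv w b)) (at b)" for b
  proof -
    have "exp (w (scale_inv w b)) * \<kappa> (scale_inv w b) * exp (- w (scale_inv w b)) = \<kappa> (scale_inv w b)"
      by (simp add: exp_minus)
    with DERIV_chain2[OF k scale_inv_has_derivative, of b] show ?thesis by metis
  qed
  show "((\<lambda>b. \<kappa> (scale_inv w b)) has_real_derivative speed_rate w b * r (scale_inv w b)) (at b)" for b
  proof -
    have "exp (- y) * exp (- y) = exp (- 2 * y)" for y :: real by (simp flip: exp_add)
    then have "exp (- w (scale_inv w b)) * r (scale_inv w b) * exp (- w (scale_inv w b)) = speed_rate w b * r (scale_inv w b)"
      unfolding speed_rate_def by (metis mult.assoc mult.commute)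
    with DERIV_chain2[OF \<kappa> scale_inv_has_derivative, of b] show ?thesis by metis
  qed
  show "continuous_on UNIV (\<lambda>b. speed_rate w b * r (scale_inv w b))"
    by (intro continuous_intros continuous_speed_rate continuous_on_compose2[OF r(1)] continuous_scale_inv) auto
  \<comment> \<open>The scale function maps the bounded support of \<open>r\<close> into a bounded
    set.\<close>
  show "speed_rate w b * r (scale_inv w b) = 0" if "max \<bar>scale_fun w R\<bar> \<bar>scale_fun w (- R)\<bar> < \<bar>b\<bar>" for b
  proof -
    have "R < \<bar>scale_inv w b\<bar>"
    proof (rule ccontr)
      assume "\<not> R < \<bar>scale_inv w b\<bar>"
      then have "- R \<le> scale_inv w b" "scale_inv w b \<le> R" by auto
      then have "scale_fun w (- R) \<le> b" "b \<le> scale_fun w R"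
        using scale_fun_le_iff[OF w] scale_fun_scale_inv by metis+
      then show False using that by auto
    qed
    then show ?thesis using r(2) by simp
  qed
  show "0 \<le> k (scale_inv w b)" for b by (rule k0)
qed

lemma frozen_cases:
  fixes b c :: "real \<Rightarrow> real" and N :: real
  assumes "b 0 = 0"
  defines "\<tau> \<equiv> \<lambda>j k. N / 2 ^ j * (\<Sum>i<k. c (b (real i * (N / 2 ^ j))))"
  obtains i where "i \<le> 2 ^ j" "frozen Q c b N j = (b (real i * (N / 2 ^ j)), \<tau> j i)"
    "\<And>i'. i' < i \<Longrightarrow> \<not> Q (b (real i' * (N / 2 ^ j))) (\<tau> j i')"
    "i = 2 ^ j \<or> Q (b (real i * (N / 2 ^ j))) (\<tau> j i)"
  using chain_freeze_step[of "\<lambda>i. b (real i * (N / 2 ^ j))" "2 ^ j" Q c "N / 2 ^ j"] assms(1) that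
  unfolding frozen_def \<tau>_def by auto

text \<open>The product of \<open>k\<close> at the position and \<open>exp (- \<rho> * T)\<close> is
  a supermartingale, because the generator image satisfies \<open>r / 2 \<le> \<rho> * k\<close>.
  Frozen at a passage of \<open>v\<close> before time \<open>t\<close> it is at least
  \<open>k v * exp (- \<rho> * t)\<close>.\<close>

lemma quenched_hitting_upper:
  fixes k \<kappa> r :: "real \<Rightarrow> real"
  assumes B: "brownian_on M {0..} B" and t: "0 < t" and N: "0 < N" and \<rho>: "0 < \<rho>"
    and k: "\<And>x. (k has_real_derivative exp (w x) * \<kappa> x) (at x)"
    and \<kappa>: "\<And>x. (\<kappa> has_real_derivative exp (- w x) * r x) (at x)"
    and r: "continuous_on UNIV r" "\<And>x. R < \<bar>x\<bar> \<Longrightarrow> r x = 0" and k0: "\<And>x. 0 \<le> k x"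
    and rk: "\<And>x. r x \<le> 2 * \<rho> * k x" and kv: "\<And>x. v \<le> x \<Longrightarrow> k v \<le> k x"
    and A: "A \<in> sets M" "\<And>\<omega>. \<omega> \<in> A \<Longrightarrow> \<exists>u\<ge>0. u < N \<and> scale_fun w v < B u \<omega> \<and> clock (speed_rate w) (\<lambda>r. B r \<omega>) u < t"
  shows "k v * exp (- \<rho> * t) * measure M A \<le> k 0"
proof -
  let ?c = "speed_rate w"
  have k_cont: "continuous_on UNIV k"
    using k by (intro DERIV_continuous_on) (auto intro: has_field_derivative_at_within)
  have [measurable]: "(\<lambda>b. k (scale_inv w b)) \<in> borel_measurable borel"
    by (intro borel_measurable_continuous_onI continuous_on_compose2[OF k_cont] continuous_scale_inv) auto
  have "k v * exp (- \<rho> * t) * measure M A \<le> k (scale_inv w 0) * exp (- \<rho> * 0)"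
  proof (rule frozen_supermartingale_bound[where F="\<lambda>b T. k (scale_inv w b) * exp (- \<rho> * T)"
        and Q="\<lambda>b T. scale_fun w v < b" and c="?c" and A=A and g="k v * exp (- \<rho> * t)", OF B N])
    show "(\<lambda>(b, T). k (scale_inv w b) * exp (- \<rho> * T)) \<in> borel_measurable (borel \<Otimes>\<^sub>M borel)" by measurable
    show "Measurable.pred (borel \<Otimes>\<^sub>M borel) (\<lambda>(b, T). scale_fun w v < b)" by measurable
    show "?c \<in> borel_measurable borel" by (rule measurable_speed_rate)
    show "0 \<le> ?c b" for b using speed_rate_pos[of b] by simp
    show "0 \<le> k (scale_inv w b) * exp (- \<rho> * T)" for b T using k0 by simp
    show "0 \<le> k v * exp (- \<rho> * t)" using k0 by simp
  next
    fix e :: real assume e: "0 < e"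
    obtain h0 where h0: "h0 > 0" "\<And>h b. 0 < h \<Longrightarrow> h < h0 \<Longrightarrow>
        (\<integral>\<^sup>+z. ennreal (k (scale_inv w (b + z))) \<partial>gauss h)
          \<le> ennreal (k (scale_inv w b) + h * (?c b * r (scale_inv w b)) / 2 + e * h)"
      using generator_step[OF k \<kappa> r k0 e] by blast
    show "\<exists>h0>0. \<forall>h b T. 0 < h \<longrightarrow> h < h0 \<longrightarrow> 0 \<le> T \<longrightarrow> \<not> scale_fun w v < b \<longrightarrow>
      (\<integral>\<^sup>+z. ennreal (k (scale_inv w (b + z)) * exp (- \<rho> * (T + h * ?c b))) \<partial>gauss h)
        \<le> ennreal (k (scale_inv w b) * exp (- \<rho> * T) + e * h)"
    proof (intro exI[of _ h0] conjI h0(1) allI impI)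
      fix h b T :: real assume h: "0 < h" "h < h0" and T: "0 \<le> T"
      define x where "x = \<rho> * (h * ?c b)"
      define K where "K = k (scale_inv w b)"
      have x: "0 \<le> x" using h \<rho> speed_rate_pos[of b] by (simp add: x_def)
      have K: "0 \<le> K" using k0 by (simp add: K_def)
      have "h * (?c b * r (scale_inv w b)) / 2 \<le> h * (?c b * (2 * \<rho> * K)) / 2"
        using rk[of "scale_inv w b"] h speed_rate_pos[of b] by (auto simp: K_def intro!: mult_left_mono divide_right_mono)
      then have le: "h * (?c b * r (scale_inv w b)) / 2 \<le> K * x" by (simp add: x_def mult_ac)
      have "(\<integral>\<^sup>+z. ennreal (k (scale_inv w (b + z)) * exp (- \<rho> * (T + h * ?c b))) \<partial>gauss h)
          = ennreal (exp (- \<rho> * T - x)) * (\<integral>\<^sup>+z. ennreal (k (scale_inv w (b + z))) \<partial>gauss h)"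
        by (subst nn_integral_cmult[symmetric]) (auto simp: x_def mult.commute distrib_left simp flip: ennreal_mult'')
      also have "\<dots> \<le> ennreal (exp (- \<rho> * T - x)) * ennreal (K + K * x + e * h)"
      proof (rule mult_left_mono)
        have "(\<integral>\<^sup>+z. ennreal (k (scale_inv w (b + z))) \<partial>gauss h)
            \<le> ennreal (K + h * (?c b * r (scale_inv w b)) / 2 + e * h)"
          using h0(2)[OF h, of b] by (simp add: K_def)
        also have "\<dots> \<le> ennreal (K + K * x + e * h)" using le by (intro ennreal_leI) linarith
        finally show "(\<integral>\<^sup>+z. ennreal (k (scale_inv w (b + z))) \<partial>gauss h) \<le> ennreal (K + K * x + e * h)" .
      qed simp
      also have "\<dots> = ennreal (exp (- \<rho> * T - x) * (K + K * x + e * h))"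
        by (simp add: ennreal_mult')
      also have "\<dots> \<le> ennreal (K * exp (- \<rho> * T) + e * h)"
      proof (rule ennreal_leI)
        have "K + K * x = K * (1 + x)" by (simp add: distrib_left)
        also have "\<dots> \<le> K * exp x"
          using K exp_ge_add_one_self[of x] by (intro mult_left_mono) auto
        finally have "exp (- \<rho> * T - x) * (K + K * x) \<le> exp (- \<rho> * T - x) * (K * exp x)"
          by (intro mult_left_mono) auto
        also have "\<dots> = K * (exp (- \<rho> * T - x) * exp x)" by (simp only: mult_ac)
        also have "exp (- \<rho> * T - x) * exp x = exp (- \<rho> * T)" by (simp flip: exp_add)
        finally have 1: "exp (- \<rho> * T - x) * (K + K * x) \<le> K * exp (- \<rho> * T)" .
        have "0 \<le> \<rho> * T" using T \<rho> by simp
        then have "exp (- \<rho> * T - x) \<le> 1" using x by simp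
        then have "exp (- \<rho> * T - x) * (e * h) \<le> 1 * (e * h)"
          using e h by (intro mult_right_mono) auto
        with 1 show "exp (- \<rho> * T - x) * (K + K * x + e * h) \<le> K * exp (- \<rho> * T) + e * h"
          unfolding distrib_left[of _ "K + K * x"] by linarith
      qed
      finally show "(\<integral>\<^sup>+z. ennreal (k (scale_inv w (b + z)) * exp (- \<rho> * (T + h * ?c b))) \<partial>gauss h)
        \<le> ennreal (k (scale_inv w b) * exp (- \<rho> * T) + e * h)" unfolding K_def .
    qed
  next
    fix \<omega> assume \<omega>A: "\<omega> \<in> A"
    then have \<omega>: "\<omega> \<in> space M" using sets.sets_into_space[OF A(1)] by auto
    define b where "b r = B r \<omega>" for r
    have b: "continuous_on {0..} b" using brownian_onD(5)[OF B \<omega>] by (simp add: b_def[abs_def])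
    have b0: "b 0 = 0" using brownian_onD(4)[OF B \<omega>] by (simp add: b_def)
    let ?T = "clock ?c b"
    obtain u where u: "0 \<le> u" "u < N" "scale_fun w v < b u" "?T u < t"
      using A(2)[OF \<omega>A] by (auto simp: b_def[abs_def])
    \<comment> \<open>Half of the slack in \<open>?T u < t\<close> covers the motion of the clock
      near \<open>u\<close>, the other half the Riemann error.\<close>
    define e where "e = (t - ?T u) / 2"
    have e: "0 < e" using u by (simp add: e_def)
    have ue: "?T u < t - e" using u by (simp add: e_def field_simps)
    have "continuous_on {0..} ?T" by (rule continuous_on_subset[OF continuous_clock[OF continuous_speed_rate b]]) simp
    then have "\<forall>\<^sub>F r in at u within {0..}. ?T r < t - e \<and> scale_fun w v < b r"
      using b u ue by (intro eventually_conj order_tendstoD[of ?T "?T u"] order_tendstoD[of b "b u"])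
        (auto simp: continuous_on_def)
    then obtain d where d: "0 < d" "\<And>r. 0 \<le> r \<Longrightarrow> r \<noteq> u \<Longrightarrow> dist r u < d \<Longrightarrow> ?T r < t - e \<and> scale_fun w v < b r"
      unfolding eventually_at by auto
    have d': "?T r < t - e \<and> scale_fun w v < b r" if "0 \<le> r" "\<bar>r - u\<bar> < d" for r
      using d(2)[OF that(1)] that(2) u ue by (cases "r = u") (auto simp: dist_real_def)
    have "(\<lambda>j. N * (1/2) ^ j) \<longlonglongrightarrow> N * 0" by (intro tendsto_intros LIMSEQ_realpow_zero) auto
    then have "\<forall>\<^sub>F j in sequentially. N * (1/2) ^ j < d"
      using d(1) by (intro order_tendstoD) auto
    then show "\<forall>\<^sub>F j in sequentially. k v * exp (- \<rho> * t)
        \<le> (\<lambda>(b, T). k (scale_inv w b) * exp (- \<rho> * T)) (frozen (\<lambda>b T. scale_fun w v < b) ?c (\<lambda>r. B r \<omega>) N j)"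
      using clock_riemann[OF continuous_speed_rate b e N]
    proof eventually_elim
      case (elim j)
      define h where "h = N / 2 ^ j"
      define \<tau> where "\<tau> i = h * (\<Sum>i<i. ?c (b (real i * h)))" for i
      have h: "0 < h" "h < d" "2 ^ j * h = N" using N elim(1) by (auto simp: h_def power_divide)
      \<comment> \<open>The first grid index not before \<open>u\<close>. There the path is still
        beyond the level, so the chain freezes at this index or earlier.\<close>
      define m where "m = nat \<lceil>u / h\<rceil>"
      have mr: "real m = of_int \<lceil>u / h\<rceil>" using u h by (simp add: m_def)
      have m_bounds: "u / h \<le> real m" "real m < u / h + 1" unfolding mr by linarith+
      have m1: "u \<le> real m * h" "real m * h < u + h"
        using m_bounds h by (simp_all add: field_simps)
      have m2: "m \<le> 2 ^ j"
      proof -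
        have "u / h \<le> of_int (2 ^ j)" using u h by (simp add: field_simps)
        then have "\<lceil>u / h\<rceil> \<le> 2 ^ j" by (rule ceiling_le)
        then show ?thesis by (simp add: m_def nat_le_iff)
      qed
      have "?T (real m * h) < t - e" "scale_fun w v < b (real m * h)"
        using d'[of "real m * h"] m1 u h by auto
      moreover have "\<bar>\<tau> m - ?T (real m * h)\<bar> \<le> e"
        using elim(2)[rule_format, OF m2] by (simp add: \<tau>_def h_def)
      ultimately have \<tau>m: "\<tau> m < t" "scale_fun w v < b (real m * h)" by auto
      obtain i where i: "i \<le> 2 ^ j" "frozen (\<lambda>b T. scale_fun w v < b) ?c b N j = (b (real i * h), \<tau> i)"
        "\<And>i'. i' < i \<Longrightarrow> \<not> scale_fun w v < b (real i' * h)" "i = 2 ^ j \<or> scale_fun w v < b (real i * h)"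
        using frozen_cases[where b=b and j=j and N=N and c="?c" and Q="\<lambda>b T. scale_fun w v < b", OF b0]
        unfolding \<tau>_def h_def by metis
      have im: "i \<le> m" using i(3)[of m] \<tau>m(2) by (meson not_le)
      have bi: "scale_fun w v < b (real i * h)"
      proof (cases "i = m")
        case False
        then have "i \<noteq> 2 ^ j" using im m2 by auto
        then show ?thesis using i(4) by blast
      qed (use \<tau>m in simp)
      have "\<tau> i \<le> \<tau> m"
        unfolding \<tau>_def using im h speed_rate_pos by (intro mult_left_mono sum_mono2) (auto simp: less_imp_le)
      then have "\<tau> i \<le> t" using \<tau>m by simp
      moreover have "v \<le> scale_inv w (b (real i * h))" using bi less_scale_inv_iff by (simp add: less_imp_le)
      ultimately have "k v * exp (- \<rho> * t) \<le> k (scale_inv w (b (real i * h))) * exp (- \<rho> * \<tau> i)"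
        using kv k0 \<rho> by (intro mult_mono) auto
      then show ?case using i(2) by (simp add: b_def[abs_def])
    qed
  qed (use A in auto)
  then show ?thesis by (simp add: scale_inv_0[OF w])
qed

text \<open>Three quantities are added in \<open>F\<close>. The first, \<open>g\<close>, is at least
  1 up to \<open>v'\<close> and is discounted at rate \<open>\<alpha>\<close> in the remaining time,
  so it starts small; \<open>g'\<close> is at least 1 once the path leaves through
  \<open>x0\<close>; the last term pays for the drift \<open>\<beta>\<close> that each of them may
  gain in \<open>{x1..x2}\<close>. The chain is frozen at clock time \<open>t\<close> or below
  \<open>x0\<close>, and then every path of \<open>A\<close> has \<open>F\<close> at least
  1.\<close>

lemma quenched_not_beyond:
  fixes g \<kappa> r g' \<kappa>' r' :: "real \<Rightarrow> real"
  assumes B: "brownian_on M {0..} B" and t: "0 < t" and N: "0 < N" and \<alpha>: "0 \<le> \<alpha>" and \<beta>: "0 \<le> \<beta>"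
    and g: "\<And>x. (g has_real_derivative exp (w x) * \<kappa> x) (at x)"
    and \<kappa>: "\<And>x. (\<kappa> has_real_derivative exp (- w x) * r x) (at x)"
    and r: "continuous_on UNIV r" "\<And>x. R < \<bar>x\<bar> \<Longrightarrow> r x = 0" and g0: "\<And>x. 0 \<le> g x"
    and g': "\<And>x. (g' has_real_derivative exp (w x) * \<kappa>' x) (at x)"
    and \<kappa>': "\<And>x. (\<kappa>' has_real_derivative exp (- w x) * r' x) (at x)"
    and r': "continuous_on UNIV r'" "\<And>x. R < \<bar>x\<bar> \<Longrightarrow> r' x = 0" and g'0: "\<And>x. 0 \<le> g' x"
    and drift: "\<And>x. x0 \<le> x \<Longrightarrow> r x \<le> - 2 * \<alpha> * g x + (if x \<in> {x1..x2} then 2 * \<beta> else 0)"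
    and drift': "\<And>x. x0 \<le> x \<Longrightarrow> r' x \<le> (if x \<in> {x1..x2} then 2 * \<beta> else 0)"
    and g1: "\<And>x. x \<le> v' \<Longrightarrow> 1 \<le> g x" and g'1: "\<And>x. x \<le> x0 \<Longrightarrow> 1 \<le> g' x" and v: "v < v'"
    and A: "A \<in> sets M" "\<And>\<omega>. \<omega> \<in> A \<Longrightarrow> t < clock (speed_rate w) (\<lambda>r. B r \<omega>) N \<and>
        (\<exists>u\<ge>0. clock (speed_rate w) (\<lambda>r. B r \<omega>) u = t \<and> B u \<omega> \<le> scale_fun w v)"
  shows "measure M A \<le> exp (- \<alpha> * t) * g 0 + g' 0 + 2 * \<beta> * (t + 1)"
proof -
  let ?c = "speed_rate w"
  let ?Q = "\<lambda>b T. t \<le> T \<or> b < scale_fun w x0"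
  \<comment> \<open>The horizon of the last term is \<open>t + 1\<close> because the step that
    passes \<open>t\<close> overshoots; up to an overshoot of 1 the term must still decrease at full
    rate.\<close>
  define F where "F b T = exp (- \<alpha> * max 0 (t - T)) * g (scale_inv w b) + g' (scale_inv w b) + 2 * \<beta> * max 0 (t + 1 - T)" for b T
  have g_cont: "continuous_on UNIV g" "continuous_on UNIV g'"
    using g g' by (auto intro!: DERIV_continuous_on intro: has_field_derivative_at_within)
  have [measurable]: "(\<lambda>b. g (scale_inv w b)) \<in> borel_measurable borel" "(\<lambda>b. g' (scale_inv w b)) \<in> borel_measurable borel"
    by (intro borel_measurable_continuous_onI continuous_on_compose2[OF g_cont(1)] continuous_on_compose2[OF g_cont(2)] continuous_scale_inv; simp)+
  have F0: "0 \<le> F b T" for b T using g0 g'0 \<beta> by (simp add: F_def)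
  obtain a where a: "0 < a" "\<And>b. scale_inv w b \<in> {x1..x2} \<Longrightarrow> ?c b \<le> a"
  proof -
    have "bounded ((\<lambda>x. exp (- 2 * w x)) ` {x1..x2})"
      by (intro compact_imp_bounded compact_continuous_image continuous_intros continuous_on_subset[OF w]) auto
    then obtain a where a: "\<forall>x\<in>{x1..x2}. \<bar>exp (- 2 * w x)\<bar> \<le> a" by (auto simp: bounded_iff)
    show ?thesis
    proof (rule that[of "\<bar>a\<bar> + 1"])
      fix b assume "scale_inv w b \<in> {x1..x2}"
      then have "?c b \<le> a" using a by (auto simp: speed_rate_def)
      then show "?c b \<le> \<bar>a\<bar> + 1" by linarith
    qed simp
  qed
  have "1 * measure M A \<le> F 0 0"
  proof (rule frozen_supermartingale_bound[where F=F and Q="?Q" and c="?c" and A=A and g=1, OF B N])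
    show "(\<lambda>(b, T). F b T) \<in> borel_measurable (borel \<Otimes>\<^sub>M borel)" unfolding F_def by measurable
    show "Measurable.pred (borel \<Otimes>\<^sub>M borel) (\<lambda>(b, T). ?Q b T)" by measurable
    show "?c \<in> borel_measurable borel" by (rule measurable_speed_rate)
    show "0 \<le> ?c b" for b using speed_rate_pos[of b] by simp
    show "0 \<le> F b T" for b T by (rule F0)
  next
    fix e :: real assume e: "0 < e"
    then have e2: "0 < e / 2" by simp
    obtain h1 where h1: "h1 > 0" "\<And>h b. 0 < h \<Longrightarrow> h < h1 \<Longrightarrow>
        (\<integral>\<^sup>+z. ennreal (g (scale_inv w (b + z))) \<partial>gauss h)
          \<le> ennreal (g (scale_inv w b) + h * (?c b * r (scale_inv w b)) / 2 + e / 2 * h)"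
      using generator_step[OF g \<kappa> r g0 e2] by blast
    obtain h2 where h2: "h2 > 0" "\<And>h b. 0 < h \<Longrightarrow> h < h2 \<Longrightarrow>
        (\<integral>\<^sup>+z. ennreal (g' (scale_inv w (b + z))) \<partial>gauss h)
          \<le> ennreal (g' (scale_inv w b) + h * (?c b * r' (scale_inv w b)) / 2 + e / 2 * h)"
      using generator_step[OF g' \<kappa>' r' g'0 e2] by blast
    \<comment> \<open>Where \<open>\<beta>\<close> acts the clock rate is at most \<open>a\<close>;
      below \<open>1 / a\<close> one step advances the clock there by at most 1.\<close>
    define h0 where "h0 = min (min h1 h2) (1 / a)"
    show "\<exists>h0>0. \<forall>h b T. 0 < h \<longrightarrow> h < h0 \<longrightarrow> 0 \<le> T \<longrightarrow> \<not> ?Q b T \<longrightarrow>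
      (\<integral>\<^sup>+z. ennreal (F (b + z) (T + h * ?c b)) \<partial>gauss h) \<le> ennreal (F b T + e * h)"
    proof (intro exI[of _ h0] conjI allI impI)
      show "0 < h0" using h1 h2 a by (simp add: h0_def)
      fix h b T :: real assume h: "0 < h" "h < h0" and T: "0 \<le> T" "\<not> ?Q b T"
      define x where "x = scale_inv w b"
      define s where "s = h * ?c b"
      define T' where "T' = T + s"
      define E where "E = exp (- \<alpha> * max 0 (t - T'))"
      have Tt: "T < t" and x0: "x0 \<le> x" using T scale_inv_less_iff by (auto simp: x_def not_less[symmetric])
      have hh: "h < h1" "h < h2" "h < 1 / a" using h by (auto simp: h0_def)
      have s: "0 \<le> s" using h speed_rate_pos[of b] by (simp add: s_def)
      have E: "0 \<le> E" "E \<le> 1" using \<alpha> by (auto simp: E_def)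
      have "(\<integral>\<^sup>+z. ennreal (F (b + z) (T + h * ?c b)) \<partial>gauss h)
          = (\<integral>\<^sup>+z. ennreal E * ennreal (g (scale_inv w (b + z))) + ennreal (g' (scale_inv w (b + z))) + ennreal (2 * \<beta> * max 0 (t + 1 - T')) \<partial>gauss h)"
        using g0 g'0 \<beta> E
        by (intro nn_integral_cong) (simp add: F_def E_def T'_def s_def flip: ennreal_mult')
      also have "\<dots> = ennreal E * (\<integral>\<^sup>+z. ennreal (g (scale_inv w (b + z))) \<partial>gauss h)
          + (\<integral>\<^sup>+z. ennreal (g' (scale_inv w (b + z))) \<partial>gauss h) + ennreal (2 * \<beta> * max 0 (t + 1 - T'))"
      proof -
        interpret gp: prob_space "gauss h" using h(1) by (rule prob_space_gauss)
        show ?thesis using gp.emeasure_space_1 by (simp add: nn_integral_add nn_integral_cmult)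
      qed
      also have "\<dots> \<le> ennreal E * ennreal (g x + s * r x / 2 + e / 2 * h) + ennreal (g' x + s * r' x / 2 + e / 2 * h) + ennreal (2 * \<beta> * max 0 (t + 1 - T'))"
        using h1(2)[OF h(1) hh(1), of b] h2(2)[OF h(1) hh(2), of b]
        by (intro add_mono mult_left_mono order_refl) (auto simp: x_def s_def mult.assoc)
      also have "\<dots> \<le> ennreal (F b T + e * h)"
      proof -
        have Ey: "ennreal E * ennreal y = ennreal (E * y)" for y using E by (simp add: ennreal_mult')
        define d where "d = (if x \<in> {x1..x2} then \<beta> else 0)"
        have d0: "0 \<le> d" using \<beta> by (simp add: d_def)
        have 1: "s * r x / 2 \<le> - \<alpha> * s * g x + d * s"
          using mult_left_mono[OF drift[OF x0] s] by (auto simp: d_def algebra_simps split: if_splits)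
        have 2: "s * r' x / 2 \<le> d * s"
          using mult_left_mono[OF drift'[OF x0] s] by (auto simp: d_def algebra_simps split: if_splits)
        have 3: "2 * \<beta> * max 0 (t + 1 - T') \<le> 2 * \<beta> * max 0 (t + 1 - T) - 2 * d * s"
        proof (cases "x \<in> {x1..x2}")
          case True
          have "?c b \<le> a" using a(2)[of b] True by (simp add: x_def)
          then have "s \<le> h * a" using h by (auto simp: s_def)
          also have "\<dots> \<le> 1" using hh(3) a by (simp add: field_simps)
          finally have eq: "max 0 (t + 1 - T') = max 0 (t + 1 - T) - s" using Tt by (simp add: T'_def)
          show ?thesis unfolding eq using True by (simp add: d_def right_diff_distrib)
        next
          case False
          then show ?thesis using \<beta> s by (auto simp: d_def T'_def intro!: mult_left_mono)
        qed
        have 4: "E * ((1 - \<alpha> * s) * g x) \<le> exp (- \<alpha> * (t - T)) * g x"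
        proof (cases "1 - \<alpha> * s \<ge> 0")
          case True
          have "1 - \<alpha> * s \<le> exp (- (\<alpha> * s))" using exp_ge_add_one_self[of "- (\<alpha> * s)"] by simp
          then have "E * (1 - \<alpha> * s) \<le> E * exp (- (\<alpha> * s))" using E by (intro mult_left_mono) auto
          also have "\<dots> = exp (- \<alpha> * max 0 (t - T') - \<alpha> * s)" by (simp add: E_def flip: exp_add)
          also have "\<dots> \<le> exp (- \<alpha> * (t - T))"
          proof -
            have "\<alpha> * (t - T) \<le> \<alpha> * (max 0 (t - T') + s)" using \<alpha> by (intro mult_left_mono) (auto simp: T'_def)
            then show ?thesis by (simp add: algebra_simps)
          qed
          finally have "E * (1 - \<alpha> * s) * g x \<le> exp (- \<alpha> * (t - T)) * g x" using g0 by (intro mult_right_mono)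
          then show ?thesis by (simp add: mult.assoc)
        next
          \<comment> \<open>If the clock jumps so far in one step that the linear factor is
            negative, the left side is nonpositive.\<close>
          case False
          then have "(1 - \<alpha> * s) * g x \<le> 0" using g0 by (intro mult_nonpos_nonneg) auto
          then have "E * ((1 - \<alpha> * s) * g x) \<le> 0" by (rule mult_nonneg_nonpos[OF E(1)])
          also have "0 \<le> exp (- \<alpha> * (t - T)) * g x" using g0 by simp
          finally show ?thesis .
        qed
        have P0: "0 \<le> d * s + e / 2 * h" using d0 s e h by simp
        have "g x + s * r x / 2 + e / 2 * h \<le> (1 - \<alpha> * s) * g x + (d * s + e / 2 * h)"
          using 1 by (simp add: algebra_simps)
        then have "E * (g x + s * r x / 2 + e / 2 * h) \<le> E * ((1 - \<alpha> * s) * g x + (d * s + e / 2 * h))"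
          using E by (intro mult_left_mono) auto
        also have "\<dots> \<le> exp (- \<alpha> * (t - T)) * g x + 1 * (d * s + e / 2 * h)"
          unfolding distrib_left[of E "(1 - \<alpha> * s) * g x"] by (rule add_mono[OF 4 mult_right_mono[OF E(2) P0]])
        finally have A: "E * (g x + s * r x / 2 + e / 2 * h) \<le> exp (- \<alpha> * (t - T)) * g x + (d * s + e / 2 * h)" by simp
        have B: "g' x + s * r' x / 2 + e / 2 * h \<le> g' x + (d * s + e / 2 * h)" using 2 by simp
        have C: "2 * \<beta> * max 0 (t + 1 - T') \<le> 2 * \<beta> * max 0 (t + 1 - T) - 2 * d * s" by (rule 3)
        have nn: "0 \<le> exp (- \<alpha> * (t - T)) * g x + (d * s + e / 2 * h)" "0 \<le> g' x + (d * s + e / 2 * h)"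
          using g0 g'0 d0 s e h by (auto intro!: add_nonneg_nonneg)
        have "ennreal E * ennreal (g x + s * r x / 2 + e / 2 * h) + ennreal (g' x + s * r' x / 2 + e / 2 * h) + ennreal (2 * \<beta> * max 0 (t + 1 - T'))
            \<le> ennreal (exp (- \<alpha> * (t - T)) * g x + (d * s + e / 2 * h)) + ennreal (g' x + (d * s + e / 2 * h)) + ennreal (2 * \<beta> * max 0 (t + 1 - T'))"
          unfolding Ey by (rule add_mono[OF add_mono[OF ennreal_leI[OF A] ennreal_leI[OF B]] order_refl])
        also have "\<dots> = ennreal (exp (- \<alpha> * (t - T)) * g x + (d * s + e / 2 * h) + (g' x + (d * s + e / 2 * h)) + 2 * \<beta> * max 0 (t + 1 - T'))"
        proof -
          have plus3: "ennreal a + ennreal b + ennreal c = ennreal (a + b + c)" if "0 \<le> a" "0 \<le> b" "0 \<le> c" for a b c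
            using that by simp
          show ?thesis by (rule plus3[OF nn]) (simp add: \<beta>)
        qed
        also have "\<dots> \<le> ennreal (F b T + e * h)"
          using C Tt by (intro ennreal_leI) (simp add: F_def x_def max_def algebra_simps)
        finally show ?thesis .
      qed
      finally show "(\<integral>\<^sup>+z. ennreal (F (b + z) (T + h * ?c b)) \<partial>gauss h) \<le> ennreal (F b T + e * h)" .
    qed
  next
    fix \<omega> assume \<omega>A: "\<omega> \<in> A"
    then have \<omega>: "\<omega> \<in> space M" using sets.sets_into_space[OF A(1)] by auto
    define b where "b r = B r \<omega>" for r
    have b: "continuous_on {0..} b" using brownian_onD(5)[OF B \<omega>] by (simp add: b_def[abs_def])
    have b0: "b 0 = 0" using brownian_onD(4)[OF B \<omega>] by (simp add: b_def)
    let ?T = "clock ?c b"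
    obtain u where u: "0 \<le> u" "?T u = t" "b u \<le> scale_fun w v" and TN: "t < ?T N"
      using A(2)[OF \<omega>A] by (auto simp: b_def[abs_def])
    have u0: "0 < u" using u t by (cases "u = 0") auto
    have T_less: "?T r < ?T r'" if "r < r'" for r r'
      by (rule clock_strict_mono[OF continuous_speed_rate b speed_rate_pos that])
    have T_le: "?T r \<le> ?T r'" if "r \<le> r'" for r r'
      using T_less[of r r'] that by (cases "r = r'") auto
    have sv: "scale_fun w v < scale_fun w v'" by (rule scale_fun_less[OF w v])
    have "\<forall>\<^sub>F r in at u within {0..}. b r < scale_fun w v'"
      using b u sv by (intro order_tendstoD[of b "b u"]) (auto simp: continuous_on_def)
    then obtain d where d: "0 < d" "\<And>r. 0 \<le> r \<Longrightarrow> r \<noteq> u \<Longrightarrow> dist r u < d \<Longrightarrow> b r < scale_fun w v'"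
      unfolding eventually_at by auto
    have d': "b r < scale_fun w v'" if "0 \<le> r" "\<bar>r - u\<bar> < d" for r
      using d(2)[OF that(1)] that(2) u sv by (cases "r = u") (auto simp: dist_real_def)
    \<comment> \<open>The clock is strictly increasing. A Riemann error below these gaps places the
      freezing index within \<open>d\<close> of \<open>u\<close>, where the path is still below the
      level of \<open>v'\<close>, and ensures that the discrete clock reaches \<open>t\<close>
      before the horizon \<open>N\<close>.\<close>
    define e' where "e' = min (min (?T (u + d / 2) - t) (t - ?T (u - d))) (?T N - t)"
    define e where "e = e' / 2"
    have e: "0 < e" "e < ?T (u + d / 2) - t" "e < t - ?T (u - d)" "e < ?T N - t"
    proof -
      have "0 < ?T (u + d / 2) - t" "0 < t - ?T (u - d)" "0 < ?T N - t"
        using T_less[of u "u + d / 2"] T_less[of "u - d" u] d(1) u TN by auto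
      then have "0 < e'" "e' \<le> ?T (u + d / 2) - t" "e' \<le> t - ?T (u - d)" "e' \<le> ?T N - t"
        by (auto simp: e'_def)
      then show "0 < e" "e < ?T (u + d / 2) - t" "e < t - ?T (u - d)" "e < ?T N - t"
        unfolding e_def by simp_all
    qed
    have "(\<lambda>j. N * (1/2) ^ j) \<longlonglongrightarrow> N * 0" by (intro tendsto_intros LIMSEQ_realpow_zero) auto
    then have "\<forall>\<^sub>F j in sequentially. N * (1/2) ^ j < d / 2"
      using d(1) by (intro order_tendstoD) auto
    then show "\<forall>\<^sub>F j in sequentially. 1 \<le> (\<lambda>(b, T). F b T) (frozen ?Q ?c (\<lambda>r. B r \<omega>) N j)"
      using clock_riemann[OF continuous_speed_rate b e(1) N]
    proof eventually_elim
      case (elim j)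
      define h where "h = N / 2 ^ j"
      define \<tau> where "\<tau> i = h * (\<Sum>i<i. ?c (b (real i * h)))" for i
      have h: "0 < h" "h < d / 2" "2 ^ j * h = N" using N elim(1) by (auto simp: h_def power_divide)
      have close: "\<bar>\<tau> i - ?T (real i * h)\<bar> \<le> e" if "i \<le> 2 ^ j" for i
        using elim(2)[rule_format, OF that] by (simp add: \<tau>_def h_def)
      obtain i where i: "i \<le> 2 ^ j" "frozen ?Q ?c b N j = (b (real i * h), \<tau> i)"
        "\<And>i'. i' < i \<Longrightarrow> \<not> ?Q (b (real i' * h)) (\<tau> i')" "i = 2 ^ j \<or> ?Q (b (real i * h)) (\<tau> i)"
        using frozen_cases[where b=b and j=j and N=N and c="?c" and Q="?Q", OF b0]
        unfolding \<tau>_def h_def by metis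
      have "1 \<le> F (b (real i * h)) (\<tau> i)"
      proof (cases "b (real i * h) < scale_fun w x0")
        case True
        then have "1 \<le> g' (scale_inv w (b (real i * h)))"
          using g'1 scale_inv_less_iff by (simp add: less_imp_le)
        then show ?thesis using g0 \<beta> by (simp add: F_def add_nonneg_nonneg add_increasing add_increasing2)
      next
        case False
        have "t \<le> \<tau> i"
        proof (cases "i = 2 ^ j")
          case True
          then have "\<bar>\<tau> i - ?T N\<bar> \<le> e" using close[OF i(1)] h(3) by simp
          then show ?thesis using e(4) by linarith
        qed (use i(4) False in blast)
        \<comment> \<open>The discrete clock is below \<open>t\<close> at the preceding index and at
          least \<open>t\<close> at \<open>i\<close>; this bounds \<open>real i * h\<close> from
          both sides.\<close>
        then have "i \<noteq> 0" using t by (intro notI) (simp add: \<tau>_def)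
        then obtain i' where i': "i = Suc i'" by (cases i) auto
        have "\<tau> i' < t" using i(3)[of i'] i' by auto
        then have "?T (real i' * h) < ?T (u + d / 2)" using close[of i'] i(1) i' e(2) by auto
        then have 1: "real i' * h < u + d / 2" using T_le[of "u + d / 2" "real i' * h"] by linarith
        have "?T (u - d) < ?T (real i * h)" using close[OF i(1)] \<open>t \<le> \<tau> i\<close> e(3) by linarith
        then have 2: "u - d < real i * h" using T_le[of "real i * h" "u - d"] by linarith
        have "real i * h = real i' * h + h" by (simp add: i' distrib_right)
        with 1 2 h have "\<bar>real i * h - u\<bar> < d" by linarith
        then have "b (real i * h) < scale_fun w v'" using d' h by simp
        then have "1 \<le> g (scale_inv w (b (real i * h)))"
          using g1 scale_inv_less_iff by (simp add: less_imp_le)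
        then show ?thesis using \<open>t \<le> \<tau> i\<close> g'0 \<beta> by (simp add: F_def max_def add_nonneg_nonneg add_increasing2)
      qed
      then show ?case using i(2) by (simp add: b_def[abs_def])
    qed
  qed (use A in auto)
  then show ?thesis using t by (simp add: F_def scale_inv_0[OF w])
qed

end

section \<open>Subsolutions over consecutive blocks\<close>

lemma antideriv_mono_on:
  assumes f: "continuous_on UNIV f" and g: "continuous_on UNIV g" and ab: "a \<le> b"
    and le: "\<And>x. a \<le> x \<Longrightarrow> x \<le> b \<Longrightarrow> f x \<le> g x"
  shows "antideriv f b - antideriv f a \<le> antideriv g b - antideriv g a"
proof -
  have "(\<lambda>x. antideriv g x - antideriv f x) a \<le> (\<lambda>x. antideriv g x - antideriv f x) b"
  proof (rule DERIV_nonneg_imp_nondecreasing[OF ab])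
    fix x assume "a \<le> x" "x \<le> b"
    moreover have "((\<lambda>x. antideriv g x - antideriv f x) has_real_derivative g x - f x) (at x)"
      by (intro DERIV_diff antideriv_has_derivative f g)
    ultimately show "\<exists>y. ((\<lambda>x. antideriv g x - antideriv f x) has_real_derivative y) (at x) \<and> 0 \<le> y"
      using le by (intro exI[of _ "g x - f x"]) simp
  qed
  then show ?thesis by simp
qed

lemma antideriv_const_diff:
  assumes f: "continuous_on UNIV f" and ab: "a \<le> b" and eq: "\<And>x. a \<le> x \<Longrightarrow> x \<le> b \<Longrightarrow> f x = 0"
  shows "antideriv f b = antideriv f a"
proof -
  have z: "continuous_on UNIV (\<lambda>_. 0 :: real)" by simp
  have "antideriv f b - antideriv f a = antideriv (\<lambda>_. 0) b - antideriv (\<lambda>_. 0) a"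
    using antideriv_mono_on[OF f z ab] antideriv_mono_on[OF z f ab] eq by fastforce
  also have "\<dots> = 0" by (simp add: antideriv_def)
  finally show ?thesis by simp
qed

lemma antideriv_increasing:
  assumes f: "continuous_on UNIV f" and ab: "a \<le> b" and pos: "\<And>x. a \<le> x \<Longrightarrow> x \<le> b \<Longrightarrow> 0 \<le> f x"
  shows "antideriv f a \<le> antideriv f b"
proof -
  have z: "continuous_on UNIV (\<lambda>_. 0 :: real)" by simp
  have "antideriv (\<lambda>_. 0) b - antideriv (\<lambda>_. 0) a \<le> antideriv f b - antideriv f a"
    by (rule antideriv_mono_on[OF z f ab pos])
  then show ?thesis by (simp add: antideriv_def)
qed

lemma zero_derivative_const:
  fixes f :: "real \<Rightarrow> real"
  assumes "\<And>x. (f has_real_derivative 0) (at x)"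
  shows "f x = f y"
  using DERIV_isconst_all[of f x y] assms by blast

lemma antideriv_const: "antideriv (\<lambda>_. c) b - antideriv (\<lambda>_. c) a = c * (b - a)"
proof -
  have "antideriv (\<lambda>_. c) x = c * x" for x :: real
  proof -
    have c: "continuous_on UNIV (\<lambda>_. c)" by simp
    have d: "((\<lambda>x. antideriv (\<lambda>_. c) x - c * x) has_real_derivative 0) (at x)" for x
    proof -
      have "((\<lambda>x. antideriv (\<lambda>_. c) x - c * x) has_real_derivative (c - c * 1)) (at x)"
        by (intro DERIV_diff antideriv_has_derivative[OF c] DERIV_cmult DERIV_ident)
      then show ?thesis by simp
    qed
    show ?thesis using zero_derivative_const[OF d, of x 0] by simp
  qed
  then show ?thesis by (simp add: right_diff_distrib)
qed

lemma antideriv_le: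
  assumes f: "continuous_on UNIV f" and ab: "a \<le> b" and le: "\<And>x. a \<le> x \<Longrightarrow> x \<le> b \<Longrightarrow> f x \<le> c"
  shows "antideriv f b - antideriv f a \<le> c * (b - a)"
  using antideriv_mono_on[OF f _ ab, of "\<lambda>_. c"] le by (simp add: antideriv_const)

lemma antideriv_ge:
  assumes f: "continuous_on UNIV f" and ab: "a \<le> b" and le: "\<And>x. a \<le> x \<Longrightarrow> x \<le> b \<Longrightarrow> c \<le> f x"
  shows "c * (b - a) \<le> antideriv f b - antideriv f a"
  using antideriv_mono_on[OF _ f ab, of "\<lambda>_. c"] le by (simp add: antideriv_const)

lemma continuous_antideriv: "continuous_on UNIV f \<Longrightarrow> continuous_on UNIV (antideriv f)"
  using antideriv_has_derivative by (intro DERIV_continuous_on) (auto intro: has_field_derivative_at_within)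

lemma antideriv_cmult:
  assumes f: "continuous_on UNIV f"
  shows "antideriv (\<lambda>x. c * f x) x = c * antideriv f x"
proof -
  have cf: "continuous_on UNIV (\<lambda>x. c * f x)" using f by (intro continuous_intros)
  have "((\<lambda>x. antideriv (\<lambda>x. c * f x) x - c * antideriv f x) has_real_derivative (c * f x - c * f x)) (at x)" for x
    by (intro DERIV_diff DERIV_cmult antideriv_has_derivative f cf)
  then have d: "((\<lambda>x. antideriv (\<lambda>x. c * f x) x - c * antideriv f x) has_real_derivative 0) (at x)" for x by simp
  show ?thesis using zero_derivative_const[OF d, of x 0] by simp
qed

lemma cell_avg_uminus: "continuous_on UNIV w \<Longrightarrow> cell_avg (\<lambda>x. - w x) s l = - cell_avg w s l"
  using antideriv_cmult[of w "-1"] by (simp add: cell_avg_def diff_divide_distrib)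

text \<open>Jensen's inequality, from the tangent line of the exponential at the average.\<close>

lemma antideriv_exp_ge:
  assumes w: "continuous_on UNIV w" and l: "0 < l"
  shows "l * exp (cell_avg w s l) \<le> antideriv (\<lambda>x. exp (w x)) (s + l) - antideriv (\<lambda>x. exp (w x)) s"
proof -
  define c where "c = cell_avg w s l"
  have ew: "continuous_on UNIV (\<lambda>x. exp (w x))" using w by (intro continuous_intros)
  let ?f = "\<lambda>x. antideriv (\<lambda>x. exp (w x)) x - exp c * ((1 - c) * x + antideriv w x)"
  have "?f s \<le> ?f (s + l)"
  proof (rule DERIV_nonneg_imp_nondecreasing[where f="?f" and a=s and b="s + l"])
    fix x
    have "((\<lambda>x. antideriv (\<lambda>x. exp (w x)) x - exp c * ((1 - c) * x + antideriv w x)) has_real_derivative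
        exp (w x) - exp c * ((1 - c) * 1 + w x)) (at x)"
      by (intro DERIV_diff DERIV_cmult DERIV_add DERIV_ident antideriv_has_derivative ew w)
    moreover have "0 \<le> exp (w x) - exp c * ((1 - c) * 1 + w x)"
    proof -
      have "exp c * (1 + (w x - c)) \<le> exp c * exp (w x - c)"
        by (intro mult_left_mono) auto
      also have "\<dots> = exp (w x)" by (simp flip: exp_add)
      finally show ?thesis by (simp add: algebra_simps)
    qed
    ultimately show "\<exists>y. (?f has_real_derivative y) (at x) \<and> 0 \<le> y" by blast
  qed (use l in simp)
  moreover have "antideriv w (s + l) - antideriv w s = l * c" using l by (simp add: c_def cell_avg_def)
  ultimately have "exp c * ((1 - c) * l + l * c) \<le> antideriv (\<lambda>x. exp (w x)) (s + l) - antideriv (\<lambda>x. exp (w x)) s"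
    by (simp add: algebra_simps)
  then show ?thesis by (simp add: c_def algebra_simps)
qed

section \<open>Growth of Picard subsolutions\<close>

text \<open>Cuts the source off to \<open>[0, v]\<close>, so that the generator image has bounded
  support and the solution is constant on the left half-line. The cut-off is invisible on
  \<open>[1, v - 1]\<close>, which is where the blocks are placed.\<close>

definition window :: "real \<Rightarrow> real \<Rightarrow> real" where
  "window v x = max 0 (min 1 (min x (v - x)))"

lemma window_bounds: "0 \<le> window v x" "window v x \<le> 1"
  by (auto simp: window_def)

lemma window_eq_1: "1 \<le> x \<Longrightarrow> x \<le> v - 1 \<Longrightarrow> window v x = 1"
  by (simp add: window_def)

lemma window_eq_0: "x \<le> 0 \<or> v \<le> x \<Longrightarrow> window v x = 0"
  by (auto simp: window_def)

lemma continuous_window: "continuous_on UNIV (window v)"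
  unfolding window_def[abs_def] by (intro continuous_on_max continuous_on_min continuous_intros)

text \<open>Picard iterates of \<open>(e\<^sup>-\<^sup>w u')' = 2 \<rho> e\<^sup>-\<^sup>w u\<close>; every iterate is a subsolution, so no passage to the limit is needed.\<close>

primrec picard :: "(real \<Rightarrow> real) \<Rightarrow> real \<Rightarrow> real \<Rightarrow> nat \<Rightarrow> real \<Rightarrow> real" where
  "picard w \<rho> v 0 = (\<lambda>_. 1)"
| "picard w \<rho> v (Suc n) = (\<lambda>x. 1 + antideriv (\<lambda>y. exp (w y) *
      antideriv (\<lambda>z. exp (- w z) * (2 * \<rho> * window v z * picard w \<rho> v n z)) y) x)"

text \<open>The flux \<open>exp (- w) * u'\<close> of iterate \<open>Suc n\<close>, whose source
  contains iterate \<open>n\<close>.\<close>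

definition picard_flux :: "(real \<Rightarrow> real) \<Rightarrow> real \<Rightarrow> real \<Rightarrow> nat \<Rightarrow> real \<Rightarrow> real" where
  "picard_flux w \<rho> v n = antideriv (\<lambda>z. exp (- w z) * (2 * \<rho> * window v z * picard w \<rho> v n z))"

context
  fixes w :: "real \<Rightarrow> real" and \<rho> v :: real
  assumes w: "continuous_on UNIV w" and \<rho>: "0 < \<rho>"
begin

lemma picard_Suc: "picard w \<rho> v (Suc n) x = 1 + antideriv (\<lambda>y. exp (w y) * picard_flux w \<rho> v n y) x"
  by (simp add: picard_flux_def)

lemma continuous_picard: "continuous_on UNIV (picard w \<rho> v n)"
proof (induction n)
  case (Suc n)
  then show ?case
    unfolding picard.simps
    by (intro continuous_intros continuous_antideriv w continuous_window)
qed simp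

lemma continuous_picard_source: "continuous_on UNIV (\<lambda>z. exp (- w z) * (2 * \<rho> * window v z * picard w \<rho> v n z))"
  by (intro continuous_intros w continuous_window continuous_picard)

lemma continuous_picard_flux: "continuous_on UNIV (\<lambda>y. exp (w y) * picard_flux w \<rho> v n y)"
  unfolding picard_flux_def by (intro continuous_intros w continuous_antideriv continuous_picard_source)

lemma picard_flux_derivative:
  "(picard_flux w \<rho> v n has_real_derivative exp (- w x) * (2 * \<rho> * window v x * picard w \<rho> v n x)) (at x)"
  unfolding picard_flux_def by (rule antideriv_has_derivative[OF continuous_picard_source])

lemma picard_derivative:
  "(picard w \<rho> v (Suc n) has_real_derivative exp (w x) * picard_flux w \<rho> v n x) (at x)"
  unfolding picard_Suc[abs_def]
  by (auto intro!: derivative_eq_intros antideriv_has_derivative continuous_picard_flux)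

lemma picard_flux_left: "x \<le> 0 \<Longrightarrow> picard_flux w \<rho> v n x = 0"
  unfolding picard_flux_def
  using antideriv_const_diff[OF continuous_picard_source, of x 0 n] by (simp add: window_eq_0)

lemma picard_left: "x \<le> 0 \<Longrightarrow> picard w \<rho> v n x = 1"
proof (cases n)
  case (Suc m)
  assume "x \<le> 0"
  then show ?thesis
    using antideriv_const_diff[OF continuous_picard_flux, of x 0 m] by (simp add: Suc picard_Suc picard_flux_left del: picard.simps)
qed simp

lemma picard_ge_1_flux_nonneg: "1 \<le> picard w \<rho> v n x \<and> 0 \<le> picard_flux w \<rho> v n x"
proof (induction n arbitrary: x)
  have flux: "0 \<le> picard_flux w \<rho> v n x" if "\<And>x. 1 \<le> picard w \<rho> v n x" for n x
  proof (cases "x \<le> 0")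
    case False
    have "0 \<le> picard w \<rho> v n z" for z using that[of z] by linarith
    then have "antideriv (\<lambda>z. exp (- w z) * (2 * \<rho> * window v z * picard w \<rho> v n z)) 0 \<le> picard_flux w \<rho> v n x"
      unfolding picard_flux_def using \<rho> window_bounds False
      by (intro antideriv_increasing continuous_picard_source) auto
    then show ?thesis by simp
  qed (simp add: picard_flux_left)
  {
    case 0
    then show ?case using flux[of 0] by simp
  next
    case (Suc n)
    have p: "1 \<le> picard w \<rho> v (Suc n) x" for x
    proof (cases "x \<le> 0")
      case False
      have "antideriv (\<lambda>y. exp (w y) * picard_flux w \<rho> v n y) 0 \<le> antideriv (\<lambda>y. exp (w y) * picard_flux w \<rho> v n y) x"
        using Suc False by (intro antideriv_increasing continuous_picard_flux) auto
      then show ?thesis by (simp add: picard_Suc del: picard.simps)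
    qed (simp add: picard_left del: picard.simps)
    then show ?case using flux by blast
  }
qed

lemma picard_ge_1: "1 \<le> picard w \<rho> v n x"
  using picard_ge_1_flux_nonneg by blast

lemma picard_flux_nonneg: "0 \<le> picard_flux w \<rho> v n x"
  using picard_ge_1_flux_nonneg by blast

lemma picard_mono: "x \<le> y \<Longrightarrow> picard w \<rho> v n x \<le> picard w \<rho> v n y"
proof (cases n)
  case (Suc m)
  assume "x \<le> y"
  then have "antideriv (\<lambda>y. exp (w y) * picard_flux w \<rho> v m y) x \<le> antideriv (\<lambda>y. exp (w y) * picard_flux w \<rho> v m y) y"
    using picard_flux_nonneg by (intro antideriv_increasing continuous_picard_flux) auto
  then show ?thesis by (simp add: Suc picard_Suc del: picard.simps)
qed simp

text \<open>Monotonicity in the index is what makes each iterate a subsolution: its source contains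
  the previous iterate, which is no larger.\<close>

lemma picard_le_Suc: "picard w \<rho> v n x \<le> picard w \<rho> v (Suc n) x"
proof (induction n arbitrary: x)
  case 0
  then show ?case using picard_ge_1[of "Suc 0" x] by simp
next
  case (Suc n)
  have flux: "picard_flux w \<rho> v n y \<le> picard_flux w \<rho> v (Suc n) y" for y
  proof (cases "y \<le> 0")
    case False
    have "antideriv (\<lambda>z. exp (- w z) * (2 * \<rho> * window v z * picard w \<rho> v n z)) y - antideriv (\<lambda>z. exp (- w z) * (2 * \<rho> * window v z * picard w \<rho> v n z)) 0
      \<le> antideriv (\<lambda>z. exp (- w z) * (2 * \<rho> * window v z * picard w \<rho> v (Suc n) z)) y - antideriv (\<lambda>z. exp (- w z) * (2 * \<rho> * window v z * picard w \<rho> v (Suc n) z)) 0"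
      using False \<rho> window_bounds by (intro antideriv_mono_on continuous_picard_source mult_left_mono Suc) auto
    then show ?thesis by (simp add: picard_flux_def del: picard.simps)
  qed (simp add: picard_flux_left)
  show ?case
  proof (cases "x \<le> 0")
    case False
    have "antideriv (\<lambda>y. exp (w y) * picard_flux w \<rho> v n y) x - antideriv (\<lambda>y. exp (w y) * picard_flux w \<rho> v n y) 0
      \<le> antideriv (\<lambda>y. exp (w y) * picard_flux w \<rho> v (Suc n) y) x - antideriv (\<lambda>y. exp (w y) * picard_flux w \<rho> v (Suc n) y) 0"
      using False flux by (intro antideriv_mono_on continuous_picard_flux mult_left_mono) auto
    then show ?thesis by (simp add: picard_Suc del: picard.simps)
  qed (simp add: picard_left del: picard.simps)
qed

text \<open>The source on \<open>[a, a + l]\<close> produces a flux of at least \<open>D\<close>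
  from \<open>b\<close> on, and integrating this flux against \<open>exp w\<close> over
  \<open>[b, b + l]\<close> raises the next iterate. Jensen's inequality bounds both integrals by
  averages; \<open>1 \<le> l\<close> allows the two factors \<open>l\<close> to be dropped.\<close>

lemma picard_pair_growth:
  assumes s: "1 \<le> s" and l: "1 \<le> l" and ab: "s \<le> a" "a + l \<le> b" "b + l \<le> s'" "s' \<le> v - 1"
  shows "picard w \<rho> v n s * (1 + 2 * \<rho> * exp (cell_avg w b l - cell_avg w a l)) \<le> picard w \<rho> v (Suc n) s'"
proof -
  define p where "p = picard w \<rho> v n s"
  have p: "1 \<le> p" using picard_ge_1 by (simp add: p_def)
  have ew: "continuous_on UNIV (\<lambda>x. exp (w x))" and emw: "continuous_on UNIV (\<lambda>x. exp (- w x))"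
    using w by (auto intro!: continuous_intros)
  define D where "D = 2 * \<rho> * p * exp (- cell_avg w a l)"
  have D: "0 \<le> D" using \<rho> p by (simp add: D_def)
  have flux: "D \<le> picard_flux w \<rho> v n y" if y: "b \<le> y" "y \<le> s'" for y
  proof -
    have "2 * \<rho> * p * (antideriv (\<lambda>x. exp (- w x)) (a + l) - antideriv (\<lambda>x. exp (- w x)) a)
        = antideriv (\<lambda>x. 2 * \<rho> * p * exp (- w x)) (a + l) - antideriv (\<lambda>x. 2 * \<rho> * p * exp (- w x)) a"
      by (simp add: antideriv_cmult[OF emw] right_diff_distrib)
    also have "\<dots> \<le> picard_flux w \<rho> v n (a + l) - picard_flux w \<rho> v n a"
      unfolding picard_flux_def
    proof (intro antideriv_mono_on continuous_picard_source)
      show "continuous_on UNIV (\<lambda>x. 2 * \<rho> * p * exp (- w x))" by (intro continuous_intros w)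
      fix x assume x: "a \<le> x" "x \<le> a + l"
      have "window v x = 1" using x ab s l y by (intro window_eq_1) auto
      moreover have "p \<le> picard w \<rho> v n x" unfolding p_def using x ab by (intro picard_mono) auto
      ultimately show "2 * \<rho> * p * exp (- w x) \<le> exp (- w x) * (2 * \<rho> * window v x * picard w \<rho> v n x)"
        using \<rho> by (simp add: mult.commute)
    qed (use l in simp)
    also have "\<dots> \<le> picard_flux w \<rho> v n (a + l)" using picard_flux_nonneg by simp
    also have "\<dots> \<le> picard_flux w \<rho> v n y"
    proof -
      have "0 \<le> picard w \<rho> v n z" for z using picard_ge_1[of n z] by linarith
      then show ?thesis unfolding picard_flux_def using \<rho> window_bounds y ab
        by (intro antideriv_increasing continuous_picard_source) auto
    qed
    finally have 1: "2 * \<rho> * p * (antideriv (\<lambda>x. exp (- w x)) (a + l) - antideriv (\<lambda>x. exp (- w x)) a) \<le> picard_flux w \<rho> v n y" .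
    have "l * exp (cell_avg (\<lambda>x. - w x) a l) \<le> antideriv (\<lambda>x. exp (- w x)) (a + l) - antideriv (\<lambda>x. exp (- w x)) a"
      using w l by (intro antideriv_exp_ge continuous_intros) auto
    moreover have "1 * exp (cell_avg (\<lambda>x. - w x) a l) \<le> l * exp (cell_avg (\<lambda>x. - w x) a l)"
      using l by (intro mult_right_mono) auto
    ultimately have "exp (- cell_avg w a l) \<le> antideriv (\<lambda>x. exp (- w x)) (a + l) - antideriv (\<lambda>x. exp (- w x)) a"
      unfolding cell_avg_uminus[OF w] by linarith
    then have "D \<le> 2 * \<rho> * p * (antideriv (\<lambda>x. exp (- w x)) (a + l) - antideriv (\<lambda>x. exp (- w x)) a)"
      unfolding D_def using \<rho> p by (intro mult_left_mono) auto
    with 1 show ?thesis by linarith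
  qed
  have "D * (antideriv (\<lambda>x. exp (w x)) (b + l) - antideriv (\<lambda>x. exp (w x)) b)
      = antideriv (\<lambda>x. D * exp (w x)) (b + l) - antideriv (\<lambda>x. D * exp (w x)) b"
    by (simp add: antideriv_cmult[OF ew] right_diff_distrib)
  also have "\<dots> \<le> antideriv (\<lambda>y. exp (w y) * picard_flux w \<rho> v n y) (b + l) - antideriv (\<lambda>y. exp (w y) * picard_flux w \<rho> v n y) b"
  proof (intro antideriv_mono_on continuous_picard_flux)
    show "continuous_on UNIV (\<lambda>x. D * exp (w x))" by (intro continuous_intros w)
    fix x assume "b \<le> x" "x \<le> b + l"
    then show "D * exp (w x) \<le> exp (w x) * picard_flux w \<rho> v n x"
      using flux[of x] ab by (simp add: mult.commute)
  qed (use l in simp)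
  also have "\<dots> = picard w \<rho> v (Suc n) (b + l) - picard w \<rho> v (Suc n) b" by (simp add: picard_Suc del: picard.simps)
  finally have 2: "D * (antideriv (\<lambda>x. exp (w x)) (b + l) - antideriv (\<lambda>x. exp (w x)) b)
      \<le> picard w \<rho> v (Suc n) (b + l) - picard w \<rho> v (Suc n) b" .
  have "l * exp (cell_avg w b l) \<le> antideriv (\<lambda>x. exp (w x)) (b + l) - antideriv (\<lambda>x. exp (w x)) b"
    using w l by (intro antideriv_exp_ge) auto
  moreover have "1 * exp (cell_avg w b l) \<le> l * exp (cell_avg w b l)"
    using l by (intro mult_right_mono) auto
  ultimately have "exp (cell_avg w b l) \<le> antideriv (\<lambda>x. exp (w x)) (b + l) - antideriv (\<lambda>x. exp (w x)) b"
    by linarith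
  then have "D * exp (cell_avg w b l) \<le> D * (antideriv (\<lambda>x. exp (w x)) (b + l) - antideriv (\<lambda>x. exp (w x)) b)"
    using D by (rule mult_left_mono)
  then have "p + D * exp (cell_avg w b l) \<le> picard w \<rho> v (Suc n) (b + l)"
    using 2 picard_mono[of s b "Suc n"] picard_le_Suc[of n s] ab l unfolding p_def by linarith
  also have "\<dots> \<le> picard w \<rho> v (Suc n) s'" using ab by (intro picard_mono) auto
  also have "p + D * exp (cell_avg w b l) = p * (1 + 2 * \<rho> * exp (cell_avg w b l - cell_avg w a l))"
    by (simp add: D_def exp_diff exp_minus field_simps)
  finally show ?thesis by (simp add: p_def)
qed

text \<open>The growth \<open>X\<close> over the block dominates the contribution of every single
  pair, and there are at most \<open>(real J)\<^sup>2\<close> pairs; so the sum over pairs divided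
  by this number is a lower bound for the growth.\<close>

lemma picard_block_growth:
  assumes s: "1 \<le> s" and l: "1 \<le> l" "l \<le> c" and s': "s + real J * c \<le> v - 1" and J: "0 < J"
  shows "picard w \<rho> v n s * (1 + 2 * \<rho> / (real J)\<^sup>2 * block_rise w s c l J) \<le> picard w \<rho> v (Suc n) (s + real J * c)"
proof -
  define p where "p = picard w \<rho> v n s"
  define X where "X = (picard w \<rho> v (Suc n) (s + real J * c) / p - 1) / (2 * \<rho>)"
  have p: "1 \<le> p" using picard_ge_1 by (simp add: p_def)
  have X0: "0 \<le> X"
  proof -
    have "p \<le> picard w \<rho> v (Suc n) (s + real J * c)"
      using picard_le_Suc[of n s] picard_mono[of s "s + real J * c" "Suc n"] l unfolding p_def by auto
    then show ?thesis using p \<rho> by (simp add: X_def)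
  qed
  have X: "exp (cell_avg w (s + real j * c) l - cell_avg w (s + real i * c) l) \<le> X" if ij: "j < J" "i < j" for i j
  proof -
    have 1: "real i * c + c \<le> real j * c"
    proof -
      have "real (Suc i) * c \<le> real j * c" using ij l by (intro mult_right_mono) auto
      then show ?thesis by (simp add: distrib_right)
    qed
    have 2: "real j * c + c \<le> real J * c"
    proof -
      have "real (Suc j) * c \<le> real J * c" using ij l by (intro mult_right_mono) auto
      then show ?thesis by (simp add: distrib_right)
    qed
    have "p * (1 + 2 * \<rho> * exp (cell_avg w (s + real j * c) l - cell_avg w (s + real i * c) l)) \<le> picard w \<rho> v (Suc n) (s + real J * c)"
      unfolding p_def using 1 2 l s s' by (intro picard_pair_growth) auto
    then show ?thesis using p \<rho> by (simp add: X_def field_simps)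
  qed
  have "block_rise w s c l J \<le> (\<Sum>j<J. \<Sum>i<j. X)"
    unfolding block_rise_def using X by (intro sum_mono) auto
  also have "\<dots> \<le> (\<Sum>j<J. real J * X)"
    using X0 by (intro sum_mono) (simp add: mult_right_mono)
  also have "\<dots> = (real J)\<^sup>2 * X" by (simp add: power2_eq_square)
  finally have "1 / (real J)\<^sup>2 * block_rise w s c l J \<le> X" using J by (simp add: field_simps)
  then have "2 * \<rho> * (1 / (real J)\<^sup>2 * block_rise w s c l J) \<le> 2 * \<rho> * X" using \<rho> by (intro mult_left_mono) auto
  then have "p * (1 + 2 * \<rho> / (real J)\<^sup>2 * block_rise w s c l J) \<le> p * (1 + 2 * \<rho> * X)"
    using p by (intro mult_left_mono) auto
  also have "\<dots> = picard w \<rho> v (Suc n) (s + real J * c)" using p \<rho> by (simp add: X_def)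
  finally show ?thesis by (simp add: p_def)
qed

text \<open>Each block uses up one Picard iteration, so the iterate index equals the number of
  blocks.\<close>

lemma picard_blocks_growth:
  assumes l: "1 \<le> l" "l \<le> c" and J: "0 < J" and v: "1 + real m * (real J * c) \<le> v - 1"
  shows "(\<Prod>k<m. 1 + 2 * \<rho> / (real J)\<^sup>2 * block_rise w (1 + real k * (real J * c)) c l J)
    \<le> picard w \<rho> v m (1 + real m * (real J * c))"
  using v
proof (induction m)
  case (Suc m)
  have Jc: "0 < real J * c" using J l by simp
  have m: "1 + real m * (real J * c) \<le> v - 1" using Suc.prems Jc by (simp add: distrib_right)
  have "(\<Prod>k<Suc m. 1 + 2 * \<rho> / (real J)\<^sup>2 * block_rise w (1 + real k * (real J * c)) c l J)
     \<le> picard w \<rho> v m (1 + real m * (real J * c)) * (1 + 2 * \<rho> / (real J)\<^sup>2 * block_rise w (1 + real m * (real J * c)) c l J)"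
    using Suc.IH[OF m] \<rho> block_rise_nonneg by (auto intro!: mult_right_mono add_nonneg_nonneg)
  also have "\<dots> \<le> picard w \<rho> v (Suc m) (1 + real m * (real J * c) + real J * c)"
    using Suc.prems Jc l J by (intro picard_block_growth) (auto simp: distrib_right)
  also have "1 + real m * (real J * c) + real J * c = 1 + real (Suc m) * (real J * c)"
    by (simp add: distrib_right)
  finally show ?case .
qed simp

end

text \<open>The discount rate \<open>\<rho> = 1 / t\<close> costs only a factor \<open>exp 1\<close>
  up to time \<open>t\<close>. Iterate \<open>Suc m\<close> serves as test function: its flux and
  source are given by iterate \<open>m\<close>, and it dominates that iterate, for which the product
  bound holds.\<close>

theorem quenched_blocks_upper:
  assumes w: "continuous_on UNIV w" and surj: "surj (scale_fun w)" and B: "brownian_on M {0..} B"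
    and t: "0 < t" and N: "0 < N" and l: "1 \<le> l" "l \<le> c" and J: "0 < J" and v: "1 + real m * (real J * c) \<le> v - 1"
    and A: "A \<in> sets M" "\<And>\<omega>. \<omega> \<in> A \<Longrightarrow> \<exists>u\<ge>0. u < N \<and> scale_fun w v < B u \<omega> \<and> clock (speed_rate w) (\<lambda>r. B r \<omega>) u < t"
  shows "measure M A \<le> exp 1 * (\<Prod>k<m. 1 / (1 + 2 / (t * (real J)\<^sup>2) * block_rise w (1 + real k * (real J * c)) c l J))"
proof -
  define \<rho> where "\<rho> = 1 / t"
  have \<rho>: "0 < \<rho>" using t by (simp add: \<rho>_def)
  define G where "G = (\<Prod>k<m. 1 + 2 * \<rho> / (real J)\<^sup>2 * block_rise w (1 + real k * (real J * c)) c l J)"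
  have G: "0 < G"
    unfolding G_def using \<rho> block_rise_nonneg by (intro prod_pos) (auto intro!: add_pos_nonneg)
  let ?p = "picard w \<rho> v"
  have nn: "0 \<le> ?p n x" for n x using picard_ge_1[OF w \<rho>, of v n x] by linarith
  have "?p (Suc m) v * exp (- \<rho> * t) * measure M A \<le> ?p (Suc m) 0"
  proof (rule quenched_hitting_upper[OF w surj B t N \<rho> picard_derivative[OF w \<rho>] picard_flux_derivative[OF w \<rho>] _ _ nn, where R="\<bar>v\<bar>"])
    show "continuous_on UNIV (\<lambda>x. 2 * \<rho> * window v x * ?p m x)"
      by (intro continuous_intros continuous_window continuous_picard[OF w \<rho>])
    show "2 * \<rho> * window v x * ?p m x = 0" if "\<bar>v\<bar> < \<bar>x\<bar>" for x
      using that by (auto simp: window_eq_0 abs_if split: if_splits)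
    show "2 * \<rho> * window v x * ?p m x \<le> 2 * \<rho> * ?p (Suc m) x" for x
    proof -
      have "window v x * ?p m x \<le> 1 * ?p (Suc m) x"
        using window_bounds nn picard_le_Suc[OF w \<rho>] by (intro mult_mono) auto
      then show ?thesis using \<rho> by (simp add: mult.assoc del: picard.simps)
    qed
    show "?p (Suc m) v \<le> ?p (Suc m) x" if "v \<le> x" for x
      by (rule picard_mono[OF w \<rho> that])
  qed (use A in auto)
  moreover have "?p (Suc m) 0 = 1" by (rule picard_left[OF w \<rho>]) simp
  moreover have "\<rho> * t = 1" using t by (simp add: \<rho>_def)
  ultimately have 1: "?p (Suc m) v * measure M A \<le> exp 1"
    by (simp add: exp_minus field_simps del: picard.simps)
  have "G \<le> ?p m (1 + real m * (real J * c))"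
    unfolding G_def by (rule picard_blocks_growth[OF w \<rho> l J v])
  also have "\<dots> \<le> ?p (Suc m) (1 + real m * (real J * c))" by (rule picard_le_Suc[OF w \<rho>])
  also have "\<dots> \<le> ?p (Suc m) v" using v by (intro picard_mono[OF w \<rho>]) auto
  finally have "G * measure M A \<le> ?p (Suc m) v * measure M A" by (intro mult_right_mono) auto
  then have "G * measure M A \<le> exp 1" using 1 by linarith
  then have "measure M A \<le> exp 1 * (1 / G)" using G by (simp add: field_simps)
  also have "1 / G = (\<Prod>k<m. 1 / (1 + 2 / (t * (real J)\<^sup>2) * block_rise w (1 + real k * (real J * c)) c l J))"
    using t by (simp add: G_def \<rho>_def prod_dividef)
  finally show ?thesis .
qed

section \<open>Environments with a valley\<close>

text \<open>A bump supported on \<open>[j, j + 1]\<close> with its peak in the middle; it also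
  serves as a localised source.\<close>

definition sink :: "real \<Rightarrow> real \<Rightarrow> real" where
  "sink j z = tent (2 * (z - j) - 1)"

definition plateau :: "real \<Rightarrow> real \<Rightarrow> real \<Rightarrow> real" where
  "plateau a b x = max 0 (min 1 (min (x - a + 1) (b + 1 - x)))"

lemma sink_bounds: "0 \<le> sink j z" "sink j z \<le> 1"
  by (auto simp: sink_def)

lemma sink_outside: "z \<le> j \<or> j + 1 \<le> z \<Longrightarrow> sink j z = 0"
  unfolding sink_def by (rule tent_outside) auto

lemma sink_middle: "j + 1/4 \<le> z \<Longrightarrow> z \<le> j + 3/4 \<Longrightarrow> 1/2 \<le> sink j z"
  by (auto simp: sink_def tent_def abs_if)

lemma continuous_sink: "continuous_on UNIV (sink j)"
  unfolding sink_def[abs_def] by (intro continuous_tent continuous_intros)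

lemma plateau_bounds: "0 \<le> plateau a b z" "plateau a b z \<le> 1"
  by (auto simp: plateau_def)

lemma plateau_outside: "z \<le> a - 1 \<or> b + 1 \<le> z \<Longrightarrow> plateau a b z = 0"
  by (auto simp: plateau_def)

lemma plateau_eq_1: "a \<le> z \<Longrightarrow> z \<le> b \<Longrightarrow> plateau a b z = 1"
  by (simp add: plateau_def)

lemma continuous_plateau: "continuous_on UNIV (plateau a b)"
  unfolding plateau_def[abs_def] by (intro continuous_on_max continuous_on_min continuous_intros)

section \<open>Green potentials with a balancing sink\<close>

definition mass_upto :: "(real \<Rightarrow> real) \<Rightarrow> (real \<Rightarrow> real) \<Rightarrow> real \<Rightarrow> real \<Rightarrow> real" where
  "mass_upto w f a x = antideriv (\<lambda>z. exp (- w z) * f z) x - antideriv (\<lambda>z. exp (- w z) * f z) a"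

text \<open>The strength that a sink at \<open>j\<close> needs to absorb the whole mass of
  \<open>f\<close> under the speed density \<open>exp (- w)\<close>, so that no flux is left beyond
  \<open>j + 1\<close>.\<close>

definition sink_ratio :: "(real \<Rightarrow> real) \<Rightarrow> (real \<Rightarrow> real) \<Rightarrow> real \<Rightarrow> real \<Rightarrow> real \<Rightarrow> real" where
  "sink_ratio w f a b j = mass_upto w f a b / mass_upto w (sink j) j (j + 1)"

definition potential_flux :: "(real \<Rightarrow> real) \<Rightarrow> (real \<Rightarrow> real) \<Rightarrow> real \<Rightarrow> real \<Rightarrow> real \<Rightarrow> real \<Rightarrow> real" where
  "potential_flux w f a b j x = mass_upto w f a x - sink_ratio w f a b j * mass_upto w (sink j) j x"

text \<open>The Green potential of the source \<open>f\<close>, normalised to vanish to the right of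
  the sink: it solves \<open>exp w * (exp (- w) * u')' = sink_ratio * sink - f\<close>. Without the
  sink it could not be constant on both sides of a bounded interval.\<close>

definition potential :: "(real \<Rightarrow> real) \<Rightarrow> (real \<Rightarrow> real) \<Rightarrow> real \<Rightarrow> real \<Rightarrow> real \<Rightarrow> real \<Rightarrow> real" where
  "potential w f a b j x = antideriv (\<lambda>y. exp (w y) * potential_flux w f a b j y) (j + 1)
     - antideriv (\<lambda>y. exp (w y) * potential_flux w f a b j y) x"

lemma mass_upto_mono:
  assumes w: "continuous_on UNIV w" and f: "continuous_on UNIV f" and f0: "\<And>x. 0 \<le> f x" and xy: "x \<le> y"
  shows "mass_upto w f a x \<le> mass_upto w f a y"
  unfolding mass_upto_def using xy f0
  by (intro diff_right_mono antideriv_increasing continuous_intros w f) auto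

lemma mass_upto_left:
  assumes w: "continuous_on UNIV w" and f: "continuous_on UNIV f" and z: "\<And>z. z \<le> a \<Longrightarrow> f z = 0" and x: "x \<le> a"
  shows "mass_upto w f a x = 0"
  unfolding mass_upto_def
  using antideriv_const_diff[of "\<lambda>z. exp (- w z) * f z" x a] x z by (simp add: w f continuous_intros)

lemma mass_upto_right:
  assumes w: "continuous_on UNIV w" and f: "continuous_on UNIV f" and z: "\<And>z. b \<le> z \<Longrightarrow> f z = 0" and x: "b \<le> x"
  shows "mass_upto w f a x = mass_upto w f a b"
  unfolding mass_upto_def
  using antideriv_const_diff[of "\<lambda>z. exp (- w z) * f z" b x] x z by (simp add: w f continuous_intros)

lemma mass_upto_derivative:
  assumes w: "continuous_on UNIV w" and f: "continuous_on UNIV f"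
  shows "(mass_upto w f a has_real_derivative exp (- w x) * f x) (at x)"
proof -
  have "((\<lambda>x. antideriv (\<lambda>z. exp (- w z) * f z) x - antideriv (\<lambda>z. exp (- w z) * f z) a) has_real_derivative exp (- w x) * f x - 0) (at x)"
    by (intro DERIV_diff DERIV_const antideriv_has_derivative continuous_intros w f)
  then show ?thesis by (simp add: mass_upto_def[abs_def])
qed

text \<open>On the middle half of the bump, of length 1/2, the bump is at least 1/2; this gives the
  factor 1/4.\<close>

lemma sink_mass_ge:
  assumes w: "continuous_on UNIV w" and e: "\<And>y. j \<le> y \<Longrightarrow> y \<le> j + 1 \<Longrightarrow> w y \<le> e"
  shows "exp (- e) / 4 \<le> mass_upto w (sink j) j (j + 1)"
proof -
  note s = continuous_sink[of j]
  have "exp (- e) / 2 * (j + 3/4 - (j + 1/4))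
      \<le> antideriv (\<lambda>z. exp (- w z) * sink j z) (j + 3/4) - antideriv (\<lambda>z. exp (- w z) * sink j z) (j + 1/4)"
  proof (rule antideriv_ge)
    show "continuous_on UNIV (\<lambda>z. exp (- w z) * sink j z)" by (intro continuous_intros w s)
    fix x assume x: "j + 1/4 \<le> x" "x \<le> j + 3/4"
    have "exp (- e) * (1/2) \<le> exp (- w x) * sink j x"
      using x e[of x] sink_middle[OF x] by (intro mult_mono) auto
    then show "exp (- e) / 2 \<le> exp (- w x) * sink j x" by simp
  qed simp
  also have "\<dots> = mass_upto w (sink j) j (j + 3/4) - mass_upto w (sink j) j (j + 1/4)"
    by (simp add: mass_upto_def)
  also have "\<dots> \<le> mass_upto w (sink j) j (j + 1) - 0"
  proof (rule diff_mono)
    show "mass_upto w (sink j) j (j + 3/4) \<le> mass_upto w (sink j) j (j + 1)"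
      by (intro mass_upto_mono w s sink_bounds) simp
    have "mass_upto w (sink j) j j \<le> mass_upto w (sink j) j (j + 1/4)"
      by (intro mass_upto_mono w s sink_bounds) simp
    then show "0 \<le> mass_upto w (sink j) j (j + 1/4)" by (simp add: mass_upto_def)
  qed
  finally show ?thesis by simp
qed

lemma sink_mass_pos:
  assumes w: "continuous_on UNIV w"
  shows "0 < mass_upto w (sink j) j (j + 1)"
proof -
  have "bounded (w ` {j..j + 1})"
    by (intro compact_imp_bounded compact_continuous_image continuous_on_subset[OF w]) auto
  then obtain e where "\<forall>y\<in>{j..j+1}. \<bar>w y\<bar> \<le> e" by (auto simp: bounded_iff)
  then have "w y \<le> e" if "j \<le> y" "y \<le> j + 1" for y using that by force
  from sink_mass_ge[OF w this] have "exp (- e) / 4 \<le> mass_upto w (sink j) j (j + 1)" .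
  moreover have "0 < exp (- e) / 4" by simp
  ultimately show ?thesis by linarith
qed

context
  fixes w f :: "real \<Rightarrow> real" and a b j :: real
  assumes w: "continuous_on UNIV w" and f: "continuous_on UNIV f"
    and f01: "\<And>x. 0 \<le> f x" "\<And>x. f x \<le> 1"
    and supp: "\<And>z. z \<le> a \<or> b \<le> z \<Longrightarrow> f z = 0" and ab: "a \<le> b" "b \<le> j"
begin

lemma mass_nonneg: "0 \<le> mass_upto w f a x"
proof (cases "x \<le> a")
  case False
  then show ?thesis using mass_upto_mono[OF w f f01(1), of a x a] by (simp add: mass_upto_def)
qed (use mass_upto_left[OF w f] supp in simp)

lemma mass_le: "mass_upto w f a x \<le> mass_upto w f a b"
proof (cases "b \<le> x")
  case True
  then show ?thesis using mass_upto_right[OF w f, of b x a] supp by simp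
qed (use mass_upto_mono[OF w f f01(1)] in simp)

lemma sink_ratio_nonneg: "0 \<le> sink_ratio w f a b j"
  unfolding sink_ratio_def using mass_nonneg sink_mass_pos[OF w, of j] by (simp add: less_imp_le)

lemma sink_part_nonneg: "0 \<le> mass_upto w (sink j) j x"
proof (cases "x \<le> j")
  case False
  then show ?thesis using mass_upto_mono[OF w continuous_sink sink_bounds(1), of j x j j] by (simp add: mass_upto_def)
next
  case True
  have "mass_upto w (sink j) j x = 0"
    by (rule mass_upto_left[OF w continuous_sink]) (auto intro: sink_outside True)
  then show ?thesis by simp
qed

lemma potential_flux_le: "potential_flux w f a b j x \<le> mass_upto w f a x"
  unfolding potential_flux_def using sink_ratio_nonneg sink_part_nonneg by simp

lemma potential_flux_left_of_sink: "x \<le> j \<Longrightarrow> potential_flux w f a b j x = mass_upto w f a x"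
proof -
  assume "x \<le> j"
  then have "mass_upto w (sink j) j x = 0"
    by (intro mass_upto_left[OF w continuous_sink]) (auto intro: sink_outside)
  then show ?thesis by (simp add: potential_flux_def)
qed

text \<open>Left of the sink the flux is the accumulated mass. Further right the sink has absorbed
  at most its full share, which by the choice of the ratio is the total mass.\<close>

lemma potential_flux_nonneg: "0 \<le> potential_flux w f a b j x"
proof (cases "x \<le> j")
  case False
  then have x: "mass_upto w f a x = mass_upto w f a b"
    using mass_upto_right[OF w f, of b x a] supp ab by simp
  have "mass_upto w (sink j) j x \<le> mass_upto w (sink j) j (j + 1)"
  proof (cases "j + 1 \<le> x")
    case True
    then have "mass_upto w (sink j) j x = mass_upto w (sink j) j (j + 1)"
      by (intro mass_upto_right[OF w continuous_sink]) (auto intro: sink_outside)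
    then show ?thesis by simp
  qed (use mass_upto_mono[OF w continuous_sink sink_bounds(1)] in simp)
  then have "sink_ratio w f a b j * mass_upto w (sink j) j x \<le> sink_ratio w f a b j * mass_upto w (sink j) j (j + 1)"
    using sink_ratio_nonneg by (intro mult_left_mono)
  also have "\<dots> = mass_upto w f a b" using sink_mass_pos[OF w, of j] by (simp add: sink_ratio_def)
  finally show ?thesis by (simp add: potential_flux_def x)
qed (simp add: potential_flux_left_of_sink mass_nonneg)

lemma potential_flux_zero: "x \<le> a \<or> j + 1 \<le> x \<Longrightarrow> potential_flux w f a b j x = 0"
proof (cases "x \<le> a")
  case True
  then show ?thesis using potential_flux_left_of_sink[of x] mass_upto_left[OF w f, of a x] supp ab by simp
next
  case False
  assume "x \<le> a \<or> j + 1 \<le> x"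
  with False have x: "j + 1 \<le> x" by simp
  then have "mass_upto w f a x = mass_upto w f a b"
    using mass_upto_right[OF w f, of b x a] supp ab by simp
  moreover have "mass_upto w (sink j) j x = mass_upto w (sink j) j (j + 1)"
    by (intro mass_upto_right[OF w continuous_sink] x) (auto intro: sink_outside)
  ultimately show ?thesis
    using sink_mass_pos[OF w, of j] by (simp add: potential_flux_def sink_ratio_def)
qed

lemma potential_flux_derivative:
  "((\<lambda>x. - potential_flux w f a b j x) has_real_derivative exp (- w x) * (sink_ratio w f a b j * sink j x - f x)) (at x)"
proof -
  have "((\<lambda>x. - (mass_upto w f a x - sink_ratio w f a b j * mass_upto w (sink j) j x)) has_real_derivative
      - (exp (- w x) * f x - sink_ratio w f a b j * (exp (- w x) * sink j x))) (at x)"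
    by (intro DERIV_minus DERIV_diff DERIV_cmult mass_upto_derivative w f continuous_sink)
  then show ?thesis by (simp add: potential_flux_def[abs_def] algebra_simps)
qed

lemma continuous_potential_flux: "continuous_on UNIV (\<lambda>y. exp (w y) * potential_flux w f a b j y)"
proof -
  have cm: "continuous_on UNIV (\<lambda>x. mass_upto w g c x)" if "continuous_on UNIV g" for g c
    using mass_upto_derivative[OF w that] by (intro DERIV_continuous_on) (auto intro: has_field_derivative_at_within)
  then show ?thesis unfolding potential_flux_def by (intro continuous_intros w cm f continuous_sink)
qed

lemma potential_derivative: "(potential w f a b j has_real_derivative exp (w x) * - potential_flux w f a b j x) (at x)"
proof -
  have "((\<lambda>x. antideriv (\<lambda>y. exp (w y) * potential_flux w f a b j y) (j + 1) - antideriv (\<lambda>y. exp (w y) * potential_flux w f a b j y) x)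
      has_real_derivative 0 - exp (w x) * potential_flux w f a b j x) (at x)"
    by (intro DERIV_diff DERIV_const antideriv_has_derivative continuous_potential_flux)
  then show ?thesis by (simp add: potential_def[abs_def])
qed

lemma potential_diff: "x \<le> y \<Longrightarrow> potential w f a b j y \<le> potential w f a b j x"
  unfolding potential_def using potential_flux_nonneg
  by (intro diff_left_mono antideriv_increasing continuous_potential_flux) auto

lemma potential_right: "j + 1 \<le> x \<Longrightarrow> potential w f a b j x = 0"
  unfolding potential_def
  using antideriv_const_diff[OF continuous_potential_flux, of "j + 1" x] potential_flux_zero by simp

lemma potential_nonneg: "0 \<le> potential w f a b j x"
proof (cases "x \<le> j + 1")
  case True
  then show ?thesis using potential_diff[OF True] potential_right[of "j + 1"] by simp
qed (simp add: potential_right)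

lemma potential_left: "x \<le> a \<Longrightarrow> potential w f a b j x = potential w f a b j a"
  unfolding potential_def
  using antideriv_const_diff[OF continuous_potential_flux, of x a] potential_flux_zero by simp

text \<open>Between source and sink the flux carries the whole mass of \<open>f\<close>, so a unit
  interval there of height at least \<open>m\<close> is a barrier that contributes this mass times
  \<open>exp m\<close>.\<close>

lemma potential_ge:
  assumes "x \<le> c" "b \<le> c" "c + 1 \<le> j" and m: "\<And>y. c \<le> y \<Longrightarrow> y \<le> c + 1 \<Longrightarrow> m \<le> w y"
  shows "mass_upto w f a b * exp m \<le> potential w f a b j x"
proof -
  have "mass_upto w f a b * exp m * (c + 1 - c)
      \<le> antideriv (\<lambda>y. exp (w y) * potential_flux w f a b j y) (c + 1) - antideriv (\<lambda>y. exp (w y) * potential_flux w f a b j y) c"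
  proof (rule antideriv_ge[OF continuous_potential_flux])
    fix y assume y: "c \<le> y" "y \<le> c + 1"
    have "potential_flux w f a b j y = mass_upto w f a b"
      using potential_flux_left_of_sink[of y] mass_upto_right[OF w f, of b y a] supp assms y by simp
    then show "mass_upto w f a b * exp m \<le> exp (w y) * potential_flux w f a b j y"
      using mult_right_mono[of "exp m" "exp (w y)", OF _ mass_nonneg[of b]] m[OF y] by (simp add: mult.commute)
  qed simp
  also have "\<dots> = potential w f a b j c - potential w f a b j (c + 1)" by (simp add: potential_def)
  also have "\<dots> \<le> potential w f a b j x"
    using potential_diff[of x c] potential_nonneg[of "c + 1"] assms by linarith
  finally show ?thesis by simp
qed

lemma potential_le_mass:
  assumes x: "x \<le> j + 1" and m: "\<And>y. x \<le> y \<Longrightarrow> y \<le> j + 1 \<Longrightarrow> w y \<le> m"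
  shows "potential w f a b j x \<le> (j + 1 - x) * (mass_upto w f a b * exp m)"
proof -
  have "antideriv (\<lambda>y. exp (w y) * potential_flux w f a b j y) (j + 1) - antideriv (\<lambda>y. exp (w y) * potential_flux w f a b j y) x
      \<le> exp m * mass_upto w f a b * (j + 1 - x)"
  proof (rule antideriv_le[OF continuous_potential_flux x])
    fix y assume y: "x \<le> y" "y \<le> j + 1"
    show "exp (w y) * potential_flux w f a b j y \<le> exp m * mass_upto w f a b"
      using m[OF y] potential_flux_nonneg order_trans[OF potential_flux_le mass_le] by (intro mult_mono) auto
  qed
  then show ?thesis by (simp add: potential_def mult_ac)
qed

text \<open>The potential is at most a double integral of \<open>exp (w y - w z)\<close> over
  \<open>z \<le> y\<close>, so a bound on the rises from source points suffices, whatever the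
  absolute heights of the environment.\<close>

lemma potential_le_pairs:
  assumes x: "a \<le> x" "x \<le> j + 1"
    and e: "\<And>y z. x \<le> y \<Longrightarrow> y \<le> j + 1 \<Longrightarrow> a \<le> z \<Longrightarrow> z \<le> b \<Longrightarrow> z \<le> y \<Longrightarrow> w y - w z \<le> e"
  shows "potential w f a b j x \<le> (j + 1 - a)\<^sup>2 * exp e"
proof -
  have "antideriv (\<lambda>y. exp (w y) * potential_flux w f a b j y) (j + 1) - antideriv (\<lambda>y. exp (w y) * potential_flux w f a b j y) x
      \<le> (j + 1 - a) * exp e * (j + 1 - x)"
  proof (rule antideriv_le[OF continuous_potential_flux x(2)])
    fix y assume y: "x \<le> y" "y \<le> j + 1"
    have "antideriv (\<lambda>z. exp (- w z) * f z) y - antideriv (\<lambda>z. exp (- w z) * f z) a \<le> exp (e - w y) * (y - a)"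
    proof (rule antideriv_le)
      show "continuous_on UNIV (\<lambda>z. exp (- w z) * f z)" by (intro continuous_intros w f)
      fix z assume z: "a \<le> z" "z \<le> y"
      show "exp (- w z) * f z \<le> exp (e - w y)"
      proof (cases "z \<le> b")
        case True
        have "exp (- w z) * f z \<le> exp (e - w y) * 1"
          using e[OF y z(1) True z(2)] f01 by (intro mult_mono) auto
        then show ?thesis by simp
      qed (use supp in simp)
    qed (use x y in simp)
    then have "mass_upto w f a y \<le> exp (e - w y) * (y - a)" by (simp add: mass_upto_def)
    then have "potential_flux w f a b j y \<le> exp (e - w y) * (y - a)" using potential_flux_le order_trans by blast
    then have "exp (w y) * potential_flux w f a b j y \<le> exp (w y) * (exp (e - w y) * (y - a))" by (intro mult_left_mono) auto
    also have "\<dots> = exp e * (y - a)" by (simp flip: exp_add mult.assoc)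
    also have "\<dots> \<le> exp e * (j + 1 - a)" using y by (intro mult_left_mono) auto
    finally show "exp (w y) * potential_flux w f a b j y \<le> (j + 1 - a) * exp e" by (simp add: mult.commute)
  qed
  also have "\<dots> \<le> (j + 1 - a) * exp e * (j + 1 - a)" using x ab by (intro mult_left_mono) auto
  finally show ?thesis by (simp add: potential_def power2_eq_square mult_ac)
qed

lemma sink_ratio_le:
  assumes m: "\<And>y. j \<le> y \<Longrightarrow> y \<le> j + 1 \<Longrightarrow> w y \<le> m"
  shows "sink_ratio w f a b j \<le> 4 * (mass_upto w f a b * exp m)"
proof -
  have "sink_ratio w f a b j \<le> mass_upto w f a b / (exp (- m) / 4)"
    unfolding sink_ratio_def using sink_mass_ge[OF w m] sink_mass_pos[OF w, of j] mass_nonneg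
    by (intro divide_left_mono mult_pos_pos) auto
  also have "\<dots> = 4 * (mass_upto w f a b * exp m)" by (simp add: exp_minus field_simps)
  finally show ?thesis .
qed

lemma mass_le_length:
  assumes m: "\<And>y. a \<le> y \<Longrightarrow> y \<le> b \<Longrightarrow> m \<le> w y"
  shows "mass_upto w f a b \<le> (b - a) * exp (- m)"
proof -
  have "antideriv (\<lambda>z. exp (- w z) * f z) b - antideriv (\<lambda>z. exp (- w z) * f z) a \<le> exp (- m) * (b - a)"
  proof (rule antideriv_le)
    show "continuous_on UNIV (\<lambda>z. exp (- w z) * f z)" by (intro continuous_intros w f)
    fix z assume z: "a \<le> z" "z \<le> b"
    have "exp (- w z) * f z \<le> exp (- m) * 1"
      using m[OF z] f01 by (intro mult_mono) auto
    then show "exp (- w z) * f z \<le> exp (- m)" by simp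
  qed (use ab in simp)
  then show ?thesis by (simp add: mass_upto_def mult.commute)
qed

end

text \<open>In units of \<open>L = ln t\<close> the environment has a wall of height about 8 on the
  left, rises of at most 1 up to \<open>V\<close>, and a descent by about 8 behind \<open>V\<close>.
  Reaching the valley takes time of order at most \<open>U\<close>, governed by
  \<open>exp a\<close>, whereas passing the left wall or climbing back from the valley carries
  weights of order \<open>exp (- 3 * L)\<close>, small even after multiplication by the available
  time \<open>t\<close>.\<close>

theorem quenched_valley_lower:
  assumes w: "continuous_on UNIV w" "w 0 = 0" and surj: "surj (scale_fun w)" and B: "brownian_on M {0..} B"
    and N: "0 < N" and L: "0 < L" "10 \<le> L\<^sup>2" and e: "8 / L \<le> e" "e \<le> L / 10" and aL: "0 \<le> a" "a \<le> L"
    and v: "0 \<le> v" "v < V"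
    and left: "\<And>x. - L\<^sup>2 \<le> x \<Longrightarrow> x \<le> 0 \<Longrightarrow> \<bar>w x - w (- L\<^sup>2) - (- 8 / L) * (x - - L\<^sup>2)\<bar> \<le> e"
    and rise: "\<And>x y. 0 \<le> x \<Longrightarrow> x \<le> y \<Longrightarrow> y \<le> V \<Longrightarrow> w y - w x \<le> a"
    and right: "\<And>x. V \<le> x \<Longrightarrow> x \<le> V + L\<^sup>2 \<Longrightarrow> \<bar>w x - w V - (- 8 / L) * (x - V)\<bar> \<le> e"
    and D: "D = V + 2 * L\<^sup>2" and U: "D\<^sup>2 * exp (a + 5 * e) \<le> U" "1 \<le> U"
    and t: "t = exp L"
    and A: "A \<in> sets M" "\<And>\<omega>. \<omega> \<in> A \<Longrightarrow> t < clock (speed_rate w) (\<lambda>r. B r \<omega>) N \<and>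
        (\<exists>u\<ge>0. clock (speed_rate w) (\<lambda>r. B r \<omega>) u = t \<and> B u \<omega> \<le> scale_fun w v)"
  shows "measure M A \<le> 2 * exp (- t / (4 * U)) + D / t ^ 3 + (t + 1) * (D\<^sup>2 * exp (2 * e) / (2 * U\<^sup>2) + 14 * D / t ^ 3)"
proof -
  define l where "l = L\<^sup>2"
  \<comment> \<open>The sink sits at the bottom of the valley, with \<open>j + 1 = V + l\<close>. To
    the left of \<open>x0\<close> lie the unit source at \<open>- l\<close> and the unit flank of
    the plateau. The point \<open>x1\<close> is the middle of the right descent, at depth about
    \<open>4 * L\<close>.\<close>
  define j where "j = V + l - 1"
  define x0 where "x0 = - l + 2"
  define x1 where "x1 = V + l / 2"
  have l: "10 \<le> l" using L by (simp add: l_def)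
  have V: "0 < V" using v by simp
  have D1: "1 \<le> D" "0 < D" using l V unfolding D l_def by auto
  have Ll: "8 / L * l = 8 * L" "8 / L * (l / 2) = 4 * L" using L by (auto simp: l_def power2_eq_square)
  have e0: "0 < e" using e L by (smt (verit) divide_pos_pos)
  have slope: "8 / L * r \<le> 8 / L * s" if "r \<le> s" for r s using that L by (intro mult_left_mono) auto
  have slope0: "0 \<le> 8 / L * r" if "0 \<le> r" for r using that L by simp
  have W_left: "- (8 / L * x) - 2 * e \<le> w x" "w x \<le> - (8 / L * x) + 2 * e" if "- l \<le> x" "x \<le> 0" for x
  proof -
    have eq: "(- 8 / L) * (y - - L\<^sup>2) = - (8 / L * y) - 8 / L * L\<^sup>2" for y
      by (simp add: algebra_simps add_divide_distrib)
    have "\<bar>w x - w (- L\<^sup>2) - (- (8 / L * x) - 8 / L * L\<^sup>2)\<bar> \<le> e"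
      using left[of x] that unfolding eq l_def by blast
    moreover have "\<bar>0 - w (- L\<^sup>2) - (- (8 / L * 0) - 8 / L * L\<^sup>2)\<bar> \<le> e"
      using left[of 0] w(2) unfolding eq by simp
    ultimately show "- (8 / L * x) - 2 * e \<le> w x" "w x \<le> - (8 / L * x) + 2 * e" by linarith+
  qed
  have W_mid: "w x \<le> a" if "0 \<le> x" "x \<le> V" for x
    using rise[of 0 x] that w(2) by simp
  have W_V: "w V - a \<le> w x" if "0 \<le> x" "x \<le> V" for x using rise[of x V] that by simp
  have W_right: "w V - 8 / L * (x - V) - e \<le> w x" "w x \<le> w V - 8 / L * (x - V) + e" if "V \<le> x" "x \<le> V + l" for x
  proof -
    have eq: "(- 8 / L) * (x - V) = - (8 / L * (x - V))" by simp
    have "\<bar>w x - w V - - (8 / L * (x - V))\<bar> \<le> e"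
      using right[of x] that unfolding eq l_def by blast
    then show "w V - 8 / L * (x - V) - e \<le> w x" "w x \<le> w V - 8 / L * (x - V) + e" by linarith+
  qed
  have wV: "w V \<le> a" using W_mid[of V] V by simp
  have s1: "8 / L * 1 \<le> e" using e by simp
  have s2: "8 / L * 2 \<le> 2 * e" "8 / L * 3 \<le> 3 * e" using e by simp_all
  have below_V: "w x \<le> w V + e" if "V \<le> x" "x \<le> V + l" for x
    using W_right(2)[OF that] slope0[of "x - V"] that by simp
  have deep1: "w y \<le> w V - 4 * L + e" if "x1 \<le> y" "y \<le> V + l" for y
    using W_right(2)[of y] slope[of "l / 2" "y - V"] Ll(2) that l by (auto simp: x1_def)
  have deep2: "w y \<le> w V - 8 * L + 2 * e" if "j \<le> y" "y \<le> V + l" for y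
  proof -
    have "8 / L * (l - 1) = 8 * L - 8 / L" using Ll(1) by (simp add: right_diff_distrib)
    then show ?thesis using W_right(2)[of y] slope[of "l - 1" "y - V"] s1 that l by (auto simp: j_def)
  qed
  have near: "w V - 3 * e \<le> w z" if "V + 1 \<le> z" "z \<le> V + 2" for z
    using W_right(1)[of z] slope[of "z - V" 2] s2 that l by auto
  have high: "8 * L - 5 * e \<le> w z" if "x0 \<le> z" "z \<le> x0 + 1" for z
  proof -
    have "8 / L * (l - 3) = 8 * L - 8 / L * 3" using Ll(1) by (simp only: right_diff_distrib)
    then show ?thesis using W_left(1)[of z] slope[of "l - 3" "- z"] s2 that l by (auto simp: x0_def)
  qed
  \<comment> \<open>On the two slopes only tube errors can produce a rise, and on
    \<open>[0, V]\<close> a rise is at most \<open>a\<close>; across the junctions these bounds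
    combine.\<close>
  have pairs: "w y - w z \<le> a + 5 * e" if "- l \<le> z" "z \<le> y" "y \<le> V + l" for y z
  proof -
    consider "y \<le> 0" | "0 \<le> y" "y \<le> V" | "V \<le> y" by linarith
    then show ?thesis
    proof cases
      case 1
      then show ?thesis using W_left(2)[of y] W_left(1)[of z] slope[of "- y" "- z"] that aL e0 by auto
    next
      case 2
      then show ?thesis
        using rise[of z y] W_mid[of y] W_left(1)[of z] slope0[of "- z"] that aL e0 by (cases "z \<le> 0") auto
    next
      case 3
      consider "z \<le> 0" | "0 \<le> z" "z \<le> V" | "V \<le> z" by linarith
      then show ?thesis
      proof cases
        case 1
        then show ?thesis using below_V[of y] wV W_left(1)[of z] slope0[of "- z"] that 3 e0 by auto
      next
        case 2
        then show ?thesis using below_V[of y] W_V[of z] that 3 e0 by auto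
      next
        case 3
        then show ?thesis using W_right(1)[of z] W_right(2)[of y] slope[of "z - V" "y - V"] that aL e0 by auto
      qed
    qed
  qed
  have floor0: "w V - 4 * L - 2 * e \<le> w z" if "- l \<le> z" "z \<le> x1 + 1" for z
  proof -
    consider "z \<le> 0" | "0 \<le> z" "z \<le> V" | "V \<le> z" by linarith
    then show ?thesis
    proof cases
      case 1
      then show ?thesis using W_left(1)[of z] slope0[of "- z"] wV aL L(1) that by auto
    next
      case 2
      then show ?thesis using W_V[of z] aL L(1) e0 by auto
    next
      case 3
      have "8 / L * (l / 2 + 1) \<le> 4 * L + e" unfolding distrib_left using Ll(2) s1 by linarith
      then show ?thesis using W_right(1)[of z] slope[of "z - V" "l / 2 + 1"] that l 3 by (auto simp: x1_def)
    qed
  qed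
  \<comment> \<open>Up to an error \<open>2 * e\<close>, the lower half of the right descent lies
    below everything to its left, so these rises do not involve \<open>a\<close>.\<close>
  have pairs_deep: "w y - w z \<le> 2 * e" if "x1 \<le> y" "y \<le> V + l" "- l \<le> z" "z \<le> y" for y z
  proof -
    consider "z \<le> 0" | "0 \<le> z" "z \<le> V" | "V \<le> z" by linarith
    then show ?thesis
    proof cases
      case 1
      then show ?thesis using deep1[of y] W_left(1)[of z] slope0[of "- z"] wV aL L(1) e that by auto
    next
      case 2
      then show ?thesis using deep1[of y] W_V[of z] aL L(1) e0 that by auto
    next
      case 3
      then show ?thesis using W_right(1)[of z] W_right(2)[of y] slope[of "z - V" "y - V"] that by auto
    qed
  qed
  \<comment> \<open>The slope \<open>8 / L\<close> is chosen for this: half of the descent is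
    \<open>4 * L\<close>, and with \<open>e \<le> L / 10\<close> the worst exponent,
    \<open>- 4 * L + 4 * e\<close>, is still below \<open>- 3 * L\<close>.\<close>
  define \<epsilon> where "\<epsilon> = exp (- 3 * L)"
  have \<epsilon>: "\<epsilon> = 1 / t ^ 3" by (simp add: \<epsilon>_def t exp_minus field_simps flip: exp_of_nat_mult)
  have \<epsilon>0: "0 \<le> \<epsilon>" by (simp add: \<epsilon>_def)
  have small: "exp r * exp s \<le> \<epsilon>" if "r + s \<le> - 3 * L" for r s
    using that by (simp add: \<epsilon>_def flip: exp_add)

  \<comment> \<open>Divided by its value at \<open>V\<close>, \<open>fv\<close> weighs the return
    from the valley to \<open>V\<close>; divided by its value at \<open>x0\<close>,
    \<open>fl\<close> weighs the exit to the left; \<open>f0\<close> measures the time spent on the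
    plateau before the valley is reached.\<close>
  define fv where "fv = potential w (sink V) V (V + 1) j"
  define fl where "fl = potential w (sink (- l)) (- l) (- l + 1) j"
  define f0 where "f0 = potential w (plateau x0 x1) (x0 - 1) (x1 + 1) j"
  define cv where "cv = sink_ratio w (sink V) V (V + 1) j"
  define cl where "cl = sink_ratio w (sink (- l)) (- l) (- l + 1) j"
  define c0 where "c0 = sink_ratio w (plateau x0 x1) (x0 - 1) (x1 + 1) j"
  define qv where "qv = potential_flux w (sink V) V (V + 1) j"
  define ql where "ql = potential_flux w (sink (- l)) (- l) (- l + 1) j"
  define q0 where "q0 = potential_flux w (plateau x0 x1) (x0 - 1) (x1 + 1) j"
  have ordl: "- l \<le> - l + 1" "- l + 1 \<le> j" and ordv: "V \<le> V + 1" "V + 1 \<le> j"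
    and ord0: "x0 - 1 \<le> x1 + 1" "x1 + 1 \<le> j" using l V by (auto simp: j_def x0_def x1_def)
  note pv = w(1) continuous_sink[of V] sink_bounds[of V] sink_outside[of _ V] ordv
  note pl = w(1) continuous_sink[of "- l"] sink_bounds[of "- l"] sink_outside[of _ "- l"] ordl
  have p0_out: "plateau x0 x1 z = 0" if "z \<le> x0 - 1 \<or> x1 + 1 \<le> z" for z using that by (rule plateau_outside)
  note p0 = w(1) continuous_plateau plateau_bounds p0_out ord0
  define mv where "mv = mass_upto w (sink V) V (V + 1)"
  define ml where "ml = mass_upto w (sink (- l)) (- l) (- l + 1)"
  define m0 where "m0 = mass_upto w (plateau x0 x1) (x0 - 1) (x1 + 1)"
  have mv: "0 < mv" and ml: "0 < ml" unfolding mv_def ml_def by (rule sink_mass_pos[OF w(1)])+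
  have m0: "0 \<le> m0" unfolding m0_def by (rule mass_nonneg[OF p0])

  have fv_V: "mv * exp (w V - 3 * e) \<le> fv V"
    unfolding fv_def mv_def by (rule potential_ge[OF pv, where c="V + 1"]) (use near l in \<open>auto simp: j_def\<close>)
  have fl_x0: "ml * exp (8 * L - 5 * e) \<le> fl x0"
    unfolding fl_def ml_def by (rule potential_ge[OF pl, where c=x0]) (use high l V in \<open>auto simp: j_def x0_def\<close>)
  have fvV0: "0 < fv V" and flx0: "0 < fl x0"
    by (rule less_le_trans[OF _ fv_V] less_le_trans[OF _ fl_x0]; simp add: mv ml)+
  have j1: "j + 1 = V + l" by (simp add: j_def)
  have len: "V + l - x1 \<le> D" "0 \<le> V + l - x1" "V + l \<le> D" "V + l - (x0 - 1) \<le> D" "x1 + 1 - (x0 - 1) \<le> D"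
    using l V by (auto simp: D x1_def x0_def l_def)
  have ratio: "y / z \<le> c" if "y \<le> c * z'" "z' \<le> z" "0 < z" "0 \<le> c" for y z z' c :: real
  proof -
    have "y \<le> c * z" using that mult_left_mono[of z' z c] by linarith
    then show ?thesis using that by (simp add: pos_divide_le_eq)
  qed
  have b1: "fv x1 / fv V \<le> D * \<epsilon>"
  proof (rule ratio[OF _ fv_V fvV0])
    have "fv x1 \<le> (V + l - x1) * (mv * exp (w V - 4 * L + e))"
      unfolding fv_def mv_def using potential_le_mass[OF pv, of x1 "w V - 4 * L + e"] deep1 len j1 by simp
    also have "\<dots> \<le> D * (mv * exp (w V - 4 * L + e))" using len mv by (intro mult_right_mono) auto
    also have "exp (w V - 4 * L + e) = exp (w V - 3 * e) * exp (- 4 * L + 4 * e)" by (simp flip: exp_add)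
    also have "exp (- 4 * L + 4 * e) \<le> \<epsilon>" using small[of "- 4 * L + 4 * e" 0] e e0 L(1) by simp
    finally show "fv x1 \<le> D * \<epsilon> * (mv * exp (w V - 3 * e))" using D1 mv by (simp add: mult_ac)
  qed (use D1 \<epsilon>0 in simp)
  have b2: "cv / fv V \<le> 4 * \<epsilon>"
  proof (rule ratio[OF _ fv_V fvV0])
    have "cv \<le> 4 * (mv * exp (w V - 8 * L + 2 * e))"
      unfolding cv_def mv_def using deep2 j1 by (intro sink_ratio_le[OF pv]) auto
    also have "exp (w V - 8 * L + 2 * e) = exp (w V - 3 * e) * exp (- 8 * L + 5 * e)" by (simp flip: exp_add)
    also have "exp (- 8 * L + 5 * e) \<le> \<epsilon>" using small[of "- 8 * L + 5 * e" 0] e L e0 L(1) by simp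
    finally show "cv \<le> 4 * \<epsilon> * (mv * exp (w V - 3 * e))" using mv by (simp add: mult_ac)
  qed (use \<epsilon>0 in simp)
  have b3: "cl / fl x0 \<le> 4 * \<epsilon>"
  proof (rule ratio[OF _ fl_x0 flx0])
    have "cl \<le> 4 * (ml * exp (w V - 8 * L + 2 * e))"
      unfolding cl_def ml_def using deep2 j1 by (intro sink_ratio_le[OF pl]) auto
    also have "exp (w V - 8 * L + 2 * e) = exp (8 * L - 5 * e) * exp (w V - 16 * L + 7 * e)" by (simp flip: exp_add)
    also have "exp (w V - 16 * L + 7 * e) \<le> \<epsilon>" using small[of "w V - 16 * L + 7 * e" 0] e L wV aL e0 L(1) by simp
    finally show "cl \<le> 4 * \<epsilon> * (ml * exp (8 * L - 5 * e))" using ml by (simp add: mult_ac)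
  qed (use \<epsilon>0 in simp)
  have b4: "fl 0 / fl x0 \<le> D * \<epsilon>"
  proof (rule ratio[OF _ fl_x0 flx0])
    have "fl 0 \<le> (V + l - 0) * (ml * exp (a + e))"
      unfolding fl_def ml_def j1[symmetric]
    proof (rule potential_le_mass[OF pl])
      fix y assume y: "0 \<le> y" "y \<le> j + 1"
      show "w y \<le> a + e"
      proof (cases "y \<le> V")
        case True
        then show ?thesis using W_mid[of y] y e0 by simp
      next
        case False
        then show ?thesis using below_V[of y] y j1 wV by simp
      qed
    qed (use j1 l V in auto)
    also have "\<dots> \<le> D * (ml * exp (a + e))" using len ml by (intro mult_right_mono) auto
    also have "exp (a + e) = exp (8 * L - 5 * e) * exp (a - 8 * L + 6 * e)" by (simp flip: exp_add)
    also have "exp (a - 8 * L + 6 * e) \<le> \<epsilon>" using small[of "a - 8 * L + 6 * e" 0] e L aL e0 L(1) by simp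
    finally show "fl 0 \<le> D * \<epsilon> * (ml * exp (8 * L - 5 * e))" using D1 ml by (simp add: mult_ac)
  qed (use D1 \<epsilon>0 in simp)
  have b5: "c0 \<le> 4 * D * \<epsilon>"
  proof -
    have "c0 \<le> 4 * (m0 * exp (w V - 8 * L + 2 * e))"
      unfolding c0_def m0_def using deep2 j1 by (intro sink_ratio_le[OF p0]) auto
    also have "m0 \<le> (x1 + 1 - (x0 - 1)) * exp (- (w V - 4 * L - 2 * e))"
      unfolding m0_def using floor0 by (intro mass_le_length[OF p0]) (auto simp: x0_def)
    also have "\<dots> \<le> D * exp (- (w V - 4 * L - 2 * e))" using len by (intro mult_right_mono) auto
    also have "4 * (D * exp (- (w V - 4 * L - 2 * e)) * exp (w V - 8 * L + 2 * e))
        = 4 * D * (exp (- (w V - 4 * L - 2 * e)) * exp (w V - 8 * L + 2 * e))" by (simp only: mult_ac)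
    also have "\<dots> \<le> 4 * D * \<epsilon>" using D1 e e0 L(1) by (intro mult_left_mono small) auto
    finally show ?thesis by simp
  qed
  have f0_U: "f0 x \<le> U" for x
  proof -
    have "f0 (x0 - 1) \<le> (j + 1 - (x0 - 1))\<^sup>2 * exp (a + 5 * e)"
      unfolding f0_def using pairs j1 ord0 by (intro potential_le_pairs[OF p0]) (auto simp: x0_def)
    also have "\<dots> \<le> D\<^sup>2 * exp (a + 5 * e)"
      using len j1 ord0 by (intro mult_right_mono power_mono) auto
    also have "\<dots> \<le> U" by (rule U)
    finally have "f0 (x0 - 1) \<le> U" .
    moreover have "f0 x \<le> f0 (x0 - 1)"
      unfolding f0_def using potential_left[OF p0, of x] potential_diff[OF p0, of "x0 - 1" x] by (cases "x \<le> x0 - 1") auto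
    ultimately show ?thesis by simp
  qed
  have b6: "f0 x1 \<le> D\<^sup>2 * exp (2 * e)"
  proof -
    have "f0 x1 \<le> (j + 1 - (x0 - 1))\<^sup>2 * exp (2 * e)"
      unfolding f0_def using pairs_deep j1 l V by (intro potential_le_pairs[OF p0]) (auto simp: x0_def x1_def)
    also have "\<dots> \<le> D\<^sup>2 * exp (2 * e)"
      using len j1 ord0 by (intro mult_right_mono power_mono) auto
    finally show ?thesis .
  qed

  define g where "g x = fv x / fv V + f0 x / U" for x
  define k where "k x = fl x / fl x0" for x
  define \<kappa>g where "\<kappa>g x = - qv x / fv V - q0 x / U" for x
  define \<kappa>k where "\<kappa>k x = - ql x / fl x0" for x
  define rg where "rg x = (cv * sink j x - sink V x) / fv V + (c0 * sink j x - plateau x0 x1 x) / U" for x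
  define rk where "rk x = (cl * sink j x - sink (- l) x) / fl x0" for x
  \<comment> \<open>Since \<open>g\<close> is at most 2, this rate satisfies
    \<open>2 * \<alpha> * g \<le> 1 / U\<close>, which is what the plateau part of \<open>rg\<close>
    provides between \<open>x0\<close> and \<open>x1\<close>.\<close>
  define \<alpha> where "\<alpha> = 1 / (4 * U)"
  define \<beta> where "\<beta> = \<alpha> * g x1 + (cv / fv V + c0 / U + cl / fl x0) / 2"
  have U0: "0 < U" using U by simp
  have nn: "0 \<le> fv x" "0 \<le> f0 x" "0 \<le> fl x" "0 \<le> cv" "0 \<le> c0" "0 \<le> cl" for x
    unfolding fv_def f0_def fl_def cv_def c0_def cl_def
    using potential_nonneg[OF pv] potential_nonneg[OF p0] potential_nonneg[OF pl]
      sink_ratio_nonneg[OF pv] sink_ratio_nonneg[OF p0] sink_ratio_nonneg[OF pl] by blast+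
  have g0: "0 \<le> g x" and k0: "0 \<le> k x" for x
    using nn fvV0 flx0 U0 by (auto simp: g_def k_def)
  have \<beta>0: "0 \<le> \<beta>" using nn g0 fvV0 flx0 U0 by (simp add: \<beta>_def \<alpha>_def)
  have fv_le: "fv x \<le> fv V" for x
    unfolding fv_def using potential_left[OF pv, of x] potential_diff[OF pv, of V x] by (cases "x \<le> V") auto
  have g2: "g x \<le> 2" for x
  proof -
    have "fv x / fv V \<le> 1" using fv_le fvV0 by simp
    moreover have "f0 x / U \<le> 1" using f0_U U0 by simp
    ultimately show ?thesis by (simp add: g_def)
  qed
  have "measure M A \<le> exp (- \<alpha> * t) * g 0 + k 0 + 2 * \<beta> * (t + 1)"
  proof (rule quenched_not_beyond[OF w(1) surj B _ N, where g=g and \<kappa>=\<kappa>g and r=rg and g'=k and \<kappa>'=\<kappa>k and r'=rk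
        and R="\<bar>V\<bar> + l + 2" and ?x0.0=x0 and ?x1.0=x1 and ?x2.0="V + l" and v'=V and v=v])
    show "0 < t" by (simp add: t)
    show "0 \<le> \<alpha>" using U0 by (simp add: \<alpha>_def)
    show "(g has_real_derivative exp (w x) * \<kappa>g x) (at x)" for x
    proof -
      have "((\<lambda>x. fv x / fv V + f0 x / U) has_real_derivative
          exp (w x) * - qv x / fv V + exp (w x) * - q0 x / U) (at x)"
        unfolding fv_def f0_def qv_def q0_def
        by (intro DERIV_add DERIV_cdivide potential_derivative[OF pv] potential_derivative[OF p0])
      then show ?thesis by (simp add: g_def[abs_def] \<kappa>g_def right_diff_distrib)
    qed
    show "(\<kappa>g has_real_derivative exp (- w x) * rg x) (at x)" for x
    proof -
      have "((\<lambda>x. - qv x / fv V + - q0 x / U) has_real_derivative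
          exp (- w x) * (cv * sink j x - sink V x) / fv V + exp (- w x) * (c0 * sink j x - plateau x0 x1 x) / U) (at x)"
        unfolding qv_def q0_def cv_def c0_def
        by (intro DERIV_add DERIV_cdivide potential_flux_derivative[OF pv] potential_flux_derivative[OF p0])
      then show ?thesis by (simp add: \<kappa>g_def[abs_def] rg_def distrib_left)
    qed
    show "(k has_real_derivative exp (w x) * \<kappa>k x) (at x)" for x
    proof -
      have "((\<lambda>x. fl x / fl x0) has_real_derivative exp (w x) * - ql x / fl x0) (at x)"
        unfolding fl_def ql_def by (intro DERIV_cdivide potential_derivative[OF pl])
      then show ?thesis by (simp add: k_def[abs_def] \<kappa>k_def)
    qed
    show "(\<kappa>k has_real_derivative exp (- w x) * rk x) (at x)" for x
    proof -
      have "((\<lambda>x. - ql x / fl x0) has_real_derivative exp (- w x) * (cl * sink j x - sink (- l) x) / fl x0) (at x)"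
        unfolding ql_def cl_def by (intro DERIV_cdivide potential_flux_derivative[OF pl])
      then show ?thesis by (simp add: \<kappa>k_def[abs_def] rk_def)
    qed
    show "continuous_on UNIV rg" "continuous_on UNIV rk"
      unfolding rg_def rk_def using U0 fvV0 flx0 by (intro continuous_intros continuous_sink continuous_plateau; simp)+
    show "rg x = 0" "rk x = 0" if "\<bar>V\<bar> + l + 2 < \<bar>x\<bar>" for x
    proof -
      have "x < - l - 2 \<or> V + l + 2 < x" using that V l by (auto simp: abs_if split: if_splits)
      then have "sink j x = 0" "sink V x = 0" "sink (- l) x = 0" "plateau x0 x1 x = 0"
        using V l by (auto intro!: sink_outside plateau_outside simp: j_def x0_def x1_def)
      then show "rg x = 0" "rk x = 0" by (simp_all add: rg_def rk_def)
    qed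
    have sj: "sink j x = 0" if "x \<notin> {x1..V + l}" for x
      using that l by (intro sink_outside) (auto simp: j_def x1_def)
    have sink_le: "cv * sink j x \<le> cv" "c0 * sink j x \<le> c0" "cl * sink j x \<le> cl" for x
      using nn sink_bounds by (auto intro: mult_left_le)
    show "rg x \<le> - 2 * \<alpha> * g x + (if x \<in> {x1..V + l} then 2 * \<beta> else 0)" if x: "x0 \<le> x" for x
    proof (cases "x \<in> {x1..V + l}")
      case True
      have "rg x \<le> cv / fv V + c0 / U"
        unfolding rg_def using sink_le sink_bounds(1)[of V x] plateau_bounds(1)[of x0 x1 x] fvV0 U0
        by (intro add_mono divide_right_mono) (use sink_le(1)[of x] sink_le(2)[of x] in linarith)+
      moreover have "g x \<le> g x1"
        unfolding g_def fv_def f0_def using True fvV0 U0 potential_diff[OF pv, of x1 x] potential_diff[OF p0, of x1 x]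
        by (intro add_mono divide_right_mono) (auto simp: fv_def)
      then have "\<alpha> * g x \<le> \<alpha> * g x1" using U0 by (intro mult_left_mono) (auto simp: \<alpha>_def)
      moreover have "0 \<le> cl / fl x0" using nn flx0 by simp
      moreover have "2 * \<beta> = 2 * (\<alpha> * g x1) + (cv / fv V + c0 / U + cl / fl x0)" unfolding \<beta>_def by argo
      ultimately show ?thesis using True by simp
    next
      case False
      show ?thesis
      proof (cases "x < x1")
        case True
        have "rg x = - sink V x / fv V - 1 / U"
          using sj[OF False] plateau_eq_1[OF x, of x1] True by (simp add: rg_def diff_divide_distrib)
        also have "\<dots> \<le> - 1 / U" using sink_bounds(1)[of V x] fvV0 by simp
        also have "\<dots> \<le> - 2 * \<alpha> * g x"
        proof -
          have "\<alpha> * g x \<le> \<alpha> * 2" using U0 g2 by (intro mult_left_mono) (auto simp: \<alpha>_def)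
          then show ?thesis by (simp add: \<alpha>_def)
        qed
        finally show ?thesis unfolding if_not_P[OF False] by simp
      next
        case x1: False
        then have x': "V + l < x" using False by simp
        \<comment> \<open>Beyond the sink both potentials vanish, so the discount requires
          nothing.\<close>
        then have "g x = 0" unfolding g_def fv_def f0_def
          using potential_right[OF pv, of x] potential_right[OF p0, of x] j1 by simp
        moreover have "rg x \<le> 0"
          unfolding rg_def using sj[OF False] sink_bounds(1)[of V x] plateau_bounds(1)[of x0 x1 x] fvV0 U0
          by (intro add_nonpos_nonpos divide_nonpos_pos) auto
        ultimately show ?thesis unfolding if_not_P[OF False] by simp
      qed
    qed
    show "rk x \<le> (if x \<in> {x1..V + l} then 2 * \<beta> else 0)" if x: "x0 \<le> x" for x
    proof -
      have s: "sink (- l) x = 0" using x by (intro sink_outside) (auto simp: x0_def)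
      show ?thesis
      proof (cases "x \<in> {x1..V + l}")
        case True
        have "rk x \<le> cl / fl x0" unfolding rk_def s using sink_le flx0 by (simp add: divide_right_mono)
        moreover have "0 \<le> cv / fv V" "0 \<le> c0 / U" "0 \<le> \<alpha> * g x1"
          using nn g0[of x1] fvV0 U0 by (auto simp: \<alpha>_def)
        then have "cl / fl x0 \<le> 2 * \<beta>" unfolding \<beta>_def by argo
        ultimately show ?thesis using True by simp
      next
        case False
        then show ?thesis unfolding if_not_P[OF False] by (simp add: rk_def s sj)
      qed
    qed
    show "1 \<le> g x" if "x \<le> V" for x
      using potential_left[OF pv that] fvV0 nn(2)[of x] U0 by (simp add: g_def fv_def)
    show "1 \<le> k x" if "x \<le> x0" for x
      using potential_diff[OF pl that] flx0 by (simp add: k_def fl_def)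
  qed (use g0 k0 \<beta>0 v A in auto)
  also have "\<dots> \<le> exp (- \<alpha> * t) * 2 + D * \<epsilon> + 2 * \<beta> * (t + 1)"
    using g2[of 0] b4 \<beta>0 by (intro add_mono mult_left_mono) (auto simp: k_def)
  \<comment> \<open>The number 14 is 2 + 4 + 4 + 4: the contribution of \<open>fv\<close> to
    \<open>g x1\<close> and the three sink ratios.\<close>
  also have "2 * \<beta> \<le> D\<^sup>2 * exp (2 * e) / (2 * U\<^sup>2) + 14 * D * \<epsilon>"
  proof -
    have "g x1 \<le> D * \<epsilon> + D\<^sup>2 * exp (2 * e) / U"
      unfolding g_def using b1 b6 U0 by (intro add_mono divide_right_mono) auto
    then have "2 * (\<alpha> * g x1) \<le> 2 * (\<alpha> * (D * \<epsilon> + D\<^sup>2 * exp (2 * e) / U))"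
      using U0 by (intro mult_left_mono) (auto simp: \<alpha>_def)
    also have "\<dots> = 2 * (\<alpha> * (D * \<epsilon>)) + D\<^sup>2 * exp (2 * e) / (2 * U\<^sup>2)"
      by (simp add: \<alpha>_def power2_eq_square distrib_left)
    also have "2 * (\<alpha> * (D * \<epsilon>)) \<le> 2 * (1 * (D * \<epsilon>))"
      using U D1 \<epsilon>0 by (intro mult_left_mono mult_right_mono) (auto simp: \<alpha>_def)
    finally have 1: "2 * (\<alpha> * g x1) \<le> 2 * (D * \<epsilon>) + D\<^sup>2 * exp (2 * e) / (2 * U\<^sup>2)" by simp
    have "c0 / U \<le> 4 * D * \<epsilon> / 1"
      using b5 U D1 \<epsilon>0 nn by (intro frac_le) auto
    moreover have "\<epsilon> \<le> D * \<epsilon>" using D1 \<epsilon>0 by (simp add: mult_le_cancel_right1)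
    ultimately show ?thesis using 1 b2 b3 unfolding \<beta>_def by argo
  qed
  finally show ?thesis using t by (simp add: \<alpha>_def \<epsilon> mult.commute mult_right_mono)
qed

section \<open>Measurability and averaging over the environment\<close>

definition clock_inv :: "(real \<Rightarrow> real) \<Rightarrow> (real \<Rightarrow> real) \<Rightarrow> real \<Rightarrow> real" where
  "clock_inv c b t = (SOME u. 0 \<le> u \<and> clock c b u = t)"

definition diffusion :: "(real \<Rightarrow> real) \<Rightarrow> (real \<Rightarrow> real) \<Rightarrow> real \<Rightarrow> real" where
  "diffusion w b t = scale_inv w (b (clock_inv (speed_rate w) b t))"

lemma brox_scale_inv_eq: "brox_scale_inv W \<omega> = scale_inv (\<lambda>x. W x \<omega>)"
proof -
  have "brox_scale W \<omega> = scale_fun (\<lambda>x. W x \<omega>)"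
    by (rule ext) (simp add: brox_scale_def scale_fun_def antideriv_def)
  then show ?thesis by (simp add: brox_scale_inv_def scale_inv_def)
qed

lemma brox_clock_eq: "0 \<le> u \<Longrightarrow> brox_clock W B \<omega> u = clock (speed_rate (\<lambda>x. W x \<omega>)) (\<lambda>r. B r \<omega>) u"
  unfolding brox_clock_def brox_scale_inv_eq clock_def antideriv_def
  by (rule interval_integral_cong) (auto simp: speed_rate_def einterval_def)

text \<open>The two choice operators agree because they select from the same predicate: the clocks
  coincide at all nonnegative times.\<close>

lemma brox_X_eq: "brox_X W B t \<omega> = diffusion (\<lambda>x. W x \<omega>) (\<lambda>r. B r \<omega>) t"
proof -
  have "(\<lambda>u. 0 \<le> u \<and> brox_clock W B \<omega> u = t) = (\<lambda>u. 0 \<le> u \<and> clock (speed_rate (\<lambda>x. W x \<omega>)) (\<lambda>r. B r \<omega>) u = t)"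
    using brox_clock_eq[of _ W B \<omega>] by (intro ext conj_cong) auto
  then show ?thesis
    by (simp add: brox_X_def diffusion_def brox_clock_inv_def clock_inv_def brox_scale_inv_eq)
qed

context
  fixes c b :: "real \<Rightarrow> real"
  assumes c: "continuous_on UNIV c" "\<And>x. 0 < c x" and b: "continuous_on {0..} b" and rec: "recurrent_path b"
begin

lemma clock_less_iff: "clock c b u < clock c b u' \<longleftrightarrow> u < u'"
  using clock_strict_mono[OF c(1) b c(2), of u u'] clock_strict_mono[OF c(1) b c(2), of u' u]
  by (cases u u' rule: linorder_cases) auto

lemma clock_eq_iff: "clock c b u = clock c b u' \<longleftrightarrow> u = u'"
  using clock_less_iff[of u u'] clock_less_iff[of u' u] by (cases u u' rule: linorder_cases) auto

lemma clock_inv: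
  assumes "0 \<le> t"
  shows "0 \<le> clock_inv c b t" "clock c b (clock_inv c b t) = t"
proof -
  obtain N where "0 \<le> N" "t < clock c b N" using clock_unbounded[OF c b rec] by blast
  then have "\<exists>u\<ge>0. u \<le> N \<and> clock c b u = t"
    using assms by (intro IVT' continuous_on_subset[OF continuous_clock[OF c(1) b]]) auto
  then have "\<exists>u. 0 \<le> u \<and> clock c b u = t" by blast
  from someI_ex[OF this] show "0 \<le> clock_inv c b t" "clock c b (clock_inv c b t) = t"
    by (auto simp: clock_inv_def)
qed

lemma clock_inv_clock: "0 \<le> u \<Longrightarrow> clock_inv c b (clock c b u) = u"
proof -
  assume u: "0 \<le> u"
  have "clock c b 0 \<le> clock c b u" using clock_less_iff[of u 0] u by simp
  then show ?thesis using clock_inv(2)[of "clock c b u"] by (simp add: clock_eq_iff)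
qed

lemma clock_inv_less_iff: "0 \<le> t \<Longrightarrow> clock_inv c b t < u \<longleftrightarrow> t < clock c b u"
  using clock_less_iff[of "clock_inv c b t" u] clock_inv(2) by simp

end

section \<open>Events of the diffusion as events of path and clock\<close>

text \<open>Up to time \<open>t\<close> the diffusion visits only the continuous image of a compact
  interval of Brownian time. Boundedness is what makes \<open>SUP\<close> a genuine least upper
  bound.\<close>

lemma bdd_above_diffusion:
  assumes w: "continuous_on UNIV w" and surj: "surj (scale_fun w)"
    and b: "continuous_on {0..} b" and rec: "recurrent_path b" and t: "0 \<le> t"
  shows "bdd_above (diffusion w b ` {0..t})"
proof -
  let ?c = "speed_rate w"
  note cl = continuous_speed_rate[OF w surj] speed_rate_pos[OF w surj] b rec
  define T where "T = clock_inv ?c b t"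
  have "compact ((\<lambda>u. scale_inv w (b u)) ` {0..T})"
    by (intro compact_continuous_image continuous_on_compose2[OF continuous_scale_inv[OF w surj]] continuous_on_subset[OF b]) auto
  then have "bdd_above ((\<lambda>u. scale_inv w (b u)) ` {0..T})"
    by (intro bounded_imp_bdd_above compact_imp_bounded)
  moreover have "diffusion w b ` {0..t} \<subseteq> (\<lambda>u. scale_inv w (b u)) ` {0..T}"
  proof
    fix y assume "y \<in> diffusion w b ` {0..t}"
    then obtain s where s: "0 \<le> s" "s \<le> t" "y = diffusion w b s" by auto
    have "clock_inv ?c b s \<le> T"
      using clock_inv_less_iff[OF cl, of t "clock_inv ?c b s"] clock_inv(2)[OF cl, of s] s t by (auto simp: T_def)
    then show "y \<in> (\<lambda>u. scale_inv w (b u)) ` {0..T}"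
      using clock_inv(1)[OF cl s(1)] s(3) by (auto simp: diffusion_def)
  qed
  ultimately show ?thesis by (rule bdd_above_mono)
qed

text \<open>This expresses the supremum through the Brownian path and the clock, without the inverse
  clock. The strict inequality for the clock is reached by moving slightly back in time, where
  continuity keeps the path above the level.\<close>

lemma less_SUP_diffusion_iff:
  assumes w: "continuous_on UNIV w" and surj: "surj (scale_fun w)"
    and b: "continuous_on {0..} b" and b0: "b 0 = 0" and rec: "recurrent_path b" and t: "0 < t" and v: "0 \<le> v"
  shows "v < (SUP s\<in>{0..t}. diffusion w b s) \<longleftrightarrow> (\<exists>u\<ge>0. scale_fun w v < b u \<and> clock (speed_rate w) b u < t)"
proof -
  let ?c = "speed_rate w"
  note cl = continuous_speed_rate[OF w surj] speed_rate_pos[OF w surj] b rec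
  have Sv: "0 \<le> scale_fun w v" using scale_fun_le_iff[OF w, of 0 v] v by simp
  have bdd: "bdd_above (diffusion w b ` {0..t})" using t by (intro bdd_above_diffusion w surj b rec) simp
  have "v < (SUP s\<in>{0..t}. diffusion w b s) \<longleftrightarrow> (\<exists>s\<in>{0..t}. v < diffusion w b s)"
    using t by (intro less_cSUP_iff bdd) auto
  also have "\<dots> \<longleftrightarrow> (\<exists>u\<ge>0. scale_fun w v < b u \<and> clock ?c b u < t)"
  proof
    assume "\<exists>s\<in>{0..t}. v < diffusion w b s"
    then obtain s where s: "0 \<le> s" "s \<le> t" "scale_fun w v < b (clock_inv ?c b s)"
      by (auto simp: diffusion_def less_scale_inv_iff[OF w surj])
    define u where "u = clock_inv ?c b s"
    have u0: "0 \<le> u" and us: "clock ?c b u = s" using clock_inv[OF cl s(1)] by (simp_all add: u_def)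
    \<comment> \<open>The path starts at 0, which by \<open>0 \<le> v\<close> is not above the
      level; hence there is room to the left of \<open>u\<close>.\<close>
    have "u \<noteq> 0" using s(3) Sv b0 unfolding u_def[symmetric] by auto
    with u0 have u: "0 < u" by simp
    have "\<exists>d>0. \<forall>r\<in>{0..}. dist r u < d \<longrightarrow> dist (b r) (b u) < b u - scale_fun w v"
      using b u s(3) unfolding continuous_on_iff u_def[symmetric] by (auto simp: Ball_def)
    then obtain d where d: "0 < d" "\<And>r. 0 \<le> r \<Longrightarrow> dist r u < d \<Longrightarrow> dist (b r) (b u) < b u - scale_fun w v" by auto
    define r where "r = max (u / 2) (u - d / 2)"
    have r: "0 \<le> r" "r < u" "dist r u < d" using u d(1) by (auto simp: r_def dist_real_def)
    then have "scale_fun w v < b r" using d(2)[of r] by (auto simp: dist_real_def)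
    moreover have "clock ?c b r < t" using clock_less_iff[OF cl, of r u] r us s(2) by simp
    ultimately show "\<exists>u\<ge>0. scale_fun w v < b u \<and> clock ?c b u < t" using r by blast
  next
    assume "\<exists>u\<ge>0. scale_fun w v < b u \<and> clock ?c b u < t"
    then obtain u where u: "0 \<le> u" "scale_fun w v < b u" "clock ?c b u < t" by blast
    have "0 \<le> clock ?c b u" using clock_less_iff[OF cl, of u 0] u by simp
    moreover have "v < diffusion w b (clock ?c b u)"
      using u by (simp add: diffusion_def less_scale_inv_iff[OF w surj] clock_inv_clock[OF cl])
    ultimately show "\<exists>s\<in>{0..t}. v < diffusion w b s" using u(3) by (intro bexI[of _ "clock ?c b u"]) auto
  qed
  finally show ?thesis .
qed

text \<open>Evaluation at a random point is a limit of evaluations at points of the grids with mesh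
  \<open>1 / Suc n\<close>, and each grid is countable.\<close>

lemma measurable_continuous_eval:
  fixes f :: "'a \<Rightarrow> real \<Rightarrow> real"
  assumes f: "\<And>\<omega>. \<omega> \<in> space M \<Longrightarrow> continuous_on UNIV (f \<omega>)" and m: "\<And>x. (\<lambda>\<omega>. f \<omega> x) \<in> borel_measurable M"
    and g[measurable]: "g \<in> borel_measurable M"
  shows "(\<lambda>\<omega>. f \<omega> (g \<omega>)) \<in> borel_measurable M"
proof (rule borel_measurable_LIMSEQ_real)
  fix n :: nat
  have [measurable]: "(\<lambda>\<omega>. \<lfloor>g \<omega> * real (Suc n)\<rfloor>) \<in> measurable M (count_space UNIV)" by measurable
  show "(\<lambda>\<omega>. f \<omega> (real_of_int \<lfloor>g \<omega> * real (Suc n)\<rfloor> / real (Suc n))) \<in> borel_measurable M"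
    by (rule measurable_compose_countable[where f="\<lambda>i \<omega>. f \<omega> (real_of_int i / real (Suc n))" and g="\<lambda>\<omega>. \<lfloor>g \<omega> * real (Suc n)\<rfloor>"])
      (rule m, measurable)
next
  fix \<omega> assume "\<omega> \<in> space M"
  then have "isCont (f \<omega>) (g \<omega>)" using f by (simp add: continuous_on_eq_continuous_at)
  moreover have "(\<lambda>n. real_of_int \<lfloor>g \<omega> * real (Suc n)\<rfloor> / real (Suc n)) \<longlonglongrightarrow> g \<omega>"
  proof (rule Lim_null_comparison[THEN LIM_zero_cancel])
    show "\<forall>\<^sub>F n in sequentially. norm (real_of_int \<lfloor>g \<omega> * real (Suc n)\<rfloor> / real (Suc n) - g \<omega>) \<le> inverse (real (Suc n))"
    proof (rule always_eventually, intro allI)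
      fix n
      have "real_of_int \<lfloor>g \<omega> * real (Suc n)\<rfloor> / real (Suc n) - g \<omega> = (real_of_int \<lfloor>g \<omega> * real (Suc n)\<rfloor> - g \<omega> * real (Suc n)) / real (Suc n)"
        by (simp add: field_simps)
      moreover have "\<bar>real_of_int \<lfloor>g \<omega> * real (Suc n)\<rfloor> - g \<omega> * real (Suc n)\<bar> \<le> 1" by linarith
      then have "\<bar>real_of_int \<lfloor>g \<omega> * real (Suc n)\<rfloor> - g \<omega> * real (Suc n)\<bar> / real (Suc n) \<le> 1 / real (Suc n)"
        by (intro divide_right_mono) auto
      ultimately show "norm (real_of_int \<lfloor>g \<omega> * real (Suc n)\<rfloor> / real (Suc n) - g \<omega>) \<le> inverse (real (Suc n))"
        by (simp only: real_norm_def abs_divide inverse_eq_divide abs_of_nat)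
    qed
    show "(\<lambda>n. inverse (real (Suc n))) \<longlonglongrightarrow> 0" by (rule LIMSEQ_inverse_real_of_nat)
  qed
  ultimately show "(\<lambda>n. f \<omega> (real_of_int \<lfloor>g \<omega> * real (Suc n)\<rfloor> / real (Suc n))) \<longlonglongrightarrow> f \<omega> (g \<omega>)"
    by (rule isCont_tendsto_compose)
qed

text \<open>All conditions persist for times slightly larger than \<open>u\<close>, so rational
  times suffice and the event becomes a countable union.\<close>

lemma ex_nonneg_rational_iff:
  fixes b T :: "real \<Rightarrow> real"
  assumes b: "continuous_on {0..} b" and T: "continuous_on UNIV T"
  shows "(\<exists>u\<ge>0. u < N \<and> s < b u \<and> T u < t) \<longleftrightarrow> (\<exists>q::rat. 0 \<le> real_of_rat q \<and> real_of_rat q < N \<and> s < b (real_of_rat q) \<and> T (real_of_rat q) < t)"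
proof
  assume "\<exists>u\<ge>0. u < N \<and> s < b u \<and> T u < t"
  then obtain u where u: "0 \<le> u" "u < N" "s < b u" "T u < t" by blast
  have "\<exists>d>0. \<forall>r\<in>{0..}. dist r u < d \<longrightarrow> dist (b r) (b u) < b u - s"
    using b u unfolding continuous_on_iff by (auto simp: Ball_def)
  then obtain d where d: "0 < d" "\<And>r. 0 \<le> r \<Longrightarrow> dist r u < d \<Longrightarrow> dist (b r) (b u) < b u - s" by auto
  have "\<exists>d>0. \<forall>r\<in>UNIV. dist r u < d \<longrightarrow> dist (T r) (T u) < t - T u"
    using T u unfolding continuous_on_iff by (auto simp: Ball_def)
  then obtain d' where d': "0 < d'" "\<And>r. dist r u < d' \<Longrightarrow> dist (T r) (T u) < t - T u" by auto
  obtain q where q: "u < real_of_rat q" "real_of_rat q < min N (u + min d d')"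
    using of_rat_dense[of u "min N (u + min d d')"] u d d' by auto
  have q0: "0 \<le> real_of_rat q" using q u by linarith
  have "dist (real_of_rat q) u < d" "dist (real_of_rat q) u < d'" using q by (auto simp: dist_real_def)
  then have "dist (b (real_of_rat q)) (b u) < b u - s" "dist (T (real_of_rat q)) (T u) < t - T u"
    using d(2)[OF q0] d'(2)[of "real_of_rat q"] by blast+
  then have "s < b (real_of_rat q)" "T (real_of_rat q) < t" by (auto simp: dist_real_def abs_if split: if_splits)
  then show "\<exists>q::rat. 0 \<le> real_of_rat q \<and> real_of_rat q < N \<and> s < b (real_of_rat q) \<and> T (real_of_rat q) < t"
    using q q0 by (intro exI[of _ q]) auto
qed blast

context
  fixes Q :: "'q measure" and w b :: "'q \<Rightarrow> real \<Rightarrow> real"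
  assumes w: "\<And>q. q \<in> space Q \<Longrightarrow> continuous_on UNIV (w q)" and surj: "\<And>q. q \<in> space Q \<Longrightarrow> surj (scale_fun (w q))"
    and b: "\<And>q. q \<in> space Q \<Longrightarrow> continuous_on {0..} (b q)" and rec: "\<And>q. q \<in> space Q \<Longrightarrow> recurrent_path (b q)"
    and mw: "\<And>x. (\<lambda>q. w q x) \<in> borel_measurable Q" and mb: "\<And>r. 0 \<le> r \<Longrightarrow> (\<lambda>q. b q r) \<in> borel_measurable Q"
begin

lemma measurable_scale_fun_path: "(\<lambda>q. scale_fun (w q) x) \<in> borel_measurable Q"
proof (cases "0 \<le> x")
  case True
  have "(\<lambda>q. clock exp (w q) x) \<in> borel_measurable Q"
    using mw True w by (intro measurable_clock) (auto intro!: continuous_intros intro: continuous_on_subset)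
  also have "?this \<longleftrightarrow> ?thesis"
    using scale_fun_eq_clock[OF w True] by (intro measurable_cong) simp
  finally show ?thesis .
next
  case False
  have "(\<lambda>q. - clock exp (\<lambda>r. w q (- r)) (- x)) \<in> borel_measurable Q"
    using mw False
    by (intro borel_measurable_uminus measurable_clock) (auto intro!: continuous_intros continuous_on_compose2[OF w])
  moreover have "- clock exp (\<lambda>r. w q (- r)) (- x) = scale_fun (w q) x" if "q \<in> space Q" for q
    using scale_fun_minus_eq_clock[OF w[OF that], of "- x"] False by simp
  then have "(\<lambda>q. - clock exp (\<lambda>r. w q (- r)) (- x)) \<in> borel_measurable Q \<longleftrightarrow> ?thesis"
    by (intro measurable_cong)
  ultimately show ?thesis by simp
qed

lemma measurable_scale_inv_path:
  assumes [measurable]: "g \<in> borel_measurable Q"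
  shows "(\<lambda>q. scale_inv (w q) (g q)) \<in> borel_measurable Q"
proof (unfold borel_measurable_iff_less, intro allI)
  fix x
  have [measurable]: "(\<lambda>q. scale_fun (w q) x) \<in> borel_measurable Q" by (rule measurable_scale_fun_path)
  have "{q \<in> space Q. scale_inv (w q) (g q) < x} = {q \<in> space Q. g q < scale_fun (w q) x}"
    using scale_inv_less_iff[OF w surj] by auto
  then show "{q \<in> space Q. scale_inv (w q) (g q) < x} \<in> sets Q" by simp
qed

lemma measurable_clock_path:
  assumes u: "0 \<le> u"
  shows "(\<lambda>q. clock (speed_rate (w q)) (b q) u) \<in> borel_measurable Q"
proof (rule measurable_clock[OF _ b _ u])
  show "continuous_on UNIV (speed_rate (w q))" if "q \<in> space Q" for q
    using continuous_speed_rate[OF w surj] that by blast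
  fix r :: real assume "0 \<le> r"
  from measurable_continuous_eval[OF w mw measurable_scale_inv_path[OF mb[OF this]]]
  have [measurable]: "(\<lambda>q. w q (scale_inv (w q) (b q r))) \<in> borel_measurable Q" .
  show "(\<lambda>q. speed_rate (w q) (b q r)) \<in> borel_measurable Q" unfolding speed_rate_def by measurable
qed

lemma measurable_diffusion_path:
  assumes t: "0 \<le> t"
  shows "(\<lambda>q. diffusion (w q) (b q) t) \<in> borel_measurable Q"
proof -
  note cl = continuous_speed_rate[OF w surj] speed_rate_pos[OF w surj] b rec
  have "(\<lambda>q. clock_inv (speed_rate (w q)) (b q) t) \<in> borel_measurable Q"
  proof (unfold borel_measurable_iff_less, intro allI)
    fix u :: real
    show "{q \<in> space Q. clock_inv (speed_rate (w q)) (b q) t < u} \<in> sets Q"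
    proof (cases "0 \<le> u")
      case True
      have [measurable]: "(\<lambda>q. clock (speed_rate (w q)) (b q) u) \<in> borel_measurable Q"
        using True by (rule measurable_clock_path)
      have "{q \<in> space Q. clock_inv (speed_rate (w q)) (b q) t < u} = {q \<in> space Q. t < clock (speed_rate (w q)) (b q) u}"
        using clock_inv_less_iff[OF cl] t by auto
      then show ?thesis by simp
    next
      case False
      have "0 \<le> clock_inv (speed_rate (w q)) (b q) t" if "q \<in> space Q" for q
        using that by (intro clock_inv(1) t cl)
      then have "{q \<in> space Q. clock_inv (speed_rate (w q)) (b q) t < u} = {}"
        using False by force
      then show ?thesis by (metis sets.empty_sets)
    qed
  qed
  moreover have "continuous_on UNIV (\<lambda>x. b q (max 0 x))" if "q \<in> space Q" for q
    by (rule continuous_on_compose2[OF b[OF that]]) (auto intro!: continuous_intros)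
  moreover have "(\<lambda>q. b q (max 0 x)) \<in> borel_measurable Q" for x by (rule mb) simp
  ultimately have [measurable]: "(\<lambda>q. b q (max 0 (clock_inv (speed_rate (w q)) (b q) t))) \<in> borel_measurable Q"
    by (intro measurable_continuous_eval[where f="\<lambda>q x. b q (max 0 x)" and g="\<lambda>q. clock_inv (speed_rate (w q)) (b q) t"])
  have ci: "0 \<le> clock_inv (speed_rate (w q)) (b q) t" if "q \<in> space Q" for q
    using that by (intro clock_inv(1) t cl)
  have "(\<lambda>q. b q (clock_inv (speed_rate (w q)) (b q) t)) \<in> borel_measurable Q \<longleftrightarrow>
      (\<lambda>q. b q (max 0 (clock_inv (speed_rate (w q)) (b q) t))) \<in> borel_measurable Q"
    using ci by (intro measurable_cong) (simp add: max_absorb2)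
  then show ?thesis unfolding diffusion_def by (intro measurable_scale_inv_path) simp
qed

lemma measurable_crossing_path:
  "{q \<in> space Q. \<exists>u\<ge>0. u < N \<and> scale_fun (w q) v < b q u \<and> clock (speed_rate (w q)) (b q) u < t} \<in> sets Q"
proof -
  have [measurable]: "(\<lambda>q. scale_fun (w q) v) \<in> borel_measurable Q" by (rule measurable_scale_fun_path)
  have "Measurable.pred Q (\<lambda>q. 0 \<le> real_of_rat r \<and> real_of_rat r < N \<and> scale_fun (w q) v < b q (real_of_rat r) \<and>
      clock (speed_rate (w q)) (b q) (real_of_rat r) < t)" for r
  proof (cases "0 \<le> real_of_rat r")
    case True
    have [measurable]: "(\<lambda>q. b q (real_of_rat r)) \<in> borel_measurable Q"
        "(\<lambda>q. clock (speed_rate (w q)) (b q) (real_of_rat r)) \<in> borel_measurable Q"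
      using mb[OF True] measurable_clock_path[OF True] by auto
    show ?thesis by measurable
  next
    case False
    then show ?thesis by simp
  qed
  then have "{q \<in> space Q. \<exists>r::rat. 0 \<le> real_of_rat r \<and> real_of_rat r < N \<and> scale_fun (w q) v < b q (real_of_rat r) \<and>
      clock (speed_rate (w q)) (b q) (real_of_rat r) < t} \<in> sets Q"
    by (intro predE pred_intros_countable)
  also have "{q \<in> space Q. \<exists>r::rat. 0 \<le> real_of_rat r \<and> real_of_rat r < N \<and> scale_fun (w q) v < b q (real_of_rat r) \<and>
      clock (speed_rate (w q)) (b q) (real_of_rat r) < t}
    = {q \<in> space Q. \<exists>u\<ge>0. u < N \<and> scale_fun (w q) v < b q u \<and> clock (speed_rate (w q)) (b q) u < t}"
    using ex_nonneg_rational_iff[OF b continuous_clock[OF continuous_speed_rate[OF w surj] b]] by blast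
  finally show ?thesis .
qed

end

section \<open>Averaging over independent environment and path\<close>

text \<open>Fubini for independent variables on one probability space: on the product of the two
  generated sigma-algebras the diagonal map has the product law, so the probability of a diagonal
  event is the average over its sections.\<close>

lemma independent_sections:
  fixes X Y :: "'a \<Rightarrow> 'b"
  assumes M: "prob_space M" and indep: "prob_space.indep_var M S X T Y"
    and F: "F \<in> sets (vimage_algebra (space M) X S \<Otimes>\<^sub>M vimage_algebra (space M) Y T)"
  shows "{\<omega> \<in> space M. (\<omega>, \<omega>) \<in> F} \<in> sets M"
    and "\<And>\<omega>. \<omega> \<in> space M \<Longrightarrow> {\<omega>' \<in> space M. (\<omega>, \<omega>') \<in> F} \<in> sets M"
    and "(\<lambda>\<omega>. emeasure M {\<omega>' \<in> space M. (\<omega>, \<omega>') \<in> F}) \<in> borel_measurable M"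
    and "emeasure M {\<omega> \<in> space M. (\<omega>, \<omega>) \<in> F} = (\<integral>\<^sup>+\<omega>. emeasure M {\<omega>' \<in> space M. (\<omega>, \<omega>') \<in> F} \<partial>M)"
proof -
  interpret prob_space M by fact
  let ?R = "vimage_algebra (space M) X S" and ?V = "vimage_algebra (space M) Y T"
  have rv: "random_variable S X" "random_variable T Y" and ind: "indep_set
      (sigma_sets (space M) {X -` A \<inter> space M | A. A \<in> sets S}) (sigma_sets (space M) {Y -` A \<inter> space M | A. A \<in> sets T})"
    using indep unfolding indep_var_eq by auto
  have sR: "sets ?R = {X -` A \<inter> space M | A. A \<in> sets S}" and sV: "sets ?V = {Y -` A \<inter> space M | A. A \<in> sets T}"
    using rv by (auto intro!: sets_vimage_algebra2 dest: measurable_space)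
  have idR: "(\<lambda>\<omega>. \<omega>) \<in> M \<rightarrow>\<^sub>M ?R" and idV: "(\<lambda>\<omega>. \<omega>) \<in> M \<rightarrow>\<^sub>M ?V"
    using rv by (auto intro!: measurable_vimage_algebra2)
  have "indep_var ?R (\<lambda>\<omega>. \<omega>) ?V (\<lambda>\<omega>. \<omega>)"
  proof -
    have "{(\<lambda>\<omega>. \<omega>) -` A \<inter> space M | A. A \<in> sets ?R} = sets ?R" "{(\<lambda>\<omega>. \<omega>) -` A \<inter> space M | A. A \<in> sets ?V} = sets ?V"
      using sets.sets_into_space[of _ ?R] sets.sets_into_space[of _ ?V] by (auto simp: Int_absorb2)
    moreover have "sigma_sets (space M) (sets ?R) = sigma_sets (space M) {X -` A \<inter> space M | A. A \<in> sets S}"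
      "sigma_sets (space M) (sets ?V) = sigma_sets (space M) {Y -` A \<inter> space M | A. A \<in> sets T}"
      by (simp_all only: sR sV)
    ultimately show ?thesis using idR idV ind unfolding indep_var_eq by simp
  qed
  then have eq: "distr M ?R (\<lambda>\<omega>. \<omega>) \<Otimes>\<^sub>M distr M ?V (\<lambda>\<omega>. \<omega>) = distr M (?R \<Otimes>\<^sub>M ?V) (\<lambda>\<omega>. (\<omega>, \<omega>))"
    unfolding indep_var_distribution_eq by simp
  have diag: "(\<lambda>\<omega>. (\<omega>, \<omega>)) \<in> M \<rightarrow>\<^sub>M ?R \<Otimes>\<^sub>M ?V" using idR idV by (rule measurable_Pair)
  have set_eq: "{\<omega> \<in> space M. (\<omega>, \<omega>) \<in> F} = (\<lambda>\<omega>. (\<omega>, \<omega>)) -` F \<inter> space M" by auto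
  show "{\<omega> \<in> space M. (\<omega>, \<omega>) \<in> F} \<in> sets M"
    unfolding set_eq using diag F by (rule measurable_sets)
  interpret V: prob_space "distr M ?V (\<lambda>\<omega>. \<omega>)" using idV by (rule prob_space_distr)
  have sec: "{\<omega>' \<in> space M. (\<omega>, \<omega>') \<in> F} = (\<lambda>\<omega>. \<omega>) -` (Pair \<omega> -` F) \<inter> space M" for \<omega> by auto
  have secV: "Pair \<omega> -` F \<in> sets ?V" for \<omega> using F by (rule sets_Pair1)
  show "{\<omega>' \<in> space M. (\<omega>, \<omega>') \<in> F} \<in> sets M" for \<omega>
    unfolding sec using idV secV by (rule measurable_sets)
  have em: "emeasure M {\<omega>' \<in> space M. (\<omega>, \<omega>') \<in> F} = emeasure (distr M ?V (\<lambda>\<omega>. \<omega>)) (Pair \<omega> -` F)" for \<omega>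
    unfolding sec using emeasure_distr[OF idV secV] by simp
  have F': "F \<in> sets (distr M ?R (\<lambda>\<omega>. \<omega>) \<Otimes>\<^sub>M distr M ?V (\<lambda>\<omega>. \<omega>))"
    using F by (simp cong: sets_pair_measure_cong)
  have mR: "(\<lambda>\<omega>. emeasure (distr M ?V (\<lambda>\<omega>. \<omega>)) (Pair \<omega> -` F)) \<in> borel_measurable (distr M ?R (\<lambda>\<omega>. \<omega>))"
    by (rule V.measurable_emeasure_Pair[OF F'])
  then show "(\<lambda>\<omega>. emeasure M {\<omega>' \<in> space M. (\<omega>, \<omega>') \<in> F}) \<in> borel_measurable M"
    unfolding em using measurable_compose[OF idR] by simp
  have "emeasure M {\<omega> \<in> space M. (\<omega>, \<omega>) \<in> F} = emeasure (distr M (?R \<Otimes>\<^sub>M ?V) (\<lambda>\<omega>. (\<omega>, \<omega>))) F"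
    unfolding set_eq using emeasure_distr[OF diag F] by simp
  also have "\<dots> = (\<integral>\<^sup>+\<omega>. emeasure (distr M ?V (\<lambda>\<omega>. \<omega>)) (Pair \<omega> -` F) \<partial>distr M ?R (\<lambda>\<omega>. \<omega>))"
    unfolding eq[symmetric] by (rule V.emeasure_pair_measure_alt[OF F'])
  also have "\<dots> = (\<integral>\<^sup>+\<omega>. emeasure M {\<omega>' \<in> space M. (\<omega>, \<omega>') \<in> F} \<partial>M)"
    unfolding em using mR by (intro nn_integral_distr[OF idR]) simp
  finally show "emeasure M {\<omega> \<in> space M. (\<omega>, \<omega>) \<in> F} = (\<integral>\<^sup>+\<omega>. emeasure M {\<omega>' \<in> space M. (\<omega>, \<omega>') \<in> F} \<partial>M)" .
qed

text \<open>The set of \<open>P\<close> differs from \<open>A\<close> only inside a null set, and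
  the completion contains all subsets of null sets.\<close>

lemma measure_completion_AE:
  assumes A: "A \<in> sets (completion M)" and P: "AE \<omega> in M. P \<omega> \<longleftrightarrow> \<omega> \<in> A"
  shows "{\<omega> \<in> space M. P \<omega>} \<in> sets (completion M)" "measure (completion M) {\<omega> \<in> space M. P \<omega>} = measure (completion M) A"
proof -
  have "AE \<omega> in M. \<not> (P \<omega> \<noteq> (\<omega> \<in> A))" using P by eventually_elim simp
  then have [measurable]: "Measurable.pred (completion M) (\<lambda>\<omega>. P \<omega> \<noteq> (\<omega> \<in> A))" by (rule sets_completion_AE)
  from A have [measurable]: "Measurable.pred (completion M) (\<lambda>\<omega>. \<omega> \<in> A)" by (rule pred_sets2) simp
  have "Measurable.pred (completion M) (\<lambda>\<omega>. (\<omega> \<in> A) \<noteq> (P \<omega> \<noteq> (\<omega> \<in> A)))" by measurable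
  moreover have "(\<lambda>\<omega>. (\<omega> \<in> A) \<noteq> (P \<omega> \<noteq> (\<omega> \<in> A))) = P" by auto
  ultimately have "Measurable.pred (completion M) P" by simp
  from predE[OF this] show m: "{\<omega> \<in> space M. P \<omega>} \<in> sets (completion M)" by simp
  have "AE \<omega> in completion M. P \<omega> \<longleftrightarrow> \<omega> \<in> A" using P by (rule AE_completion)
  moreover have "AE \<omega> in completion M. \<omega> \<in> space M" using AE_space[of "completion M"] by simp
  ultimately have "AE \<omega> in completion M. \<omega> \<in> {\<omega> \<in> space M. P \<omega>} \<longleftrightarrow> \<omega> \<in> A" by eventually_elim simp
  then show "measure (completion M) {\<omega> \<in> space M. P \<omega>} = measure (completion M) A"
    using m A by (rule measure_eq_AE)
qed

text \<open>A path that violates recurrence is replaced by the zero path, which is recurrent. The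
  required properties then hold for every outcome, and no exceptional sets enter the product
  space.\<close>

definition tame_env :: "(real \<Rightarrow> real) \<Rightarrow> real \<Rightarrow> real" where
  "tame_env w = (if recurrent_path w \<and> recurrent_path (\<lambda>r. w (- r)) then w else (\<lambda>_. 0))"

definition tame_path :: "(real \<Rightarrow> real) \<Rightarrow> real \<Rightarrow> real" where
  "tame_path b = (if recurrent_path b then b else (\<lambda>_. 0))"

lemma recurrent_path_zero: "recurrent_path (\<lambda>_. 0)"
proof -
  have "clock tent (\<lambda>_. 0) u = u" for u
    using interval_integral_const[of 0 u "1::real"] by (simp add: clock_def antideriv_def tent_def zero_ereal_def)
  then show ?thesis unfolding recurrent_path_def by (metis lessI of_nat_less_iff)
qed

lemma recurrent_tame_path: "recurrent_path (tame_path b)"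
  by (simp add: tame_path_def recurrent_path_zero)

lemma continuous_tame_path: "continuous_on A b \<Longrightarrow> continuous_on A (tame_path b)"
  by (simp add: tame_path_def)

lemma continuous_tame_env: "continuous_on A w \<Longrightarrow> continuous_on A (tame_env w)"
  by (simp add: tame_env_def)

lemma surj_scale_fun_tame_env: "continuous_on UNIV w \<Longrightarrow> surj (scale_fun (tame_env w))"
  by (rule surj_scale_fun) (auto simp: tame_env_def recurrent_path_zero)

definition tame_family :: "'q measure \<Rightarrow> ('q \<Rightarrow> real \<Rightarrow> real) \<Rightarrow> ('q \<Rightarrow> real \<Rightarrow> real) \<Rightarrow> bool" where
  "tame_family Q w b \<longleftrightarrow>
    (\<forall>q\<in>space Q. continuous_on UNIV (w q) \<and> surj (scale_fun (w q)) \<and> continuous_on {0..} (b q) \<and> recurrent_path (b q)) \<and>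
    (\<forall>x. (\<lambda>q. w q x) \<in> borel_measurable Q) \<and> (\<forall>r\<ge>0. (\<lambda>q. b q r) \<in> borel_measurable Q)"

context
  fixes M :: "'a measure" and W B :: "real \<Rightarrow> 'a \<Rightarrow> real"
  assumes W: "brownian_on M UNIV W" and B: "brownian_on M {0..} B"
    and indep: "prob_space.indep_var M (Pi\<^sub>M UNIV (\<lambda>_. borel)) (\<lambda>\<omega> x. W x \<omega>)
                                 (Pi\<^sub>M {0..} (\<lambda>_. borel)) (\<lambda>\<omega>. restrict (\<lambda>s. B s \<omega>) {0..})"
begin

text \<open>Recurrence is used three times: for the driving path and for each half-line of the
  environment.\<close>

lemma AE_tame: "AE \<omega> in M. tame_env (\<lambda>x. W x \<omega>) = (\<lambda>x. W x \<omega>) \<and> tame_path (\<lambda>r. B r \<omega>) = (\<lambda>r. B r \<omega>)"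
  using brownian_recurrent[OF B] brownian_recurrent[OF brownian_restrict_nonneg[OF W]] brownian_recurrent[OF brownian_reverse[OF W]]
  by eventually_elim (simp add: tame_env_def tame_path_def)

text \<open>Quenched sections average to the annealed probability. The predicate is tested on pairs
  of outcomes, the first supplying the environment and the second the Brownian path. Tamed paths
  agree with the original ones only almost surely, hence the completion on the annealed
  side.\<close>

lemma annealed_event:
  fixes \<Phi> :: "(real \<Rightarrow> real) \<Rightarrow> (real \<Rightarrow> real) \<Rightarrow> bool"
  assumes \<Phi>: "\<And>(Q :: ('a \<times> 'a) measure) w b. tame_family Q w b \<Longrightarrow> {q \<in> space Q. \<Phi> (w q) (b q)} \<in> sets Q"
  shows "{\<omega> \<in> space M. \<Phi> (\<lambda>x. W x \<omega>) (\<lambda>r. B r \<omega>)} \<in> sets (completion M)"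
    and "\<And>\<omega>. \<omega> \<in> space M \<Longrightarrow> {\<omega>' \<in> space M. \<Phi> (tame_env (\<lambda>x. W x \<omega>)) (tame_path (\<lambda>r. B r \<omega>'))} \<in> sets M"
    and "ennreal (measure (completion M) {\<omega> \<in> space M. \<Phi> (\<lambda>x. W x \<omega>) (\<lambda>r. B r \<omega>)}) =
      (\<integral>\<^sup>+\<omega>. emeasure M {\<omega>' \<in> space M. \<Phi> (tame_env (\<lambda>x. W x \<omega>)) (tame_path (\<lambda>r. B r \<omega>'))} \<partial>M)"
proof -
  interpret prob_space M using W by (rule brownian_onD)
  define R where "R = vimage_algebra (space M) (\<lambda>\<omega> x. W x \<omega>) (Pi\<^sub>M UNIV (\<lambda>_. borel))"
  define V where "V = vimage_algebra (space M) (\<lambda>\<omega>. restrict (\<lambda>s. B s \<omega>) {0..}) (Pi\<^sub>M {0..} (\<lambda>_. borel))"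
  have sp: "space R = space M" "space V = space M" by (simp_all add: R_def V_def)
  have mW [measurable]: "W x \<in> borel_measurable R" for x
  proof -
    have "(\<lambda>\<omega> x. W x \<omega>) \<in> R \<rightarrow>\<^sub>M Pi\<^sub>M UNIV (\<lambda>_. borel)"
      unfolding R_def by (intro measurable_vimage_algebra1) (auto simp: space_PiM)
    from measurable_compose[OF this measurable_component_singleton[of x UNIV]] show ?thesis by simp
  qed
  have mB [measurable]: "B r \<in> borel_measurable V" if "0 \<le> r" for r
  proof -
    have "(\<lambda>\<omega>. restrict (\<lambda>s. B s \<omega>) {0..}) \<in> V \<rightarrow>\<^sub>M Pi\<^sub>M {0..} (\<lambda>_. borel)"
      unfolding V_def by (intro measurable_vimage_algebra1) (auto simp: space_PiM)
    from measurable_compose[OF this measurable_component_singleton[of r "{0..}"]] that show ?thesis by simp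
  qed
  have cW: "continuous_on UNIV (\<lambda>x. W x \<omega>)" if "\<omega> \<in> space M" for \<omega> using brownian_onD(5)[OF W that] .
  have cB: "continuous_on {0..} (\<lambda>r. B r \<omega>)" if "\<omega> \<in> space M" for \<omega> using brownian_onD(5)[OF B that] .
  have [measurable]: "Measurable.pred R (\<lambda>\<omega>. recurrent_path (\<lambda>r. W r \<omega>))" "Measurable.pred R (\<lambda>\<omega>. recurrent_path (\<lambda>r. W (- r) \<omega>))"
    "Measurable.pred V (\<lambda>\<omega>. recurrent_path (\<lambda>r. B r \<omega>))"
    unfolding pred_def using cW cB
    by (intro measurable_recurrent_path mW mB; auto simp: sp intro: continuous_on_subset intro!: continuous_on_compose2[OF cW] continuous_intros)+
  have tW [measurable]: "(\<lambda>\<omega>. tame_env (\<lambda>x. W x \<omega>) x) \<in> borel_measurable R" for x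
  proof -
    have "(\<lambda>\<omega>. tame_env (\<lambda>x. W x \<omega>) x) =
      (\<lambda>\<omega>. if recurrent_path (\<lambda>r. W r \<omega>) \<and> recurrent_path (\<lambda>r. W (- r) \<omega>) then W x \<omega> else 0)"
      by (auto simp: tame_env_def)
    then show ?thesis by simp
  qed
  have tB [measurable]: "(\<lambda>\<omega>. tame_path (\<lambda>r. B r \<omega>) r) \<in> borel_measurable V" if r: "0 \<le> r" for r
  proof -
    note mB[OF r, measurable]
    have "(\<lambda>\<omega>. tame_path (\<lambda>r. B r \<omega>) r) = (\<lambda>\<omega>. if recurrent_path (\<lambda>r. B r \<omega>) then B r \<omega> else 0)"
      by (auto simp: tame_path_def)
    then show ?thesis by simp
  qed
  define F where "F = {q \<in> space (R \<Otimes>\<^sub>M V). \<Phi> (tame_env (\<lambda>x. W x (fst q))) (tame_path (\<lambda>r. B r (snd q)))}"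
  have "tame_family (R \<Otimes>\<^sub>M V) (\<lambda>q. tame_env (\<lambda>x. W x (fst q))) (\<lambda>q. tame_path (\<lambda>r. B r (snd q)))"
    unfolding tame_family_def
  proof (intro conjI ballI allI impI)
    fix q assume "q \<in> space (R \<Otimes>\<^sub>M V)"
    then have q: "fst q \<in> space M" "snd q \<in> space M" by (auto simp: space_pair_measure sp)
    show "continuous_on UNIV (tame_env (\<lambda>x. W x (fst q)))" "surj (scale_fun (tame_env (\<lambda>x. W x (fst q))))"
      "continuous_on {0..} (tame_path (\<lambda>r. B r (snd q)))" "recurrent_path (tame_path (\<lambda>r. B r (snd q)))"
      by (intro continuous_tame_env continuous_tame_path recurrent_tame_path surj_scale_fun_tame_env cW cB q)+
  next
    show "(\<lambda>q. tame_env (\<lambda>x. W x (fst q)) x) \<in> borel_measurable (R \<Otimes>\<^sub>M V)" for x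
      by (rule measurable_compose[OF measurable_fst tW])
    show "(\<lambda>q. tame_path (\<lambda>r. B r (snd q)) r) \<in> borel_measurable (R \<Otimes>\<^sub>M V)" if "0 \<le> r" for r
      by (rule measurable_compose[OF measurable_snd tB[OF that]])
  qed
  from \<Phi>[OF this] have F: "F \<in> sets (R \<Otimes>\<^sub>M V)" unfolding F_def .
  note S = independent_sections[OF prob_space_axioms indep F[unfolded R_def V_def]]
  have memF: "(\<omega>, \<omega>') \<in> F \<longleftrightarrow> \<Phi> (tame_env (\<lambda>x. W x \<omega>)) (tame_path (\<lambda>r. B r \<omega>'))"
    if "\<omega> \<in> space M" "\<omega>' \<in> space M" for \<omega> \<omega>' using that by (simp add: F_def space_pair_measure sp)
  have sec: "{\<omega>' \<in> space M. (\<omega>, \<omega>') \<in> F} = {\<omega>' \<in> space M. \<Phi> (tame_env (\<lambda>x. W x \<omega>)) (tame_path (\<lambda>r. B r \<omega>'))}"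
    if "\<omega> \<in> space M" for \<omega> using memF[OF that] by auto
  show "{\<omega>' \<in> space M. \<Phi> (tame_env (\<lambda>x. W x \<omega>)) (tame_path (\<lambda>r. B r \<omega>'))} \<in> sets M" if "\<omega> \<in> space M" for \<omega>
    using S(2)[OF that] unfolding sec[OF that] .
  have AE: "AE \<omega> in M. \<Phi> (\<lambda>x. W x \<omega>) (\<lambda>r. B r \<omega>) \<longleftrightarrow> \<omega> \<in> {\<omega> \<in> space M. (\<omega>, \<omega>) \<in> F}"
    using AE_tame AE_space by eventually_elim (simp add: memF)
  have S1: "{\<omega> \<in> space M. (\<omega>, \<omega>) \<in> F} \<in> sets (completion M)" using S(1) by simp
  note C = measure_completion_AE[OF S1 AE]
  show "{\<omega> \<in> space M. \<Phi> (\<lambda>x. W x \<omega>) (\<lambda>r. B r \<omega>)} \<in> sets (completion M)" by (rule C(1))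
  show "ennreal (measure (completion M) {\<omega> \<in> space M. \<Phi> (\<lambda>x. W x \<omega>) (\<lambda>r. B r \<omega>)}) =
      (\<integral>\<^sup>+\<omega>. emeasure M {\<omega>' \<in> space M. \<Phi> (tame_env (\<lambda>x. W x \<omega>)) (tame_path (\<lambda>r. B r \<omega>'))} \<partial>M)"
    unfolding C(2) measure_completion[OF S(1)] emeasure_eq_measure[symmetric] S(4) by (intro nn_integral_cong) (simp add: sec)
qed

lemma recurrent_B_event: "{\<omega> \<in> space M. recurrent_path (\<lambda>r. B r \<omega>)} \<in> sets M"
  using brownian_onD(3,5)[OF B] by (intro measurable_recurrent_path) auto

lemma crossing_event:
  "tame_family Q w b \<Longrightarrow> {q \<in> space Q. \<exists>u\<ge>0. u < N \<and> scale_fun (w q) v < b q u \<and> clock (speed_rate (w q)) (b q) u < t} \<in> sets Q"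
  unfolding tame_family_def by (intro measurable_crossing_path) auto

lemma unbounded_crossing_event:
  assumes "tame_family Q w b"
  shows "{q \<in> space Q. \<exists>u\<ge>0. scale_fun (w q) v < b q u \<and> clock (speed_rate (w q)) (b q) u < t} \<in> sets Q"
proof -
  have "{q \<in> space Q. \<exists>u\<ge>0. scale_fun (w q) v < b q u \<and> clock (speed_rate (w q)) (b q) u < t} =
    (\<Union>n::nat. {q \<in> space Q. \<exists>u\<ge>0. u < real n \<and> scale_fun (w q) v < b q u \<and> clock (speed_rate (w q)) (b q) u < t})"
  proof -
    have "\<exists>n::nat. u < real n" for u by (rule reals_Archimedean2)
    then show ?thesis by blast
  qed
  then show ?thesis using crossing_event[OF assms] by auto
qed

lemma diffusion_event: "0 \<le> t \<Longrightarrow> tame_family Q w b \<Longrightarrow> {q \<in> space Q. v < diffusion (w q) (b q) t} \<in> sets Q"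
proof -
  assume t: "0 \<le> t" and f: "tame_family Q w b"
  have [measurable]: "(\<lambda>q. diffusion (w q) (b q) t) \<in> borel_measurable Q"
    using f t unfolding tame_family_def by (intro measurable_diffusion_path) auto
  show ?thesis by measurable
qed

lemma sup_event:
  assumes t: "0 < t" and v: "0 \<le> v"
  shows "{\<omega> \<in> space M. v < (SUP s\<in>{0..t}. brox_X W B s \<omega>)} \<in> sets (completion M)"
    and "ennreal (measure (completion M) {\<omega> \<in> space M. v < (SUP s\<in>{0..t}. brox_X W B s \<omega>)}) =
      (\<integral>\<^sup>+\<omega>. emeasure M {\<omega>' \<in> space M. \<exists>u\<ge>0. scale_fun (tame_env (\<lambda>x. W x \<omega>)) v < tame_path (\<lambda>r. B r \<omega>') u \<and>
        clock (speed_rate (tame_env (\<lambda>x. W x \<omega>))) (tame_path (\<lambda>r. B r \<omega>')) u < t} \<partial>M)"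
proof -
  let ?\<Phi> = "\<lambda>w b. \<exists>u\<ge>0. scale_fun w v < b u \<and> clock (speed_rate w) b u < t"
  let ?D = "{\<omega> \<in> space M. ?\<Phi> (\<lambda>x. W x \<omega>) (\<lambda>r. B r \<omega>)}"
  have E: "?D \<in> sets (completion M)" "ennreal (measure (completion M) ?D) =
    (\<integral>\<^sup>+\<omega>. emeasure M {\<omega>' \<in> space M. ?\<Phi> (tame_env (\<lambda>x. W x \<omega>)) (tame_path (\<lambda>r. B r \<omega>'))} \<partial>M)"
    by (intro annealed_event unbounded_crossing_event; assumption)+
  have "AE \<omega> in M. v < (SUP s\<in>{0..t}. brox_X W B s \<omega>) \<longleftrightarrow> \<omega> \<in> ?D"
    using AE_tame AE_space
  proof eventually_elim
    case (elim \<omega>)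
    have "surj (scale_fun (\<lambda>x. W x \<omega>))" "recurrent_path (\<lambda>r. B r \<omega>)"
      using surj_scale_fun_tame_env[OF brownian_onD(5)[OF W elim(2)]] recurrent_tame_path[of "\<lambda>r. B r \<omega>"] elim(1) by auto
    then show ?case
      using less_SUP_diffusion_iff[of "\<lambda>x. W x \<omega>" "\<lambda>r. B r \<omega>" t v] brownian_onD(4,5)[OF B elim(2)] brownian_onD(5)[OF W elim(2)] t v elim(2)
      by (simp add: brox_X_eq)
  qed
  note C = measure_completion_AE[OF E(1) this]
  show "{\<omega> \<in> space M. v < (SUP s\<in>{0..t}. brox_X W B s \<omega>)} \<in> sets (completion M)"
    using C(1) by simp
  show "ennreal (measure (completion M) {\<omega> \<in> space M. v < (SUP s\<in>{0..t}. brox_X W B s \<omega>)}) =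
      (\<integral>\<^sup>+\<omega>. emeasure M {\<omega>' \<in> space M. ?\<Phi> (tame_env (\<lambda>x. W x \<omega>)) (tame_path (\<lambda>r. B r \<omega>'))} \<partial>M)"
    using C(2) E(2) by simp
qed

text \<open>\<open>K\<close> bounds the quenched probability of a crossing before Brownian time
  \<open>N\<close>. It does not depend on \<open>N\<close>, so for a fixed environment the horizon
  may tend to infinity before the average over environments is taken.\<close>

theorem annealed_upper:
  assumes t: "0 < t" and v: "0 \<le> v" and K0: "\<And>w. 0 \<le> K w" and int: "integrable M (\<lambda>\<omega>. K (\<lambda>x. W x \<omega>))"
    and K: "\<And>w N A. continuous_on UNIV w \<Longrightarrow> surj (scale_fun w) \<Longrightarrow> 0 < N \<Longrightarrow> A \<in> sets M \<Longrightarrow>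
      (\<And>\<omega>. \<omega> \<in> A \<Longrightarrow> \<exists>u\<ge>0. u < N \<and> scale_fun w v < B u \<omega> \<and> clock (speed_rate w) (\<lambda>r. B r \<omega>) u < t) \<Longrightarrow> measure M A \<le> K w"
  shows "measure (completion M) {\<omega> \<in> space M. v < (SUP s\<in>{0..t}. brox_X W B s \<omega>)} \<le> (\<integral>\<omega>. K (\<lambda>x. W x \<omega>) \<partial>M)"
proof -
  interpret prob_space M using W by (rule brownian_onD)
  let ?G = "{\<omega> \<in> space M. recurrent_path (\<lambda>r. B r \<omega>)}"
  let ?\<Phi> = "\<lambda>w b u. scale_fun w v < b u \<and> clock (speed_rate w) b u < t"
  have sec_bound: "emeasure M {\<omega>' \<in> space M. \<exists>u\<ge>0. ?\<Phi> (tame_env (\<lambda>x. W x \<omega>)) (tame_path (\<lambda>r. B r \<omega>')) u} \<le> ennreal (K (tame_env (\<lambda>x. W x \<omega>)))"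
    if \<omega>: "\<omega> \<in> space M" for \<omega>
  proof -
    define w where "w = tame_env (\<lambda>x. W x \<omega>)"
    have w: "continuous_on UNIV w" "surj (scale_fun w)"
      unfolding w_def by (intro continuous_tame_env surj_scale_fun_tame_env brownian_onD(5)[OF W \<omega>])+
    define A where "A n = {\<omega>' \<in> space M. \<exists>u\<ge>0. u < real (Suc n) \<and> ?\<Phi> w (tame_path (\<lambda>r. B r \<omega>')) u}" for n
    have mA: "A n \<in> sets M" for n
      unfolding A_def w_def by (intro annealed_event(2)[OF crossing_event \<omega>])
    have "emeasure M (A n) \<le> ennreal (K w)" for n
    proof -
      \<comment> \<open>On recurrent paths taming changes nothing, so the quenched bound for
        \<open>B\<close> applies there.\<close>
      have "emeasure M (A n) = emeasure M (A n \<inter> ?G)"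
        using brownian_recurrent[OF B] mA recurrent_B_event by (intro emeasure_eq_AE) (auto simp: A_def)
      also have "measure M (A n \<inter> ?G) \<le> K w"
        by (rule K[OF w, of "real (Suc n)"]) (use mA recurrent_B_event in \<open>auto simp: A_def tame_path_def\<close>)
      then have "emeasure M (A n \<inter> ?G) \<le> ennreal (K w)" unfolding emeasure_eq_measure by (rule ennreal_leI)
      finally show ?thesis .
    qed
    then have "(SUP n. emeasure M (A n)) \<le> ennreal (K w)" by (rule SUP_least)
    moreover have "{\<omega>' \<in> space M. \<exists>u\<ge>0. ?\<Phi> w (tame_path (\<lambda>r. B r \<omega>')) u} = (\<Union>n. A n)"
    proof -
      have "\<exists>n. u < real (Suc n)" for u using reals_Archimedean2[of u] by (metis less_trans lessI of_nat_less_iff)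
      then show ?thesis unfolding A_def by blast
    qed
    moreover have "(SUP n. emeasure M (A n)) = emeasure M (\<Union>n. A n)"
      using mA by (intro SUP_emeasure_incseq) (auto simp: A_def incseq_Suc_iff intro: less_trans)
    ultimately show ?thesis unfolding w_def[symmetric] by simp
  qed
  have "ennreal (measure (completion M) {\<omega> \<in> space M. v < (SUP s\<in>{0..t}. brox_X W B s \<omega>)})
      \<le> (\<integral>\<^sup>+\<omega>. ennreal (K (tame_env (\<lambda>x. W x \<omega>))) \<partial>M)"
    unfolding sup_event(2)[OF t v] by (intro nn_integral_mono sec_bound)
  also have "\<dots> = (\<integral>\<^sup>+\<omega>. ennreal (K (\<lambda>x. W x \<omega>)) \<partial>M)"
    using AE_tame by (intro nn_integral_cong_AE) (auto elim: eventually_mono)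
  also have "\<dots> = ennreal (\<integral>\<omega>. K (\<lambda>x. W x \<omega>) \<partial>M)"
    using int K0 by (intro nn_integral_eq_integral) auto
  finally show ?thesis using K0 by (simp add: ennreal_le_iff integral_nonneg_AE)
qed

text \<open>For an environment in \<open>E\<close>, the recurrent paths that miss the quenched event
  are exhausted by sets \<open>A n\<close> on which the clock has passed \<open>t\<close> by
  Brownian time \<open>n + 1\<close>. Each of them has probability at most \<open>\<delta>\<close>,
  hence so has their union.\<close>

theorem annealed_lower:
  assumes t: "0 < t" and E: "E \<in> sets M"
    and K: "\<And>\<omega> N A. \<omega> \<in> E \<Longrightarrow> surj (scale_fun (\<lambda>x. W x \<omega>)) \<Longrightarrow> 0 < N \<Longrightarrow> A \<in> sets M \<Longrightarrow>
      (\<And>\<omega>'. \<omega>' \<in> A \<Longrightarrow> t < clock (speed_rate (\<lambda>x. W x \<omega>)) (\<lambda>r. B r \<omega>') N \<and>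
        (\<exists>u\<ge>0. clock (speed_rate (\<lambda>x. W x \<omega>)) (\<lambda>r. B r \<omega>') u = t \<and> B u \<omega>' \<le> scale_fun (\<lambda>x. W x \<omega>) v)) \<Longrightarrow> measure M A \<le> \<delta>"
  shows "(1 - \<delta>) * measure M E \<le> measure (completion M) {\<omega> \<in> space M. v < brox_X W B t \<omega>}"
proof -
  interpret prob_space M using W by (rule brownian_onD)
  have t0: "0 \<le> t" using t by simp
  let ?G = "{\<omega> \<in> space M. recurrent_path (\<lambda>r. B r \<omega>)}"
  let ?sec = "\<lambda>\<omega>. {\<omega>' \<in> space M. v < diffusion (tame_env (\<lambda>x. W x \<omega>)) (tame_path (\<lambda>r. B r \<omega>')) t}"
  have sec_bound: "ennreal (1 - \<delta>) \<le> emeasure M (?sec \<omega>)"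
    if \<omega>: "\<omega> \<in> E" "tame_env (\<lambda>x. W x \<omega>) = (\<lambda>x. W x \<omega>)" for \<omega>
  proof -
    have \<omega>M: "\<omega> \<in> space M" using \<omega> sets.sets_into_space[OF E] by auto
    define w where "w = (\<lambda>x. W x \<omega>)"
    have w: "continuous_on UNIV w" "surj (scale_fun w)"
      unfolding w_def using brownian_onD(5)[OF W \<omega>M] surj_scale_fun_tame_env[OF brownian_onD(5)[OF W \<omega>M]] \<omega>(2) by auto
    note cl = continuous_speed_rate[OF w] speed_rate_pos[OF w] brownian_onD(5)[OF B]
    have msec: "?sec \<omega> \<in> sets M" by (rule annealed_event(2)[OF diffusion_event[OF t0] \<omega>M])
    define A where "A n = {\<omega>' \<in> ?G. t < clock (speed_rate w) (\<lambda>r. B r \<omega>') (real (Suc n))} - ?sec \<omega>" for n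
    have mA: "A n \<in> sets M" for n
    proof -
      have [measurable]: "(\<lambda>\<omega>'. clock (speed_rate w) (\<lambda>r. B r \<omega>') (real (Suc n))) \<in> borel_measurable M"
        using cl measurable_compose[OF brownian_onD(3)[OF B] measurable_speed_rate[OF w]] by (intro measurable_clock) auto
      have eq: "{\<omega>' \<in> ?G. t < clock (speed_rate w) (\<lambda>r. B r \<omega>') (real (Suc n))} = ?G \<inter> {\<omega>' \<in> space M. t < clock (speed_rate w) (\<lambda>r. B r \<omega>') (real (Suc n))}"
        by auto
      have "{\<omega>' \<in> space M. t < clock (speed_rate w) (\<lambda>r. B r \<omega>') (real (Suc n))} \<in> sets M" by measurable
      then show ?thesis unfolding A_def eq using msec recurrent_B_event by blast
    qed
    have "measure M (A n) \<le> \<delta>" for n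
    proof (rule K[OF \<omega>(1), of "real (Suc n)"])
      show "surj (scale_fun (\<lambda>x. W x \<omega>))" using w by (simp add: w_def)
      fix \<omega>' assume "\<omega>' \<in> A n"
      then have a: "\<omega>' \<in> space M" "recurrent_path (\<lambda>r. B r \<omega>')" "t < clock (speed_rate w) (\<lambda>r. B r \<omega>') (real (Suc n))" "\<omega>' \<notin> ?sec \<omega>"
        by (auto simp: A_def)
      have "\<not> scale_fun w v < B (clock_inv (speed_rate w) (\<lambda>r. B r \<omega>') t) \<omega>'"
        using a \<omega>(2) less_scale_inv_iff[OF w] by (simp add: diffusion_def tame_path_def w_def)
      then show "t < clock (speed_rate (\<lambda>x. W x \<omega>)) (\<lambda>r. B r \<omega>') (real (Suc n)) \<and>
        (\<exists>u\<ge>0. clock (speed_rate (\<lambda>x. W x \<omega>)) (\<lambda>r. B r \<omega>') u = t \<and> B u \<omega>' \<le> scale_fun (\<lambda>x. W x \<omega>) v)"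
        using a(3) clock_inv[OF cl(1,2) cl(3)[OF a(1)] a(2) t0] unfolding w_def[symmetric] by (auto simp: not_less)
    qed (use mA in auto)
    moreover have "(\<lambda>n. measure M (A n)) \<longlonglongrightarrow> measure M (\<Union>n. A n)"
    proof (rule finite_Lim_measure_incseq)
      have "clock (speed_rate w) (\<lambda>r. B r \<omega>') (real (Suc n)) \<le> clock (speed_rate w) (\<lambda>r. B r \<omega>') (real (Suc (Suc n)))" if "\<omega>' \<in> space M" for \<omega>' n
        using cl(2) by (intro clock_mono[OF cl(1) cl(3)[OF that]]) (auto intro: less_imp_le)
      then show "incseq A" unfolding incseq_Suc_iff A_def by (fastforce intro: less_le_trans)
    qed (use mA in auto)
    ultimately have "measure M (\<Union>n. A n) \<le> \<delta>" by (auto intro: LIMSEQ_le_const2)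
    also have "(\<Union>n. A n) = ?G - ?sec \<omega>"
    proof -
      have "\<exists>n. t < clock (speed_rate w) (\<lambda>r. B r \<omega>') (real (Suc n))" if \<omega>': "\<omega>' \<in> ?G" for \<omega>'
      proof -
        obtain N where N: "0 \<le> N" "t < clock (speed_rate w) (\<lambda>r. B r \<omega>') N"
          using clock_unbounded[OF cl(1,2) cl(3)] \<omega>' by blast
        obtain n where n: "N < real n" using reals_Archimedean2 by blast
        have "clock (speed_rate w) (\<lambda>r. B r \<omega>') N \<le> clock (speed_rate w) (\<lambda>r. B r \<omega>') (real (Suc n))"
          using cl(2) \<omega>' n by (intro clock_mono[OF cl(1) cl(3)]) (auto intro: less_imp_le)
        then show ?thesis using N by (auto intro: less_le_trans)
      qed
      then show ?thesis unfolding A_def by blast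
    qed
    finally have "prob (?G - ?sec \<omega>) \<le> \<delta>" .
    moreover have "prob ?G = 1" using brownian_recurrent[OF B] by (rule prob_Collect_eq_1[THEN iffD2, rotated]) (use recurrent_B_event in simp)
    moreover have "prob ?G \<le> prob ((?G - ?sec \<omega>) \<union> ?sec \<omega>)"
      using msec recurrent_B_event by (intro finite_measure_mono) auto
    moreover have "prob ((?G - ?sec \<omega>) \<union> ?sec \<omega>) \<le> prob (?G - ?sec \<omega>) + prob (?sec \<omega>)"
      using msec recurrent_B_event by (intro measure_Un_le) auto
    ultimately have "1 - \<delta> \<le> prob (?sec \<omega>)" by linarith
    then show ?thesis unfolding emeasure_eq_measure by (rule ennreal_leI)
  qed
  have "ennreal (1 - \<delta>) * emeasure M E = (\<integral>\<^sup>+\<omega>. ennreal (1 - \<delta>) * indicator E \<omega> \<partial>M)"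
    using E by (simp add: nn_integral_cmult_indicator)
  also have "\<dots> \<le> (\<integral>\<^sup>+\<omega>. emeasure M (?sec \<omega>) \<partial>M)"
  proof (rule nn_integral_mono_AE)
    show "AE \<omega> in M. ennreal (1 - \<delta>) * indicator E \<omega> \<le> emeasure M (?sec \<omega>)"
      using AE_tame
    proof eventually_elim
      case (elim \<omega>)
      then show ?case using sec_bound[of \<omega>] by (cases "\<omega> \<in> E") simp_all
    qed
  qed
  also have "\<dots> = ennreal (measure (completion M) {\<omega> \<in> space M. v < diffusion (\<lambda>x. W x \<omega>) (\<lambda>r. B r \<omega>) t})"
    by (rule annealed_event(3)[symmetric]) (rule diffusion_event[OF t0])
  also have "\<dots> = ennreal (measure (completion M) {\<omega> \<in> space M. v < brox_X W B t \<omega>})" by (simp add: brox_X_eq)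
  finally have le: "ennreal (1 - \<delta>) * emeasure M E \<le> ennreal (measure (completion M) {\<omega> \<in> space M. v < brox_X W B t \<omega>})" .
  show ?thesis
  proof (cases "\<delta> \<le> 1")
    case True
    then show ?thesis using le by (simp add: emeasure_eq_measure flip: ennreal_mult)
  next
    case False
    then have "(1 - \<delta>) * measure M E \<le> 0" by (simp add: mult_nonpos_nonneg)
    then show ?thesis using measure_nonneg order_trans by blast
  qed
qed

lemma prob_diffusion_le_prob_sup:
  assumes t: "0 < t" and v: "0 \<le> v"
  shows "measure (completion M) {\<omega> \<in> space M. v < brox_X W B t \<omega>}
    \<le> measure (completion M) {\<omega> \<in> space M. v < (SUP s\<in>{0..t}. brox_X W B s \<omega>)}"
proof -
  interpret prob_space M using W by (rule brownian_onD)
  interpret C: prob_space "completion M" by (rule prob_space_completion)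
  have "AE \<omega> in M. v < brox_X W B t \<omega> \<longrightarrow> v < (SUP s\<in>{0..t}. brox_X W B s \<omega>)"
    using AE_tame AE_space
  proof eventually_elim
    case (elim \<omega>)
    have "surj (scale_fun (\<lambda>x. W x \<omega>))" "recurrent_path (\<lambda>r. B r \<omega>)"
      using surj_scale_fun_tame_env[OF brownian_onD(5)[OF W elim(2)]] recurrent_tame_path[of "\<lambda>r. B r \<omega>"] elim(1) by auto
    then have "bdd_above (diffusion (\<lambda>x. W x \<omega>) (\<lambda>r. B r \<omega>) ` {0..t})"
      using brownian_onD(5)[OF B elim(2)] brownian_onD(5)[OF W elim(2)] t by (intro bdd_above_diffusion) auto
    then have "diffusion (\<lambda>x. W x \<omega>) (\<lambda>r. B r \<omega>) t \<le> (SUP s\<in>{0..t}. diffusion (\<lambda>x. W x \<omega>) (\<lambda>r. B r \<omega>) s)"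
      using t by (intro cSUP_upper) auto
    then show ?case by (simp add: brox_X_eq)
  qed
  then have "AE \<omega> in completion M. \<omega> \<in> {\<omega> \<in> space M. v < brox_X W B t \<omega>} \<longrightarrow> \<omega> \<in> {\<omega> \<in> space M. v < (SUP s\<in>{0..t}. brox_X W B s \<omega>)}"
    by (intro AE_completion) (auto elim: eventually_mono)
  then show ?thesis by (rule C.finite_measure_mono_AE) (rule sup_event(1)[OF t v])
qed

end

section \<open>Asymptotics\<close>

lemma tendsto_exp_neg_mult: "c < 0 \<Longrightarrow> ((\<lambda>L::real. exp (c * L)) \<longlongrightarrow> 0) at_top"
  by (rule filterlim_compose[OF exp_at_bot]) (auto intro!: filterlim_tendsto_neg_mult_at_bot[OF tendsto_const _ filterlim_ident])

text \<open>Everything is chosen at unit scale and rescaled later. With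
  \<open>\<theta>\<^sup>2 / 2\<close> strictly between \<open>\<rho>\<close> and
  \<open>pi\<^sup>2 / 8\<close> one has \<open>\<theta> < pi / 2\<close>, which leaves room for a
  height \<open>a > 1\<close>. Then the block is made long, its mesh fine and the averaging cells
  short, in this order, so that each of three errors is below a quarter of the target
  \<open>q\<close>.\<close>

lemma block_constants:
  fixes \<rho> :: real
  assumes \<rho>: "0 < \<rho>" "\<rho> < pi\<^sup>2 / 8"
  obtains \<theta> a \<eta> z h :: real and n p :: nat where "0 < \<theta>" "0 < a" "0 < \<eta>" "0 < z" "0 < h" "\<theta> * (a + \<eta>) < pi / 2" "2 * z + 1 - a < 0"
    "(exp (- \<theta>\<^sup>2 * (n * h) / 2) + n * (3 * h\<^sup>2 * (1 / (8 * \<eta> ^ 4) + 1 / (pi / (2 * \<theta>) - \<eta> - a) ^ 4)))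
        / cos (\<theta> * (a + \<eta>)) + real (Suc n) * (h / 2 ^ p / z\<^sup>2) < exp (- \<rho> * (real (Suc n) * h))"
proof -
  obtain \<sigma> where \<sigma>: "\<rho> < \<sigma>" "\<sigma> < pi\<^sup>2 / 8" using dense[OF \<rho>(2)] by blast
  define \<theta> where "\<theta> = sqrt (2 * \<sigma>)"
  have \<theta>: "0 < \<theta>" "\<theta>\<^sup>2 = 2 * \<sigma>" using \<rho> \<sigma> by (auto simp: \<theta>_def)
  have "\<theta> < pi / 2"
  proof (rule power2_less_imp_less)
    show "\<theta>\<^sup>2 < (pi / 2)\<^sup>2" using \<theta>(2) \<sigma>(2) by (simp add: power_divide)
  qed simp
  then have r: "1 < pi / 2 / \<theta>" using \<theta>(1) by (simp add: pos_less_divide_eq)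
  \<comment> \<open>The gap above 1 is divided into six parts: \<open>a + \<eta> = 1 + 3 * s\<close>
    stays below \<open>pi / 2 / \<theta> = 1 + 6 * s\<close>, and taking \<open>s / 2\<close> for
    \<open>z\<close> gives \<open>2 * z + 1 - a = - s\<close>.\<close>
  define s where "s = (pi / 2 / \<theta> - 1) / 6"
  have s: "0 < s" using r by (simp add: s_def)
  define a where "a = 1 + 2 * s"
  define \<eta> where "\<eta> = s"
  have "a + \<eta> < pi / 2 / \<theta>" using r unfolding a_def \<eta>_def s_def by argo
  then have "\<theta> * (a + \<eta>) < \<theta> * (pi / 2 / \<theta>)" using \<theta>(1) by (rule mult_strict_left_mono)
  then have ang: "\<theta> * (a + \<eta>) < pi / 2" using \<theta>(1) by simp
  define g where "g = cos (\<theta> * (a + \<eta>))"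
  have g: "0 < g" unfolding g_def using \<theta>(1) s ang by (intro cos_gt_zero) (auto simp: a_def \<eta>_def)
  define C where "C = 1 / (8 * \<eta> ^ 4) + 1 / (pi / (2 * \<theta>) - \<eta> - a) ^ 4"
  have C: "0 \<le> C" by (simp add: C_def)
  have "((\<lambda>k. exp ((\<rho> - \<sigma>) * k)) \<longlongrightarrow> 0) at_top" by (rule tendsto_exp_neg_mult) (use \<sigma> in simp)
  then have "\<forall>\<^sub>F k in at_top. exp ((\<rho> - \<sigma>) * k) < g / 4 * exp (- \<rho>)"
    by (rule order_tendstoD) (use g in simp)
  from eventually_conj[OF this eventually_gt_at_top[of 0]] obtain k where k: "exp ((\<rho> - \<sigma>) * k) < g / 4 * exp (- \<rho>)" "0 < k"
    using eventually_happens by fastforce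
  \<comment> \<open>A block has \<open>Suc n\<close> cells although the walk makes only
    \<open>n\<close> steps; \<open>k + 1\<close> bounds its length once
    \<open>h \<le> 1\<close>.\<close>
  define q where "q = exp (- \<rho> * (k + 1))"
  have q: "0 < q" by (simp add: q_def)
  have main: "exp (- \<sigma> * k) / g < q / 4"
  proof -
    have "exp (- \<sigma> * k) = exp (- \<rho> * k) * exp ((\<rho> - \<sigma>) * k)" by (simp add: algebra_simps flip: exp_add)
    also have "\<dots> < exp (- \<rho> * k) * (g / 4 * exp (- \<rho>))" using k(1) by simp
    also have "\<dots> = g * (q / 4)" by (simp add: q_def algebra_simps exp_add exp_diff exp_minus field_simps)
    finally show ?thesis using g by (simp add: pos_divide_less_eq mult.commute)
  qed
  \<comment> \<open>With \<open>n * h = k\<close> fixed, the quartic error is of order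
    \<open>k\<^sup>2 / n\<close>.\<close>
  obtain n0 :: nat where n0: "12 * k\<^sup>2 * C / (g * q) + k + 1 < real n0" using reals_Archimedean2 by blast
  define n where "n = n0"
  have "0 \<le> 12 * k\<^sup>2 * C / (g * q)" using C g q by simp
  then have n: "0 < real n" "k \<le> real n" "12 * k\<^sup>2 * C / (g * q) < real n" using n0 k(2) by (auto simp: n_def)
  define h where "h = k / real n"
  have h: "0 < h" "h \<le> 1" "real n * h = k" using n k(2) by (auto simp: h_def)
  have second: "real n * (3 * h\<^sup>2 * C) / g < q / 4"
  proof -
    have "4 * (real n * (3 * h\<^sup>2 * C)) * real n = 12 * (real n * h)\<^sup>2 * C" by (simp add: power2_eq_square)
    also have "\<dots> = 12 * k\<^sup>2 * C" by (simp only: h(3))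
    also have "\<dots> < real n * (g * q)" using n(3) g q by (simp only: pos_divide_less_eq mult_pos_pos)
    also have "\<dots> = (g * q) * real n" by (rule mult.commute)
    finally have "4 * (real n * (3 * h\<^sup>2 * C)) < g * q" using n(1) by (simp only: mult_less_cancel_right_pos)
    then show ?thesis using g by (simp only: pos_divide_less_eq) (simp add: mult_ac)
  qed
  define s' where "s' = s / 2"
  have "(\<lambda>p. real (Suc n) * h / s'\<^sup>2 * (1 / 2) ^ p) \<longlonglongrightarrow> real (Suc n) * h / s'\<^sup>2 * 0"
    by (intro tendsto_mult tendsto_const LIMSEQ_power_zero) simp
  then have "\<forall>\<^sub>F p in sequentially. real (Suc n) * h / s'\<^sup>2 * (1 / 2) ^ p < q / 4"
    by (rule order_tendstoD) (use q in simp)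
  then obtain p where p: "real (Suc n) * h / s'\<^sup>2 * (1 / 2) ^ p < q / 4"
    using eventually_happens'[OF sequentially_bot] by blast
  have third: "real (Suc n) * (h / 2 ^ p / s'\<^sup>2) < q / 4"
    using p by (simp add: power_one_over field_simps del: of_nat_Suc)
  have "q \<le> exp (- \<rho> * (real (Suc n) * h))"
  proof -
    have "real (Suc n) * h \<le> k + 1" using h by (simp add: distrib_right)
    then have "\<rho> * (real (Suc n) * h) \<le> \<rho> * (k + 1)" using \<rho> by (intro mult_left_mono) auto
    then show ?thesis by (simp add: q_def del: of_nat_Suc)
  qed
  have e: "exp (- \<theta>\<^sup>2 * (real n * h) / 2) = exp (- \<sigma> * k)" unfolding \<theta>(2) h(3) by simp
  note add_strict_mono[OF add_strict_mono[OF main second] third]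
  also have "q / 4 + q / 4 + q / 4 \<le> q" using q by simp
  also note \<open>q \<le> exp (- \<rho> * (real (Suc n) * h))\<close>
  finally have "(exp (- \<theta>\<^sup>2 * (real n * h) / 2) + real n * (3 * h\<^sup>2 * C)) / g + real (Suc n) * (h / 2 ^ p / s'\<^sup>2) < exp (- \<rho> * (real (Suc n) * h))"
    unfolding e add_divide_distrib .
  then show ?thesis
    using that[of \<theta> a \<eta> s' h n p] \<theta>(1) s ang h unfolding C_def g_def by (simp add: a_def \<eta>_def s'_def)
qed

text \<open>The additional term decays in \<open>L\<close>: a rise by \<open>a * L\<close> with
  \<open>a > 1 + 2 * z\<close> outweighs the factor \<open>t = exp L\<close> by which the growth is
  divided. The condition with \<open>2 ^ p\<close> says that the averaging cells have length at
  least 1.\<close>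

lemma eventually_block_constants:
  fixes \<rho> :: real
  assumes \<rho>: "0 < \<rho>" "\<rho> < pi\<^sup>2 / 8"
  obtains \<theta> a \<eta> z h L0 :: real and n p :: nat where "0 < \<theta>" "0 < a" "0 < \<eta>" "0 < z" "0 < h" "0 < L0" "\<theta> * (a + \<eta>) < pi / 2"
    "\<And>L. L0 \<le> L \<Longrightarrow> 1 \<le> h * L\<^sup>2 / 2 ^ p"
    "\<And>L. L0 \<le> L \<Longrightarrow> (exp (- \<theta>\<^sup>2 * (n * h) / 2) + n * (3 * h\<^sup>2 * (1 / (8 * \<eta> ^ 4) + 1 / (pi / (2 * \<theta>) - \<eta> - a) ^ 4)))
        / cos (\<theta> * (a + \<eta>)) + (real (Suc n) * (h / 2 ^ p / z\<^sup>2) + exp ((2 * z + 1 - a) * L) * (real (Suc n))\<^sup>2 / 2)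
      \<le> exp (- \<rho> * (real (Suc n) * h))"
proof -
  from block_constants[OF \<rho>] obtain \<theta> a \<eta> z h :: real and n p :: nat where
    c: "0 < \<theta>" "0 < a" "0 < \<eta>" "0 < z" "0 < h" "\<theta> * (a + \<eta>) < pi / 2" "2 * z + 1 - a < 0" and
    k: "(exp (- \<theta>\<^sup>2 * (n * h) / 2) + n * (3 * h\<^sup>2 * (1 / (8 * \<eta> ^ 4) + 1 / (pi / (2 * \<theta>) - \<eta> - a) ^ 4)))
        / cos (\<theta> * (a + \<eta>)) + real (Suc n) * (h / 2 ^ p / z\<^sup>2) < exp (- \<rho> * (real (Suc n) * h))" (is "?k < ?q")
    by metis
  have "((\<lambda>L. ?k + exp ((2 * z + 1 - a) * L) * (real (Suc n))\<^sup>2 / 2) \<longlongrightarrow> ?k + 0 * (real (Suc n))\<^sup>2 / 2) at_top"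
    by (intro tendsto_intros tendsto_exp_neg_mult c) simp
  then have 1: "\<forall>\<^sub>F L in at_top. ?k + exp ((2 * z + 1 - a) * L) * (real (Suc n))\<^sup>2 / 2 < ?q"
    by (rule order_tendstoD) (use k in simp)
  have "filterlim (\<lambda>L::real. h / 2 ^ p * L\<^sup>2) at_top at_top"
    using c(5) by (intro filterlim_tendsto_pos_mult_at_top[OF tendsto_const] filterlim_pow_at_top filterlim_ident) auto
  then have 2: "\<forall>\<^sub>F L in at_top. 1 \<le> h / 2 ^ p * L\<^sup>2" unfolding filterlim_at_top by blast
  from eventually_conj[OF 1 2] obtain N where N: "\<And>L. N \<le> L \<Longrightarrow> ?k + exp ((2 * z + 1 - a) * L) * (real (Suc n))\<^sup>2 / 2 < ?q \<and> 1 \<le> h / 2 ^ p * L\<^sup>2"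
    unfolding eventually_at_top_linorder by blast
  show ?thesis
  proof (rule that[OF c(1-5) _ c(6), of "max N 1" p n])
    show "1 \<le> h * L\<^sup>2 / 2 ^ p" if "max N 1 \<le> L" for L using N[of L] that by simp
    show "(exp (- \<theta>\<^sup>2 * (n * h) / 2) + n * (3 * h\<^sup>2 * (1 / (8 * \<eta> ^ 4) + 1 / (pi / (2 * \<theta>) - \<eta> - a) ^ 4)))
        / cos (\<theta> * (a + \<eta>)) + (real (Suc n) * (h / 2 ^ p / z\<^sup>2) + exp ((2 * z + 1 - a) * L) * (real (Suc n))\<^sup>2 / 2)
      \<le> ?q" if "max N 1 \<le> L" for L using N[of L] that by simp
  qed simp
qed

text \<open>Even after multiplication by \<open>exp L\<close> all exponents are negative:
  \<open>1 + d / 4 + d / 10 - 2 + d\<close> is below 0 for \<open>d < 1 / 2\<close>.\<close>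

lemma eventually_valley_error:
  fixes d :: real
  assumes d: "0 < d" "d < 1 / 2"
  shows "\<forall>\<^sub>F L in at_top. 2 * exp (- exp (d / 2 * L) / 4) + exp ((d / 8 - 3) * L)
      + (exp L + 1) * (exp ((d / 4 + d / 10 - 2 + d) * L) / 2 + 14 * exp ((d / 8 - 3) * L)) \<le> 1 / 2"
proof -
  have "filterlim (\<lambda>L. exp (d / 2 * L)) at_top at_top"
    using d by (intro filterlim_compose[OF exp_at_top] filterlim_tendsto_pos_mult_at_top[OF tendsto_const _ filterlim_ident]) simp
  then have "filterlim (\<lambda>L. - (1 / 4) * exp (d / 2 * L)) at_bot at_top"
    by (intro filterlim_tendsto_neg_mult_at_bot[OF tendsto_const]) simp
  then have 1: "((\<lambda>L. exp (- (1 / 4) * exp (d / 2 * L))) \<longlongrightarrow> 0) at_top"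
    by (rule filterlim_compose[OF exp_at_bot])
  have "((\<lambda>L. 2 * exp (- (1 / 4) * exp (d / 2 * L)) + exp ((d / 8 - 3) * L)
      + ((exp ((1 + (d / 4 + d / 10 - 2 + d)) * L) + exp ((d / 4 + d / 10 - 2 + d) * L)) / 2
        + 14 * (exp ((1 + (d / 8 - 3)) * L) + exp ((d / 8 - 3) * L)))) \<longlongrightarrow> 2 * 0 + 0 + ((0 + 0) / 2 + 14 * (0 + 0))) at_top"
    using d by (intro tendsto_intros tendsto_exp_neg_mult 1) auto
  then have "\<forall>\<^sub>F L in at_top. 2 * exp (- (1 / 4) * exp (d / 2 * L)) + exp ((d / 8 - 3) * L)
      + ((exp ((1 + (d / 4 + d / 10 - 2 + d)) * L) + exp ((d / 4 + d / 10 - 2 + d) * L)) / 2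
        + 14 * (exp ((1 + (d / 8 - 3)) * L) + exp ((d / 8 - 3) * L))) < 1 / 2"
    by (rule order_tendstoD) simp
  then show ?thesis
  proof eventually_elim
    case (elim L)
    have e: "exp L * exp (c * L) = exp ((1 + c) * L)" for c :: real by (simp add: distrib_right exp_add)
    have "(exp L + 1) * (exp ((d / 4 + d / 10 - 2 + d) * L) / 2 + 14 * exp ((d / 8 - 3) * L))
      = (exp ((1 + (d / 4 + d / 10 - 2 + d)) * L) + exp ((d / 4 + d / 10 - 2 + d) * L)) / 2
        + 14 * (exp ((1 + (d / 8 - 3)) * L) + exp ((d / 8 - 3) * L))"
      unfolding e[symmetric] by argo
    then show ?case using elim by simp
  qed
qed

text \<open>A distance up to \<open>exp (d / 16 * L)\<close> makes the whole width a small power of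
  \<open>t\<close>; the doubled exponent absorbs the polynomial part.\<close>

lemma eventually_valley_width:
  fixes d :: real
  assumes d: "0 < d"
  shows "\<forall>\<^sub>F L in at_top. exp (d / 16 * L) + 1 + 2 * L\<^sup>2 \<le> exp (d / 8 * L)"
proof -
  have a: "0 < d / 16" using d by simp
  have pw: "((\<lambda>L. L ^ 2 / exp (d / 16 * L)) \<longlongrightarrow> 0) at_top"
  proof -
    have "((\<lambda>L::real. (d / 16 * L) ^ 2 / exp (d / 16 * L)) \<longlongrightarrow> 0) at_top"
      using a by (intro filterlim_compose[OF tendsto_power_div_exp_0] filterlim_tendsto_pos_mult_at_top[OF tendsto_const _ filterlim_ident])
    then have "((\<lambda>L::real. 1 / (d / 16) ^ 2 * ((d / 16 * L) ^ 2 / exp (d / 16 * L))) \<longlongrightarrow> 1 / (d / 16) ^ 2 * 0) at_top"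
      by (intro tendsto_mult tendsto_const)
    moreover have "1 / (d / 16) ^ 2 * ((d / 16 * L) ^ 2 / y) = L ^ 2 / y" for L y :: real
      using d by (simp add: power_mult_distrib power_divide)
    ultimately show ?thesis by (simp only: mult_zero_right)
  qed
  have "((\<lambda>L. exp (- (d / 16) * L)) \<longlongrightarrow> 0) at_top" by (rule tendsto_exp_neg_mult) (use d in simp)
  with pw have "((\<lambda>L. exp (- (d / 16) * L) + 2 * (L ^ 2 / exp (d / 16 * L))) \<longlongrightarrow> 0 + 2 * 0) at_top"
    by (intro tendsto_intros)
  then have 1: "\<forall>\<^sub>F L in at_top. exp (- (d / 16) * L) + 2 * (L ^ 2 / exp (d / 16 * L)) < 1"
    by (rule order_tendstoD) simp
  have "filterlim (\<lambda>L. exp (d / 16 * L)) at_top at_top"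
    using a by (intro filterlim_compose[OF exp_at_top] filterlim_tendsto_pos_mult_at_top[OF tendsto_const _ filterlim_ident])
  then have 2: "\<forall>\<^sub>F L in at_top. 2 \<le> exp (d / 16 * L)" by (simp add: filterlim_at_top)
  show ?thesis using 1 2
  proof eventually_elim
    case (elim L)
    define y where "y = exp (d / 16 * L)"
    have y: "2 \<le> y" "0 < y" "1 / y + 2 * (L\<^sup>2 / y) < 1" using elim by (auto simp: y_def exp_minus inverse_eq_divide)
    have "1 + 2 * L\<^sup>2 < y" using y(2,3) by (simp add: field_simps)
    also have "y \<le> y * y - y" using y mult_right_mono[of 2 y y] by linarith
    also have "y * y = exp (d / 8 * L)" by (simp add: y_def flip: exp_add)
    finally show ?case by (simp add: y_def)
  qed
qed

lemma eventually_valley_exponents: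
  fixes d :: real
  assumes d: "0 < d" "d < 1 / 2"
  obtains L0 :: real where "0 < L0"
    "\<And>L. L0 \<le> L \<Longrightarrow> 10 \<le> L\<^sup>2" "\<And>L. L0 \<le> L \<Longrightarrow> 8 / L \<le> d / 20 * L"
    "\<And>L. L0 \<le> L \<Longrightarrow> exp (d / 16 * L) + 1 + 2 * L\<^sup>2 \<le> exp (d / 8 * L)"
    "\<And>L. L0 \<le> L \<Longrightarrow> 2 * exp (- exp (d / 2 * L) / 4) + exp ((d / 8 - 3) * L)
      + (exp L + 1) * (exp ((d / 4 + d / 10 - 2 + d) * L) / 2 + 14 * exp ((d / 8 - 3) * L)) \<le> 1 / 2"
proof -
  have sq: "filterlim (\<lambda>L::real. L\<^sup>2) at_top at_top" by (intro filterlim_pow_at_top filterlim_ident) simp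
  then have "\<forall>\<^sub>F L in at_top. max 10 (160 / d) \<le> (L::real)\<^sup>2" by (simp only: filterlim_at_top)
  from eventually_conj[OF this eventually_conj[OF eventually_valley_width[OF d(1)] eventually_valley_error[OF d]]]
  obtain N where N: "\<And>L. N \<le> L \<Longrightarrow> max 10 (160 / d) \<le> L\<^sup>2 \<and> exp (d / 16 * L) + 1 + 2 * L\<^sup>2 \<le> exp (d / 8 * L) \<and>
      2 * exp (- exp (d / 2 * L) / 4) + exp ((d / 8 - 3) * L)
      + (exp L + 1) * (exp ((d / 4 + d / 10 - 2 + d) * L) / 2 + 14 * exp ((d / 8 - 3) * L)) \<le> 1 / 2"
    unfolding eventually_at_top_linorder by blast
  show ?thesis
  proof (rule that[of "max N 1"])
    fix L assume L: "max N 1 \<le> L"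
    then have "160 / d \<le> L\<^sup>2" using N[of L] by auto
    then have "160 \<le> d * L * L" using d by (simp add: pos_divide_le_eq power2_eq_square mult_ac)
    then show "8 / L \<le> d / 20 * L" using L by (simp add: pos_divide_le_eq)
  qed (use N in auto)
qed

context
  fixes M :: "'a measure" and W B :: "real \<Rightarrow> 'a \<Rightarrow> real"
  assumes W: "brownian_on M UNIV W" and B: "brownian_on M {0..} B"
    and indep: "prob_space.indep_var M (Pi\<^sub>M UNIV (\<lambda>_. borel)) (\<lambda>\<omega> x. W x \<omega>)
                                 (Pi\<^sub>M {0..} (\<lambda>_. borel)) (\<lambda>\<omega>. restrict (\<lambda>s. B s \<omega>) {0..})"
begin

text \<open>Brownian scaling transfers the constants from unit scale to scale
  \<open>L = ln t\<close>: lengths are multiplied by \<open>L\<^sup>2\<close>, heights by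
  \<open>L\<close>, and \<open>\<theta>\<close> is divided by \<open>L\<close>. Then
  \<open>\<kappa>\<close> does not depend on \<open>L\<close> apart from one decaying
  exponential.\<close>

lemma prob_sup_decay:
  fixes \<rho> :: real
  assumes \<rho>: "0 < \<rho>" "\<rho> < pi\<^sup>2 / 8"
  shows "\<exists>K L0. 0 < K \<and> 0 < L0 \<and> (\<forall>t v m. 0 < t \<longrightarrow> L0 \<le> ln t \<longrightarrow> 1 + real m * (K * (ln t)\<^sup>2) \<le> v - 1 \<longrightarrow>
      measure (completion M) {\<omega> \<in> space M. v < (SUP s\<in>{0..t}. brox_X W B s \<omega>)} \<le> exp (1 - \<rho> * K * real m))"
proof -
  from eventually_block_constants[OF \<rho>] obtain \<theta> a \<eta> z h L0 :: real and n p :: nat where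
    c: "0 < \<theta>" "0 < a" "0 < \<eta>" "0 < z" "0 < h" "0 < L0" "\<theta> * (a + \<eta>) < pi / 2" and
    l: "\<And>L. L0 \<le> L \<Longrightarrow> 1 \<le> h * L\<^sup>2 / 2 ^ p" and
    k: "\<And>L. L0 \<le> L \<Longrightarrow> (exp (- \<theta>\<^sup>2 * (n * h) / 2) + n * (3 * h\<^sup>2 * (1 / (8 * \<eta> ^ 4) + 1 / (pi / (2 * \<theta>) - \<eta> - a) ^ 4)))
        / cos (\<theta> * (a + \<eta>)) + (real (Suc n) * (h / 2 ^ p / z\<^sup>2) + exp ((2 * z + 1 - a) * L) * (real (Suc n))\<^sup>2 / 2)
      \<le> exp (- \<rho> * (real (Suc n) * h))"
    by metis
  interpret prob_space M using W by (rule brownian_onD)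
  define J where "J = Suc n"
  show ?thesis
  proof (rule exI[of _ "real J * h"], rule exI[of _ L0], intro conjI allI impI)
    fix t v :: real and m :: nat
    assume t: "0 < t" "L0 \<le> ln t" and v: "1 + real m * (real J * h * (ln t)\<^sup>2) \<le> v - 1"
    define L where "L = ln t"
    have L: "0 < L" "L0 \<le> L" "t = exp L" using t c(6) unfolding L_def by (simp_all add: exp_ln less_le_trans[OF _ t(2)])
    define cc where "cc = h * L\<^sup>2"
    have cc: "0 < cc" using c L by (simp add: cc_def)
    have lc: "1 \<le> cc / 2 ^ p" "cc / 2 ^ p \<le> cc"
      using l[OF L(2)] cc by (auto simp: cc_def divide_le_eq mult_le_cancel_left1)
    define r where "r = 2 / (t * (real J)\<^sup>2)"
    have J: "0 < J" by (simp add: J_def)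
    have r: "0 < r" using t J by (simp add: r_def)
    define Z where "Z w = (\<Prod>k<m. 1 / (1 + r * block_rise w (1 + real k * (real J * cc)) cc (cc / 2 ^ p) J))" for w
    have fac: "0 \<le> 1 / (1 + r * block_rise w x cc (cc / 2 ^ p) J)" "1 / (1 + r * block_rise w x cc (cc / 2 ^ p) J) \<le> 1" for w x
    proof -
      have "0 \<le> r * block_rise w x cc (cc / 2 ^ p) J" using r block_rise_nonneg[of w x cc "cc / 2 ^ p" J] by simp
      then show "0 \<le> 1 / (1 + r * block_rise w x cc (cc / 2 ^ p) J)" "1 / (1 + r * block_rise w x cc (cc / 2 ^ p) J) \<le> 1" by auto
    qed
    have Z: "0 \<le> Z w" "Z w \<le> 1" for w
      unfolding Z_def using fac by (auto intro!: prod_nonneg prod_le_1)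
    have [measurable]: "(\<lambda>\<omega>. Z (\<lambda>x. W x \<omega>)) \<in> borel_measurable M"
      unfolding Z_def using cc by (intro borel_measurable_prod borel_measurable_divide borel_measurable_add borel_measurable_times borel_measurable_const measurable_block_rise[OF W]) auto
    have v0: "0 \<le> v"
    proof -
      have "0 \<le> real m * (real J * h * (ln t)\<^sup>2)" using c by simp
      then show ?thesis using v by linarith
    qed
    define \<kappa> where "\<kappa> = (exp (- (\<theta> / L)\<^sup>2 * (n * cc) / 2) + n * (3 * cc\<^sup>2 * (1 / (8 * (\<eta> * L) ^ 4) + 1 / (pi / (2 * (\<theta> / L)) - \<eta> * L - a * L) ^ 4)))
        / cos (\<theta> / L * (a * L + \<eta> * L)) + (real (Suc n) * (cc / 2 ^ p / (z * L)\<^sup>2) + exp (2 * (z * L) - a * L) / r)"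
    have I:  "(\<integral>\<omega>. Z (\<lambda>x. W x \<omega>) \<partial>M) \<le> (\<kappa>) ^ m"
    proof -
      have ang: "\<theta> / L * (a * L + \<eta> * L) < pi / 2" using c L by (simp add: distrib_left)
      show ?thesis unfolding Z_def J_def \<kappa>_def
        by (rule block_rise_product_bound[OF W cc r _ _ _ _ ang]) (use c L in auto)
    qed
    have eq: "\<kappa>
      = (exp (- \<theta>\<^sup>2 * (n * h) / 2) + n * (3 * h\<^sup>2 * (1 / (8 * \<eta> ^ 4) + 1 / (pi / (2 * \<theta>) - \<eta> - a) ^ 4)))
        / cos (\<theta> * (a + \<eta>)) + (real (Suc n) * (h / 2 ^ p / z\<^sup>2) + exp ((2 * z + 1 - a) * L) * (real (Suc n))\<^sup>2 / 2)"
    proof -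
      have 1: "(\<theta> / L)\<^sup>2 * (n * cc) = \<theta>\<^sup>2 * (n * h)" using L by (simp add: cc_def power_divide)
      have "pi / (2 * (\<theta> / L)) - \<eta> * L - a * L = (pi / (2 * \<theta>) - \<eta> - a) * L" using L c by (simp add: field_simps)
      then have 2: "cc\<^sup>2 * (1 / (8 * (\<eta> * L) ^ 4) + 1 / (pi / (2 * (\<theta> / L)) - \<eta> * L - a * L) ^ 4)
        = h\<^sup>2 * (1 / (8 * \<eta> ^ 4) + 1 / (pi / (2 * \<theta>) - \<eta> - a) ^ 4)"
      proof -
        have s: "(h * L\<^sup>2)\<^sup>2 * (1 / (8 * (\<eta> * L) ^ 4) + 1 / (y * L) ^ 4) = h\<^sup>2 * (1 / (8 * \<eta> ^ 4) + 1 / y ^ 4)" for y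
        proof -
          have "(h * L\<^sup>2)\<^sup>2 = h\<^sup>2 * L ^ 4" by (simp add: power_mult_distrib flip: power_mult)
          moreover have "L ^ 4 * (1 / (8 * (\<eta> * L) ^ 4) + 1 / (y * L) ^ 4) = 1 / (8 * \<eta> ^ 4) + 1 / y ^ 4"
            using L(1) by (simp add: power_mult_distrib distrib_left)
          ultimately show ?thesis by (simp only: mult.assoc)
        qed
        show ?thesis unfolding cc_def \<open>pi / (2 * (\<theta> / L)) - \<eta> * L - a * L = (pi / (2 * \<theta>) - \<eta> - a) * L\<close> by (rule s)
      qed
      have 3: "\<theta> / L * (a * L + \<eta> * L) = \<theta> * (a + \<eta>)" using L by (simp add: distrib_left)
      have 4: "cc / 2 ^ p / (z * L)\<^sup>2 = h / 2 ^ p / z\<^sup>2" using L by (simp add: cc_def power_mult_distrib)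
      have 5: "exp (2 * (z * L) - a * L) / r = exp ((2 * z + 1 - a) * L) * (real (Suc n))\<^sup>2 / 2"
      proof -
        \<comment> \<open>The additional \<open>L\<close> in the exponent is the factor
          \<open>t\<close> contained in \<open>1 / r\<close>.\<close>
        have "(2 * z + 1 - a) * L = (2 * (z * L) - a * L) + L" by (simp add: algebra_simps)
        then have "exp ((2 * z + 1 - a) * L) = exp (2 * (z * L) - a * L) * t" using L(3) by (simp only: exp_add)
        then show ?thesis by (simp add: r_def J_def)
      qed
      show ?thesis unfolding \<kappa>_def mult.assoc[of 3] 2 3 4 5 using 1 by simp
    qed
    have "0 < cos (\<theta> * (a + \<eta>))" using c by (intro cos_gt_zero) auto
    then have "0 \<le> \<kappa>"
      unfolding eq using c by (intro add_nonneg_nonneg divide_nonneg_nonneg mult_nonneg_nonneg) auto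
    moreover have "\<kappa> \<le> exp (- \<rho> * (real (Suc n) * h))" unfolding eq by (rule k[OF L(2)])
    ultimately have "\<kappa> ^ m \<le> exp (- \<rho> * (real (Suc n) * h)) ^ m" by (intro power_mono)
    with I have "exp 1 * (\<integral>\<omega>. Z (\<lambda>x. W x \<omega>) \<partial>M) \<le> exp 1 * exp (- \<rho> * (real (Suc n) * h)) ^ m" by simp
    also have "\<dots> = exp (1 - \<rho> * (real J * h) * real m)"
      by (simp add: J_def algebra_simps flip: exp_add exp_of_nat_mult)
    finally have decay: "(\<integral>\<omega>. exp 1 * Z (\<lambda>x. W x \<omega>) \<partial>M) \<le> exp (1 - \<rho> * (real J * h) * real m)" by simp
    have "measure (completion M) {\<omega> \<in> space M. v < (SUP s\<in>{0..t}. brox_X W B s \<omega>)} \<le> (\<integral>\<omega>. exp 1 * Z (\<lambda>x. W x \<omega>) \<partial>M)"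
    proof (rule annealed_upper[OF W B indep t(1) v0])
      show "integrable M (\<lambda>\<omega>. exp 1 * Z (\<lambda>x. W x \<omega>))"
        using Z by (intro integrable_const_bound[where B="exp 1"]) auto
      fix w N A assume w: "continuous_on UNIV w" "surj (scale_fun w)" "0 < N" "A \<in> sets M"
        "\<And>\<omega>. \<omega> \<in> A \<Longrightarrow> \<exists>u\<ge>0. u < N \<and> scale_fun w v < B u \<omega> \<and> clock (speed_rate w) (\<lambda>r. B r \<omega>) u < t"
      have "1 + real m * (real J * cc) \<le> v - 1" using v by (simp add: cc_def L_def mult_ac)
      from quenched_blocks_upper[OF w(1,2) B t(1) w(3) lc J this w(4,5)]
      show "measure M A \<le> exp 1 * Z w" unfolding Z_def r_def .
    qed (use Z in simp)
    also note decay
    finally show "measure (completion M) {\<omega> \<in> space M. v < (SUP s\<in>{0..t}. brox_X W B s \<omega>)} \<le> exp (1 - \<rho> * (real J * h) * real m)" .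
  qed (use c in \<open>auto simp: J_def\<close>)
qed

text \<open>Lowering the permitted rise to \<open>(1 - d) * ln t\<close> frees a factor
  \<open>exp (d * L)\<close>, of which tube errors and the squared width consume half. The tubes
  have length \<open>L\<^sup>2\<close>, slope of order \<open>1 / L\<close> and width of order
  \<open>L\<close>, so by scaling each of them costs at most the constant factor
  \<open>exp (- C0)\<close>.\<close>

lemma prob_diffusion_decay:
  fixes d :: real
  assumes d: "0 < d" "d < 1 / 2"
  shows "\<exists>C L0. 0 < L0 \<and> (\<forall>t v. 0 < t \<longrightarrow> L0 \<le> ln t \<longrightarrow> 0 \<le> v \<longrightarrow> v \<le> exp (d / 16 * ln t) \<longrightarrow>
      exp (- C - pi\<^sup>2 * (v + 1) / (8 * (1 - d)\<^sup>2 * (ln t)\<^sup>2)) \<le> measure (completion M) {\<omega> \<in> space M. v < brox_X W B t \<omega>})"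
proof -
  from eventually_valley_exponents[OF d] obtain L0 :: real where L0: "0 < L0" and
    ev: "\<And>L. L0 \<le> L \<Longrightarrow> 10 \<le> L\<^sup>2" "\<And>L. L0 \<le> L \<Longrightarrow> 8 / L \<le> d / 20 * L"
    "\<And>L. L0 \<le> L \<Longrightarrow> exp (d / 16 * L) + 1 + 2 * L\<^sup>2 \<le> exp (d / 8 * L)"
    "\<And>L. L0 \<le> L \<Longrightarrow> 2 * exp (- exp (d / 2 * L) / 4) + exp ((d / 8 - 3) * L)
      + (exp L + 1) * (exp ((d / 4 + d / 10 - 2 + d) * L) / 2 + 14 * exp ((d / 8 - 3) * L)) \<le> 1 / 2"
    by metis
  define C0 where "C0 = (64 + (pi / (2 * (d / 20)))\<^sup>2) / 2 + 8 * (d / 20)"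
  show ?thesis
  proof (rule exI[of _ "2 * C0 + ln 2"], rule exI[of _ L0], intro conjI allI impI L0)
    fix t v :: real assume t: "0 < t" "L0 \<le> ln t" and v: "0 \<le> v" "v \<le> exp (d / 16 * ln t)"
    define L where "L = ln t"
    have L: "0 < L" "L0 \<le> L" "t = exp L" using t L0 unfolding L_def by (simp_all add: exp_ln less_le_trans[OF _ t(2)])
    define e where "e = d / 20 * L"
    define a where "a = (1 - d) * L"
    define V where "V = v + 1"
    define D where "D = V + 2 * L\<^sup>2"
    \<comment> \<open>The exponents add up as \<open>d / 4\<close> from \<open>D\<^sup>2\<close>,
      \<open>1 - d\<close> from \<open>a\<close> and \<open>d / 4\<close> from \<open>5 * e\<close>,
      which makes \<open>1 - d / 2\<close>; so \<open>t / U = exp (d / 2 * L)\<close> is still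
      large.\<close>
    define U where "U = exp ((1 - d / 2) * L)"
    define \<mu> where "\<mu> = - 8 / L"
    have e0: "0 < e" and a0: "0 < a" using d L by (simp_all add: e_def a_def)
    define E where "E = {\<omega> \<in> space M.
      (\<forall>x. - L\<^sup>2 \<le> x \<and> x \<le> 0 \<longrightarrow> \<bar>W x \<omega> - W (- L\<^sup>2) \<omega> - \<mu> * (x - - L\<^sup>2)\<bar> \<le> e) \<and>
      (\<forall>x y. 0 \<le> x \<and> x \<le> y \<and> y \<le> V \<longrightarrow> W y \<omega> - W x \<omega> \<le> a) \<and>
      (\<forall>x. V \<le> x \<and> x \<le> V + L\<^sup>2 \<longrightarrow> \<bar>W x \<omega> - W V \<omega> - \<mu> * (x - V)\<bar> \<le> e)}"
    have ord: "- L\<^sup>2 < 0" "0 < V" "V < V + L\<^sup>2" using L v by (auto simp: V_def)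
    note T = brownian_tube_rise_tube[OF W ord a0 e0, of \<mu>, folded E_def]
    have const: "exp (- (\<mu>\<^sup>2 + (pi / (2 * e))\<^sup>2) * L\<^sup>2 / 2) / exp (\<bar>\<mu>\<bar> * e) = exp (- C0)"
    proof -
      have 1: "\<bar>\<mu>\<bar> * e = 8 * (d / 20)" using L by (simp add: \<mu>_def e_def)
      have 2: "\<mu>\<^sup>2 * L\<^sup>2 = 64" using L by (simp add: \<mu>_def power_divide)
      have 3: "(pi / (2 * e))\<^sup>2 * L\<^sup>2 = (pi / (2 * (d / 20)))\<^sup>2" using L by (simp add: e_def power_divide power_mult_distrib)
      have "(\<mu>\<^sup>2 + (pi / (2 * e))\<^sup>2) * L\<^sup>2 = 64 + (pi / (2 * (d / 20)))\<^sup>2" by (simp only: distrib_right 2 3)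
      then have "- (\<mu>\<^sup>2 + (pi / (2 * e))\<^sup>2) * L\<^sup>2 / 2 - \<bar>\<mu>\<bar> * e = - C0"
        unfolding C0_def using 1 by (simp only: mult_minus_left)
      then show ?thesis by (simp flip: exp_diff)
    qed
    have E: "exp (- C0) * exp (- pi\<^sup>2 * V / (8 * a\<^sup>2)) * exp (- C0) \<le> measure M E"
    proof -
      have "0 - - L\<^sup>2 = L\<^sup>2" "V - 0 = V" "V + L\<^sup>2 - V = L\<^sup>2" by simp_all
      from T(2)[unfolded this const] show ?thesis .
    qed
    have D: "D \<le> exp (d / 8 * L)" "0 \<le> D"
    proof -
      show "D \<le> exp (d / 8 * L)" using ev(3)[OF L(2)] v(2) unfolding D_def V_def L_def by linarith
      show "0 \<le> D" using ord(2) by (simp add: D_def)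
    qed
    have D2: "D\<^sup>2 \<le> exp (d / 4 * L)"
    proof -
      have "D\<^sup>2 \<le> (exp (d / 8 * L))\<^sup>2" using D by (intro power_mono)
      also have "\<dots> = exp (d / 4 * L)" by (simp add: power2_eq_square flip: exp_add)
      finally show ?thesis .
    qed
    have small: "2 * exp (- t / (4 * U)) + D / t ^ 3 + (t + 1) * (D\<^sup>2 * exp (2 * e) / (2 * U\<^sup>2) + 14 * D / t ^ 3) \<le> 1 / 2"
    proof -
      have 1: "- t / (4 * U) = - exp (d / 2 * L) / 4"
      proof -
        have "t = exp (d / 2 * L) * U" unfolding L(3) U_def by (simp add: algebra_simps flip: exp_add)
        then show ?thesis by (simp add: U_def)
      qed
      have t3: "t ^ 3 = exp (3 * L)" unfolding L(3) by (simp flip: exp_of_nat_mult)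
      have "D / t ^ 3 \<le> exp (d / 8 * L) / exp (3 * L)" unfolding t3 by (intro divide_right_mono D) simp
      then have 2: "D / t ^ 3 \<le> exp ((d / 8 - 3) * L)" by (simp add: left_diff_distrib exp_diff)
      have "D\<^sup>2 * exp (2 * e) / (2 * U\<^sup>2) \<le> exp (d / 4 * L) * exp (2 * e) / (2 * U\<^sup>2)"
        by (intro divide_right_mono mult_right_mono D2) auto
      also have "\<dots> = exp ((d / 4 + d / 10 - 2 + d) * L) / 2"
      proof -
        have "(d / 4 + d / 10 - 2 + d) * L = d / 4 * L + 2 * e - ((1 - d / 2) * L + (1 - d / 2) * L)" by (simp add: e_def algebra_simps)
        then have "exp ((d / 4 + d / 10 - 2 + d) * L) = exp (d / 4 * L) * exp (2 * e) / U\<^sup>2"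
          by (simp only: U_def power2_eq_square exp_diff exp_add)
        then show ?thesis by simp
      qed
      finally have "D\<^sup>2 * exp (2 * e) / (2 * U\<^sup>2) + 14 * D / t ^ 3 \<le> exp ((d / 4 + d / 10 - 2 + d) * L) / 2 + 14 * exp ((d / 8 - 3) * L)"
        using 2 by simp
      then have "(t + 1) * (D\<^sup>2 * exp (2 * e) / (2 * U\<^sup>2) + 14 * D / t ^ 3) \<le> (exp L + 1) * (exp ((d / 4 + d / 10 - 2 + d) * L) / 2 + 14 * exp ((d / 8 - 3) * L))"
        unfolding L(3) by (intro mult_left_mono) (auto simp: add_nonneg_nonneg)
      then show ?thesis using 2 ev(4)[OF L(2)] unfolding 1 by linarith
    qed
    have quenched: "measure M A \<le> 1 / 2" if \<omega>: "\<omega> \<in> E" and surj: "surj (scale_fun (\<lambda>x. W x \<omega>))" and N: "0 < N" and A: "A \<in> sets M"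
      "\<And>\<omega>'. \<omega>' \<in> A \<Longrightarrow> t < clock (speed_rate (\<lambda>x. W x \<omega>)) (\<lambda>r. B r \<omega>') N \<and>
        (\<exists>u\<ge>0. clock (speed_rate (\<lambda>x. W x \<omega>)) (\<lambda>r. B r \<omega>') u = t \<and> B u \<omega>' \<le> scale_fun (\<lambda>x. W x \<omega>) v)" for \<omega> N A
    proof -
      have \<omega>M: "\<omega> \<in> space M" using \<omega> by (simp add: E_def)
      have "measure M A \<le> 2 * exp (- t / (4 * U)) + D / t ^ 3 + (t + 1) * (D\<^sup>2 * exp (2 * e) / (2 * U\<^sup>2) + 14 * D / t ^ 3)"
      proof (rule quenched_valley_lower[OF brownian_onD(5)[OF W \<omega>M] brownian_onD(4)[OF W \<omega>M] surj B N L(1) ev(1)[OF L(2)], where a=a and e=e and V=V and v=v and D=D])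
        show "8 / L \<le> e" using ev(2)[OF L(2)] by (simp add: e_def)
        show "e \<le> L / 10" using d L by (simp add: e_def)
        show "0 \<le> a" "a \<le> L" using a0 d L by (auto simp: a_def mult_le_cancel_right1)
        show "0 \<le> v" "v < V" using v by (auto simp: V_def)
        show "D = V + 2 * L\<^sup>2" by (rule D_def)
        show "t = exp L" by (rule L(3))
        show "1 \<le> U" using d L by (simp add: U_def)
        have "D\<^sup>2 * exp (a + 5 * e) \<le> exp (d / 4 * L) * exp (a + 5 * e)" by (intro mult_right_mono D2) simp
        also have "\<dots> = U" unfolding U_def a_def e_def by (simp add: algebra_simps flip: exp_add)
        finally show "D\<^sup>2 * exp (a + 5 * e) \<le> U" .
      qed (use \<omega> A in \<open>auto simp: E_def \<mu>_def\<close>)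
      then show ?thesis using small by linarith
    qed
    \<comment> \<open>Any error bound below 1 would serve; the factor lost here is the
      \<open>ln 2\<close> in the constant.\<close>
    have lower: "(1 - 1 / 2) * measure M E \<le> measure (completion M) {\<omega> \<in> space M. v < brox_X W B t \<omega>}"
      by (rule annealed_lower[OF W B indep t(1) T(1)]) (rule quenched)
    have "exp (- (2 * C0 + ln 2) - pi\<^sup>2 * (v + 1) / (8 * (1 - d)\<^sup>2 * (ln t)\<^sup>2)) = 1 / 2 * (exp (- C0) * exp (- pi\<^sup>2 * V / (8 * a\<^sup>2)) * exp (- C0))"
    proof -
      have half: "1 / 2 = exp (- ln (2 :: real))" by (simp add: exp_minus)
      have "pi\<^sup>2 * (v + 1) / (8 * (1 - d)\<^sup>2 * (ln t)\<^sup>2) = pi\<^sup>2 * V / (8 * a\<^sup>2)"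
        by (simp add: V_def a_def L_def power_mult_distrib mult.assoc)
      then have "- (2 * C0 + ln 2) - pi\<^sup>2 * (v + 1) / (8 * (1 - d)\<^sup>2 * (ln t)\<^sup>2) = - ln 2 + (- C0 + - pi\<^sup>2 * V / (8 * a\<^sup>2) + - C0)"
        by simp
      then show ?thesis unfolding half by (simp only: exp_add)
    qed
    also have "\<dots> \<le> 1 / 2 * measure M E" using E by simp
    also have "\<dots> \<le> measure (completion M) {\<omega> \<in> space M. v < brox_X W B t \<omega>}" using lower by simp
    finally show "exp (- (2 * C0 + ln 2) - pi\<^sup>2 * (v + 1) / (8 * (1 - d)\<^sup>2 * (ln t)\<^sup>2)) \<le> measure (completion M) {\<omega> \<in> space M. v < brox_X W B t \<omega>}" .
  qed
qed

section \<open>Passage to the limit\<close>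

context
  fixes t v :: "nat \<Rightarrow> real"
  assumes t: "filterlim t at_top sequentially" and v: "filterlim v at_top sequentially"
    and vt: "filterlim (\<lambda>n. v n / (ln (t n))\<^sup>2) at_top sequentially" and lv: "(\<lambda>n. ln (v n) / ln (t n)) \<longlonglongrightarrow> 0"
begin

lemma filterlim_ln_t: "filterlim (\<lambda>n. ln (t n)) at_top sequentially"
  by (rule filterlim_compose[OF ln_at_top t])

lemma tendsto_ratio_0: "(\<lambda>n. (ln (t n))\<^sup>2 / v n) \<longlonglongrightarrow> 0" "(\<lambda>n. 1 / v n) \<longlonglongrightarrow> 0"
proof -
  have "(\<lambda>n. inverse (v n / (ln (t n))\<^sup>2)) \<longlonglongrightarrow> 0" "(\<lambda>n. inverse (v n)) \<longlonglongrightarrow> 0"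
    by (rule tendsto_inverse_0_at_top[OF vt] tendsto_inverse_0_at_top[OF v])+
  then show "(\<lambda>n. (ln (t n))\<^sup>2 / v n) \<longlonglongrightarrow> 0" "(\<lambda>n. 1 / v n) \<longlonglongrightarrow> 0"
    by (simp_all add: inverse_eq_divide)
qed

text \<open>The rate \<open>pi\<^sup>2 / (8 * (1 - d)\<^sup>2)\<close> tends to
  \<open>pi\<^sup>2 / 8\<close> as \<open>d\<close> decreases to 0. For fixed \<open>d\<close>, the
  constant \<open>C\<close> and the extra unit in \<open>v + 1\<close> vanish after multiplication
  by \<open>(ln (t n))\<^sup>2 / v n\<close>. Positivity is recorded because later comparisons of
  logarithms depend on it.\<close>

lemma eventually_rate_lower:
  assumes a: "a < - (pi\<^sup>2 / 8)"
  shows "\<forall>\<^sub>F n in sequentially. 0 < measure (completion M) {\<omega> \<in> space M. brox_X W B (t n) \<omega> > v n} \<and>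
    a < (ln (t n))\<^sup>2 / v n * ln (measure (completion M) {\<omega> \<in> space M. brox_X W B (t n) \<omega> > v n})"
proof -
  have "((\<lambda>d. - (pi\<^sup>2 / (8 * (1 - d)\<^sup>2))) \<longlongrightarrow> - (pi\<^sup>2 / (8 * (1 - 0)\<^sup>2))) (at_right 0)"
    by (intro tendsto_intros) auto
  then have "\<forall>\<^sub>F d in at_right 0. a < - (pi\<^sup>2 / (8 * (1 - d)\<^sup>2))"
    by (rule order_tendstoD) (use a in simp)
  moreover have "\<forall>\<^sub>F d in at_right (0::real). d \<in> {0<..<1 / 2}" by (rule eventually_at_right_real) simp
  ultimately have "\<forall>\<^sub>F d in at_right 0. a < - (pi\<^sup>2 / (8 * (1 - d)\<^sup>2)) \<and> d \<in> {0<..<1 / 2}" by (rule eventually_conj)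
  from eventually_happens'[OF trivial_limit_at_right_real this]
  obtain d where d: "0 < d" "d < 1 / 2" "a < - (pi\<^sup>2 / (8 * (1 - d)\<^sup>2))" by auto
  obtain C L0 where L0: "0 < L0" and dec:
    "\<And>t v. 0 < t \<Longrightarrow> L0 \<le> ln t \<Longrightarrow> 0 \<le> v \<Longrightarrow> v \<le> exp (d / 16 * ln t) \<Longrightarrow>
      exp (- C - pi\<^sup>2 * (v + 1) / (8 * (1 - d)\<^sup>2 * (ln t)\<^sup>2)) \<le> measure (completion M) {\<omega> \<in> space M. v < brox_X W B t \<omega>}"
    using prob_diffusion_decay[OF d(1,2)] by auto
  define \<gamma> where "\<gamma> = pi\<^sup>2 / (8 * (1 - d)\<^sup>2)"
  have "(\<lambda>n. - C * ((ln (t n))\<^sup>2 / v n) - \<gamma> * (1 + 1 / v n)) \<longlonglongrightarrow> - C * 0 - \<gamma> * (1 + 0)"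
    by (intro tendsto_intros tendsto_ratio_0)
  then have "\<forall>\<^sub>F n in sequentially. a < - C * ((ln (t n))\<^sup>2 / v n) - \<gamma> * (1 + 1 / v n)"
    by (rule order_tendstoD) (use d in \<open>simp add: \<gamma>_def\<close>)
  moreover have "\<forall>\<^sub>F n in sequentially. L0 \<le> ln (t n)" using filterlim_ln_t by (simp add: filterlim_at_top)
  moreover have "\<forall>\<^sub>F n in sequentially. 0 < t n" using t by (simp add: filterlim_at_top_dense)
  moreover have "\<forall>\<^sub>F n in sequentially. 0 < v n" using v by (simp add: filterlim_at_top_dense)
  moreover have "\<forall>\<^sub>F n in sequentially. ln (v n) / ln (t n) < d / 16" using lv by (rule order_tendstoD) (use d in simp)
  ultimately show ?thesis
  proof eventually_elim
    case (elim n)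
    let ?P = "measure (completion M) {\<omega> \<in> space M. brox_X W B (t n) \<omega> > v n}"
    have L: "0 < ln (t n)" using elim(2) L0 by linarith
    \<comment> \<open>Here the ratio of logarithms tending to 0 makes \<open>v n\<close> smaller
      than a prescribed small power of \<open>t n\<close>.\<close>
    have "ln (v n) \<le> d / 16 * ln (t n)" using elim(5) L by (simp add: pos_divide_less_eq)
    then have "v n \<le> exp (d / 16 * ln (t n))" using elim(4) by (metis exp_le_cancel_iff exp_ln)
    from dec[OF elim(3,2) _ this] have le: "exp (- C - pi\<^sup>2 * (v n + 1) / (8 * (1 - d)\<^sup>2 * (ln (t n))\<^sup>2)) \<le> ?P"
      using elim(4) by simp
    then have pos: "0 < ?P" by (rule less_le_trans[rotated]) simp
    from le have "- C - pi\<^sup>2 * (v n + 1) / (8 * (1 - d)\<^sup>2 * (ln (t n))\<^sup>2) \<le> ln ?P" using pos by (simp add: ln_ge_iff)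
    then have "(ln (t n))\<^sup>2 / v n * (- C - pi\<^sup>2 * (v n + 1) / (8 * (1 - d)\<^sup>2 * (ln (t n))\<^sup>2)) \<le> (ln (t n))\<^sup>2 / v n * ln ?P"
      using elim(4) by (intro mult_left_mono) auto
    also have "(ln (t n))\<^sup>2 / v n * (- C - pi\<^sup>2 * (v n + 1) / (8 * (1 - d)\<^sup>2 * (ln (t n))\<^sup>2))
      = - C * ((ln (t n))\<^sup>2 / v n) - \<gamma> * (1 + 1 / v n)"
    proof -
      have "(ln (t n))\<^sup>2 / v n * (pi\<^sup>2 * (v n + 1) / (8 * (1 - d)\<^sup>2 * (ln (t n))\<^sup>2)) = \<gamma> * ((v n + 1) / v n)"
        using L by (simp add: \<gamma>_def)
      moreover have "(v n + 1) / v n = 1 + 1 / v n" using elim(4) by (simp add: add_divide_distrib)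
      ultimately show ?thesis unfolding right_diff_distrib by simp
    qed
    finally show ?case using elim(1) pos by linarith
  qed
qed

text \<open>The number of blocks is the integer part of \<open>(v n - 2) / (K * L\<^sup>2)\<close>;
  rounding and the margin 2 vanish after multiplication by \<open>L\<^sup>2 / v n\<close>, so only
  \<open>- \<rho>\<close> remains. The claim is conditional on positivity, which comes from the
  lower estimate.\<close>

lemma eventually_rate_upper:
  assumes a: "- (pi\<^sup>2 / 8) < a"
  shows "\<forall>\<^sub>F n in sequentially. 0 < measure (completion M) {\<omega> \<in> space M. (SUP s\<in>{0..t n}. brox_X W B s \<omega>) > v n} \<longrightarrow>
    (ln (t n))\<^sup>2 / v n * ln (measure (completion M) {\<omega> \<in> space M. (SUP s\<in>{0..t n}. brox_X W B s \<omega>) > v n}) < a"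
proof -
  have "0 < pi\<^sup>2 / 8" "- a < pi\<^sup>2 / 8" using a pi_gt_zero by (simp, linarith)
  then have "max 0 (- a) < pi\<^sup>2 / 8" by (rule max_less_iff_conj[THEN iffD2, OF conjI])
  then obtain \<rho> where "max 0 (- a) < \<rho>" "\<rho> < pi\<^sup>2 / 8" using dense by blast
  then have \<rho>: "0 < \<rho>" "\<rho> < pi\<^sup>2 / 8" "- \<rho> < a" by auto
  obtain K L0 where KL: "0 < K" "0 < L0" and dec:
    "\<And>t v m. 0 < t \<Longrightarrow> L0 \<le> ln t \<Longrightarrow> 1 + real m * (K * (ln t)\<^sup>2) \<le> v - 1 \<Longrightarrow>
      measure (completion M) {\<omega> \<in> space M. v < (SUP s\<in>{0..t}. brox_X W B s \<omega>)} \<le> exp (1 - \<rho> * K * real m)"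
    using prob_sup_decay[OF \<rho>(1,2)] by auto
  have "(\<lambda>n. (1 + \<rho> * K) * ((ln (t n))\<^sup>2 / v n) - \<rho> + 2 * \<rho> * (1 / v n)) \<longlonglongrightarrow> (1 + \<rho> * K) * 0 - \<rho> + 2 * \<rho> * 0"
    by (intro tendsto_intros tendsto_ratio_0)
  then have "\<forall>\<^sub>F n in sequentially. (1 + \<rho> * K) * ((ln (t n))\<^sup>2 / v n) - \<rho> + 2 * \<rho> * (1 / v n) < a"
    by (rule order_tendstoD) (use \<rho> in simp)
  moreover have "\<forall>\<^sub>F n in sequentially. L0 \<le> ln (t n)" using filterlim_ln_t by (simp add: filterlim_at_top)
  moreover have "\<forall>\<^sub>F n in sequentially. 0 < t n" using t by (simp add: filterlim_at_top_dense)
  moreover have "\<forall>\<^sub>F n in sequentially. 2 < v n" using v by (simp add: filterlim_at_top_dense)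
  ultimately show ?thesis
  proof eventually_elim
    case (elim n)
    let ?P = "measure (completion M) {\<omega> \<in> space M. (SUP s\<in>{0..t n}. brox_X W B s \<omega>) > v n}"
    define L where "L = ln (t n)"
    define x where "x = (v n - 2) / (K * L\<^sup>2)"
    define m where "m = nat \<lfloor>x\<rfloor>"
    have L: "0 < L" using elim(2) KL by (simp add: L_def)
    then have KL2: "0 < K * L\<^sup>2" using KL by simp
    have x0: "0 \<le> x" using elim(4) KL2 by (simp add: x_def)
    then have m: "real m \<le> x" "x - 1 \<le> real m" by (auto simp: m_def)
    have "real m * (K * L\<^sup>2) \<le> v n - 2" using m(1) KL2 by (simp add: x_def pos_le_divide_eq)
    then have "?P \<le> exp (1 - \<rho> * K * real m)" using elim(3,2) by (intro dec) (auto simp: L_def)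
    show ?case
    proof
      assume pos: "0 < ?P"
      have "ln ?P \<le> ln (exp (1 - \<rho> * K * real m))" using pos \<open>?P \<le> _\<close> by (intro ln_mono)
      also have "\<dots> = 1 - \<rho> * K * real m" by simp
      also have "\<dots> \<le> 1 - \<rho> * K * (x - 1)" using m(2) \<rho>(1) KL by simp
      finally have "L\<^sup>2 / v n * ln ?P \<le> L\<^sup>2 / v n * (1 - \<rho> * K * (x - 1))"
        using elim(4) by (intro mult_left_mono) auto
      also have "\<dots> = (1 + \<rho> * K) * (L\<^sup>2 / v n) - \<rho> * (L\<^sup>2 * (K * x) / v n)" by (simp add: algebra_simps)
      also have "L\<^sup>2 * (K * x) = v n - 2" using KL L by (simp add: x_def)
      also have "\<rho> * ((v n - 2) / v n) = \<rho> - 2 * \<rho> * (1 / v n)" using elim(4) by (simp add: diff_divide_distrib right_diff_distrib)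
      finally show "(ln (t n))\<^sup>2 / v n * ln ?P < a" using elim(1) by (simp add: L_def)
    qed
  qed
qed

text \<open>Almost surely the event at time \<open>t n\<close> is contained in the event for the
  supremum, so the lower estimate for the former and the upper estimate for the latter enclose both
  sequences.\<close>

lemma deviation_limits:
  "(\<lambda>n. (ln (t n))\<^sup>2 / v n * ln (measure (completion M) {\<omega> \<in> space M. brox_X W B (t n) \<omega> > v n})) \<longlonglongrightarrow> - (pi\<^sup>2 / 8)"
  "(\<lambda>n. (ln (t n))\<^sup>2 / v n * ln (measure (completion M) {\<omega> \<in> space M. (SUP s\<in>{0..t n}. brox_X W B s \<omega>) > v n})) \<longlonglongrightarrow> - (pi\<^sup>2 / 8)"
proof -
  let ?P = "\<lambda>n. measure (completion M) {\<omega> \<in> space M. brox_X W B (t n) \<omega> > v n}"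
  let ?S = "\<lambda>n. measure (completion M) {\<omega> \<in> space M. (SUP s\<in>{0..t n}. brox_X W B s \<omega>) > v n}"
  have "\<forall>\<^sub>F n in sequentially. 0 < t n" using t by (simp add: filterlim_at_top_dense)
  moreover have "\<forall>\<^sub>F n in sequentially. 0 < v n" using v by (simp add: filterlim_at_top_dense)
  moreover have "\<forall>\<^sub>F n in sequentially. 0 < ?P n"
    using eventually_rate_lower[of "- (pi\<^sup>2 / 8) - 1"] by (auto elim: eventually_mono)
  ultimately have le: "\<forall>\<^sub>F n in sequentially. 0 < ?S n \<and> (ln (t n))\<^sup>2 / v n * ln (?P n) \<le> (ln (t n))\<^sup>2 / v n * ln (?S n)"
  proof eventually_elim
    case (elim n)
    have "?P n \<le> ?S n" using elim by (intro prob_diffusion_le_prob_sup[OF W B indep]) auto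
    moreover from this have "ln (?P n) \<le> ln (?S n)" using elim(3) by (intro ln_mono) auto
    then have "(ln (t n))\<^sup>2 / v n * ln (?P n) \<le> (ln (t n))\<^sup>2 / v n * ln (?S n)"
      using elim(2) by (intro mult_left_mono) auto
    ultimately show ?case using elim(3) by linarith
  qed
  have low: "\<forall>\<^sub>F n in sequentially. a < (ln (t n))\<^sup>2 / v n * ln (?P n)" if "a < - (pi\<^sup>2 / 8)" for a
    using eventually_rate_lower[OF that] by eventually_elim simp
  have up: "\<forall>\<^sub>F n in sequentially. (ln (t n))\<^sup>2 / v n * ln (?S n) < a" if "- (pi\<^sup>2 / 8) < a" for a
    using eventually_rate_upper[OF that] le by eventually_elim simp
  show "(\<lambda>n. (ln (t n))\<^sup>2 / v n * ln (?P n)) \<longlonglongrightarrow> - (pi\<^sup>2 / 8)"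
  proof (rule order_tendstoI)
    show "\<forall>\<^sub>F n in sequentially. (ln (t n))\<^sup>2 / v n * ln (?P n) < a" if "- (pi\<^sup>2 / 8) < a" for a
      using up[OF that] le by eventually_elim simp
  qed (rule low)
  show "(\<lambda>n. (ln (t n))\<^sup>2 / v n * ln (?S n)) \<longlonglongrightarrow> - (pi\<^sup>2 / 8)"
  proof (rule order_tendstoI)
    show "\<forall>\<^sub>F n in sequentially. a < (ln (t n))\<^sup>2 / v n * ln (?S n)" if "a < - (pi\<^sup>2 / 8)" for a
      using low[OF that] le by eventually_elim simp
  qed (rule up)
qed

end

end

theorem theorem1p2:
  fixes M :: "'a measure" and W B :: "real \<Rightarrow> 'a \<Rightarrow> real"
    and t v :: "nat \<Rightarrow> real"
  assumes "prob_space M"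
    and "brownian_on M UNIV W"
    and "brownian_on M {0..} B"
    and "prob_space.indep_var M (Pi\<^sub>M UNIV (\<lambda>_. borel)) (\<lambda>\<omega> x. W x \<omega>)
                                 (Pi\<^sub>M {0..} (\<lambda>_. borel)) (\<lambda>\<omega>. restrict (\<lambda>s. B s \<omega>) {0..})"
    and "filterlim t at_top sequentially"
    and "filterlim v at_top sequentially"
    and "filterlim (\<lambda>n. v n / (ln (t n))\<^sup>2) at_top sequentially"
    and "(\<lambda>n. ln (v n) / ln (t n)) \<longlonglongrightarrow> 0"
  shows "((\<lambda>n. (ln (t n))\<^sup>2 / v n *
            ln (measure (completion M) {\<omega> \<in> space M. brox_X W B (t n) \<omega> > v n}))
           \<longlonglongrightarrow> - (pi\<^sup>2 / 8)) \<and>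
         ((\<lambda>n. (ln (t n))\<^sup>2 / v n *
            ln (measure (completion M)
                  {\<omega> \<in> space M. (SUP s\<in>{0..t n}. brox_X W B s \<omega>) > v n}))
           \<longlonglongrightarrow> - (pi\<^sup>2 / 8))"
  using deviation_limits[OF assms(2-8)] by (rule conjI)

end
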